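(* Let $A\to B$ be a rank-$n$ algebra and let $D$ and $D'$ be quadratic $B$-algebras. Then $\mathrm{Nm}_{B/A}(D\ast D')\cong \mathrm{Nm}_{B/A}(D)\ast\mathrm{Nm}_{B/A}(D')$ as $A$-algebras. That is, $\mathrm{Nm}_{B/A}$ is a homomorphism with respect to the monoid operation $\ast$ on isomorphism classes of quadratic algebras.
   Context: All rings and algebras are commutative and unital. A ring homomorphism $A\to B$ is a rank-$n$ algebra if $B$ is projective of constant rank $n$ as an $A$-module; a quadratic algebra is a rank-$2$ algebra. Norm function: for a rank-$n$ algebra $A\to B$, $s_n\colon B\to A$ sends $b$ to the determinant of multiplication by $b$ on $B$ (computed locally on $A$ where $B$ is free, then glued). It commutes with base change. For natural numbers $k_1+\dots+k_m=n$ and $b_1,\dots,b_m\in B$, the polarized form $s_{k_1,\dots,k_m}(b_1,\dots,b_m)\in A$ is the coefficient of $\lambda_1^{k_1}\cdots\lambda_m^{k_m}$ in $s_n(\lambda_1b_1+\dots+\lambda_mb_m)$, computed for $A[\lambda_1,\dots,\lambda_m]\to B[\lambda_1,\dots,\lambda_m]$. Based quadratic algebras: for a ring $R$ and $t,m\in R$ write $Q_R(t,m)=R[x]/(x^2-tx+m)$, with chosen generator $x$. For a rank-$n$ algebra $A\to B$ and $T,N\in B$, $$\mathrm{Nm}_{B/A}Q_B(T,N):=Q_A\Bigl(s_n(T),\ \sum_{k=1}^n(-4)^{k-1}s_{k,n-k}(N,T^2)\Bigr).$$ An isomorphism $f\colon Q_B(T',N')\to Q_B(T,N)$, $x\mapsto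 Ux+C$, induces an isomorphism $\mathrm{Nm}_{B/A}(f)\colon \mathrm{Nm}_{B/A}Q_B(T',N')\to\mathrm{Nm}_{B/A}Q_B(T,N)$, $x\mapsto s_n(U)x+\sum_{k=1}^n2^{k-1}s_{k,n-k}(C,UT)$, functorially in $f$. General quadratic algebras: for a quadratic $B$-algebra $D$, choose $a_1,\dots,a_k\in A$ generating the unit ideal such that each $D_{a_i}$ is free as a $B_{a_i}$-module, and choose algebra generators giving isomorphisms $D_{a_i}\cong Q_{B_{a_i}}(T_i,N_i)$. The $A_{a_i}$-algebras $\mathrm{Nm}_{B_{a_i}/A_{a_i}}Q_{B_{a_i}}(T_i,N_i)$ are glued over the overlaps $A_{a_ia_j}$ along the norms of the isomorphisms $Q_{B_{a_ia_j}}(T_i,N_i)\cong D_{a_ia_j}\cong Q_{B_{a_ia_j}}(T_j,N_j)$; the result is the quadratic $A$-algebra $\mathrm{Nm}_{B/A}(D)$, well defined up to isomorphism independently of the choices. The operation $\ast$ (Voight): for quadratic algebras over a ring $R$ it is defined locally on $R$ by $$Q_R(s,m)\ast Q_R(t,p):=Q_R(st,\ mt^2+ps^2-4mp),$$ glued along the following isomorphisms: isomorphisms $Q_R(s',m')\to Q_R(s,m)$, $x\mapsto ux+c$, and $Q_R(t',p')\to Q_R(t,p)$, $x\mapsto vx+d$, induce $Q_R(s',m')\ast Q_R(t',p')\to Q_R(s,m)\ast Q_R(t,p)$, $x\mapsto uvx+(cvt+dus+2cd)$. On isomorphism classes, $\ast$ is commutative and associative with identity $Q_R(1,0)\cong R\times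 R$. *)

theory Defs
  imports "HOL-Algebra.UnivPoly" "HOL-Algebra.QuotRing" "HOL-Combinatorics.Permutations"
begin

hide_const (open) Multiset.mult \<comment> \<open>shadows the record field \<open>mult\<close>\<close>

text \<open>
  Throughout, an algebra over a commutative ring \<open>A\<close> is a commutative ring \<open>B\<close> together with a
  ring homomorphism \<open>\<phi>\<close> from \<open>A\<close> to \<open>B\<close>.
\<close>

definition is_alg ::
  "('a, 'm) ring_scheme \<Rightarrow> ('b, 'n) ring_scheme \<Rightarrow> ('a \<Rightarrow> 'b) \<Rightarrow> bool" where
  "is_alg A B \<phi> \<longleftrightarrow> cring A \<and> cring B \<and> \<phi> \<in> ring_hom A B"

definition alg_iso ::
  "('a, 'm) ring_scheme \<Rightarrow> ('b, 'n) ring_scheme \<Rightarrow> ('a \<Rightarrow> 'b)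
    \<Rightarrow> ('c, 'k) ring_scheme \<Rightarrow> ('a \<Rightarrow> 'c) \<Rightarrow> ('b \<Rightarrow> 'c) \<Rightarrow> bool" where
  "alg_iso A B \<phi> C \<psi> h \<longleftrightarrow> h \<in> ring_iso B C \<and> (\<forall>a\<in>carrier A. h (\<phi> a) = \<psi> a)"


section \<open>Localization\<close>

text \<open>
  \<open>loc R V\<close> is the localization of \<open>R\<close> at the submonoid \<open>mgen R V\<close> of \<open>(R, \<cdot>)\<close> generated by \<open>V\<close>.
  Thus \<open>loc R {a}\<close> is the localization \<open>R\<close>[1/a], \<open>loc R {a, b}\<close> is \<open>R\<close>[1/(ab)], and
  \<open>loc R (carrier R - P)\<close> is the localization at a prime ideal \<open>P\<close>.
  Its elements are equivalence classes of pairs (numerator, denominator).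
\<close>

definition mgen :: "('a, 'm) ring_scheme \<Rightarrow> 'a set \<Rightarrow> 'a set" where
  "mgen R V = \<Inter>{S. submonoid S R \<and> V \<subseteq> S}"

definition loc_rel :: "('a, 'm) ring_scheme \<Rightarrow> 'a set \<Rightarrow> (('a \<times> 'a) \<times> ('a \<times> 'a)) set" where
  "loc_rel R V = {((r, s), (r', s')).
     r \<in> carrier R \<and> s \<in> mgen R V \<and> r' \<in> carrier R \<and> s' \<in> mgen R V \<and>
     (\<exists>t\<in>mgen R V. t \<otimes>\<^bsub>R\<^esub> (r \<otimes>\<^bsub>R\<^esub> s') = t \<otimes>\<^bsub>R\<^esub> (r' \<otimes>\<^bsub>R\<^esub> s))}"

definition frac :: "('a, 'm) ring_scheme \<Rightarrow> 'a set \<Rightarrow> 'a \<Rightarrow> 'a \<Rightarrow> ('a \<times> 'a) set" where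
  "frac R V r s = loc_rel R V `` {(r, s)}"

text \<open>
  The unions over representatives below are unions of equal classes, as usual for operations
  on a quotient.
\<close>

definition loc :: "('a, 'm) ring_scheme \<Rightarrow> 'a set \<Rightarrow> ('a \<times> 'a) set ring" where
  "loc R V =
    \<lparr>carrier = (carrier R \<times> mgen R V) // loc_rel R V,
     mult = (\<lambda>P Q. \<Union>(r, s)\<in>P. \<Union>(r', s')\<in>Q. frac R V (r \<otimes>\<^bsub>R\<^esub> r') (s \<otimes>\<^bsub>R\<^esub> s')),
     one = frac R V \<one>\<^bsub>R\<^esub> \<one>\<^bsub>R\<^esub>,
     zero = frac R V \<zero>\<^bsub>R\<^esub> \<one>\<^bsub>R\<^esub>,
     add = (\<lambda>P Q. \<Union>(r, s)\<in>P. \<Union>(r', s')\<in>Q.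
              frac R V ((r \<otimes>\<^bsub>R\<^esub> s') \<oplus>\<^bsub>R\<^esub> (r' \<otimes>\<^bsub>R\<^esub> s)) (s \<otimes>\<^bsub>R\<^esub> s'))\<rparr>"

text \<open>
  \<open>loc_map S Y f\<close> is the map from \<open>loc R V\<close> to \<open>loc S Y\<close> induced by a homomorphism \<open>f\<close>
  from \<open>R\<close> to \<open>S\<close> with \<open>f ` V \<subseteq> mgen S Y\<close>, sending \<open>r / s\<close> to \<open>f r / f s\<close>; with \<open>f\<close> the identity
  it is the restriction map from \<open>loc R V\<close> to a further localization \<open>loc R Y\<close>, \<open>V \<subseteq> Y\<close>.
\<close>

definition loc_map ::
  "('b, 'n) ring_scheme \<Rightarrow> 'b set \<Rightarrow> ('a \<Rightarrow> 'b) \<Rightarrow> ('a \<times> 'a) set \<Rightarrow> ('b \<times> 'b) set" where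
  "loc_map S Y f P = (\<Union>(r, s)\<in>P. frac S Y (f r) (f s))"

definition loc_res ::
  "('a, 'm) ring_scheme \<Rightarrow> 'a set \<Rightarrow> ('a \<times> 'a) set \<Rightarrow> ('a \<times> 'a) set" where
  "loc_res R Y = loc_map R Y (\<lambda>r. r)"


section \<open>Algebras of rank \<open>n\<close>\<close>

definition alg_module ::
  "('a, 'm) ring_scheme \<Rightarrow> ('b, 'n) ring_scheme \<Rightarrow> ('a \<Rightarrow> 'b) \<Rightarrow> ('a, 'b) module" where
  "alg_module A B \<phi> =
    \<lparr>carrier = carrier B, mult = mult B, one = one B, zero = zero B, add = add B,
     smult = (\<lambda>a b. \<phi> a \<otimes>\<^bsub>B\<^esub> b)\<rparr>"

definition free_module :: "('a, 'm) ring_scheme \<Rightarrow> nat \<Rightarrow> ('a, nat \<Rightarrow> 'a) module" where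
  "free_module R m =
    \<lparr>carrier = {..<m} \<rightarrow>\<^sub>E carrier R,
     mult = (\<lambda>f g. \<lambda>i\<in>{..<m}. f i \<otimes>\<^bsub>R\<^esub> g i),
     one = (\<lambda>i\<in>{..<m}. \<one>\<^bsub>R\<^esub>),
     zero = (\<lambda>i\<in>{..<m}. \<zero>\<^bsub>R\<^esub>),
     add = (\<lambda>f g. \<lambda>i\<in>{..<m}. f i \<oplus>\<^bsub>R\<^esub> g i),
     smult = (\<lambda>a f. \<lambda>i\<in>{..<m}. a \<otimes>\<^bsub>R\<^esub> f i)\<rparr>"

definition linear_map ::
  "('a, 'm) ring_scheme \<Rightarrow> ('a, 'b, 'n) module_scheme \<Rightarrow> ('a, 'c, 'k) module_scheme
    \<Rightarrow> ('b \<Rightarrow> 'c) \<Rightarrow> bool" where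
  "linear_map R M N f \<longleftrightarrow>
     f \<in> carrier M \<rightarrow> carrier N \<and>
     (\<forall>x\<in>carrier M. \<forall>y\<in>carrier M. f (x \<oplus>\<^bsub>M\<^esub> y) = f x \<oplus>\<^bsub>N\<^esub> f y) \<and>
     (\<forall>a\<in>carrier R. \<forall>x\<in>carrier M. f (a \<odot>\<^bsub>M\<^esub> x) = a \<odot>\<^bsub>N\<^esub> f x)"

text \<open>Finitely generated projective: a direct summand (retract) of some \<open>R\<^sup>m\<close>.\<close>

definition fg_projective :: "('a, 'm) ring_scheme \<Rightarrow> ('a, 'b, 'n) module_scheme \<Rightarrow> bool" where
  "fg_projective R M \<longleftrightarrow> module R M \<and>
     (\<exists>m i p. linear_map R M (free_module R m) i \<and> linear_map R (free_module R m) M p \<and>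
              (\<forall>x\<in>carrier M. p (i x) = x))"

definition represents ::
  "('a, 'm) ring_scheme \<Rightarrow> ('a, 'b, 'n) module_scheme \<Rightarrow> nat \<Rightarrow> (nat \<Rightarrow> 'b) \<Rightarrow> 'b \<Rightarrow> (nat \<Rightarrow> 'a) \<Rightarrow> bool"
  where
  "represents R M n e x c \<longleftrightarrow>
     c \<in> {..<n} \<rightarrow>\<^sub>E carrier R \<and> x = (\<Oplus>\<^bsub>M\<^esub>i\<in>{..<n}. c i \<odot>\<^bsub>M\<^esub> e i)"

definition is_basis ::
  "('a, 'm) ring_scheme \<Rightarrow> ('a, 'b, 'n) module_scheme \<Rightarrow> nat \<Rightarrow> (nat \<Rightarrow> 'b) \<Rightarrow> bool" where
  "is_basis R M n e \<longleftrightarrow>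
     (\<forall>i<n. e i \<in> carrier M) \<and> (\<forall>x\<in>carrier M. \<exists>!c. represents R M n e x c)"

text \<open>
  In \<open>rank_algebra\<close>, the module underlying the localization of \<open>B\<close> at the image of \<open>A - P\<close> is the
  localization of the \<open>A\<close>-module \<open>B\<close> at the prime \<open>P\<close>.
\<close>

definition rank_algebra ::
  "nat \<Rightarrow> ('a, 'm) ring_scheme \<Rightarrow> ('b, 'n) ring_scheme \<Rightarrow> ('a \<Rightarrow> 'b) \<Rightarrow> bool" where
  "rank_algebra n A B \<phi> \<longleftrightarrow>
     is_alg A B \<phi> \<and> fg_projective A (alg_module A B \<phi>) \<and>
     (\<forall>P. primeideal P A \<longrightarrow>
       (let V = carrier A - P; Y = \<phi> ` V in
         \<exists>e. is_basis (loc A V) (alg_module (loc A V) (loc B Y) (loc_map B Y \<phi>)) n e))"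


section \<open>The norm function and its polarized forms\<close>

definition det :: "('a, 'm) ring_scheme \<Rightarrow> nat \<Rightarrow> (nat \<Rightarrow> nat \<Rightarrow> 'a) \<Rightarrow> 'a" where
  "det R n M =
     (\<Oplus>\<^bsub>R\<^esub>\<sigma>\<in>{\<sigma>. \<sigma> permutes {..<n}}. [sign \<sigma>] \<cdot>\<^bsub>R\<^esub> (\<Otimes>\<^bsub>R\<^esub>i\<in>{..<n}. M i (\<sigma> i)))"

definition mult_det ::
  "nat \<Rightarrow> ('a, 'm) ring_scheme \<Rightarrow> ('b, 'n) ring_scheme \<Rightarrow> ('a \<Rightarrow> 'b) \<Rightarrow> (nat \<Rightarrow> 'b) \<Rightarrow> 'b \<Rightarrow> 'a" where
  "mult_det n A B \<phi> e b =
     det A n (\<lambda>i j. (THE c. represents A (alg_module A B \<phi>) n e (b \<otimes>\<^bsub>B\<^esub> e j) c) i)"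

text \<open>
  The norm \<open>s\<^sub>n\<close> of a rank-\<open>n\<close> algebra: the unique element of \<open>A\<close> that restricts to the determinant
  of multiplication by \<open>b\<close> on every \<open>A\<close>[1/a] over which \<open>B\<close>[1/a] is free.
\<close>

definition norm_fun ::
  "nat \<Rightarrow> ('a, 'm) ring_scheme \<Rightarrow> ('b, 'n) ring_scheme \<Rightarrow> ('a \<Rightarrow> 'b) \<Rightarrow> 'b \<Rightarrow> 'a" where
  "norm_fun n A B \<phi> b = (THE c. c \<in> carrier A \<and>
     (\<forall>a\<in>carrier A. let V = {a}; Y = \<phi> ` V; \<phi>V = loc_map B Y \<phi> in
       \<forall>e. is_basis (loc A V) (alg_module (loc A V) (loc B Y) \<phi>V) n e \<longrightarrow>
           frac A V c \<one>\<^bsub>A\<^esub> = mult_det n (loc A V) (loc B Y) \<phi>V e (frac B Y b \<one>\<^bsub>B\<^esub>)))"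

text \<open>
  \<open>polar n A B \<phi> k l b\<^sub>1 b\<^sub>2\<close> is the coefficient of \<open>\<lambda>\<^sub>1\<^sup>k \<lambda>\<^sub>2\<^sup>l\<close> in the norm of \<open>\<lambda>\<^sub>1 b\<^sub>1 + \<lambda>\<^sub>2 b\<^sub>2\<close>;
  the ring \<open>A[\<lambda>\<^sub>1, \<lambda>\<^sub>2]\<close> is \<open>UP (UP A)\<close>, the outer variable being \<open>\<lambda>\<^sub>1\<close> and the inner one \<open>\<lambda>\<^sub>2\<close>.
\<close>

definition polar ::
  "nat \<Rightarrow> ('a, 'm) ring_scheme \<Rightarrow> ('b, 'n) ring_scheme \<Rightarrow> ('a \<Rightarrow> 'b)
    \<Rightarrow> nat \<Rightarrow> nat \<Rightarrow> 'b \<Rightarrow> 'b \<Rightarrow> 'a" where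
  "polar n A B \<phi> k l b\<^sub>1 b\<^sub>2 =
     coeff (UP A) (coeff (UP (UP A))
       (norm_fun n (UP (UP A)) (UP (UP B)) (\<lambda>p i j. \<phi> (p i j))
         (monom (UP (UP B)) (monom (UP B) b\<^sub>1 0) 1 \<oplus>\<^bsub>UP (UP B)\<^esub>
          monom (UP (UP B)) (monom (UP B) b\<^sub>2 1) 0)) k) l"


section \<open>Based quadratic algebras\<close>

text \<open>\<open>R[x]/(x\<^sup>2 - t x + m)\<close>, its structure map and its chosen generator.\<close>

definition Q_ideal :: "('a, 'm) ring_scheme \<Rightarrow> 'a \<Rightarrow> 'a \<Rightarrow> (nat \<Rightarrow> 'a) set" where
  "Q_ideal R t m =
     PIdl\<^bsub>UP R\<^esub> ((monom (UP R) \<one>\<^bsub>R\<^esub> 2 \<ominus>\<^bsub>UP R\<^esub> monom (UP R) t 1) \<oplus>\<^bsub>UP R\<^esub> monom (UP R) m 0)"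

definition Q_alg :: "('a, 'm) ring_scheme \<Rightarrow> 'a \<Rightarrow> 'a \<Rightarrow> (nat \<Rightarrow> 'a) set ring" where
  "Q_alg R t m = UP R Quot Q_ideal R t m"

definition Q_struct :: "('a, 'm) ring_scheme \<Rightarrow> 'a \<Rightarrow> 'a \<Rightarrow> 'a \<Rightarrow> (nat \<Rightarrow> 'a) set" where
  "Q_struct R t m r = Q_ideal R t m +>\<^bsub>UP R\<^esub> monom (UP R) r 0"

definition Q_gen :: "('a, 'm) ring_scheme \<Rightarrow> 'a \<Rightarrow> 'a \<Rightarrow> (nat \<Rightarrow> 'a) set" where
  "Q_gen R t m = Q_ideal R t m +>\<^bsub>UP R\<^esub> monom (UP R) \<one>\<^bsub>R\<^esub> 1"

text \<open>
  There is an isomorphism of \<open>R\<close>-algebras from \<open>R[x]/(x\<^sup>2 - t x + m)\<close> to \<open>D\<close> sending the generator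
  \<open>x\<close> to \<open>y\<close>. (This isomorphism is determined by \<open>y\<close>.)
\<close>

definition Q_chart ::
  "('a, 'm) ring_scheme \<Rightarrow> ('d, 'n) ring_scheme \<Rightarrow> ('a \<Rightarrow> 'd) \<Rightarrow> 'a \<Rightarrow> 'a \<Rightarrow> 'd \<Rightarrow> bool" where
  "Q_chart R D \<rho> t m y \<longleftrightarrow> t \<in> carrier R \<and> m \<in> carrier R \<and>
     (\<exists>h. alg_iso R (Q_alg R t m) (Q_struct R t m) D \<rho> h \<and> h (Q_gen R t m) = y)"

text \<open>
  Let \<open>y'\<close> and \<open>y\<close> be the images of the generators under isomorphisms \<open>Q(t', m') \<cong> D\<close> and
  \<open>Q(t, m) \<cong> D\<close>. The relation below says that the composite \<open>Q(t', m') \<cong> D \<cong> Q(t, m)\<close> is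
  \<open>x \<mapsto> u x + c\<close>.
\<close>

definition transition ::
  "('a, 'm) ring_scheme \<Rightarrow> ('d, 'n) ring_scheme \<Rightarrow> ('a \<Rightarrow> 'd) \<Rightarrow> 'd \<Rightarrow> 'd \<Rightarrow> 'a \<Rightarrow> 'a \<Rightarrow> bool" where
  "transition R D \<rho> y' y u c \<longleftrightarrow> u \<in> carrier R \<and> c \<in> carrier R \<and>
     y' = (\<rho> u \<otimes>\<^bsub>D\<^esub> y) \<oplus>\<^bsub>D\<^esub> \<rho> c"

definition covers :: "('a, 'm) ring_scheme \<Rightarrow> nat \<Rightarrow> (nat \<Rightarrow> 'a) \<Rightarrow> bool" where
  "covers R k a \<longleftrightarrow> a ` {..<k} \<subseteq> carrier R \<and> Idl\<^bsub>R\<^esub> (a ` {..<k}) = carrier R"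


section \<open>The norm of a quadratic algebra\<close>

text \<open>
  The norm of \<open>Q\<^sub>B(T, N)\<close> is \<open>Q\<^sub>A(s\<^sub>n(T), norm_const T N)\<close>, and the norm of \<open>x \<mapsto> U x + C\<close> with
  target \<open>Q\<^sub>B(T, N)\<close> is \<open>x \<mapsto> s\<^sub>n(U) x + norm_shift T U C\<close>.
\<close>

definition norm_const ::
  "nat \<Rightarrow> ('a, 'm) ring_scheme \<Rightarrow> ('b, 'n) ring_scheme \<Rightarrow> ('a \<Rightarrow> 'b) \<Rightarrow> 'b \<Rightarrow> 'b \<Rightarrow> 'a" where
  "norm_const n A B \<phi> T N =
     (\<Oplus>\<^bsub>A\<^esub>k\<in>{1..n}. [((- 4 :: int) ^ (k - 1))] \<cdot>\<^bsub>A\<^esub> polar n A B \<phi> k (n - k) N (T [^]\<^bsub>B\<^esub> (2::nat)))"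

definition norm_shift ::
  "nat \<Rightarrow> ('a, 'm) ring_scheme \<Rightarrow> ('b, 'n) ring_scheme \<Rightarrow> ('a \<Rightarrow> 'b) \<Rightarrow> 'b \<Rightarrow> 'b \<Rightarrow> 'b \<Rightarrow> 'a" where
  "norm_shift n A B \<phi> T U C =
     (\<Oplus>\<^bsub>A\<^esub>k\<in>{1..n}. [((2 :: int) ^ (k - 1))] \<cdot>\<^bsub>A\<^esub> polar n A B \<phi> k (n - k) C (U \<otimes>\<^bsub>B\<^esub> T))"

text \<open>
  \<open>is_Nm n A B \<phi> D \<psi> E \<chi>\<close>: for the rank-\<open>n\<close> algebra \<open>\<phi>\<close> from \<open>A\<close> to \<open>B\<close> and the quadratic algebra
  \<open>\<psi>\<close> from \<open>B\<close> to \<open>D\<close>, the \<open>A\<close>-algebra \<open>\<chi>\<close> from \<open>A\<close> to \<open>E\<close> is a norm of \<open>D\<close>, i.e. the result of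
  glueing for some choice of \<open>a\<^sub>i\<close> and of generators \<open>y\<^sub>i\<close> of the localizations of \<open>D\<close>. That \<open>E\<close>
  arises by glueing the norms of the \<open>Q(T\<^sub>i, N\<^sub>i)\<close> means that there are isomorphisms from these norms
  to the localizations of \<open>E\<close> (given by the images \<open>z\<^sub>i\<close> of the generators) which over each overlap
  differ by the norm of the transition isomorphism \<open>Q(T\<^sub>i, N\<^sub>i) \<cong> Q(T\<^sub>j, N\<^sub>j)\<close>.
\<close>

definition is_Nm ::
  "nat \<Rightarrow> ('a, 'm) ring_scheme \<Rightarrow> ('b, 'n) ring_scheme \<Rightarrow> ('a \<Rightarrow> 'b)
    \<Rightarrow> ('d, 'k) ring_scheme \<Rightarrow> ('b \<Rightarrow> 'd) \<Rightarrow> ('e, 'l) ring_scheme \<Rightarrow> ('a \<Rightarrow> 'e) \<Rightarrow> bool" where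
  "is_Nm n A B \<phi> D \<psi> E \<chi> \<longleftrightarrow> is_alg A E \<chi> \<and>
    (\<exists>k a T N y z. covers A k a \<and>
      (\<forall>i<k. let V = {a i}; Y = \<phi> ` V; Z = \<psi> ` Y; W = \<chi> ` V;
                 AV = loc A V; BV = loc B Y; \<phi>V = loc_map B Y \<phi>
         in Q_chart BV (loc D Z) (loc_map D Z \<psi>) (T i) (N i) (y i) \<and>
            Q_chart AV (loc E W) (loc_map E W \<chi>)
              (norm_fun n AV BV \<phi>V (T i)) (norm_const n AV BV \<phi>V (T i) (N i)) (z i)) \<and>
      (\<forall>i<k. \<forall>j<k.
         let V = {a i, a j}; Y = \<phi> ` V; Z = \<psi> ` Y; W = \<chi> ` V;
             AV = loc A V; BV = loc B Y; \<phi>V = loc_map B Y \<phi>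
         in \<forall>U C. transition BV (loc D Z) (loc_map D Z \<psi>)
                    (loc_res D Z (y i)) (loc_res D Z (y j)) U C \<longrightarrow>
                  transition AV (loc E W) (loc_map E W \<chi>)
                    (loc_res E W (z i)) (loc_res E W (z j))
                    (norm_fun n AV BV \<phi>V U) (norm_shift n AV BV \<phi>V (loc_res B Y (T j)) U C)))"


section \<open>Voight's operation on quadratic algebras\<close>

definition star_const :: "('a, 'm) ring_scheme \<Rightarrow> 'a \<Rightarrow> 'a \<Rightarrow> 'a \<Rightarrow> 'a \<Rightarrow> 'a" where
  "star_const R s m t p =
     ((m \<otimes>\<^bsub>R\<^esub> (t [^]\<^bsub>R\<^esub> (2::nat))) \<oplus>\<^bsub>R\<^esub> (p \<otimes>\<^bsub>R\<^esub> (s [^]\<^bsub>R\<^esub> (2::nat))))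
       \<ominus>\<^bsub>R\<^esub> ([(4 :: int)] \<cdot>\<^bsub>R\<^esub> (m \<otimes>\<^bsub>R\<^esub> p))"

definition star_shift ::
  "('a, 'm) ring_scheme \<Rightarrow> 'a \<Rightarrow> 'a \<Rightarrow> 'a \<Rightarrow> 'a \<Rightarrow> 'a \<Rightarrow> 'a \<Rightarrow> 'a" where
  "star_shift R s t u c v d =
     ((c \<otimes>\<^bsub>R\<^esub> v \<otimes>\<^bsub>R\<^esub> t) \<oplus>\<^bsub>R\<^esub> (d \<otimes>\<^bsub>R\<^esub> u \<otimes>\<^bsub>R\<^esub> s)) \<oplus>\<^bsub>R\<^esub> ([(2 :: int)] \<cdot>\<^bsub>R\<^esub> (c \<otimes>\<^bsub>R\<^esub> d))"

text \<open>
  \<open>is_star R D \<rho> D' \<rho>' F \<sigma>\<close>: the \<open>R\<close>-algebra \<open>F\<close> is obtained by glueing the products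
  \<open>Q(s\<^sub>i, m\<^sub>i) * Q(t\<^sub>i, p\<^sub>i) = Q(s\<^sub>i t\<^sub>i, star_const s\<^sub>i m\<^sub>i t\<^sub>i p\<^sub>i)\<close> for a choice of local generators \<open>y\<^sub>i\<close> of
  \<open>D\<close> and \<open>y'\<^sub>i\<close> of \<open>D'\<close>; the \<open>w\<^sub>i\<close> are the images in \<open>F\<close> of the generators, as in \<open>is_Nm\<close>.
\<close>

definition is_star ::
  "('a, 'm) ring_scheme \<Rightarrow> ('d, 'n) ring_scheme \<Rightarrow> ('a \<Rightarrow> 'd)
    \<Rightarrow> ('e, 'k) ring_scheme \<Rightarrow> ('a \<Rightarrow> 'e) \<Rightarrow> ('f, 'l) ring_scheme \<Rightarrow> ('a \<Rightarrow> 'f) \<Rightarrow> bool" where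
  "is_star R D \<rho> D' \<rho>' F \<sigma> \<longleftrightarrow> is_alg R F \<sigma> \<and>
    (\<exists>k a s m y t p y' w. covers R k a \<and>
      (\<forall>i<k. let V = {a i}; Z = \<rho> ` V; Z' = \<rho>' ` V; W = \<sigma> ` V; RV = loc R V
         in Q_chart RV (loc D Z) (loc_map D Z \<rho>) (s i) (m i) (y i) \<and>
            Q_chart RV (loc D' Z') (loc_map D' Z' \<rho>') (t i) (p i) (y' i) \<and>
            Q_chart RV (loc F W) (loc_map F W \<sigma>)
              (s i \<otimes>\<^bsub>RV\<^esub> t i) (star_const RV (s i) (m i) (t i) (p i)) (w i)) \<and>
      (\<forall>i<k. \<forall>j<k.
         let V = {a i, a j}; Z = \<rho> ` V; Z' = \<rho>' ` V; W = \<sigma> ` V; RV = loc R V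
         in \<forall>u c v d.
              transition RV (loc D Z) (loc_map D Z \<rho>)
                (loc_res D Z (y i)) (loc_res D Z (y j)) u c \<and>
              transition RV (loc D' Z') (loc_map D' Z' \<rho>')
                (loc_res D' Z' (y' i)) (loc_res D' Z' (y' j)) v d \<longrightarrow>
              transition RV (loc F W) (loc_map F W \<sigma>)
                (loc_res F W (w i)) (loc_res F W (w j))
                (u \<otimes>\<^bsub>RV\<^esub> v)
                (star_shift RV (loc_res R V (s j)) (loc_res R V (t j)) u c v d)))"

end

theory Submission
  imports Defs "Jordan_Normal_Form.Determinant" "HOL-Library.Poly_Mapping"
    "HOL-Library.Nat_Bijection" "HOL-Algebra.Ring_Divisibility"
begin

text \<open>
  Writing \<open>q(\<lambda>) = s\<^sub>n(b + \<lambda> c) = \<Sum> q\<^sub>k \<lambda>\<^sup>k\<close>, the coefficients and shifts occurring in the norm of a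
  based quadratic algebra are values of \<open>K\<^sub>\<mu>(c, b) = \<Sum>\<^sub>k\<^sub>\<ge>\<^sub>1 q\<^sub>k \<mu>\<^sup>k\<^sup>-\<^sup>1\<close>, which satisfies
  \<open>s\<^sub>n(b + \<mu> c) = s\<^sub>n(b) + \<mu> K\<^sub>\<mu>(c, b)\<close>. Where \<open>\<mu>\<close> can be cancelled this equation determines
  \<open>K\<^sub>\<mu>\<close>, so multiplicativity of \<open>s\<^sub>n\<close> gives identities for \<open>K\<close> over \<open>A[\<mu>]\<close>, which are then
  specialized to \<open>\<mu> = 2\<close> and \<open>\<mu> = -4\<close>. They say that the norm and the operation \<open>*\<close> are
  functorial on local generators and that the norm takes the formulas for \<open>*\<close> over \<open>B\<close> to those
  over \<open>A\<close>. Hence both sides of the theorem have local generators with equal parameters and equal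
  transitions, and these glue to an isomorphism.
\<close>

hide_const (open) Determinant.det Polynomial.monom Polynomial.coeff Ring_Hom.ring_hom

text \<open>The constants are those of trace and discriminant. A change \<open>x |-> U x + C\<close>
  turns the trace \<open>T\<close> into \<open>U T + 2 C\<close>, and \<open>T^2 - 4 N\<close> is
  the discriminant; the norm of algebras applies \<open>s_n\<close> to both. The shift and the
  constant are the remainders of these expansions divided by 2 and by -4, so where 2 is a zero
  divisor multiplicativity alone says nothing about them; this forces the passage to a variable
  scalar. One identity resists it: the change of constant rests on
  \<open>(P + 2 C)^2 = P^2 + 4 C (P + C)\<close>, which fails when 2 is replaced by a variable
  \<open>\<delta>\<close>. The repair multiplies one copy of \<open>P\<close> by
  \<open>\<gamma> = \<delta> - 1\<close>, because \<open>(\<gamma> P + \<delta> C) (P + \<delta> C)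
  = \<gamma> P^2 + \<delta>^2 C (P + C)\<close>. In the glueing, the charts of \<open>D * D'\<close>
  live over a cover of \<open>B\<close>, which need not come from \<open>A\<close>. Therefore every
  local generator over every localization, and not only the chosen ones, is given a generator of the
  glued algebra.\<close>

lemma (in cring) eq_by_diff:
  assumes "a \<ominus> b = \<zero>" "a \<in> carrier R" "b \<in> carrier R" shows "a = b"
  using assms minus_equality[of a "\<ominus> b"] by (simp add: a_minus_def)

lemmas (in cring) cring_distrib = l_distr r_distr a_ac m_ac

lemma (in ring) int_zero_mult [simp]: "[(0::int)] \<cdot> x = \<zero>"
  by (simp add: add_pow_def int_pow_def2)

section \<open>Integer polynomial identities in a ring\<close>

text \<open>A polynomial identity in matrix entries holds in every commutative ring once it holds
  for indeterminates over the integers. \<open>int_mpoly\<close> is this universal case: as a type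
  it is an integral domain, so the theory of typed matrices applies to it, and evaluation carries
  the result into a ring given by a carrier set.\<close>

type_synonym int_mpoly = "(nat \<Rightarrow>\<^sub>0 nat) \<Rightarrow>\<^sub>0 int"

context cring
begin

definition monomial_value :: "(nat \<Rightarrow> 'a) \<Rightarrow> (nat \<Rightarrow>\<^sub>0 nat) \<Rightarrow> 'a" where
  "monomial_value x k = (\<Otimes>i\<in>Poly_Mapping.keys k. x i [^] Poly_Mapping.lookup k i)"

definition mpoly_value :: "(nat \<Rightarrow> 'a) \<Rightarrow> int_mpoly \<Rightarrow> 'a" where
  "mpoly_value x p = (\<Oplus>k\<in>Poly_Mapping.keys p. [Poly_Mapping.lookup p k] \<cdot> monomial_value x k)"

lemma monomial_value_superset:
  assumes "\<And>i. x i \<in> carrier R" "finite S" "Poly_Mapping.keys k \<subseteq> S"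
  shows "monomial_value x k = (\<Otimes>i\<in>S. x i [^] Poly_Mapping.lookup k i)"
  unfolding monomial_value_def
  by (rule finprod_mono_neutral_cong_left) (use assms in \<open>auto simp: in_keys_iff\<close>)

lemma monomial_value_closed [simp]:
  assumes "\<And>i. x i \<in> carrier R" shows "monomial_value x k \<in> carrier R"
  unfolding monomial_value_def by (rule finprod_closed) (use assms in auto)

lemma monomial_value_add:
  assumes x: "\<And>i. x i \<in> carrier R"
  shows "monomial_value x (k + l) = monomial_value x k \<otimes> monomial_value x l"
proof -
  let ?S = "Poly_Mapping.keys k \<union> Poly_Mapping.keys l"
  have "monomial_value x (k + l) = (\<Otimes>i\<in>?S. x i [^] Poly_Mapping.lookup (k + l) i)"
    by (rule monomial_value_superset) (use x Poly_Mapping.keys_add[of k l] in auto)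
  also have "\<dots> = (\<Otimes>i\<in>?S. x i [^] Poly_Mapping.lookup k i \<otimes> x i [^] Poly_Mapping.lookup l i)"
    by (rule finprod_cong') (use x in \<open>auto simp: lookup_add nat_pow_mult\<close>)
  also have "\<dots> = (\<Otimes>i\<in>?S. x i [^] Poly_Mapping.lookup k i) \<otimes> (\<Otimes>i\<in>?S. x i [^] Poly_Mapping.lookup l i)"
    by (rule finprod_multf) (use x in auto)
  also have "\<dots> = monomial_value x k \<otimes> monomial_value x l"
    using x by (subst (1 2) monomial_value_superset[where S = ?S]) auto
  finally show ?thesis .
qed

lemma mpoly_value_superset:
  assumes "\<And>i. x i \<in> carrier R" "finite S" "Poly_Mapping.keys p \<subseteq> S"
  shows "mpoly_value x p = (\<Oplus>k\<in>S. [Poly_Mapping.lookup p k] \<cdot> monomial_value x k)"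
  unfolding mpoly_value_def
  by (rule add.finprod_mono_neutral_cong_left) (use assms in \<open>auto simp: in_keys_iff intro!: add.int_pow_closed\<close>)

lemma mpoly_value_closed [simp]:
  assumes "\<And>i. x i \<in> carrier R" shows "mpoly_value x p \<in> carrier R"
  unfolding mpoly_value_def by (rule finsum_closed) (use assms in auto)

lemma mpoly_value_add:
  assumes x: "\<And>i. x i \<in> carrier R"
  shows "mpoly_value x (p + q) = mpoly_value x p \<oplus> mpoly_value x q"
proof -
  let ?S = "Poly_Mapping.keys p \<union> Poly_Mapping.keys q"
  have "mpoly_value x (p + q) = (\<Oplus>k\<in>?S. [Poly_Mapping.lookup (p + q) k] \<cdot> monomial_value x k)"
    by (rule mpoly_value_superset) (use x Poly_Mapping.keys_add[of p q] in auto)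
  also have "\<dots> = (\<Oplus>k\<in>?S. [Poly_Mapping.lookup p k] \<cdot> monomial_value x k \<oplus> [Poly_Mapping.lookup q k] \<cdot> monomial_value x k)"
    by (rule finsum_cong') (use x in \<open>auto simp: lookup_add add.int_pow_mult\<close>)
  also have "\<dots> = (\<Oplus>k\<in>?S. [Poly_Mapping.lookup p k] \<cdot> monomial_value x k) \<oplus> (\<Oplus>k\<in>?S. [Poly_Mapping.lookup q k] \<cdot> monomial_value x k)"
    by (rule finsum_addf) (use x in auto)
  also have "\<dots> = mpoly_value x p \<oplus> mpoly_value x q"
    using x by (subst (1 2) mpoly_value_superset[where S = ?S]) auto
  finally show ?thesis .
qed

lemma mpoly_value_single:
  assumes "\<And>i. x i \<in> carrier R"
  shows "mpoly_value x (Poly_Mapping.single k c) = [c] \<cdot> monomial_value x k"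
  using assms mpoly_value_superset[of x "{k}" "Poly_Mapping.single k c"] by simp

lemma mpoly_value_zero [simp]: "mpoly_value x 0 = \<zero>"
  by (simp add: mpoly_value_def)

lemma monomial_value_zero [simp]: "monomial_value x 0 = \<one>"
  by (simp add: monomial_value_def)

lemma mpoly_value_one [simp]: "(\<And>i. x i \<in> carrier R) \<Longrightarrow> mpoly_value x 1 = \<one>"
  by (simp flip: single_one add: mpoly_value_single)

lemma mpoly_induct [case_names zero single add]:
  fixes p :: "'x \<Rightarrow>\<^sub>0 'y::ring"
  assumes "P 0" "\<And>k c. P (Poly_Mapping.single k c)" "\<And>p q. P p \<Longrightarrow> P q \<Longrightarrow> P (p + q)"
  shows "P p"
proof (induction p rule: Poly_Mapping.update_induct)
  case const
  then show ?case by fact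
next
  case (update f a b)
  have "Poly_Mapping.update a b f = Poly_Mapping.single a b + f"
    using update(1) by (intro poly_mapping_eqI) (auto simp: lookup_update lookup_add lookup_single in_keys_iff)
  then show ?case using assms(2,3) update by simp
qed

text \<open>Both sides are biadditive, so two nested inductions reduce the claim to a product of two
  single terms, where exponents add and coefficients multiply.\<close>

lemma mpoly_value_mult:
  assumes x: "\<And>i. x i \<in> carrier R"
  shows "mpoly_value x (p * q) = mpoly_value x p \<otimes> mpoly_value x q"
proof (induction p rule: mpoly_induct)
  case zero
  then show ?case using x by simp
next
  case (single k c)
  show ?case
  proof (induction q rule: mpoly_induct)
    case zero
    then show ?case using x by simp
  next
    case (single l d)
    then show ?case
      using x by (simp add: mult_single mpoly_value_single monomial_value_add add_pow_ldistr_int add_pow_rdistr_int add.int_pow_pow mult.commute)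
  next
    case (add p q)
    then show ?case using x by (simp add: distrib_left mpoly_value_add r_distr)
  qed
next
  case (add p q)
  then show ?case using x by (simp add: distrib_right mpoly_value_add l_distr)
qed

lemma mpoly_value_of_int:
  assumes x: "\<And>i. x i \<in> carrier R"
  shows "mpoly_value x (of_int c) = [c] \<cdot> \<one>"
  using x by (simp flip: single_of_int add: mpoly_value_single)

lemma mpoly_value_sum:
  assumes x: "\<And>i. x i \<in> carrier R" and "finite S"
  shows "mpoly_value x (\<Sum>s\<in>S. f s) = (\<Oplus>s\<in>S. mpoly_value x (f s))"
  using assms(2) by induction (use x in \<open>auto simp: mpoly_value_add\<close>)

lemma mpoly_value_prod:
  assumes x: "\<And>i. x i \<in> carrier R" and "finite S"
  shows "mpoly_value x (\<Prod>s\<in>S. f s) = (\<Otimes>s\<in>S. mpoly_value x (f s))"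
  using assms(2) by induction (use x in \<open>auto simp: mpoly_value_mult\<close>)

end

definition mpoly_var :: "nat \<Rightarrow> int_mpoly" where
  "mpoly_var i = Poly_Mapping.single (Poly_Mapping.single i 1) 1"

lemma (in cring) mpoly_value_var [simp]:
  assumes "\<And>i. x i \<in> carrier R" shows "mpoly_value x (mpoly_var i) = x i"
  using assms by (simp add: mpoly_var_def mpoly_value_single monomial_value_def)

section \<open>Determinants\<close>

text \<open>Links two notions of determinant: the one for typed matrices on the left and the Leibniz
  sum in a ring with a carrier on the right. The product formula, Sylvester's identity and the
  scalar case below pass through it.\<close>

lemma (in cring) mpoly_value_det:
  assumes x: "\<And>i. x i \<in> carrier R"
  shows "mpoly_value x (Determinant.det (Matrix.mat n n (\<lambda>(i, j). M i j)))
    = det R n (\<lambda>i j. mpoly_value x (M i j))"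
proof -
  have *: "mpoly_value x (of_int (sign p) * q) = [sign p] \<cdot> mpoly_value x q" for p :: "nat \<Rightarrow> nat" and q
    using x by (simp add: mpoly_value_mult mpoly_value_of_int add_pow_ldistr_int)
  have "mpoly_value x (Determinant.det (Matrix.mat n n (\<lambda>(i, j). M i j)))
    = mpoly_value x (\<Sum>p\<in>{p. p permutes {..<n}}. of_int (sign p) * (\<Prod>i\<in>{..<n}. M i (p i)))"
    unfolding Determinant.det_def
    by (auto intro!: arg_cong[where f = "mpoly_value x"] sum.cong prod.cong simp: atLeast0LessThan
         dest: permutes_in_image)
  also have "\<dots> = det R n (\<lambda>i j. mpoly_value x (M i j))"
    using x by (simp add: Defs.det_def mpoly_value_sum finite_permutations * mpoly_value_prod)
  finally show ?thesis .
qed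

lemma (in cring) det_closed [simp]:
  assumes "\<And>i j. i < n \<Longrightarrow> j < n \<Longrightarrow> M i j \<in> carrier R"
  shows "det R n M \<in> carrier R"
proof -
  have "p i < n" if "p permutes {..<n}" "i < n" for p i
    using that permutes_in_image[of p "{..<n}" i] by auto
  then show ?thesis
    unfolding Defs.det_def using assms by (auto intro!: finsum_closed add.int_pow_closed finprod_closed)
qed

lemma (in cring) det_cong:
  assumes "\<And>i j. i < n \<Longrightarrow> j < n \<Longrightarrow> M i j = M' i j"
    "\<And>i j. i < n \<Longrightarrow> j < n \<Longrightarrow> M' i j \<in> carrier R"
  shows "det R n M = det R n M'"
proof -
  have "p i < n" if "p permutes {..<n}" "i < n" for p i
    using that permutes_in_image[of p "{..<n}" i] by auto
  then show ?thesis
    unfolding Defs.det_def using assms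
    by (auto intro!: finsum_cong' arg_cong[where f = "add_pow R _"] finprod_cong'
        add.int_pow_closed finprod_closed)
qed


text \<open>The index \<open>b\<close> names a matrix, so that two generic matrices can be taken
  with disjoint sets of indeterminates.\<close>

definition mvar :: "nat \<Rightarrow> nat \<Rightarrow> nat \<Rightarrow> int_mpoly" where
  "mvar b i j = mpoly_var (prod_encode (b, prod_encode (i, j)))"

lemma (in cring) mvar_values:
  obtains x where "\<And>v. x v \<in> carrier R"
    "\<And>b i j. M b i j \<in> carrier R \<Longrightarrow> mpoly_value x (mvar b i j) = M b i j"
proof
  \<comment> \<open>Evaluation asks every indeterminate to have a value in the ring, so positions
    whose entry lies outside the carrier receive zero.\<close>
  define x where "x v = (let (b, w) = prod_decode v; (i, j) = prod_decode w in
    if M b i j \<in> carrier R then M b i j else \<zero>)" for v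
  show x: "x v \<in> carrier R" for v by (auto simp: x_def Let_def split: prod.splits)
  show "mpoly_value x (mvar b i j) = M b i j" if "M b i j \<in> carrier R" for b i j
    using that x by (simp add: mvar_def) (simp add: x_def)
qed

lemma (in cring) det_mat_mult:
  assumes "\<And>i j. i < n \<Longrightarrow> j < n \<Longrightarrow> M i j \<in> carrier R" "\<And>i j. i < n \<Longrightarrow> j < n \<Longrightarrow> N i j \<in> carrier R"
  shows "det R n (\<lambda>i j. \<Oplus>k\<in>{..<n}. M i k \<otimes> N k j) = det R n M \<otimes> det R n N"
proof -
  obtain x where x: "\<And>v. x v \<in> carrier R"
    "\<And>b i j. (if b = (0::nat) then M i j else N i j) \<in> carrier R \<Longrightarrow>
       mpoly_value x (mvar b i j) = (if b = 0 then M i j else N i j)"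
    using mvar_values[of "\<lambda>b i j. if b = 0 then M i j else N i j"] by blast
  note v = x(2)[of 0, simplified] x(2)[of 1, simplified]
  let ?X = "Matrix.mat n n (\<lambda>(i, j). mvar 0 i j)" and ?Y = "Matrix.mat n n (\<lambda>(i, j). mvar 1 i j)"
  have XY: "?X * ?Y = Matrix.mat n n (\<lambda>(i, j). \<Sum>k\<in>{..<n}. mvar 0 i k * mvar 1 k j)"
    by (rule eq_matI) (auto simp: scalar_prod_def atLeast0LessThan intro!: sum.cong)
  have "mpoly_value x (Determinant.det (?X * ?Y))
      = mpoly_value x (Determinant.det ?X) \<otimes> mpoly_value x (Determinant.det ?Y)"
    by (subst Determinant.det_mult[where n = n]) (use x(1) in \<open>auto simp: mpoly_value_mult\<close>)
  then have "det R n (\<lambda>i j. \<Oplus>k\<in>{..<n}. mpoly_value x (mvar 0 i k) \<otimes> mpoly_value x (mvar 1 k j))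
    = det R n (\<lambda>i j. mpoly_value x (mvar 0 i j)) \<otimes> det R n (\<lambda>i j. mpoly_value x (mvar 1 i j))"
    unfolding XY mpoly_value_det[OF x(1)] by (simp add: x(1) mpoly_value_sum mpoly_value_mult)
  also have "det R n (\<lambda>i j. mpoly_value x (mvar 0 i j)) = det R n M"
    by (rule det_cong) (use assms v in auto)
  also have "det R n (\<lambda>i j. mpoly_value x (mvar 1 i j)) = det R n N"
    by (rule det_cong) (use assms v in auto)
  also have "det R n (\<lambda>i j. \<Oplus>k\<in>{..<n}. mpoly_value x (mvar 0 i k) \<otimes> mpoly_value x (mvar 1 k j))
    = det R n (\<lambda>i j. \<Oplus>k\<in>{..<n}. M i k \<otimes> N k j)"
    by (rule det_cong) (use assms v x in \<open>auto intro!: finsum_cong'\<close>)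
  finally show ?thesis .
qed

text \<open>The block matrix \<open>?M\<close> with rows \<open>1, -X\<close> and
  \<open>Y, 1\<close> is made block triangular by unipotent left factors in two ways:
  \<open>?L\<close> eliminates \<open>Y\<close> and leaves \<open>1 + Y X\<close> in the corner,
  \<open>?U\<close> eliminates \<open>-X\<close> and leaves \<open>1 + X Y\<close>. Both products
  have the determinant of \<open>?M\<close>.\<close>

lemma det_one_plus_mult_commute:
  fixes X Y :: "'a::idom mat"
  assumes [simp]: "X \<in> carrier_mat m n" "Y \<in> carrier_mat n m"
  shows "Determinant.det (1\<^sub>m m + X * Y) = Determinant.det (1\<^sub>m n + Y * X)"
proof -
  have dX: "dim_row X = m" "dim_col X = n" "dim_row Y = n" "dim_col Y = m"
    by (fact carrier_matD[OF assms(1)] carrier_matD[OF assms(2)])+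
  let ?M = "four_block_mat (1\<^sub>m m) (- X) Y (1\<^sub>m n)"
  let ?L = "four_block_mat (1\<^sub>m m) (0\<^sub>m m n) (- Y) (1\<^sub>m n)"
  let ?U = "four_block_mat (1\<^sub>m m) X (0\<^sub>m n m) (1\<^sub>m n)"
  have z: "- Y + Y = 0\<^sub>m n m" "- X + X = 0\<^sub>m m n" using dX by auto
  have yx: "(- Y) * (- X) = Y * X" using dX by auto
  have s: "1\<^sub>m m + 0\<^sub>m m n * Y = 1\<^sub>m m" "1\<^sub>m m * - X + 0\<^sub>m m n = - X" "- Y * 1\<^sub>m m + 1\<^sub>m n * Y = 0\<^sub>m n m"
    using left_mult_zero_mat[OF assms(2), of m] left_mult_one_mat[of "- X" m n] right_mult_one_mat[of "- Y" n m]
      left_mult_one_mat[OF assms(2)] right_add_zero_mat[of "- X" m n] z by simp_all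
  have c: "Y * X + 1\<^sub>m n = 1\<^sub>m n + Y * X"
    by (rule comm_add_mat[OF mult_carrier_mat[OF assms(2,1)] one_carrier_mat])
  have 1: "?L * ?M = four_block_mat (1\<^sub>m m) (- X) (0\<^sub>m n m) (1\<^sub>m n + Y * X)"
    by (subst mult_four_block_mat[of _ m m _ n _ n _ _ m _ n]) (auto simp: s yx c)
  have s': "1\<^sub>m m * - X + X * 1\<^sub>m n = 0\<^sub>m m n" "0\<^sub>m n m + 1\<^sub>m n * Y = Y" "0\<^sub>m n m * - X + 1\<^sub>m n = 1\<^sub>m n"
    using left_mult_one_mat[of "- X" m n] right_mult_one_mat[OF assms(1)] left_mult_one_mat[OF assms(2)]
      left_add_zero_mat[OF assms(2)] left_mult_zero_mat[of "- X" m n n] z by simp_all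
  have 2: "?U * ?M = four_block_mat (1\<^sub>m m + X * Y) (0\<^sub>m m n) Y (1\<^sub>m n)"
    by (subst mult_four_block_mat[of _ m m _ n _ n _ _ m _ n]) (auto simp: s')
  have "Determinant.det (?L * ?M) = Determinant.det ?M"
    by (subst Determinant.det_mult[where n = "m + n"]) (auto simp: det_four_block_mat_upper_right_zero[of _ m _ n])
  moreover have "Determinant.det (?U * ?M) = Determinant.det ?M"
    by (subst Determinant.det_mult[where n = "m + n"]) (auto simp: det_four_block_mat_lower_left_zero[of _ m _ n])
  moreover have "Determinant.det (?L * ?M) = Determinant.det (1\<^sub>m n + Y * X)"
    unfolding 1 by (subst det_four_block_mat_lower_left_zero[of _ m _ n])
      (use add_carrier_mat[OF mult_carrier_mat[OF assms(2,1)]] in auto)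
  moreover have "Determinant.det (?U * ?M) = Determinant.det (1\<^sub>m m + X * Y)"
    unfolding 2 by (subst det_four_block_mat_upper_right_zero[of _ m _ n])
      (use add_carrier_mat[OF mult_carrier_mat[OF assms]] in auto)
  ultimately show ?thesis by simp
qed

text \<open>Its purpose is to trade an \<open>m\<close> by \<open>m\<close> determinant over a frame
  for an \<open>n\<close> by \<open>n\<close> determinant over a basis, as in
  \<open>nm_eq_det\<close>. It is the generic case of \<open>det_one_plus_mult_commute\<close>,
  evaluated at the given entries.\<close>

lemma (in cring) sylvester_det:
  assumes "\<And>i k. i < m \<Longrightarrow> k < n \<Longrightarrow> X i k \<in> carrier R" "\<And>k i. k < n \<Longrightarrow> i < m \<Longrightarrow> Y k i \<in> carrier R"
  shows "det R m (\<lambda>i j. (if i = j then \<one> else \<zero>) \<oplus> (\<Oplus>k\<in>{..<n}. X i k \<otimes> Y k j))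
    = det R n (\<lambda>k l. (if k = l then \<one> else \<zero>) \<oplus> (\<Oplus>i\<in>{..<m}. Y k i \<otimes> X i l))"
proof -
  obtain x where x: "\<And>v. x v \<in> carrier R"
    "\<And>b i j. (if b = (0::nat) then X i j else Y i j) \<in> carrier R \<Longrightarrow>
       mpoly_value x (mvar b i j) = (if b = 0 then X i j else Y i j)"
    using mvar_values[of "\<lambda>b i j. if b = 0 then X i j else Y i j"] by blast
  note v = x(2)[of 0, simplified] x(2)[of 1, simplified]
  let ?X = "Matrix.mat m n (\<lambda>(i, j). mvar 0 i j)" and ?Y = "Matrix.mat n m (\<lambda>(i, j). mvar 1 i j)"
  have XY: "1\<^sub>m m + ?X * ?Y = Matrix.mat m m (\<lambda>(i, j). (if i = j then 1 else 0) + (\<Sum>k\<in>{..<n}. mvar 0 i k * mvar 1 k j))"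
    by (rule eq_matI) (auto simp: scalar_prod_def atLeast0LessThan intro!: sum.cong)
  have YX: "1\<^sub>m n + ?Y * ?X = Matrix.mat n n (\<lambda>(i, j). (if i = j then 1 else 0) + (\<Sum>k\<in>{..<m}. mvar 1 i k * mvar 0 k j))"
    by (rule eq_matI) (auto simp: scalar_prod_def atLeast0LessThan intro!: sum.cong)
  have "mpoly_value x (Determinant.det (1\<^sub>m m + ?X * ?Y)) = mpoly_value x (Determinant.det (1\<^sub>m n + ?Y * ?X))"
    by (subst det_one_plus_mult_commute[where n = n]) auto
  then have "det R m (\<lambda>i j. mpoly_value x ((if i = j then 1 else 0) + (\<Sum>k\<in>{..<n}. mvar 0 i k * mvar 1 k j)))
    = det R n (\<lambda>i j. mpoly_value x ((if i = j then 1 else 0) + (\<Sum>k\<in>{..<m}. mvar 1 i k * mvar 0 k j)))"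
    unfolding XY YX mpoly_value_det[OF x(1)] .
  also have "det R m (\<lambda>i j. mpoly_value x ((if i = j then 1 else 0) + (\<Sum>k\<in>{..<n}. mvar 0 i k * mvar 1 k j)))
    = det R m (\<lambda>i j. (if i = j then \<one> else \<zero>) \<oplus> (\<Oplus>k\<in>{..<n}. X i k \<otimes> Y k j))"
    by (rule det_cong) (use assms v x in \<open>auto intro!: finsum_cong' arg_cong2[where f = "(\<oplus>)"] finsum_closed
      simp: mpoly_value_sum mpoly_value_mult mpoly_value_add\<close>)
  also have "det R n (\<lambda>i j. mpoly_value x ((if i = j then 1 else 0) + (\<Sum>k\<in>{..<m}. mvar 1 i k * mvar 0 k j)))
    = det R n (\<lambda>k l. (if k = l then \<one> else \<zero>) \<oplus> (\<Oplus>i\<in>{..<m}. Y k i \<otimes> X i l))"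
    by (rule det_cong) (use assms v x in \<open>auto intro!: finsum_cong' arg_cong2[where f = "(\<oplus>)"] finsum_closed
      simp: mpoly_value_sum mpoly_value_mult mpoly_value_add\<close>)
  finally show ?thesis .
qed

lemma (in cring) det_scalar:
  assumes r: "r \<in> carrier R"
  shows "det R n (\<lambda>i j. if i = j then r else \<zero>) = r [^] n"
proof -
  have x: "r \<in> carrier R" for i :: nat using r .
  let ?r = "mpoly_var 0" and ?x = "\<lambda>i::nat. r"
  have "Determinant.det (Matrix.mat n n (\<lambda>(i, j). if i = j then ?r else 0)) = Determinant.det (?r \<cdot>\<^sub>m 1\<^sub>m n)"
    by (rule arg_cong[where f = Determinant.det]) (auto intro!: eq_matI)
  also have "\<dots> = ?r ^ n" by simp
  finally have *: "Determinant.det (Matrix.mat n n (\<lambda>(i, j). if i = j then ?r else 0)) = ?r ^ n" .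
  have "mpoly_value ?x (?r ^ n) = r [^] n"
    by (induction n) (use r in \<open>auto simp: mpoly_value_mult m_comm\<close>)
  then show ?thesis
    using mpoly_value_det[of ?x n "\<lambda>i j. if i = j then ?r else 0", OF x] r
    by (simp add: * if_distrib[of "mpoly_value ?x"] cong: if_cong)
qed

lemma (in ring_hom_cring) hom_int_pow:
  assumes "a \<in> carrier R" shows "h ([(z::int)] \<cdot>\<^bsub>R\<^esub> a) = [z] \<cdot>\<^bsub>S\<^esub> h a"
proof -
  have "h ([int k] \<cdot>\<^bsub>R\<^esub> a) = [int k] \<cdot>\<^bsub>S\<^esub> h a" for k
    using assms by (induction k) (auto simp: R.add.int_pow_mult S.add.int_pow_mult )
  then show ?thesis
    using assms by (cases z rule: int_cases2) (auto simp: R.add.int_pow_neg S.add.int_pow_neg )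
qed

lemma (in ring_hom_cring) hom_det:
  assumes M: "\<And>i j. i < n \<Longrightarrow> j < n \<Longrightarrow> M i j \<in> carrier R"
  shows "h (det R n M) = det S n (\<lambda>i j. h (M i j))"
proof -
  have [simp]: "M i (p i) \<in> carrier R" if "p permutes {..<n}" "i < n" for p i
    using that permutes_in_image[of p "{..<n}" i] M by auto
  show ?thesis
    unfolding Defs.det_def
    by (subst hom_finsum) (auto simp: hom_int_pow hom_finprod intro!: S.finsum_cong' arg_cong[where f = "add_pow S _"]
         S.finprod_cong' S.finprod_closed R.finprod_closed)
qed

text \<open>Multiplication by \<open>b\<close> in a frame is written as the identity plus the effect
  of \<open>b - 1\<close>. This is the composition rule for such operators, with the summands in the
  order in which \<open>nm_mult\<close> meets them.\<close>

lemma (in cring) minus_one_mult: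
  assumes [simp]: "b \<in> carrier R" "c \<in> carrier R" "x \<in> carrier R"
  shows "(b \<otimes> c \<ominus> \<one>) \<otimes> x = (c \<ominus> \<one>) \<otimes> x \<oplus> ((b \<ominus> \<one>) \<otimes> x \<oplus> (b \<ominus> \<one>) \<otimes> ((c \<ominus> \<one>) \<otimes> x))"
  using assms by algebra

lemma (in cring) eq_plus_minus_one:
  assumes [simp]: "b \<in> carrier R" "x \<in> carrier R"
  shows "b \<otimes> x = x \<oplus> (b \<ominus> \<one>) \<otimes> x"
  using assms by algebra

section \<open>Algebras with a dual frame\<close>

definition functional ::
  "('a, 'm) ring_scheme \<Rightarrow> ('b, 'n) ring_scheme \<Rightarrow> ('a \<Rightarrow> 'b) \<Rightarrow> ('b \<Rightarrow> 'a) \<Rightarrow> bool" where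
  "functional A B \<phi> g \<longleftrightarrow> g \<in> carrier B \<rightarrow> carrier A \<and>
     (\<forall>x\<in>carrier B. \<forall>y\<in>carrier B. g (x \<oplus>\<^bsub>B\<^esub> y) = g x \<oplus>\<^bsub>A\<^esub> g y) \<and>
     (\<forall>a\<in>carrier A. \<forall>x\<in>carrier B. g (\<phi> a \<otimes>\<^bsub>B\<^esub> x) = a \<otimes>\<^bsub>A\<^esub> g x)"

lemma functionalD:
  assumes "functional A B \<phi> g"
  shows "x \<in> carrier B \<Longrightarrow> g x \<in> carrier A"
    "x \<in> carrier B \<Longrightarrow> y \<in> carrier B \<Longrightarrow> g (x \<oplus>\<^bsub>B\<^esub> y) = g x \<oplus>\<^bsub>A\<^esub> g y"
    "a \<in> carrier A \<Longrightarrow> x \<in> carrier B \<Longrightarrow> g (\<phi> a \<otimes>\<^bsub>B\<^esub> x) = a \<otimes>\<^bsub>A\<^esub> g x"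
  using assms by (auto simp: functional_def)

lemma (in ring_hom_cring) functional_zero:
  assumes "functional R S h g" shows "g \<zero>\<^bsub>S\<^esub> = \<zero>"
  using functionalD(3)[OF assms, of \<zero> "\<zero>\<^bsub>S\<^esub>"] functionalD(1)[OF assms] by simp

lemma (in ring_hom_cring) functional_finsum:
  assumes g: "functional R S h g" and F: "F \<in> I \<rightarrow> carrier S"
  shows "g (finsum S F I) = (\<Oplus>i\<in>I. g (F i))"
proof (cases "finite I")
  case True
  then show ?thesis using F
    by induction (auto simp: functionalD[OF g] functional_zero[OF g] S.finsum_closed Pi_iff)
next
  case False
  then show ?thesis by (simp add: functional_zero[OF g])
qed

text \<open>
  The family \<open>(x\<^sub>j, f\<^sub>j)\<close> is a dual frame of a finitely generated projective module: it retracts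
  \<open>A\<^sup>m\<close> onto \<open>B\<close>. The determinant of multiplication by \<open>b\<close> on \<open>B\<close>, extended by the identity on
  the complementary summand of \<open>A\<^sup>m\<close>, is a global formula for the norm.
\<close>

locale framed_algebra = ring_hom_cring A B \<phi>
  for A :: "('a, 'a1) ring_scheme" (structure) and B :: "('b, 'b1) ring_scheme" (structure) and \<phi> +
  fixes m :: nat and x :: "nat \<Rightarrow> 'b" and f :: "nat \<Rightarrow> 'b \<Rightarrow> 'a"
  assumes frame_closed [simp]: "\<And>j. j < m \<Longrightarrow> x j \<in> carrier B"
    and frame_functional: "\<And>j. j < m \<Longrightarrow> functional A B \<phi> (f j)"
    and frame_expand: "\<And>b. b \<in> carrier B \<Longrightarrow> (\<Oplus>\<^bsub>B\<^esub>j\<in>{..<m}. \<phi> (f j b) \<otimes>\<^bsub>B\<^esub> x j) = b"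

text \<open>Let \<open>p\<close> send the standard basis of \<open>A^m\<close> to the
  \<open>x j\<close> and let \<open>i\<close> have the coordinates \<open>f i\<close>. The matrix is
  that of \<open>1 + i (b - 1) p\<close>: it acts as \<open>b\<close> on the image of
  \<open>i\<close> and as the identity on the kernel of \<open>p\<close>.\<close>

definition frame_norm ::
  "('a, 'm) ring_scheme \<Rightarrow> ('b, 'n) ring_scheme \<Rightarrow> nat \<Rightarrow> (nat \<Rightarrow> 'b) \<Rightarrow> (nat \<Rightarrow> 'b \<Rightarrow> 'a) \<Rightarrow> 'b \<Rightarrow> 'a" where
  "frame_norm A B m x f b = det A m (\<lambda>i j. (if i = j then \<one>\<^bsub>A\<^esub> else \<zero>\<^bsub>A\<^esub>) \<oplus>\<^bsub>A\<^esub>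
     f i ((b \<ominus>\<^bsub>B\<^esub> \<one>\<^bsub>B\<^esub>) \<otimes>\<^bsub>B\<^esub> x j))"

context framed_algebra
begin

lemmas f_simps [simp] = functionalD[OF frame_functional]

lemma functional_expand:
  assumes g: "functional A B \<phi> g" and b: "b \<in> carrier B"
  shows "g b = (\<Oplus>j\<in>{..<m}. f j b \<otimes> g (x j))"
proof -
  have "g b = g (\<Oplus>\<^bsub>B\<^esub>j\<in>{..<m}. \<phi> (f j b) \<otimes>\<^bsub>B\<^esub> x j)" using b by (simp add: frame_expand)
  also have "\<dots> = (\<Oplus>j\<in>{..<m}. g (\<phi> (f j b) \<otimes>\<^bsub>B\<^esub> x j))"
    by (rule functional_finsum[OF g]) (use b in auto)
  also have "\<dots> = (\<Oplus>j\<in>{..<m}. f j b \<otimes> g (x j))"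
    by (rule R.finsum_cong') (use b functionalD[OF g] in auto)
  finally show ?thesis .
qed

lemma functional_mult_expand:
  assumes g: "functional A B \<phi> g" and "b \<in> carrier B" "c \<in> carrier B"
  shows "g (c \<otimes>\<^bsub>B\<^esub> b) = (\<Oplus>j\<in>{..<m}. g (c \<otimes>\<^bsub>B\<^esub> x j) \<otimes> f j b)"
proof -
  have "c \<otimes>\<^bsub>B\<^esub> b = c \<otimes>\<^bsub>B\<^esub> (\<Oplus>\<^bsub>B\<^esub>j\<in>{..<m}. \<phi> (f j b) \<otimes>\<^bsub>B\<^esub> x j)" using assms by (simp add: frame_expand)
  also have "\<dots> = (\<Oplus>\<^bsub>B\<^esub>j\<in>{..<m}. c \<otimes>\<^bsub>B\<^esub> (\<phi> (f j b) \<otimes>\<^bsub>B\<^esub> x j))"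
    by (rule S.finsum_rdistr) (use assms in auto)
  also have "g \<dots> = (\<Oplus>j\<in>{..<m}. g (c \<otimes>\<^bsub>B\<^esub> (\<phi> (f j b) \<otimes>\<^bsub>B\<^esub> x j)))"
    by (rule functional_finsum[OF g]) (use assms in auto)
  also have "\<dots> = (\<Oplus>j\<in>{..<m}. g (c \<otimes>\<^bsub>B\<^esub> x j) \<otimes> f j b)"
    by (rule R.finsum_cong') (use assms functionalD[OF g] in \<open>auto simp: S.m_lcomm[of c] R.m_comm\<close>)
  finally show ?thesis .
qed

abbreviation "nm \<equiv> frame_norm A B m x f"

lemma nm_closed [simp]: "b \<in> carrier B \<Longrightarrow> nm b \<in> carrier A"
  unfolding frame_norm_def by (rule R.det_closed) auto

lemma nm_one [simp]: "nm \<one>\<^bsub>B\<^esub> = \<one>"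
proof -
  have "nm \<one>\<^bsub>B\<^esub> = det A m (\<lambda>i j. if i = j then \<one> else \<zero>)"
    unfolding frame_norm_def
    by (rule R.det_cong) (auto simp: functional_zero[OF frame_functional] S.r_neg a_minus_def)
  then show ?thesis by (simp add: R.det_scalar)
qed

text \<open>Since \<open>p i = 1\<close> on \<open>B\<close>, which is \<open>frame_expand\<close>,
  the operators \<open>1 + i (b - 1) p\<close> and \<open>1 + i (c - 1) p\<close> compose to
  \<open>1 + i (b c - 1) p\<close>. On entries, the Kronecker deltas collapse two sums and
  \<open>functional_mult_expand\<close> the third.\<close>

lemma nm_mult:
  assumes b: "b \<in> carrier B" and c: "c \<in> carrier B"
  shows "nm (b \<otimes>\<^bsub>B\<^esub> c) = nm b \<otimes> nm c"
proof -
  let ?d = "\<lambda>i j. if i = j then \<one> else \<zero>"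
  let ?b = "b \<ominus>\<^bsub>B\<^esub> \<one>\<^bsub>B\<^esub>" and ?c = "c \<ominus>\<^bsub>B\<^esub> \<one>\<^bsub>B\<^esub>"
  have "nm b \<otimes> nm c = det A m (\<lambda>i j. \<Oplus>k\<in>{..<m}. (?d i k \<oplus> f i (?b \<otimes>\<^bsub>B\<^esub> x k)) \<otimes> (?d k j \<oplus> f k (?c \<otimes>\<^bsub>B\<^esub> x j)))"
    unfolding frame_norm_def by (rule R.det_mat_mult[symmetric]) (use b c in auto)
  also have "\<dots> = nm (b \<otimes>\<^bsub>B\<^esub> c)"
    unfolding frame_norm_def
  proof (rule R.det_cong)
    fix i j assume i: "i < m" and j: "j < m"
    have bc: "(b \<otimes>\<^bsub>B\<^esub> c \<ominus>\<^bsub>B\<^esub> \<one>\<^bsub>B\<^esub>) \<otimes>\<^bsub>B\<^esub> x j = ?c \<otimes>\<^bsub>B\<^esub> x j \<oplus>\<^bsub>B\<^esub> (?b \<otimes>\<^bsub>B\<^esub> x j \<oplus>\<^bsub>B\<^esub> ?b \<otimes>\<^bsub>B\<^esub> (?c \<otimes>\<^bsub>B\<^esub> x j))"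
      by (rule S.minus_one_mult) (use b c j in auto)
    have "(\<Oplus>k\<in>{..<m}. (?d i k \<oplus> f i (?b \<otimes>\<^bsub>B\<^esub> x k)) \<otimes> (?d k j \<oplus> f k (?c \<otimes>\<^bsub>B\<^esub> x j)))
      = (\<Oplus>k\<in>{..<m}. (if i = k then ?d k j \<oplus> f k (?c \<otimes>\<^bsub>B\<^esub> x j) else \<zero>) \<oplus>
          ((if j = k then f i (?b \<otimes>\<^bsub>B\<^esub> x k) else \<zero>) \<oplus> f i (?b \<otimes>\<^bsub>B\<^esub> x k) \<otimes> f k (?c \<otimes>\<^bsub>B\<^esub> x j)))"
      by (rule R.finsum_cong') (use b c i j in \<open>auto simp: R.l_distr R.r_distr R.a_ac\<close>)
    also have "\<dots> = (?d i j \<oplus> f i (?c \<otimes>\<^bsub>B\<^esub> x j)) \<oplus> (f i (?b \<otimes>\<^bsub>B\<^esub> x j) \<oplus> f i (?b \<otimes>\<^bsub>B\<^esub> (?c \<otimes>\<^bsub>B\<^esub> x j)))"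
      using b c i j
      by (simp add: R.finsum_addf R.add.finprod_singleton functional_mult_expand[OF frame_functional, symmetric])
    also have "\<dots> = ?d i j \<oplus> f i ((b \<otimes>\<^bsub>B\<^esub> c \<ominus>\<^bsub>B\<^esub> \<one>\<^bsub>B\<^esub>) \<otimes>\<^bsub>B\<^esub> x j)"
      using b c i j by (simp add: bc R.a_assoc)
    finally show "(\<Oplus>k\<in>{..<m}. (?d i k \<oplus> f i (?b \<otimes>\<^bsub>B\<^esub> x k)) \<otimes> (?d k j \<oplus> f k (?c \<otimes>\<^bsub>B\<^esub> x j)))
      = ?d i j \<oplus> f i ((b \<otimes>\<^bsub>B\<^esub> c \<ominus>\<^bsub>B\<^esub> \<one>\<^bsub>B\<^esub>) \<otimes>\<^bsub>B\<^esub> x j)" .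
  qed (use b c in auto)
  finally show ?thesis by simp
qed

text \<open>With \<open>X\<close> the frame coordinates of the basis and \<open>Y\<close> the basis
  coordinates of the \<open>(b - 1) x j\<close>, the frame matrix is \<open>1 + X Y\<close>, whereas
  \<open>1 + Y X\<close> is the matrix of \<open>b\<close> in the basis. Sylvester's identity
  equates the determinants, so the frame does not influence the value.\<close>

lemma nm_eq_det:
  assumes e: "\<And>i. i < n \<Longrightarrow> e i \<in> carrier B" and g: "\<And>i. i < n \<Longrightarrow> functional A B \<phi> (g i)"
    and expand: "\<And>b. b \<in> carrier B \<Longrightarrow> (\<Oplus>\<^bsub>B\<^esub>i\<in>{..<n}. \<phi> (g i b) \<otimes>\<^bsub>B\<^esub> e i) = b"
    and dual: "\<And>i j. i < n \<Longrightarrow> j < n \<Longrightarrow> g i (e j) = (if i = j then \<one> else \<zero>)"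
    and b: "b \<in> carrier B"
  shows "nm b = det A n (\<lambda>i j. g i (b \<otimes>\<^bsub>B\<^esub> e j))"
proof -
  interpret E: framed_algebra A B \<phi> n e g by unfold_locales (use e g expand in auto)
  let ?b = "b \<ominus>\<^bsub>B\<^esub> \<one>\<^bsub>B\<^esub>"
  \<comment> \<open>Rewriting the frame functionals through the coordinates \<open>g k\<close>
    produces the factorization to which Sylvester's identity applies.\<close>
  have fe: "f i y = (\<Oplus>k\<in>{..<n}. f i (e k) \<otimes> g k y)" if "i < m" "y \<in> carrier B" for i y
  proof -
    have "f i y = (\<Oplus>k\<in>{..<n}. g k y \<otimes> f i (e k))"
      using that by (intro E.functional_expand frame_functional)
    also have "\<dots> = (\<Oplus>k\<in>{..<n}. f i (e k) \<otimes> g k y)"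
      by (rule R.finsum_cong') (use that e in \<open>auto simp: R.m_comm\<close>)
    finally show ?thesis .
  qed
  have "nm b = det A m (\<lambda>i j. (if i = j then \<one> else \<zero>) \<oplus> (\<Oplus>k\<in>{..<n}. f i (e k) \<otimes> g k (?b \<otimes>\<^bsub>B\<^esub> x j)))"
    unfolding frame_norm_def
    by (rule R.det_cong) (use b e in \<open>auto simp flip: fe\<close>)
  also have "\<dots> = det A n (\<lambda>k l. (if k = l then \<one> else \<zero>) \<oplus> (\<Oplus>i\<in>{..<m}. g k (?b \<otimes>\<^bsub>B\<^esub> x i) \<otimes> f i (e l)))"
    by (rule R.sylvester_det) (use b e in auto)
  also have "\<dots> = det A n (\<lambda>i j. g i (b \<otimes>\<^bsub>B\<^esub> e j))"
  proof (rule R.det_cong)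
    fix k l assume kl: "k < n" "l < n"
    have *: "b \<otimes>\<^bsub>B\<^esub> e l = e l \<oplus>\<^bsub>B\<^esub> ?b \<otimes>\<^bsub>B\<^esub> e l"
      by (rule S.eq_plus_minus_one) (use b e kl in auto)
    show "(if k = l then \<one> else \<zero>) \<oplus> (\<Oplus>i\<in>{..<m}. g k (?b \<otimes>\<^bsub>B\<^esub> x i) \<otimes> f i (e l)) = g k (b \<otimes>\<^bsub>B\<^esub> e l)"
      using kl b e dual by (simp add: * functional_mult_expand[OF g, symmetric])
  qed (use b e in auto)
  finally show ?thesis .
qed

end

lemma finsum_alg_module [simp]: "finsum (alg_module A B \<phi>) h I = finsum B h I"
  unfolding finsum_def finprod_def alg_module_def by simp

lemma smult_alg_module [simp]: "a \<odot>\<^bsub>alg_module A B \<phi>\<^esub> b = \<phi> a \<otimes>\<^bsub>B\<^esub> b"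
  by (simp add: alg_module_def)

lemma carrier_alg_module [simp]: "carrier (alg_module A B \<phi>) = carrier B"
  by (simp add: alg_module_def)

section \<open>Coordinates with respect to a basis of an algebra\<close>

context ring_hom_cring
begin

text \<open>The description is the one inside \<open>mult_det\<close>, so that the matrix entries
  there are values of \<open>coord\<close>.\<close>

definition coord :: "nat \<Rightarrow> (nat \<Rightarrow> 'c) \<Rightarrow> nat \<Rightarrow> 'c \<Rightarrow> 'a" where
  "coord n e i b = (THE c. represents R (alg_module R S h) n e b c) i"

lemma coord_eqI:
  assumes e: "is_basis R (alg_module R S h) n e" and c: "\<And>i. i < n \<Longrightarrow> c i \<in> carrier R"
    and i: "i < n" and b: "b = (\<Oplus>\<^bsub>S\<^esub>i\<in>{..<n}. h (c i) \<otimes>\<^bsub>S\<^esub> e i)"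
  shows "coord n e i b = c i"
proof -
  let ?c = "restrict c {..<n}"
  have eS: "\<And>i. i < n \<Longrightarrow> e i \<in> carrier S" using e by (auto simp: is_basis_def)
  have bS: "b \<in> carrier S" unfolding b by (rule S.finsum_closed) (use eS c in auto)
  then have ex: "\<exists>!c. represents R (alg_module R S h) n e b c" using e by (auto simp: is_basis_def)
  have r: "represents R (alg_module R S h) n e b ?c"
    unfolding represents_def b by (auto simp: c eS intro!: S.finsum_cong')
  show ?thesis unfolding coord_def the1_equality[OF ex, OF r] using i by simp
qed

lemma
  assumes e: "is_basis R (alg_module R S h) n e"
  shows coord_closed: "\<And>i b. i < n \<Longrightarrow> b \<in> carrier S \<Longrightarrow> coord n e i b \<in> carrier R"
    and coord_expand: "\<And>b. b \<in> carrier S \<Longrightarrow> (\<Oplus>\<^bsub>S\<^esub>i\<in>{..<n}. h (coord n e i b) \<otimes>\<^bsub>S\<^esub> e i) = b"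
    and coord_functional: "\<And>i. i < n \<Longrightarrow> functional R S h (coord n e i)"
    and coord_dual: "\<And>i j. i < n \<Longrightarrow> j < n \<Longrightarrow> coord n e i (e j) = (if i = j then \<one> else \<zero>)"
proof -
  have eS [simp]: "\<And>i. i < n \<Longrightarrow> e i \<in> carrier S" using e by (auto simp: is_basis_def)
  have r: "represents R (alg_module R S h) n e b (THE c. represents R (alg_module R S h) n e b c)"
    if "b \<in> carrier S" for b
  proof -
    have "\<exists>!c. represents R (alg_module R S h) n e b c" using e that by (simp add: is_basis_def)
    from theI'[OF this] show ?thesis .
  qed
  show cl [simp]: "coord n e i b \<in> carrier R" if "i < n" "b \<in> carrier S" for i b
    using r[OF that(2)] that(1) by (auto simp: represents_def coord_def)
  show ex: "(\<Oplus>\<^bsub>S\<^esub>i\<in>{..<n}. h (coord n e i b) \<otimes>\<^bsub>S\<^esub> e i) = b" if "b \<in> carrier S" for b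
    using r[OF that] by (auto simp: represents_def coord_def)
  show "functional R S h (coord n e i)" if i: "i < n" for i
    unfolding functional_def
  proof (intro conjI ballI)
    fix b c assume b: "b \<in> carrier S" and c: "c \<in> carrier S"
    have "b \<oplus>\<^bsub>S\<^esub> c = (\<Oplus>\<^bsub>S\<^esub>i\<in>{..<n}. h (coord n e i b) \<otimes>\<^bsub>S\<^esub> e i) \<oplus>\<^bsub>S\<^esub> (\<Oplus>\<^bsub>S\<^esub>i\<in>{..<n}. h (coord n e i c) \<otimes>\<^bsub>S\<^esub> e i)"
      using b c by (simp add: ex)
    also have "\<dots> = (\<Oplus>\<^bsub>S\<^esub>i\<in>{..<n}. h (coord n e i b) \<otimes>\<^bsub>S\<^esub> e i \<oplus>\<^bsub>S\<^esub> h (coord n e i c) \<otimes>\<^bsub>S\<^esub> e i)"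
      by (rule S.finsum_addf[symmetric]) (use b c in auto)
    also have "\<dots> = (\<Oplus>\<^bsub>S\<^esub>i\<in>{..<n}. h (coord n e i b \<oplus> coord n e i c) \<otimes>\<^bsub>S\<^esub> e i)"
      by (rule S.finsum_cong') (use b c in \<open>auto simp: S.l_distr\<close>)
    finally show "coord n e i (b \<oplus>\<^bsub>S\<^esub> c) = coord n e i b \<oplus> coord n e i c"
      by (intro coord_eqI[OF e]) (use b c i in auto)
  next
    fix a b assume a: "a \<in> carrier R" and b: "b \<in> carrier S"
    have "h a \<otimes>\<^bsub>S\<^esub> b = h a \<otimes>\<^bsub>S\<^esub> (\<Oplus>\<^bsub>S\<^esub>i\<in>{..<n}. h (coord n e i b) \<otimes>\<^bsub>S\<^esub> e i)"
      using b by (simp add: ex)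
    also have "\<dots> = (\<Oplus>\<^bsub>S\<^esub>i\<in>{..<n}. h a \<otimes>\<^bsub>S\<^esub> (h (coord n e i b) \<otimes>\<^bsub>S\<^esub> e i))"
      by (rule S.finsum_rdistr) (use a b in auto)
    also have "\<dots> = (\<Oplus>\<^bsub>S\<^esub>i\<in>{..<n}. h (a \<otimes> coord n e i b) \<otimes>\<^bsub>S\<^esub> e i)"
      by (rule S.finsum_cong') (use a b in \<open>auto simp: S.m_assoc\<close>)
    finally show "coord n e i (h a \<otimes>\<^bsub>S\<^esub> b) = a \<otimes> coord n e i b"
      by (intro coord_eqI[OF e]) (use a b i in auto)
  qed (use i in auto)
  show "coord n e i (e j) = (if i = j then \<one> else \<zero>)" if i: "i < n" and j: "j < n" for i j
  proof (rule coord_eqI[OF e _ i, of "\<lambda>i. if i = j then \<one> else \<zero>"])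
    have "(\<Oplus>\<^bsub>S\<^esub>i\<in>{..<n}. h (if i = j then \<one> else \<zero>) \<otimes>\<^bsub>S\<^esub> e i) = (\<Oplus>\<^bsub>S\<^esub>i\<in>{..<n}. if j = i then e i else \<zero>\<^bsub>S\<^esub>)"
      by (rule S.finsum_cong') auto
    then show "e j = (\<Oplus>\<^bsub>S\<^esub>i\<in>{..<n}. h (if i = j then \<one> else \<zero>) \<otimes>\<^bsub>S\<^esub> e i)"
      using j by (simp add: S.add.finprod_singleton)
  qed auto
qed

end

lemma (in framed_algebra) nm_eq_mult_det:
  assumes "is_basis A (alg_module A B \<phi>) n e" "b \<in> carrier B"
  shows "nm b = mult_det n A B \<phi> e b"
proof -
  have "nm b = det A n (\<lambda>i j. coord n e i (b \<otimes>\<^bsub>B\<^esub> e j))"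
    by (rule nm_eq_det[OF _ coord_functional coord_expand coord_dual])
      (use assms in \<open>auto simp: is_basis_def\<close>)
  then show ?thesis by (simp add: mult_det_def coord_def)
qed

hide_const (open) Archimedean_Field.frac

section \<open>Localization\<close>

lemma (in ring) idealI_basic:
  assumes "I \<subseteq> carrier R" "\<zero> \<in> I" "\<And>x y. x \<in> I \<Longrightarrow> y \<in> I \<Longrightarrow> x \<oplus> y \<in> I"
    "\<And>x a. x \<in> I \<Longrightarrow> a \<in> carrier R \<Longrightarrow> a \<otimes> x \<in> I" "\<And>x a. x \<in> I \<Longrightarrow> a \<in> carrier R \<Longrightarrow> x \<otimes> a \<in> I"
  shows "ideal I R"
proof (rule idealI)
  show "ring R" by (rule ring_axioms)
  show "subgroup I (add_monoid R)"
  proof (rule add.subgroupI)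
    show "\<ominus> x \<in> I" if "x \<in> I" for x
      using assms(4)[OF that, of "\<ominus> \<one>"] assms(1) that l_minus[of \<one> x] by auto
  qed (use assms in auto)
qed (use assms in auto)

text \<open>Zorn's lemma among the ideals that contain \<open>I\<close> and avoid
  \<open>\<one>\<close>: unions of chains still avoid \<open>\<one>\<close>, and a maximal member is
  a maximal ideal, hence prime.\<close>

lemma (in cring) exists_prime_above:
  assumes I: "ideal I R" "\<one> \<notin> I"
  obtains P where "primeideal P R" "I \<subseteq> P"
proof -
  let ?S = "{J. ideal J R \<and> I \<subseteq> J \<and> \<one> \<notin> J}"
  have "\<exists>M\<in>?S. \<forall>X\<in>?S. M \<subseteq> X \<longrightarrow> X = M"
  proof (rule subset_Zorn_nonempty)
    show "?S \<noteq> {}" using I by auto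
    fix C assume C: "C \<noteq> {}" "subset.chain ?S C"
    then have "subset.chain {J. ideal J R} C" by (auto simp: subset.chain_def)
    from chain_Union_is_ideal[OF this] C show "\<Union>C \<in> ?S" by (auto simp: subset.chain_def)
  qed
  then obtain M where M: "ideal M R" "I \<subseteq> M" "\<one> \<notin> M"
    and max: "\<And>X. ideal X R \<Longrightarrow> I \<subseteq> X \<Longrightarrow> \<one> \<notin> X \<Longrightarrow> M \<subseteq> X \<Longrightarrow> X = M" by auto
  have "maximalideal M R"
  proof (rule maximalidealI)
    show "carrier R \<noteq> M" using M by auto
    show "J = M \<or> J = carrier R" if J: "ideal J R" "M \<subseteq> J" "J \<subseteq> carrier R" for J
      using max[of J] J M ideal.one_imp_carrier[of J R] by auto
  qed fact
  then show ?thesis using that M maximalideal_prime by blast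
qed

text \<open>The recurrent passage from local to global: to prove an equality, let \<open>J\<close>
  consist of the elements that annihilate the difference and find, for each prime, a member of
  \<open>J\<close> outside it. The same device yields partitions of unity in
  \<open>loc_glue\<close>.\<close>

lemma (in cring) eq_if_locally_eq_one:
  assumes J: "ideal J R" and "\<And>P. primeideal P R \<Longrightarrow> \<exists>x\<in>J. x \<notin> P"
  shows "\<one> \<in> J"
proof (rule ccontr)
  assume "\<one> \<notin> J"
  from exists_prime_above[OF J this] obtain P where "primeideal P R" "J \<subseteq> P" .
  then show False using assms(2)[of P] by auto
qed

section \<open>Localizations as commutative rings\<close>

context cring
begin

lemma submonoid_carrier: "submonoid (carrier R) R"
  by (rule submonoid.intro) auto

lemma mgen_subset: "V \<subseteq> mgen R V"
  by (auto simp: mgen_def)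

lemma mgen_least: "submonoid S R \<Longrightarrow> V \<subseteq> S \<Longrightarrow> mgen R V \<subseteq> S"
  by (auto simp: mgen_def)

lemma mgen_mono: "V \<subseteq> W \<Longrightarrow> mgen R V \<subseteq> mgen R W"
  by (auto simp: mgen_def)

lemma mgen_closed: "V \<subseteq> carrier R \<Longrightarrow> s \<in> mgen R V \<Longrightarrow> s \<in> carrier R"
  using mgen_least[OF submonoid_carrier] by auto

lemma mgen_one [simp]: "\<one> \<in> mgen R V"
  by (auto simp: mgen_def submonoid_def)

lemma mgen_mult: "s \<in> mgen R V \<Longrightarrow> t \<in> mgen R V \<Longrightarrow> s \<otimes> t \<in> mgen R V"
  by (auto simp: mgen_def submonoid_def)

lemma mgen_finprod:
  assumes "V \<subseteq> carrier R" "\<And>i. i \<in> I \<Longrightarrow> F i \<in> mgen R V"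
  shows "(\<Otimes>i\<in>I. F i) \<in> mgen R V"
proof (cases "finite I")
  case True
  then show ?thesis using assms(2)
    by induction (auto simp: mgen_closed[OF assms(1)] intro!: mgen_mult)
qed simp

text \<open>By commutativity the products of one factor from each side already form a submonoid that
  contains both generating sets.\<close>

lemma mgen_union:
  assumes V: "V \<subseteq> carrier R" "W \<subseteq> carrier R" and t: "t \<in> mgen R (V \<union> W)"
  obtains a b where "a \<in> mgen R V" "b \<in> mgen R W" "t = a \<otimes> b"
proof -
  let ?S = "{a \<otimes> b | a b. a \<in> mgen R V \<and> b \<in> mgen R W}"
  have "submonoid ?S R"
  proof (rule submonoid.intro)
    show "?S \<subseteq> carrier R" using V by (auto intro: mgen_closed)
    have "\<one> = \<one> \<otimes> \<one>" by simp
    then show "\<one> \<in> ?S" using mgen_one by blast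
    fix x y assume "x \<in> ?S" "y \<in> ?S"
    then obtain a b c d where *: "a \<in> mgen R V" "b \<in> mgen R W" "c \<in> mgen R V" "d \<in> mgen R W" "x = a \<otimes> b" "y = c \<otimes> d"
      by auto
    have [simp]: "a \<in> carrier R" "b \<in> carrier R" "c \<in> carrier R" "d \<in> carrier R"
      using * V mgen_closed by blast+
    have "x \<otimes> y = (a \<otimes> c) \<otimes> (b \<otimes> d)" by (simp add: *(5,6) m_ac)
    moreover have "a \<otimes> c \<in> mgen R V" "b \<otimes> d \<in> mgen R W" using * by (auto intro: mgen_mult)
    ultimately show "x \<otimes> y \<in> ?S" by blast
  qed
  moreover have "V \<union> W \<subseteq> ?S"
  proof
    fix v assume v: "v \<in> V \<union> W"
    then have "v = v \<otimes> \<one>" "v = \<one> \<otimes> v" using V by auto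
    moreover have "v \<in> mgen R V \<or> v \<in> mgen R W" using v mgen_subset by blast
    ultimately show "v \<in> ?S" using mgen_one by blast
  qed
  ultimately show ?thesis using that t mgen_least[of ?S "V \<union> W"] by auto
qed

lemma mgen_disjoint_prime:
  assumes P: "primeideal P R" and "V \<subseteq> carrier R" "V \<inter> P = {}"
  shows "mgen R V \<inter> P = {}"
proof -
  interpret primeideal P R by fact
  have "submonoid (carrier R - P) R"
    by (rule submonoid.intro) (use I_prime I_notcarr one_imp_carrier in auto)
  from mgen_least[OF this, of V] assms show ?thesis by auto
qed

lemma equiv_loc_rel:
  assumes V: "V \<subseteq> carrier R"
  shows "equiv (carrier R \<times> mgen R V) (loc_rel R V)"
proof (rule equivI)
  note [simp] = mgen_closed[OF V]
  show "loc_rel R V \<subseteq> (carrier R \<times> mgen R V) \<times> (carrier R \<times> mgen R V)"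
    by (auto simp: loc_rel_def)
  show "refl_on (carrier R \<times> mgen R V) (loc_rel R V)"
    by (auto simp: refl_on_def loc_rel_def intro!: bexI[of _ \<one>])
  show "sym (loc_rel R V)" by (auto simp: sym_def loc_rel_def) (metis)
  show "trans (loc_rel R V)"
  proof (rule transI)
    fix x y z assume "(x, y) \<in> loc_rel R V" "(y, z) \<in> loc_rel R V"
    then obtain r s r' s' r'' s'' t u where *: "x = (r, s)" "y = (r', s')" "z = (r'', s'')"
      and [simp]: "r \<in> carrier R" "r' \<in> carrier R" "r'' \<in> carrier R"
        "s \<in> mgen R V" "s' \<in> mgen R V" "s'' \<in> mgen R V" "t \<in> mgen R V" "u \<in> mgen R V"
      and 1: "t \<otimes> (r \<otimes> s') = t \<otimes> (r' \<otimes> s)" and 2: "u \<otimes> (r' \<otimes> s'') = u \<otimes> (r'' \<otimes> s')"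
      by (auto simp: loc_rel_def)
    \<comment> \<open>Besides the two witnesses \<open>t\<close> and \<open>u\<close> the middle
      denominator \<open>s'\<close> enters, because it has to be multiplied onto both sides before
      the two relations can be chained.\<close>
    have "(t \<otimes> u \<otimes> s') \<otimes> (r \<otimes> s'') = (u \<otimes> s'') \<otimes> (t \<otimes> (r \<otimes> s'))" by (simp add: m_ac)
    also have "\<dots> = (t \<otimes> s) \<otimes> (u \<otimes> (r' \<otimes> s''))" unfolding 1 by (simp add: m_ac)
    also have "\<dots> = (t \<otimes> u \<otimes> s') \<otimes> (r'' \<otimes> s)" unfolding 2 by (simp add: m_ac)
    finally show "(x, z) \<in> loc_rel R V"
      unfolding * loc_rel_def by (auto intro!: mgen_mult bexI[of _ "t \<otimes> u \<otimes> s'"])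
  qed
qed

lemma frac_eq_iff:
  assumes "V \<subseteq> carrier R" "r \<in> carrier R" "s \<in> mgen R V" "r' \<in> carrier R" "s' \<in> mgen R V"
  shows "frac R V r s = frac R V r' s' \<longleftrightarrow> (\<exists>t\<in>mgen R V. t \<otimes> (r \<otimes> s') = t \<otimes> (r' \<otimes> s))"
proof -
  have "frac R V r s = frac R V r' s' \<longleftrightarrow> ((r, s), (r', s')) \<in> loc_rel R V"
    unfolding Defs.frac_def by (rule eq_equiv_class_iff[OF equiv_loc_rel]) (use assms in auto)
  then show ?thesis using assms by (auto simp: loc_rel_def)
qed

lemma frac_eqI:
  assumes "V \<subseteq> carrier R" "r \<in> carrier R" "s \<in> mgen R V" "r' \<in> carrier R" "s' \<in> mgen R V"
    "r \<otimes> s' = r' \<otimes> s"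
  shows "frac R V r s = frac R V r' s'"
  using assms mgen_one by (subst frac_eq_iff) auto

lemma frac_mem:
  assumes "V \<subseteq> carrier R" "r \<in> carrier R" "s \<in> mgen R V"
  shows "(r, s) \<in> frac R V r s"
  using equiv_class_self[OF equiv_loc_rel[OF assms(1)]] assms unfolding Defs.frac_def by auto

lemma frac_memD:
  assumes "V \<subseteq> carrier R" "r \<in> carrier R" "s \<in> mgen R V" "(r', s') \<in> frac R V r s"
  shows "r' \<in> carrier R" "s' \<in> mgen R V" "frac R V r' s' = frac R V r s"
proof -
  have *: "((r, s), (r', s')) \<in> loc_rel R V" using assms(4) by (simp add: Defs.frac_def)
  then show "r' \<in> carrier R" "s' \<in> mgen R V" by (auto simp: loc_rel_def)
  show "frac R V r' s' = frac R V r s"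
    using equiv_class_eq[OF equiv_loc_rel[OF assms(1)] *] by (simp add: Defs.frac_def)
qed

lemma loc_carrierE:
  assumes "p \<in> carrier (loc R V)"
  obtains r s where "r \<in> carrier R" "s \<in> mgen R V" "p = frac R V r s"
  using assms by (auto simp: loc_def quotient_def Defs.frac_def)

lemma frac_closed [intro]:
  assumes "r \<in> carrier R" "s \<in> mgen R V" shows "frac R V r s \<in> carrier (loc R V)"
  using assms by (auto simp: loc_def quotient_def Defs.frac_def)

text \<open>The operations of \<open>loc\<close> are unions over all representatives. If every
  representative yields the same set \<open>c\<close>, the union is \<open>c\<close>, because the
  class is inhabited by \<open>(r, s)\<close>.\<close>

lemma frac_UN:
  assumes "V \<subseteq> carrier R" "r \<in> carrier R" "s \<in> mgen R V"
    and "\<And>r' s'. r' \<in> carrier R \<Longrightarrow> s' \<in> mgen R V \<Longrightarrow> frac R V r' s' = frac R V r s \<Longrightarrow> F r' s' = c"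
  shows "(\<Union>(r', s')\<in>frac R V r s. F r' s') = c"
proof -
  have "F r' s' = c" if "(r', s') \<in> frac R V r s" for r' s'
    using assms(4) frac_memD[OF assms(1-3) that] by blast
  then show ?thesis using frac_mem[OF assms(1-3)] by fastforce
qed

lemma loc_mult:
  assumes V: "V \<subseteq> carrier R" and "r \<in> carrier R" "s \<in> mgen R V" "r' \<in> carrier R" "s' \<in> mgen R V"
  shows "frac R V r s \<otimes>\<^bsub>loc R V\<^esub> frac R V r' s' = frac R V (r \<otimes> r') (s \<otimes> s')"
proof -
  note [simp] = mgen_closed[OF V]
  have "frac R V (a \<otimes> a') (b \<otimes> b') = frac R V (r \<otimes> r') (s \<otimes> s')"
    if [simp]: "a \<in> carrier R" "b \<in> mgen R V" "a' \<in> carrier R" "b' \<in> mgen R V"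
     and ab: "frac R V a b = frac R V r s" "frac R V a' b' = frac R V r' s'" for a b a' b'
  proof -
    note [simp] = assms(2-)
    from ab obtain t u where [simp]: "t \<in> mgen R V" "u \<in> mgen R V"
      and 1: "t \<otimes> (a \<otimes> s) = t \<otimes> (r \<otimes> b)" and 2: "u \<otimes> (a' \<otimes> s') = u \<otimes> (r' \<otimes> b')"
      by (auto simp: frac_eq_iff[OF V])
    have "(t \<otimes> u) \<otimes> ((a \<otimes> a') \<otimes> (s \<otimes> s')) = (t \<otimes> (a \<otimes> s)) \<otimes> (u \<otimes> (a' \<otimes> s'))" by (simp add: m_ac)
    also have "\<dots> = (t \<otimes> u) \<otimes> ((r \<otimes> r') \<otimes> (b \<otimes> b'))" unfolding 1 2 by (simp add: m_ac)
    finally show ?thesis using V by (subst frac_eq_iff) (auto intro!: mgen_mult bexI[of _ "t \<otimes> u"])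
  qed
  note * = this
  have "(\<Union>(a, b)\<in>frac R V r s. \<Union>(a', b')\<in>frac R V r' s'. frac R V (a \<otimes> a') (b \<otimes> b'))
    = frac R V (r \<otimes> r') (s \<otimes> s')"
    by (rule frac_UN[OF V assms(2,3)], rule frac_UN[OF V assms(4,5)], rule *)
  then show ?thesis by (simp add: loc_def)
qed

lemma loc_add:
  assumes V: "V \<subseteq> carrier R" and "r \<in> carrier R" "s \<in> mgen R V" "r' \<in> carrier R" "s' \<in> mgen R V"
  shows "frac R V r s \<oplus>\<^bsub>loc R V\<^esub> frac R V r' s' = frac R V ((r \<otimes> s') \<oplus> (r' \<otimes> s)) (s \<otimes> s')"
proof -
  note [simp] = mgen_closed[OF V]
  have "frac R V ((a \<otimes> b') \<oplus> (a' \<otimes> b)) (b \<otimes> b') = frac R V ((r \<otimes> s') \<oplus> (r' \<otimes> s)) (s \<otimes> s')"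
    if [simp]: "a \<in> carrier R" "b \<in> mgen R V" "a' \<in> carrier R" "b' \<in> mgen R V"
     and ab: "frac R V a b = frac R V r s" "frac R V a' b' = frac R V r' s'" for a b a' b'
  proof -
    note [simp] = assms(2-)
    from ab obtain t u where [simp]: "t \<in> mgen R V" "u \<in> mgen R V"
      and 1: "t \<otimes> (a \<otimes> s) = t \<otimes> (r \<otimes> b)" and 2: "u \<otimes> (a' \<otimes> s') = u \<otimes> (r' \<otimes> b')"
      by (auto simp: frac_eq_iff[OF V])
    have [simp]: "t \<in> carrier R" "u \<in> carrier R" "s \<in> carrier R" "s' \<in> carrier R" "b \<in> carrier R" "b' \<in> carrier R"
      by simp_all
    have "(t \<otimes> u) \<otimes> (((a \<otimes> b') \<oplus> (a' \<otimes> b)) \<otimes> (s \<otimes> s'))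
      = (t \<otimes> (a \<otimes> s)) \<otimes> (u \<otimes> (s' \<otimes> b')) \<oplus> (u \<otimes> (a' \<otimes> s')) \<otimes> (t \<otimes> (b \<otimes> s))"
      by (simp add: cring_distrib)
    also have "\<dots> = (t \<otimes> u) \<otimes> (((r \<otimes> s') \<oplus> (r' \<otimes> s)) \<otimes> (b \<otimes> b'))"
      unfolding 1 2 by (simp add: cring_distrib)
    finally show ?thesis using V by (subst frac_eq_iff) (auto intro!: mgen_mult bexI[of _ "t \<otimes> u"])
  qed
  note * = this
  have "(\<Union>(a, b)\<in>frac R V r s. \<Union>(a', b')\<in>frac R V r' s'. frac R V ((a \<otimes> b') \<oplus> (a' \<otimes> b)) (b \<otimes> b'))
    = frac R V ((r \<otimes> s') \<oplus> (r' \<otimes> s)) (s \<otimes> s')"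
    by (rule frac_UN[OF V assms(2,3)], rule frac_UN[OF V assms(4,5)], rule *)
  then show ?thesis by (simp add: loc_def)
qed

lemma loc_one: "\<one>\<^bsub>loc R V\<^esub> = frac R V \<one> \<one>" and loc_zero: "\<zero>\<^bsub>loc R V\<^esub> = frac R V \<zero> \<one>"
  by (simp_all add: loc_def)

lemma cring_loc:
  assumes V: "V \<subseteq> carrier R" shows "cring (loc R V)"
proof -
  note [simp] = mgen_closed[OF V] loc_mult[OF V] loc_add[OF V] loc_one loc_zero mgen_mult
  note [intro] = frac_eqI[OF V]
  note E = loc_carrierE[of _ V]
  show ?thesis
  proof (rule cringI)
    show "abelian_group (loc R V)"
    proof (rule abelian_groupI)
      show "\<zero>\<^bsub>loc R V\<^esub> \<in> carrier (loc R V)" by (auto)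
      show "p \<oplus>\<^bsub>loc R V\<^esub> q \<in> carrier (loc R V)" if "p \<in> carrier (loc R V)" "q \<in> carrier (loc R V)" for p q
        using that by (auto elim!: E intro!: frac_closed)
      show "p \<oplus>\<^bsub>loc R V\<^esub> q \<oplus>\<^bsub>loc R V\<^esub> r = p \<oplus>\<^bsub>loc R V\<^esub> (q \<oplus>\<^bsub>loc R V\<^esub> r)"
        if "p \<in> carrier (loc R V)" "q \<in> carrier (loc R V)" "r \<in> carrier (loc R V)" for p q r
      proof -
        from that obtain a b a' b' a'' b'' where [simp]: "a \<in> carrier R" "b \<in> mgen R V" "a' \<in> carrier R" "b' \<in> mgen R V" "a'' \<in> carrier R" "b'' \<in> mgen R V"
          and *: "p = frac R V a b" "q = frac R V a' b'" "r = frac R V a'' b''" by (auto elim!: E)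
        have [simp]: "b \<in> carrier R" "b' \<in> carrier R" "b'' \<in> carrier R" by simp_all
        have "((a \<otimes> b' \<oplus> a' \<otimes> b) \<otimes> b'' \<oplus> a'' \<otimes> (b \<otimes> b')) \<otimes> (b \<otimes> (b' \<otimes> b''))
          = (a \<otimes> (b' \<otimes> b'') \<oplus> (a' \<otimes> b'' \<oplus> a'' \<otimes> b') \<otimes> b) \<otimes> (b \<otimes> b' \<otimes> b'')"
          by (simp add: cring_distrib)
        then show ?thesis unfolding * by (simp, intro frac_eqI[OF V]) simp_all
      qed
      show "p \<oplus>\<^bsub>loc R V\<^esub> q = q \<oplus>\<^bsub>loc R V\<^esub> p" if "p \<in> carrier (loc R V)" "q \<in> carrier (loc R V)" for p q
        using that by (auto elim!: E intro!: frac_eqI[OF V] simp: m_ac a_ac)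
      show "\<zero>\<^bsub>loc R V\<^esub> \<oplus>\<^bsub>loc R V\<^esub> p = p" if "p \<in> carrier (loc R V)" for p
        using that by (auto elim!: E intro!: frac_eqI[OF V])
      show "\<exists>q\<in>carrier (loc R V). q \<oplus>\<^bsub>loc R V\<^esub> p = \<zero>\<^bsub>loc R V\<^esub>" if p: "p \<in> carrier (loc R V)" for p
      proof -
        from p obtain r s where *: "r \<in> carrier R" "s \<in> mgen R V" "p = frac R V r s" by (rule E)
        then have "frac R V (\<ominus> r) s \<oplus>\<^bsub>loc R V\<^esub> p = \<zero>\<^bsub>loc R V\<^esub>"
          by (simp add: l_neg l_minus) (rule frac_eqI[OF V], simp_all)
        then show ?thesis using * by (intro bexI[of _ "frac R V (\<ominus> r) s"]) auto
      qed
    qed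
    show "Group.comm_monoid (loc R V)"
    proof (rule comm_monoidI)
      show "\<one>\<^bsub>loc R V\<^esub> \<in> carrier (loc R V)" by auto
      show "p \<otimes>\<^bsub>loc R V\<^esub> q \<in> carrier (loc R V)" if "p \<in> carrier (loc R V)" "q \<in> carrier (loc R V)" for p q
        using that by (auto elim!: E intro!: frac_closed)
      show "p \<otimes>\<^bsub>loc R V\<^esub> q \<otimes>\<^bsub>loc R V\<^esub> r = p \<otimes>\<^bsub>loc R V\<^esub> (q \<otimes>\<^bsub>loc R V\<^esub> r)"
        if "p \<in> carrier (loc R V)" "q \<in> carrier (loc R V)" "r \<in> carrier (loc R V)" for p q r
        using that by (auto elim!: E intro!: frac_eqI[OF V] simp: m_ac)
      show "p \<otimes>\<^bsub>loc R V\<^esub> q = q \<otimes>\<^bsub>loc R V\<^esub> p" if "p \<in> carrier (loc R V)" "q \<in> carrier (loc R V)" for p q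
        using that by (auto elim!: E intro!: frac_eqI[OF V] simp: m_ac)
      show "\<one>\<^bsub>loc R V\<^esub> \<otimes>\<^bsub>loc R V\<^esub> p = p" if "p \<in> carrier (loc R V)" for p
        using that by (auto elim!: E intro!: frac_eqI[OF V])
    qed
    show "(p \<oplus>\<^bsub>loc R V\<^esub> q) \<otimes>\<^bsub>loc R V\<^esub> r = p \<otimes>\<^bsub>loc R V\<^esub> r \<oplus>\<^bsub>loc R V\<^esub> q \<otimes>\<^bsub>loc R V\<^esub> r"
      if "p \<in> carrier (loc R V)" "q \<in> carrier (loc R V)" "r \<in> carrier (loc R V)" for p q r
    proof -
      from that obtain a b a' b' a'' b'' where [simp]: "a \<in> carrier R" "b \<in> mgen R V" "a' \<in> carrier R" "b' \<in> mgen R V" "a'' \<in> carrier R" "b'' \<in> mgen R V"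
        and *: "p = frac R V a b" "q = frac R V a' b'" "r = frac R V a'' b''" by (auto elim!: E)
      have [simp]: "b \<in> carrier R" "b' \<in> carrier R" "b'' \<in> carrier R" by simp_all
      have "((a \<otimes> b' \<oplus> a' \<otimes> b) \<otimes> a'') \<otimes> ((b \<otimes> b'') \<otimes> (b' \<otimes> b''))
        = ((a \<otimes> a'') \<otimes> (b' \<otimes> b'') \<oplus> (a' \<otimes> a'') \<otimes> (b \<otimes> b'')) \<otimes> (b \<otimes> b' \<otimes> b'')"
        by (simp add: cring_distrib)
      then show ?thesis unfolding * by (simp, intro frac_eqI[OF V]) simp_all
    qed
  qed
qed

lemma frac_ring_hom:
  assumes V: "V \<subseteq> carrier R" shows "(\<lambda>r. frac R V r \<one>) \<in> ring_hom R (loc R V)"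
  by (rule ring_hom_memI) (auto simp: loc_mult[OF V] loc_add[OF V] loc_one)

lemma frac_mult_denom:
  assumes V: "V \<subseteq> carrier R" and "r \<in> carrier R" "s \<in> mgen R V"
  shows "frac R V r s \<otimes>\<^bsub>loc R V\<^esub> frac R V s \<one> = frac R V r \<one>"
proof -
  have [simp]: "s \<in> carrier R" using assms mgen_closed by auto
  have "frac R V (r \<otimes> s) (s \<otimes> \<one>) = frac R V r \<one>"
    by (rule frac_eqI[OF V]) (use assms in \<open>auto intro: mgen_mult\<close>)
  then show ?thesis using assms by (simp add: loc_mult)
qed

lemma frac_eq_mult:
  assumes V: "V \<subseteq> carrier R" and "r \<in> carrier R" "s \<in> mgen R V"
  shows "frac R V r s = frac R V \<one> s \<otimes>\<^bsub>loc R V\<^esub> frac R V r \<one>"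
  using assms by (auto simp: loc_mult mgen_closed)

lemma frac_denom_unit:
  assumes V: "V \<subseteq> carrier R" and "s \<in> mgen R V"
  shows "frac R V \<one> s \<otimes>\<^bsub>loc R V\<^esub> frac R V s \<one> = \<one>\<^bsub>loc R V\<^esub>"
  using assms frac_mult_denom[of V \<one> s] by (auto simp: loc_one)

end

section \<open>Maps between localizations\<close>

lemma (in ring_hom_cring) hom_mgen:
  assumes "V \<subseteq> carrier R" "h ` V \<subseteq> mgen S Y" "s \<in> mgen R V" "Y \<subseteq> carrier S"
  shows "h s \<in> mgen S Y"
proof -
  have "submonoid {s \<in> carrier R. h s \<in> mgen S Y} R"
    by (rule submonoid.intro) (auto intro: S.mgen_mult)
  from R.mgen_least[OF this, of V] assms show ?thesis by auto
qed

lemma (in ring_hom_cring) loc_map_frac: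
  assumes V: "V \<subseteq> carrier R" "Y \<subseteq> carrier S" "h ` V \<subseteq> mgen S Y" and "r \<in> carrier R" "s \<in> mgen R V"
  shows "loc_map S Y h (frac R V r s) = frac S Y (h r) (h s)"
proof -
  note c = hom_mgen[OF V(1,3) _ V(2)]
  have "frac S Y (h r') (h s') = frac S Y (h r) (h s)"
    if [simp]: "r' \<in> carrier R" "s' \<in> mgen R V" and eq: "frac R V r' s' = frac R V r s" for r' s'
  proof -
    note [simp] = assms(4-) R.mgen_closed[OF V(1)]
    from eq obtain t where t: "t \<in> mgen R V" "t \<otimes>\<^bsub>R\<^esub> (r' \<otimes>\<^bsub>R\<^esub> s) = t \<otimes>\<^bsub>R\<^esub> (r \<otimes>\<^bsub>R\<^esub> s')"
      by (auto simp: R.frac_eq_iff[OF V(1)])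
    have "h (t \<otimes>\<^bsub>R\<^esub> (r' \<otimes>\<^bsub>R\<^esub> s)) = h (t \<otimes>\<^bsub>R\<^esub> (r \<otimes>\<^bsub>R\<^esub> s'))"
      by (simp only: t(2))
    then have "h t \<otimes>\<^bsub>S\<^esub> (h r' \<otimes>\<^bsub>S\<^esub> h s) = h t \<otimes>\<^bsub>S\<^esub> (h r \<otimes>\<^bsub>S\<^esub> h s')"
      using t(1) by simp
    then show ?thesis using t c by (subst S.frac_eq_iff[OF V(2)]) auto
  qed
  note * = this
  show ?thesis unfolding loc_map_def
    by (rule R.frac_UN[OF V(1) assms(4,5)], rule *)
qed

lemma (in ring_hom_cring) loc_map_hom:
  assumes V: "V \<subseteq> carrier R" "Y \<subseteq> carrier S" "h ` V \<subseteq> mgen S Y"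
  shows "ring_hom_cring (loc R V) (loc S Y) (loc_map S Y h)"
proof -
  note [simp] = R.mgen_closed[OF V(1)] R.mgen_mult S.mgen_mult hom_mgen[OF V(1,3) _ V(2)] loc_map_frac[OF V]
    R.loc_mult[OF V(1)] R.loc_add[OF V(1)] R.loc_one S.loc_one S.loc_mult[OF V(2)] S.loc_add[OF V(2)]
  have "loc_map S Y h \<in> ring_hom (loc R V) (loc S Y)"
    by (rule ring_hom_memI) (auto elim!: R.loc_carrierE intro!: S.frac_closed)
  then show ?thesis
    using R.cring_loc[OF V(1)] S.cring_loc[OF V(2)]
    by (simp add: ring_hom_cring_def ring_hom_cring_axioms_def)
qed

context cring
begin

lemma id_hom: "ring_hom_cring R R (\<lambda>r. r)"
  by unfold_locales (auto intro: ring_hom_memI)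

lemma loc_res_frac:
  assumes "V \<subseteq> W" "W \<subseteq> carrier R" "r \<in> carrier R" "s \<in> mgen R V"
  shows "loc_res R W (frac R V r s) = frac R W r s"
  unfolding loc_res_def
  by (rule ring_hom_cring.loc_map_frac[OF id_hom]) (use assms mgen_subset[of W] in auto)

lemma loc_res_hom:
  assumes "V \<subseteq> W" "W \<subseteq> carrier R"
  shows "ring_hom_cring (loc R V) (loc R W) (loc_res R W)"
  unfolding loc_res_def
  by (rule ring_hom_cring.loc_map_hom[OF id_hom]) (use assms mgen_subset[of W] in auto)

lemma loc_res_closed [intro]:
  assumes "V \<subseteq> W" "W \<subseteq> carrier R" "p \<in> carrier (loc R V)"
  shows "loc_res R W p \<in> carrier (loc R W)"
  by (rule ring_hom_closed[OF ring_hom_cring.homh[OF loc_res_hom[OF assms(1,2)]] assms(3)])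

lemma loc_res_res:
  assumes "V \<subseteq> W" "W \<subseteq> X" "X \<subseteq> carrier R" "p \<in> carrier (loc R V)"
  shows "loc_res R X (loc_res R W p) = loc_res R X p"
proof -
  have "V \<subseteq> carrier R" using assms by auto
  from assms(4) obtain r s where *: "r \<in> carrier R" "s \<in> mgen R V" "p = frac R V r s" by (rule loc_carrierE)
  moreover have "s \<in> mgen R W" using * mgen_mono[OF assms(1)] by auto
  ultimately show ?thesis using assms by (simp add: loc_res_frac)
qed

end

context ring_hom_cring
begin

lemma mgen_image: 
  assumes V: "V \<subseteq> carrier R" shows "mgen S (h ` V) = h ` mgen R V"
proof
  have "submonoid (h ` mgen R V) S"
  proof (rule submonoid.intro)
    show "h ` mgen R V \<subseteq> carrier S" using V by (auto simp: R.mgen_closed)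
    show "x \<otimes>\<^bsub>S\<^esub> y \<in> h ` mgen R V" if "x \<in> h ` mgen R V" "y \<in> h ` mgen R V" for x y
    proof -
      from that obtain a b where *: "x = h a" "y = h b" "a \<in> mgen R V" "b \<in> mgen R V" by auto
      then have "x \<otimes>\<^bsub>S\<^esub> y = h (a \<otimes>\<^bsub>R\<^esub> b)" using V by (simp add: R.mgen_closed)
      then show ?thesis using * R.mgen_mult by auto
    qed
    show "\<one>\<^bsub>S\<^esub> \<in> h ` mgen R V" using R.mgen_one by (metis hom_one image_eqI)
  qed
  then show "mgen S (h ` V) \<subseteq> h ` mgen R V" using R.mgen_subset by (intro S.mgen_least) auto
  have "h ` V \<subseteq> carrier S" using V by auto
  then show "h ` mgen R V \<subseteq> mgen S (h ` V)"
    using hom_mgen[OF V S.mgen_subset] by auto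
qed

lemma loc_imageE:
  assumes V: "V \<subseteq> carrier R" and "p \<in> carrier (loc S (h ` V))"
  obtains b s where "b \<in> carrier S" "s \<in> mgen R V" "p = frac S (h ` V) b (h s)"
  using assms(2) by (auto elim!: S.loc_carrierE simp: mgen_image[OF V])

lemma hom_mem_mgen: "V \<subseteq> carrier R \<Longrightarrow> s \<in> mgen R V \<Longrightarrow> h s \<in> mgen S (h ` V)"
  by (simp add: mgen_image)

lemma loc_map_image_hom:
  assumes "V \<subseteq> carrier R"
  shows "ring_hom_cring (loc R V) (loc S (h ` V)) (loc_map S (h ` V) h)"
  by (rule loc_map_hom) (use assms S.mgen_subset in auto)

lemma loc_map_image_frac:
  assumes "V \<subseteq> carrier R" "r \<in> carrier R" "s \<in> mgen R V"
  shows "loc_map S (h ` V) h (frac R V r s) = frac S (h ` V) (h r) (h s)"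
  by (rule loc_map_frac) (use assms S.mgen_subset in auto)

lemma loc_map_res:
  assumes "V \<subseteq> W" "W \<subseteq> carrier R" "p \<in> carrier (loc R V)"
  shows "loc_res S (h ` W) (loc_map S (h ` V) h p) = loc_map S (h ` W) h (loc_res R W p)"
proof -
  have V: "V \<subseteq> carrier R" and WS: "h ` V \<subseteq> h ` W" "h ` W \<subseteq> carrier S" using assms by auto
  from assms(3) obtain r s where *: "r \<in> carrier R" "s \<in> mgen R V" "p = frac R V r s" by (rule R.loc_carrierE)
  have "s \<in> mgen R W" using * R.mgen_mono[OF assms(1)] by auto
  then show ?thesis unfolding *(3)
    using * assms(2) V by (simp add: loc_map_image_frac R.loc_res_frac[OF assms(1,2)] S.loc_res_frac[OF WS] hom_mem_mgen)
qed

end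

text \<open>The loci where the elements of \<open>V i\<close> are invertible cover the spectrum.
  Stated through primes, covers pass to intersections and to images under ring homomorphisms by
  elementary set manipulation, and overlaps become unions of the sets \<open>V i\<close>.\<close>

definition pcover :: "('a, 'm) ring_scheme \<Rightarrow> 'i set \<Rightarrow> ('i \<Rightarrow> 'a set) \<Rightarrow> bool" where
  "pcover R I V \<longleftrightarrow> (\<forall>i\<in>I. V i \<subseteq> carrier R) \<and> (\<forall>P. primeideal P R \<longrightarrow> (\<exists>i\<in>I. V i \<inter> P = {}))"

context cring
begin

lemma covers_pcover:
  assumes "covers R k a" shows "pcover R {..<k} (\<lambda>i. {a i})"
  unfolding pcover_def
proof (intro conjI ballI allI impI)
  show "{a i} \<subseteq> carrier R" if "i \<in> {..<k}" for i using assms that by (auto simp: covers_def)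
  fix P assume P: "primeideal P R"
  then interpret primeideal P R .
  show "\<exists>i\<in>{..<k}. {a i} \<inter> P = {}"
  proof (rule ccontr)
    assume "\<not> ?thesis"
    then have "a ` {..<k} \<subseteq> P" by auto
    then have "Idl\<^bsub>R\<^esub> (a ` {..<k}) \<subseteq> P" by (rule genideal_minimal[OF is_ideal])
    then show False using assms I_notcarr a_subset by (auto simp: covers_def)
  qed
qed

lemma pcover_prod:
  assumes "pcover R I V" "pcover R J W"
  shows "pcover R (I \<times> J) (\<lambda>(i, j). V i \<union> W j)"
  unfolding pcover_def
proof (intro conjI allI impI)
  fix P assume P: "primeideal P R"
  obtain i j where "i \<in> I" "j \<in> J" "V i \<inter> P = {}" "W j \<inter> P = {}"
    using assms P unfolding pcover_def by meson
  then show "\<exists>i\<in>I \<times> J. (case i of (i, j) \<Rightarrow> V i \<union> W j) \<inter> P = {}"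
    by (intro bexI[of _ "(i, j)"]) auto
qed (use assms in \<open>auto simp: pcover_def\<close>)

text \<open>An ideal saturated for the denominators from \<open>V\<close> stands for an ideal of
  \<open>loc R V\<close>. Saturation strips \<open>v\<close> from \<open>v * w\<close>, and the
  remaining \<open>w\<close> lies outside every prime disjoint from \<open>W i\<close>.\<close>

lemma pcover_locally_one:
  assumes cov: "pcover R I W" and V: "V \<subseteq> carrier R" and J: "ideal J R"
    and "\<And>i. i \<in> I \<Longrightarrow> \<exists>v w. v \<in> mgen R V \<and> w \<in> mgen R (W i) \<and> v \<otimes> w \<in> J"
    and sat: "\<And>v y. v \<in> mgen R V \<Longrightarrow> y \<in> carrier R \<Longrightarrow> v \<otimes> y \<in> J \<Longrightarrow> y \<in> J"
  shows "\<one> \<in> J"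
proof (rule eq_if_locally_eq_one[OF J])
  fix P assume P: "primeideal P R"
  then obtain i where i: "i \<in> I" "W i \<inter> P = {}" "W i \<subseteq> carrier R" using cov unfolding pcover_def by meson
  from assms(4)[OF i(1)] obtain v w where *: "v \<in> mgen R V" "w \<in> mgen R (W i)" "v \<otimes> w \<in> J" by auto
  have "w \<in> J" using * i mgen_closed sat by blast
  moreover have "w \<notin> P" using mgen_disjoint_prime[OF P i(3,2)] * by auto
  ultimately show "\<exists>x\<in>J. x \<notin> P" by auto
qed

lemma loc_separated:
  assumes cov: "pcover R I W" and V: "V \<subseteq> carrier R"
    and p: "p \<in> carrier (loc R V)" and q: "q \<in> carrier (loc R V)"
    and eq: "\<And>i. i \<in> I \<Longrightarrow> loc_res R (V \<union> W i) p = loc_res R (V \<union> W i) q"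
  shows "p = q"
proof -
  from p obtain r s where rs [simp]: "r \<in> carrier R" "s \<in> mgen R V" and p': "p = frac R V r s" by (rule loc_carrierE)
  from q obtain r' s' where rs' [simp]: "r' \<in> carrier R" "s' \<in> mgen R V" and q': "q = frac R V r' s'" by (rule loc_carrierE)
  have [simp]: "\<And>t. t \<in> mgen R V \<Longrightarrow> t \<in> carrier R" using V mgen_closed by auto
  \<comment> \<open>The annihilator of \<open>p - q\<close> in \<open>loc R V\<close>, pulled back
    to \<open>R\<close>.\<close>
  let ?J = "{y \<in> carrier R. \<exists>v\<in>mgen R V. v \<otimes> y \<otimes> (r \<otimes> s') = v \<otimes> y \<otimes> (r' \<otimes> s)}"
  have "\<one> \<in> ?J"
  proof (rule pcover_locally_one[OF cov V])
    show "ideal ?J R"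
    proof (rule idealI_basic)
      show "\<zero> \<in> ?J" using mgen_one[of V] by (auto simp del: mgen_one)
      show "y \<otimes> a \<in> ?J" if "y \<in> ?J" "a \<in> carrier R" for y a
      proof -
        from that obtain v where v: "v \<in> mgen R V" "v \<otimes> y \<otimes> (r \<otimes> s') = v \<otimes> y \<otimes> (r' \<otimes> s)" and [simp]: "y \<in> carrier R" by auto
        have "v \<otimes> (y \<otimes> a) \<otimes> (r \<otimes> s') = a \<otimes> (v \<otimes> y \<otimes> (r \<otimes> s'))" using that v(1) by (simp add: m_ac)
        also have "\<dots> = v \<otimes> (y \<otimes> a) \<otimes> (r' \<otimes> s)" unfolding v(2) using that v(1) by (simp add: m_ac)
        finally show ?thesis using that v by auto
      qed
      then show "a \<otimes> y \<in> ?J" if "y \<in> ?J" "a \<in> carrier R" for y a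
        using that by (metis (no_types, lifting) m_comm mem_Collect_eq)
      show "y \<oplus> z \<in> ?J" if "y \<in> ?J" "z \<in> ?J" for y z
      proof -
        from that obtain v w where v: "v \<in> mgen R V" "v \<otimes> y \<otimes> (r \<otimes> s') = v \<otimes> y \<otimes> (r' \<otimes> s)" 
          and w: "w \<in> mgen R V" "w \<otimes> z \<otimes> (r \<otimes> s') = w \<otimes> z \<otimes> (r' \<otimes> s)" and [simp]: "y \<in> carrier R" "z \<in> carrier R" by auto
        have "(v \<otimes> w) \<otimes> (y \<oplus> z) \<otimes> (r \<otimes> s') = w \<otimes> (v \<otimes> y \<otimes> (r \<otimes> s')) \<oplus> v \<otimes> (w \<otimes> z \<otimes> (r \<otimes> s'))"
          using v(1) w(1) by (simp add: l_distr r_distr m_ac)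
        also have "\<dots> = (v \<otimes> w) \<otimes> (y \<oplus> z) \<otimes> (r' \<otimes> s)"
          unfolding v(2) w(2) using v(1) w(1) by (simp add: l_distr r_distr m_ac)
        finally show ?thesis using v(1) w(1) mgen_mult by auto
      qed
    qed auto
    show "\<exists>v w. v \<in> mgen R V \<and> w \<in> mgen R (W i) \<and> v \<otimes> w \<in> ?J" if i: "i \<in> I" for i
    proof -
      have W: "W i \<subseteq> carrier R" using cov i by (auto simp: pcover_def)
      have sub: "mgen R V \<subseteq> mgen R (V \<union> W i)" by (rule mgen_mono) auto
      have "frac R (V \<union> W i) r s = frac R (V \<union> W i) r' s'"
        using eq[OF i] W V by (simp add: p' q' loc_res_frac)
      then obtain t where t: "t \<in> mgen R (V \<union> W i)" "t \<otimes> (r \<otimes> s') = t \<otimes> (r' \<otimes> s)"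
        using sub W V by (subst (asm) frac_eq_iff) auto
      from mgen_union[OF V W t(1)] obtain v w where vw: "v \<in> mgen R V" "w \<in> mgen R (W i)" "t = v \<otimes> w" .
      then have "v \<otimes> w \<in> carrier R" using V W mgen_closed by auto
      then have "v \<otimes> w \<in> ?J" using vw t by (auto intro!: bexI[of _ \<one>])
      then show ?thesis using vw by auto
    qed
    show "y \<in> ?J" if v: "v \<in> mgen R V" and y: "y \<in> carrier R" and "v \<otimes> y \<in> ?J" for v y
    proof -
      from that obtain u where u: "u \<in> mgen R V" "u \<otimes> (v \<otimes> y) \<otimes> (r \<otimes> s') = u \<otimes> (v \<otimes> y) \<otimes> (r' \<otimes> s)" by auto
      then have "(u \<otimes> v) \<otimes> y \<otimes> (r \<otimes> s') = (u \<otimes> v) \<otimes> y \<otimes> (r' \<otimes> s)" using v y u(1) by (simp add: m_assoc)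
      then show ?thesis using u v y mgen_mult by auto
    qed
  qed
  then obtain v where "v \<in> mgen R V" "v \<otimes> (r \<otimes> s') = v \<otimes> (r' \<otimes> s)" by auto
  then show ?thesis unfolding p' q' using V by (subst frac_eq_iff) auto
qed

lemma finprod_remove:
  assumes "finite I" "j \<in> I" "F \<in> I \<rightarrow> carrier R"
  shows "(\<Otimes>i\<in>I. F i) = F j \<otimes> (\<Otimes>i\<in>I - {j}. F i)"
proof -
  have "(\<Otimes>i\<in>insert j (I - {j}). F i) = F j \<otimes> (\<Otimes>i\<in>I - {j}. F i)"
    by (rule finprod_insert) (use assms in auto)
  then show ?thesis using assms by (simp add: insert_absorb)
qed

text \<open>The sheaf property of localization. Representatives are rescaled until their overlap
  relations hold in \<open>R\<close> itself; a partition of unity by the rescaled denominators then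
  combines the numerators into one fraction.\<close>

lemma loc_glue:
  assumes cov: "pcover R I W" and fin: "finite I" and V: "V \<subseteq> carrier R"
    and p: "\<And>i. i \<in> I \<Longrightarrow> p i \<in> carrier (loc R (V \<union> W i))"
    and eq: "\<And>i j. i \<in> I \<Longrightarrow> j \<in> I \<Longrightarrow> loc_res R (V \<union> W i \<union> W j) (p i) = loc_res R (V \<union> W i \<union> W j) (p j)"
  obtains q where "q \<in> carrier (loc R V)" "\<And>i. i \<in> I \<Longrightarrow> loc_res R (V \<union> W i) q = p i"
proof -
  have W: "W i \<subseteq> carrier R" if "i \<in> I" for i using cov that by (auto simp: pcover_def)
  define M where "M i = mgen R (V \<union> W i)" for i
  have Mc: "\<And>i t. i \<in> I \<Longrightarrow> t \<in> M i \<Longrightarrow> t \<in> carrier R" using V W mgen_closed unfolding M_def by (metis Un_least)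
  have "\<forall>i\<in>I. \<exists>r s. r \<in> carrier R \<and> s \<in> M i \<and> p i = frac R (V \<union> W i) r s"
    unfolding M_def using p loc_carrierE by metis
  then obtain r s where rs: "\<And>i. i \<in> I \<Longrightarrow> r i \<in> carrier R" "\<And>i. i \<in> I \<Longrightarrow> s i \<in> M i" "\<And>i. i \<in> I \<Longrightarrow> p i = frac R (V \<union> W i) (r i) (s i)"
    by metis
  \<comment> \<open>The factor that witnesses equality on the overlap splits into a denominator
    \<open>a\<close> allowed over index \<open>i\<close> and a denominator \<open>b\<close> allowed
    over index \<open>j\<close>.\<close>
  have "\<exists>a b. a \<in> M i \<and> b \<in> M j \<and> (a \<otimes> b) \<otimes> (r i \<otimes> s j) = (a \<otimes> b) \<otimes> (r j \<otimes> s i)" if ij: "i \<in> I" "j \<in> I" for i j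
  proof -
    have Ui: "V \<union> W i \<subseteq> V \<union> W i \<union> W j" and Uj: "V \<union> W j \<subseteq> V \<union> W i \<union> W j" and U: "V \<union> W i \<union> W j \<subseteq> carrier R"
      using V W ij by auto
    have si: "s i \<in> mgen R (V \<union> W i)" "s j \<in> mgen R (V \<union> W j)" using rs ij by (auto simp: M_def)
    then have si': "s i \<in> mgen R (V \<union> W i \<union> W j)" "s j \<in> mgen R (V \<union> W i \<union> W j)" using mgen_mono[OF Ui] mgen_mono[OF Uj] by auto
    have "frac R (V \<union> W i \<union> W j) (r i) (s i) = frac R (V \<union> W i \<union> W j) (r j) (s j)"
      using eq[OF ij] ij si rs by (simp add: loc_res_frac[OF Ui U] loc_res_frac[OF Uj U])
    then obtain t where t: "t \<in> mgen R (V \<union> W i \<union> W j)" "t \<otimes> (r i \<otimes> s j) = t \<otimes> (r j \<otimes> s i)"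
      using si' U rs ij by (subst (asm) frac_eq_iff) auto
    from mgen_union[OF _ _ t(1)] V W ij obtain a b where ab: "a \<in> M i" "b \<in> mgen R (W j)" "t = a \<otimes> b"
      unfolding M_def by (metis Un_least)
    have "b \<in> M j" using ab(2) mgen_mono[of "W j" "V \<union> W j"] by (auto simp: M_def)
    then show ?thesis using ab t by auto
  qed
  then obtain a b where ab: "\<And>i j. i \<in> I \<Longrightarrow> j \<in> I \<Longrightarrow> a i j \<in> M i" "\<And>i j. i \<in> I \<Longrightarrow> j \<in> I \<Longrightarrow> b i j \<in> M j"
    and abeq: "\<And>i j. i \<in> I \<Longrightarrow> j \<in> I \<Longrightarrow> (a i j \<otimes> b i j) \<otimes> (r i \<otimes> s j) = (a i j \<otimes> b i j) \<otimes> (r j \<otimes> s i)"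
    by metis
  have abc: "a i j \<in> carrier R" "b i j \<in> carrier R" if "i \<in> I" "j \<in> I" for i j
    using ab that Mc by blast+
  \<comment> \<open>\<open>T i\<close> collects all factors that belong to index \<open>i\<close>,
    namely \<open>a i j\<close> as first and \<open>b j i\<close> as second index. It is an
    admissible denominator over \<open>i\<close>, and \<open>T i * T j\<close> contains the witness
    \<open>a i j * b i j\<close>.\<close>
  define T where "T i = (\<Otimes>j\<in>I. a i j) \<otimes> (\<Otimes>j\<in>I. b j i)" for i
  have TM: "T i \<in> M i" if "i \<in> I" for i
    using that ab V W unfolding T_def M_def by (intro mgen_mult mgen_finprod) auto
  have Tc: "T i \<in> carrier R" if "i \<in> I" for i using TM Mc that by auto
  have Teq: "(T i \<otimes> r i) \<otimes> (T j \<otimes> s j) = (T j \<otimes> r j) \<otimes> (T i \<otimes> s i)" if ij: "i \<in> I" "j \<in> I" for i j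
  proof -
    note c = Mc[OF ij(1)] Mc[OF ij(2)] Mc
    have [simp]: "a i j \<in> carrier R" "b i j \<in> carrier R" "r i \<in> carrier R" "r j \<in> carrier R" "s i \<in> carrier R" "s j \<in> carrier R"
      using ab rs ij Mc by blast+
    define u where "u = (\<Otimes>k\<in>I - {j}. a i k) \<otimes> (\<Otimes>k\<in>I. b k i)"
    define v where "v = (\<Otimes>k\<in>I. a j k) \<otimes> (\<Otimes>k\<in>I - {i}. b k j)"
    have [simp]: "(\<Otimes>k\<in>I - {j}. a i k) \<in> carrier R" "(\<Otimes>k\<in>I. b k i) \<in> carrier R" "(\<Otimes>k\<in>I. a j k) \<in> carrier R" "(\<Otimes>k\<in>I - {i}. b k j) \<in> carrier R"
      by (rule finprod_closed, use abc ij in auto)+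
    have [simp]: "u \<in> carrier R" "v \<in> carrier R" by (simp_all add: u_def v_def)
    have "(\<Otimes>k\<in>I. a i k) = a i j \<otimes> (\<Otimes>k\<in>I - {j}. a i k)"
      by (rule finprod_remove[OF fin]) (use abc ij in auto)
    then have Ti: "T i = a i j \<otimes> u" unfolding T_def u_def by (simp add: m_ac)
    have "(\<Otimes>k\<in>I. b k j) = b i j \<otimes> (\<Otimes>k\<in>I - {i}. b k j)"
      by (rule finprod_remove[OF fin]) (use abc ij in auto)
    then have Tj: "T j = b i j \<otimes> v" unfolding T_def v_def by (simp add: m_ac)
    have "(T i \<otimes> r i) \<otimes> (T j \<otimes> s j) = (u \<otimes> v) \<otimes> ((a i j \<otimes> b i j) \<otimes> (r i \<otimes> s j))"
      unfolding Ti Tj by (simp add: m_ac)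
    also have "\<dots> = (T j \<otimes> r j) \<otimes> (T i \<otimes> s i)" unfolding abeq[OF ij] Ti Tj by (simp add: m_ac)
    finally show ?thesis .
  qed
  \<comment> \<open>Expanding the fractions by \<open>T i\<close> leaves the sections unchanged and
    makes the relations \<open>\<rho>\<tau>\<close> exact in \<open>R\<close>.\<close>
  define \<rho> where "\<rho> i = T i \<otimes> r i" for i
  define \<tau> where "\<tau> i = T i \<otimes> s i" for i
  have \<rho>: "\<And>i. i \<in> I \<Longrightarrow> \<rho> i \<in> carrier R" and \<tau>M: "\<And>i. i \<in> I \<Longrightarrow> \<tau> i \<in> M i"
    using Tc TM rs mgen_mult by (auto simp: \<rho>_def \<tau>_def M_def)
  then have \<tau>: "\<And>i. i \<in> I \<Longrightarrow> \<tau> i \<in> carrier R" using Mc by auto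
  have \<rho>\<tau>: "\<And>i j. i \<in> I \<Longrightarrow> j \<in> I \<Longrightarrow> \<rho> i \<otimes> \<tau> j = \<rho> j \<otimes> \<tau> i" using Teq by (auto simp: \<rho>_def \<tau>_def)
  have p\<rho>: "p i = frac R (V \<union> W i) (\<rho> i) (\<tau> i)" if i: "i \<in> I" for i
    unfolding rs(3)[OF i]
  proof (rule frac_eqI)
    show "r i \<otimes> \<tau> i = \<rho> i \<otimes> s i" using rs Mc Tc i by (simp add: \<rho>_def \<tau>_def m_ac)
  qed (use rs \<rho> \<tau>M V W i in \<open>auto simp: M_def\<close>)
  \<comment> \<open>The ideal generated by the \<open>\<tau> i\<close> in \<open>loc R V\<close>,
    pulled back to \<open>R\<close>. That it contains \<open>\<one>\<close> is the required
    partition of unity, with \<open>v\<close> as a common denominator.\<close>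
  let ?J = "{y \<in> carrier R. \<exists>v\<in>mgen R V. \<exists>c\<in>I \<rightarrow> carrier R. v \<otimes> y = (\<Oplus>i\<in>I. c i \<otimes> \<tau> i)}"
  have [simp]: "\<And>t. t \<in> mgen R V \<Longrightarrow> t \<in> carrier R" using V mgen_closed by auto
  have scale: "a \<otimes> (\<Oplus>i\<in>I. c i \<otimes> \<tau> i) = (\<Oplus>i\<in>I. (a \<otimes> c i) \<otimes> \<tau> i)" if "a \<in> carrier R" "c \<in> I \<rightarrow> carrier R" for a c
  proof -
    have "a \<otimes> (\<Oplus>i\<in>I. c i \<otimes> \<tau> i) = (\<Oplus>i\<in>I. a \<otimes> (c i \<otimes> \<tau> i))"
      by (rule finsum_rdistr) (use that fin \<tau> in auto)
    also have "\<dots> = (\<Oplus>i\<in>I. (a \<otimes> c i) \<otimes> \<tau> i)"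
      by (rule finsum_cong') (use that \<tau> in \<open>auto simp: m_assoc Pi_iff\<close>)
    finally show ?thesis .
  qed
  have JI: "y \<in> ?J" if "y \<in> carrier R" "v \<in> mgen R V" "c \<in> I \<rightarrow> carrier R" "v \<otimes> y = (\<Oplus>i\<in>I. c i \<otimes> \<tau> i)" for y v c
    using that by blast
  have "\<one> \<in> ?J"
  proof (rule pcover_locally_one[OF cov V])
    show "ideal ?J R"
    proof (rule idealI_basic)
      have "(\<Oplus>i\<in>I. \<zero> \<otimes> \<tau> i) = (\<Oplus>i\<in>I. \<zero>)" by (rule finsum_cong') (use \<tau> in auto)
      then have "\<one> \<otimes> \<zero> = (\<Oplus>i\<in>I. \<zero> \<otimes> \<tau> i)" by simp
      then show "\<zero> \<in> ?J" by (intro JI[of \<zero> \<one> "\<lambda>_. \<zero>"]) auto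
      show "a \<otimes> y \<in> ?J" if "y \<in> ?J" "a \<in> carrier R" for y a
      proof -
        from that obtain v c where v: "v \<in> mgen R V" "c \<in> I \<rightarrow> carrier R" "v \<otimes> y = (\<Oplus>i\<in>I. c i \<otimes> \<tau> i)" and y: "y \<in> carrier R" by auto
        have "v \<otimes> (a \<otimes> y) = a \<otimes> (v \<otimes> y)" using that v(1) y by (simp add: m_ac)
        also have "\<dots> = (\<Oplus>i\<in>I. (a \<otimes> c i) \<otimes> \<tau> i)" unfolding v(3) by (rule scale) (use that v in auto)
        finally have "v \<otimes> (a \<otimes> y) = (\<Oplus>i\<in>I. (a \<otimes> c i) \<otimes> \<tau> i)" .
        moreover have "(\<lambda>i. a \<otimes> c i) \<in> I \<rightarrow> carrier R" using v that by auto
        ultimately show ?thesis by (intro JI[of _ v "\<lambda>i. a \<otimes> c i"]) (use v(1) y that(2) in auto)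
      qed
      then show "y \<otimes> a \<in> ?J" if "y \<in> ?J" "a \<in> carrier R" for y a
        using that by (metis (no_types, lifting) m_comm mem_Collect_eq)
      show "y \<oplus> z \<in> ?J" if "y \<in> ?J" "z \<in> ?J" for y z
      proof -
        from that obtain v c w d where v: "v \<in> mgen R V" "c \<in> I \<rightarrow> carrier R" "v \<otimes> y = (\<Oplus>i\<in>I. c i \<otimes> \<tau> i)" 
          and w: "w \<in> mgen R V" "d \<in> I \<rightarrow> carrier R" "w \<otimes> z = (\<Oplus>i\<in>I. d i \<otimes> \<tau> i)" and y: "y \<in> carrier R" "z \<in> carrier R" by auto
        have "(v \<otimes> w) \<otimes> (y \<oplus> z) = w \<otimes> (v \<otimes> y) \<oplus> v \<otimes> (w \<otimes> z)" using v(1) w(1) y by (simp add: r_distr m_ac)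
        also have "\<dots> = (\<Oplus>i\<in>I. (w \<otimes> c i) \<otimes> \<tau> i) \<oplus> (\<Oplus>i\<in>I. (v \<otimes> d i) \<otimes> \<tau> i)"
          unfolding v(3) w(3) using v w by (simp add: scale)
        also have "\<dots> = (\<Oplus>i\<in>I. (w \<otimes> c i) \<otimes> \<tau> i \<oplus> (v \<otimes> d i) \<otimes> \<tau> i)"
          by (rule finsum_addf[symmetric]) (use v w \<tau> in \<open>auto simp: Pi_iff\<close>)
        also have "\<dots> = (\<Oplus>i\<in>I. (w \<otimes> c i \<oplus> v \<otimes> d i) \<otimes> \<tau> i)"
          by (rule finsum_cong') (use v w \<tau> in \<open>auto simp: l_distr Pi_iff\<close>)
        finally have "(v \<otimes> w) \<otimes> (y \<oplus> z) = (\<Oplus>i\<in>I. (w \<otimes> c i \<oplus> v \<otimes> d i) \<otimes> \<tau> i)" .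
        moreover have "(\<lambda>i. w \<otimes> c i \<oplus> v \<otimes> d i) \<in> I \<rightarrow> carrier R" using v w by (auto simp: Pi_iff)
        ultimately show ?thesis
          by (intro JI[of _ "v \<otimes> w" "\<lambda>i. w \<otimes> c i \<oplus> v \<otimes> d i"]) (use mgen_mult[OF v(1) w(1)] y in auto)
      qed
    qed auto
    show "\<exists>v w. v \<in> mgen R V \<and> w \<in> mgen R (W i) \<and> v \<otimes> w \<in> ?J" if i: "i \<in> I" for i
    proof -
      from mgen_union[OF V W[OF i]] \<tau>M[OF i] obtain v w where vw: "v \<in> mgen R V" "w \<in> mgen R (W i)" "\<tau> i = v \<otimes> w"
        unfolding M_def by metis
      have "(\<Oplus>j\<in>I. (if i = j then \<one> else \<zero>) \<otimes> \<tau> j) = (\<Oplus>j\<in>I. if i = j then \<tau> j else \<zero>)"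
        by (rule finsum_cong') (use \<tau> in auto)
      also have "\<dots> = \<tau> i" by (rule add.finprod_singleton[OF i fin]) (use \<tau> in auto)
      finally have "\<one> \<otimes> (v \<otimes> w) = (\<Oplus>j\<in>I. (if i = j then \<one> else \<zero>) \<otimes> \<tau> j)" using \<tau>[OF i] vw by simp
      then have "v \<otimes> w \<in> ?J"
        by (intro JI[of _ \<one> "\<lambda>j. if i = j then \<one> else \<zero>"]) (use vw \<tau>[OF i] in auto)
      then show ?thesis using vw by blast
    qed
    show "y \<in> ?J" if v: "v \<in> mgen R V" and y: "y \<in> carrier R" and "v \<otimes> y \<in> ?J" for v y
    proof -
      from that obtain u c where u: "u \<in> mgen R V" "c \<in> I \<rightarrow> carrier R" "u \<otimes> (v \<otimes> y) = (\<Oplus>i\<in>I. c i \<otimes> \<tau> i)" by auto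
      then have "(u \<otimes> v) \<otimes> y = (\<Oplus>i\<in>I. c i \<otimes> \<tau> i)" using v y by (simp add: m_assoc)
      then show ?thesis by (intro JI[of _ "u \<otimes> v" c]) (use mgen_mult[OF u(1) v] u(2) y in auto)
    qed
  qed
  then obtain v c where v: "v \<in> mgen R V" "c \<in> I \<rightarrow> carrier R" "v = (\<Oplus>i\<in>I. c i \<otimes> \<tau> i)" by auto
  \<comment> \<open>The numerator of the glued section: the same coefficients that write
    \<open>v\<close> in terms of the \<open>\<tau> i\<close>, applied to the
    \<open>\<rho> i\<close>.\<close>
  let ?n = "\<Oplus>i\<in>I. c i \<otimes> \<rho> i"
  have n: "?n \<in> carrier R" by (rule finsum_closed) (use v \<rho> in \<open>auto simp: Pi_iff\<close>)
  show ?thesis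
  proof
    show "frac R V ?n v \<in> carrier (loc R V)" using n v by auto
    fix i assume i: "i \<in> I"
    have "?n \<otimes> \<tau> i = (\<Oplus>j\<in>I. c j \<otimes> \<rho> j \<otimes> \<tau> i)"
      by (rule finsum_ldistr) (use v \<rho> \<tau> fin i in \<open>auto simp: Pi_iff\<close>)
    also have "\<dots> = (\<Oplus>j\<in>I. c j \<otimes> \<tau> j \<otimes> \<rho> i)"
    proof (rule finsum_cong')
      fix j assume j: "j \<in> I"
      have "c j \<otimes> \<rho> j \<otimes> \<tau> i = c j \<otimes> (\<rho> j \<otimes> \<tau> i)" using v \<rho> \<tau> i j by (simp add: m_assoc Pi_iff)
      also have "\<dots> = c j \<otimes> \<tau> j \<otimes> \<rho> i" unfolding \<rho>\<tau>[OF j i] using v \<rho> \<tau> i j by (simp add: m_ac Pi_iff)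
      finally show "c j \<otimes> \<rho> j \<otimes> \<tau> i = c j \<otimes> \<tau> j \<otimes> \<rho> i" .
    qed (use v \<rho> \<tau> i in \<open>auto simp: Pi_iff\<close>)
    also have "\<dots> = v \<otimes> \<rho> i" unfolding v(3)
      by (rule finsum_ldistr[symmetric]) (use v \<rho> \<tau> fin i in \<open>auto simp: Pi_iff\<close>)
    finally have *: "?n \<otimes> \<tau> i = \<rho> i \<otimes> v" using v(1) \<rho>[OF i] by (simp add: m_comm)
    have sub: "mgen R V \<subseteq> mgen R (V \<union> W i)" by (rule mgen_mono) auto
    have U: "V \<union> W i \<subseteq> carrier R" using V W i by auto
    show "loc_res R (V \<union> W i) (frac R V ?n v) = p i"
      unfolding p\<rho>[OF i] loc_res_frac[OF Un_upper1 U n v(1)]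
      by (rule frac_eqI[OF U n _ \<rho>[OF i] _ *]) (use sub v(1) \<tau>M[OF i] in \<open>auto simp: M_def\<close>)
  qed
qed

end

lemma (in ring_hom_cring) pcover_image:
  assumes "pcover R I V" shows "pcover S I (\<lambda>i. h ` V i)"
  unfolding pcover_def
proof (intro conjI ballI allI impI)
  show "h ` V i \<subseteq> carrier S" if "i \<in> I" for i using assms that by (auto simp: pcover_def)
  fix P assume "primeideal P S"
  then have "primeideal {r \<in> carrier R. h r \<in> P} R"
    by (rule ring.primeideal_vimage[OF R.cring_axioms])
  with assms obtain i where "i \<in> I" "V i \<inter> {r \<in> carrier R. h r \<in> P} = {}" "V i \<subseteq> carrier R" unfolding pcover_def by meson
  then show "\<exists>i\<in>I. h ` V i \<inter> P = {}" by (intro bexI[of _ i]) auto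
qed

section \<open>The norm of a rank-\<open>n\<close> algebra\<close>

context ring_hom_cring
begin

text \<open>The functional \<open>b / h s |-> g b / s\<close>. A description replaces a union over
  representatives because a representative shows only the denominator \<open>h s\<close> in
  \<open>S\<close>, while the value calls for a preimage \<open>s\<close> in
  \<open>R\<close>.\<close>

definition loc_functional :: "('c \<Rightarrow> 'a) \<Rightarrow> 'a set \<Rightarrow> ('c \<times> 'c) set \<Rightarrow> ('a \<times> 'a) set" where
  "loc_functional g V p = (THE q. \<exists>b s. b \<in> carrier S \<and> s \<in> mgen R V \<and>
     p = frac S (h ` V) b (h s) \<and> q = frac R V (g b) s)"

lemma functional_mult_right:
  assumes g: "functional R S h g" and "a \<in> carrier R" "b \<in> carrier S"
  shows "g (b \<otimes>\<^bsub>S\<^esub> h a) = g b \<otimes> a"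
  using functionalD[OF g] assms by (simp add: S.m_comm[of b] R.m_comm)

lemma loc_functional_frac:
  assumes V: "V \<subseteq> carrier R" and g: "functional R S h g" and b: "b \<in> carrier S" and s: "s \<in> mgen R V"
  shows "loc_functional g V (frac S (h ` V) b (h s)) = frac R V (g b) s"
  unfolding loc_functional_def
proof (rule the_equality)
  show "\<exists>b' s'. b' \<in> carrier S \<and> s' \<in> mgen R V \<and> frac S (h ` V) b (h s) = frac S (h ` V) b' (h s') \<and>
      frac R V (g b) s = frac R V (g b') s'" using b s by blast
  fix q assume "\<exists>b' s'. b' \<in> carrier S \<and> s' \<in> mgen R V \<and> frac S (h ` V) b (h s) = frac S (h ` V) b' (h s') \<and>
      q = frac R V (g b') s'"
  then obtain b' s' where b': "b' \<in> carrier S" "s' \<in> mgen R V" and eq: "frac S (h ` V) b (h s) = frac S (h ` V) b' (h s')"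
    and q: "q = frac R V (g b') s'" by auto
  note c = R.mgen_closed[OF V]
  have sc [simp]: "s \<in> carrier R" "s' \<in> carrier R" using s b' c by auto
  from eq obtain t where t: "t \<in> mgen R V" "h t \<otimes>\<^bsub>S\<^esub> (b \<otimes>\<^bsub>S\<^esub> h s') = h t \<otimes>\<^bsub>S\<^esub> (b' \<otimes>\<^bsub>S\<^esub> h s)"
    using b b' s V by (subst (asm) S.frac_eq_iff) (auto simp: mgen_image)
  have "t \<otimes> (g b \<otimes> s') = t \<otimes> (g b' \<otimes> s)"
    using arg_cong[OF t(2), of g] c[OF t(1)] b b' by (simp add: functionalD[OF g] functional_mult_right[OF g])
  then have "t \<otimes> (g b' \<otimes> s) = t \<otimes> (g b \<otimes> s')" by simp
  then show "q = frac R V (g b) s"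
    unfolding q using b b' s t(1) V by (subst R.frac_eq_iff) (auto simp: functionalD[OF g])
qed

lemma loc_functional_functional:
  assumes V: "V \<subseteq> carrier R" and g: "functional R S h g"
  shows "functional (loc R V) (loc S (h ` V)) (loc_map S (h ` V) h) (loc_functional g V)"
  unfolding functional_def
proof (intro conjI ballI)
  note [simp] = loc_functional_frac[OF V g] R.mgen_closed[OF V] functionalD[OF g] functional_mult_right[OF g] R.mgen_mult
    hom_mem_mgen[OF V] S.mgen_mult
  have hV: "h ` V \<subseteq> carrier S" using V by auto
  show "loc_functional g V \<in> carrier (loc S (h ` V)) \<rightarrow> carrier (loc R V)"
    by (auto elim!: loc_imageE[OF V] intro!: R.frac_closed)
  fix p assume p: "p \<in> carrier (loc S (h ` V))"
  then obtain b s where bs [simp]: "b \<in> carrier S" "s \<in> mgen R V" "p = frac S (h ` V) b (h s)" by (rule loc_imageE[OF V])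
  show "loc_functional g V (p \<oplus>\<^bsub>loc S (h ` V)\<^esub> q) = loc_functional g V p \<oplus>\<^bsub>loc R V\<^esub> loc_functional g V q"
    if q: "q \<in> carrier (loc S (h ` V))" for q
  proof -
    from q obtain b' s' where [simp]: "b' \<in> carrier S" "s' \<in> mgen R V" "q = frac S (h ` V) b' (h s')" by (rule loc_imageE[OF V])
    have "p \<oplus>\<^bsub>loc S (h ` V)\<^esub> q = frac S (h ` V) (b \<otimes>\<^bsub>S\<^esub> h s' \<oplus>\<^bsub>S\<^esub> b' \<otimes>\<^bsub>S\<^esub> h s) (h (s \<otimes> s'))"
      by (simp add: S.loc_add[OF hV])
    then show ?thesis by (simp add: R.loc_add[OF V] del: hom_mult)
  qed
  show "loc_functional g V (loc_map S (h ` V) h a \<otimes>\<^bsub>loc S (h ` V)\<^esub> p) = a \<otimes>\<^bsub>loc R V\<^esub> loc_functional g V p"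
    if a: "a \<in> carrier (loc R V)" for a
  proof -
    from a obtain r t where [simp]: "r \<in> carrier R" "t \<in> mgen R V" "a = frac R V r t" by (rule R.loc_carrierE)
    have "loc_map S (h ` V) h a \<otimes>\<^bsub>loc S (h ` V)\<^esub> p = frac S (h ` V) (h r \<otimes>\<^bsub>S\<^esub> b) (h (t \<otimes> s))"
      by (simp add: S.loc_mult[OF hV] loc_map_image_frac[OF V])
    then show ?thesis by (simp add: R.loc_mult[OF V] del: hom_mult)
  qed
qed

end

text \<open>A basis together with its dual basis up to the scalar \<open>s\<close>: over
  \<open>A[1/s]\<close> the \<open>e i\<close> form a basis with dual functionals
  \<open>g i / s\<close>. Since only equations over \<open>A\<close> are involved, the notion
  survives every base change.\<close>

definition near_basis ::
  "nat \<Rightarrow> ('a, 'm) ring_scheme \<Rightarrow> ('b, 'n) ring_scheme \<Rightarrow> ('a \<Rightarrow> 'b) \<Rightarrow> 'a \<Rightarrow> (nat \<Rightarrow> 'b) \<Rightarrow> (nat \<Rightarrow> 'b \<Rightarrow> 'a) \<Rightarrow> bool"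
  where
  "near_basis n A B \<phi> s e g \<longleftrightarrow> s \<in> carrier A \<and>
     (\<forall>i<n. e i \<in> carrier B \<and> functional A B \<phi> (g i)) \<and>
     (\<forall>b\<in>carrier B. (\<Oplus>\<^bsub>B\<^esub>i\<in>{..<n}. \<phi> (g i b) \<otimes>\<^bsub>B\<^esub> e i) = \<phi> s \<otimes>\<^bsub>B\<^esub> b) \<and>
     (\<forall>i<n. \<forall>j<n. g i (e j) = (if i = j then s else \<zero>\<^bsub>A\<^esub>))"

definition loc_free ::
  "nat \<Rightarrow> ('a, 'm) ring_scheme \<Rightarrow> ('b, 'n) ring_scheme \<Rightarrow> ('a \<Rightarrow> 'b) \<Rightarrow> bool" where
  "loc_free n A B \<phi> \<longleftrightarrow> (\<forall>P. primeideal P A \<longrightarrow> (\<exists>s e g. s \<notin> P \<and> near_basis n A B \<phi> s e g))"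

lemma (in ring_hom_cring) near_basis_unit:
  assumes nb: "near_basis n R S h s e g" and u: "u \<in> carrier R" "u \<otimes> s = \<one>"
  shows "is_basis R (alg_module R S h) n e"
  unfolding is_basis_def
proof (intro conjI allI impI ballI)
  have eS: "\<And>i. i < n \<Longrightarrow> e i \<in> carrier S" and g: "\<And>i. i < n \<Longrightarrow> functional R S h (g i)" and s: "s \<in> carrier R"
    and expand: "\<And>b. b \<in> carrier S \<Longrightarrow> (\<Oplus>\<^bsub>S\<^esub>i\<in>{..<n}. h (g i b) \<otimes>\<^bsub>S\<^esub> e i) = h s \<otimes>\<^bsub>S\<^esub> b"
    and dual: "\<And>i j. i < n \<Longrightarrow> j < n \<Longrightarrow> g i (e j) = (if i = j then s else \<zero>)"
    using nb by (auto simp: near_basis_def)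
  show "e i \<in> carrier (alg_module R S h)" if "i < n" for i using eS that by simp
  fix b assume "b \<in> carrier (alg_module R S h)"
  then have b: "b \<in> carrier S" by simp
  let ?c = "\<lambda>i\<in>{..<n}. u \<otimes> g i b"
  show "\<exists>!c. represents R (alg_module R S h) n e b c"
  proof (rule ex1I)
    have "(\<Oplus>\<^bsub>S\<^esub>i\<in>{..<n}. h (?c i) \<otimes>\<^bsub>S\<^esub> e i) = (\<Oplus>\<^bsub>S\<^esub>i\<in>{..<n}. h u \<otimes>\<^bsub>S\<^esub> (h (g i b) \<otimes>\<^bsub>S\<^esub> e i))"
      by (rule S.finsum_cong') (use b u eS functionalD[OF g] in \<open>auto simp: S.m_assoc\<close>)
    also have "\<dots> = h u \<otimes>\<^bsub>S\<^esub> (\<Oplus>\<^bsub>S\<^esub>i\<in>{..<n}. h (g i b) \<otimes>\<^bsub>S\<^esub> e i)"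
      by (rule S.finsum_rdistr[symmetric]) (use b u eS functionalD[OF g] in auto)
    also have "\<dots> = h (u \<otimes> s) \<otimes>\<^bsub>S\<^esub> b" using b u(1) s by (simp add: expand S.m_assoc)
    finally have "b = (\<Oplus>\<^bsub>S\<^esub>i\<in>{..<n}. h (?c i) \<otimes>\<^bsub>S\<^esub> e i)" using b by (simp add: u)
    then show "represents R (alg_module R S h) n e b ?c"
      unfolding represents_def using b u functionalD[OF g] by auto
    fix c assume "represents R (alg_module R S h) n e b c"
    then have c: "c \<in> {..<n} \<rightarrow>\<^sub>E carrier R" and bc: "b = (\<Oplus>\<^bsub>S\<^esub>i\<in>{..<n}. h (c i) \<otimes>\<^bsub>S\<^esub> e i)"
      by (auto simp: represents_def)
    have "c i = u \<otimes> g i b" if i: "i < n" for i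
    proof -
      have "g i b = (\<Oplus>j\<in>{..<n}. g i (h (c j) \<otimes>\<^bsub>S\<^esub> e j))"
        unfolding bc by (rule functional_finsum[OF g]) (use c eS i in auto)
      also have "\<dots> = (\<Oplus>j\<in>{..<n}. if i = j then c j \<otimes> s else \<zero>)"
        by (rule R.finsum_cong') (use c eS i dual s functionalD[OF g] in \<open>auto simp: PiE_iff\<close>)
      also have "\<dots> = c i \<otimes> s" using R.add.finprod_singleton[of i "{..<n}" "\<lambda>j. c j \<otimes> s"] c i s by (auto simp: PiE_iff)
      finally have gb: "g i b = c i \<otimes> s" .
      have ci: "c i \<in> carrier R" using c i by auto
      have "u \<otimes> (c i \<otimes> s) = c i \<otimes> (u \<otimes> s)" by (rule R.m_lcomm) (use u ci s in auto)
      then show ?thesis using ci by (simp add: gb u)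
    qed
    then show "c = ?c" using c by (intro PiE_ext[OF c]) (auto simp: u functionalD[OF g] b)
  qed
qed

text \<open>Base change in terms of frames: the target carries the image of the source frame, so the
  matrices that define the norms correspond entry by entry. Localization, passage to polynomials and
  evaluation of a variable are all instances.\<close>

locale frame_hom = dom: framed_algebra A B \<phi> m x f + cod: framed_algebra A' B' \<phi>' m x' f' +
    base: ring_hom_cring A A' \<alpha> + top: ring_hom_cring B B' \<beta>
  for A :: "('a, 'a1) ring_scheme" and B :: "('b, 'b1) ring_scheme" and \<phi> m x f
    and A' :: "('c, 'c1) ring_scheme" and B' :: "('d, 'd1) ring_scheme" and \<phi>' x' f' \<alpha> \<beta> +
  assumes x'_eq: "\<And>j. j < m \<Longrightarrow> x' j = \<beta> (x j)"
    and comm: "\<And>a. a \<in> carrier A \<Longrightarrow> \<phi>' (\<alpha> a) = \<beta> (\<phi> a)"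
    and f'_eq: "\<And>j b. j < m \<Longrightarrow> b \<in> carrier B \<Longrightarrow> f' j (\<beta> b) = \<alpha> (f j b)"
begin

lemma nm_hom:
  assumes b: "b \<in> carrier B" shows "cod.nm (\<beta> b) = \<alpha> (dom.nm b)"
proof -
  have "\<alpha> (dom.nm b) = det A' m (\<lambda>i j. \<alpha> ((if i = j then \<one>\<^bsub>A\<^esub> else \<zero>\<^bsub>A\<^esub>) \<oplus>\<^bsub>A\<^esub> f i ((b \<ominus>\<^bsub>B\<^esub> \<one>\<^bsub>B\<^esub>) \<otimes>\<^bsub>B\<^esub> x j)))"
    unfolding frame_norm_def by (rule base.hom_det) (use b in auto)
  also have "\<dots> = cod.nm (\<beta> b)"
    unfolding frame_norm_def
  proof (rule cod.R.det_cong)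
    fix i j assume ij: "i < m" "j < m"
    have "\<beta> (b \<ominus>\<^bsub>B\<^esub> \<one>\<^bsub>B\<^esub>) = \<beta> b \<ominus>\<^bsub>B'\<^esub> \<one>\<^bsub>B'\<^esub>"
      using b by (simp add: a_minus_def)
    then have "(\<beta> b \<ominus>\<^bsub>B'\<^esub> \<one>\<^bsub>B'\<^esub>) \<otimes>\<^bsub>B'\<^esub> x' j = \<beta> ((b \<ominus>\<^bsub>B\<^esub> \<one>\<^bsub>B\<^esub>) \<otimes>\<^bsub>B\<^esub> x j)"
      using ij b by (simp add: x'_eq)
    then have f': "f' i ((\<beta> b \<ominus>\<^bsub>B'\<^esub> \<one>\<^bsub>B'\<^esub>) \<otimes>\<^bsub>B'\<^esub> x' j) = \<alpha> (f i ((b \<ominus>\<^bsub>B\<^esub> \<one>\<^bsub>B\<^esub>) \<otimes>\<^bsub>B\<^esub> x j))"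
      using f'_eq[OF ij(1), of "(b \<ominus>\<^bsub>B\<^esub> \<one>\<^bsub>B\<^esub>) \<otimes>\<^bsub>B\<^esub> x j"] ij b by (simp only: dom.frame_closed dom.S.m_closed dom.S.minus_closed dom.S.one_closed)
    show "\<alpha> ((if i = j then \<one>\<^bsub>A\<^esub> else \<zero>\<^bsub>A\<^esub>) \<oplus>\<^bsub>A\<^esub> f i ((b \<ominus>\<^bsub>B\<^esub> \<one>\<^bsub>B\<^esub>) \<otimes>\<^bsub>B\<^esub> x j))
      = (if i = j then \<one>\<^bsub>A'\<^esub> else \<zero>\<^bsub>A'\<^esub>) \<oplus>\<^bsub>A'\<^esub> f' i ((\<beta> b \<ominus>\<^bsub>B'\<^esub> \<one>\<^bsub>B'\<^esub>) \<otimes>\<^bsub>B'\<^esub> x' j)"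
      unfolding f' using ij b by simp
  qed (use b in auto)
  finally show ?thesis by simp
qed

text \<open>The base change of the functional \<open>g\<close>: expand in the frame of
  \<open>B'\<close>, whose members come from \<open>B\<close>, and use the values of
  \<open>g\<close> on them.\<close>

definition "transport g b' = (\<Oplus>\<^bsub>A'\<^esub>j\<in>{..<m}. f' j b' \<otimes>\<^bsub>A'\<^esub> \<alpha> (g (x j)))"

lemma transport_functional:
  assumes g: "functional A B \<phi> g" shows "functional A' B' \<phi>' (transport g)"
  unfolding functional_def
proof (intro conjI ballI)
  note [simp] = functionalD[OF g]
  show "transport g \<in> carrier B' \<rightarrow> carrier A'"
    unfolding transport_def by (auto intro!: cod.R.finsum_closed)
  fix y assume [simp]: "y \<in> carrier B'"
  show "transport g (y \<oplus>\<^bsub>B'\<^esub> z) = transport g y \<oplus>\<^bsub>A'\<^esub> transport g z" if [simp]: "z \<in> carrier B'" for z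
    unfolding transport_def
    by (rule trans[OF cod.R.finsum_cong'[OF refl] cod.R.finsum_addf]) (auto simp: cod.R.l_distr)
  show "transport g (\<phi>' a \<otimes>\<^bsub>B'\<^esub> y) = a \<otimes>\<^bsub>A'\<^esub> transport g y" if [simp]: "a \<in> carrier A'" for a
    unfolding transport_def
    by (subst cod.R.finsum_rdistr) (auto simp: cod.R.m_assoc intro!: cod.R.finsum_cong')
qed

lemma transport_hom:
  assumes g: "functional A B \<phi> g" and b: "b \<in> carrier B" shows "transport g (\<beta> b) = \<alpha> (g b)"
proof -
  note [simp] = functionalD[OF g]
  have "\<alpha> (g b) = \<alpha> (\<Oplus>\<^bsub>A\<^esub>j\<in>{..<m}. f j b \<otimes>\<^bsub>A\<^esub> g (x j))" using dom.functional_expand[OF g b] by simp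
  also have "\<dots> = (\<Oplus>\<^bsub>A'\<^esub>j\<in>{..<m}. \<alpha> (f j b \<otimes>\<^bsub>A\<^esub> g (x j)))"
    using b by (subst base.hom_finsum) (auto simp: o_def)
  also have "\<dots> = transport g (\<beta> b)"
    unfolding transport_def by (rule cod.R.finsum_cong') (use b in \<open>auto simp: f'_eq\<close>)
  finally show ?thesis by simp
qed

lemma near_basis_hom:
  assumes "near_basis n A B \<phi> s e g"
  shows "near_basis n A' B' \<phi>' (\<alpha> s) (\<lambda>i. \<beta> (e i)) (\<lambda>i. transport (g i))"
proof -
  have e [simp]: "\<And>i. i < n \<Longrightarrow> e i \<in> carrier B" and g: "\<And>i. i < n \<Longrightarrow> functional A B \<phi> (g i)" and s [simp]: "s \<in> carrier A"
    and expand: "\<And>b. b \<in> carrier B \<Longrightarrow> (\<Oplus>\<^bsub>B\<^esub>i\<in>{..<n}. \<phi> (g i b) \<otimes>\<^bsub>B\<^esub> e i) = \<phi> s \<otimes>\<^bsub>B\<^esub> b"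
    and dual: "\<And>i j. i < n \<Longrightarrow> j < n \<Longrightarrow> g i (e j) = (if i = j then s else \<zero>\<^bsub>A\<^esub>)"
    using assms by (auto simp: near_basis_def)
  note [simp] = functionalD[OF g] functionalD[OF transport_functional[OF g]]
  have hx: "(\<Oplus>\<^bsub>B'\<^esub>i\<in>{..<n}. \<phi>' (\<alpha> (g i b)) \<otimes>\<^bsub>B'\<^esub> \<beta> (e i)) = \<phi>' (\<alpha> s) \<otimes>\<^bsub>B'\<^esub> \<beta> b" if b: "b \<in> carrier B" for b
  proof -
    have "\<phi>' (\<alpha> s) \<otimes>\<^bsub>B'\<^esub> \<beta> b = \<beta> (\<Oplus>\<^bsub>B\<^esub>i\<in>{..<n}. \<phi> (g i b) \<otimes>\<^bsub>B\<^esub> e i)" using b by (simp add: expand comm)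
    also have "\<dots> = (\<Oplus>\<^bsub>B'\<^esub>i\<in>{..<n}. \<beta> (\<phi> (g i b) \<otimes>\<^bsub>B\<^esub> e i))"
      using b by (subst top.hom_finsum) (auto simp: o_def)
    also have "\<dots> = (\<Oplus>\<^bsub>B'\<^esub>i\<in>{..<n}. \<phi>' (\<alpha> (g i b)) \<otimes>\<^bsub>B'\<^esub> \<beta> (e i))"
      by (rule cod.S.finsum_cong') (use b in \<open>auto simp: comm\<close>)
    finally show ?thesis by simp
  qed
  have "(\<Oplus>\<^bsub>B'\<^esub>i\<in>{..<n}. \<phi>' (transport (g i) b') \<otimes>\<^bsub>B'\<^esub> \<beta> (e i)) = \<phi>' (\<alpha> s) \<otimes>\<^bsub>B'\<^esub> b'" if b': "b' \<in> carrier B'" for b'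
  proof -
    \<comment> \<open>\<open>E\<close> and multiplication by the image of \<open>s\<close> are
      additive, and by \<open>E_lin\<close> they agree on multiples of elements from
      \<open>B\<close>. The expansion in the frame \<open>x'\<close> writes every element of
      \<open>B'\<close> as a sum of such multiples.\<close>
    define E where "E y = (\<Oplus>\<^bsub>B'\<^esub>i\<in>{..<n}. \<phi>' (transport (g i) y) \<otimes>\<^bsub>B'\<^esub> \<beta> (e i))" for y
    have E_sum: "E (\<Oplus>\<^bsub>B'\<^esub>j\<in>J. Y j) = (\<Oplus>\<^bsub>B'\<^esub>j\<in>J. E (Y j))" if "finite J" "Y \<in> J \<rightarrow> carrier B'" for J :: "nat set" and Y
      using that
    proof (induction J)
      case empty
      have "E \<zero>\<^bsub>B'\<^esub> = (\<Oplus>\<^bsub>B'\<^esub>i\<in>{..<n}. \<zero>\<^bsub>B'\<^esub>)"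
        unfolding E_def by (rule cod.S.finsum_cong') (auto simp: cod.functional_zero[OF transport_functional[OF g]])
      then show ?case by simp
    next
      case (insert j J)
      then have [simp]: "Y j \<in> carrier B'" "(\<Oplus>\<^bsub>B'\<^esub>j\<in>J. Y j) \<in> carrier B'" by (auto intro!: cod.S.finsum_closed)
      have EC: "E y \<in> carrier B'" if "y \<in> carrier B'" for y unfolding E_def using that by (auto intro!: cod.S.finsum_closed)
      have "E (Y j \<oplus>\<^bsub>B'\<^esub> (\<Oplus>\<^bsub>B'\<^esub>j\<in>J. Y j)) = E (Y j) \<oplus>\<^bsub>B'\<^esub> E (\<Oplus>\<^bsub>B'\<^esub>j\<in>J. Y j)"
        unfolding E_def by (rule trans[OF cod.S.finsum_cong'[OF refl] cod.S.finsum_addf]) (auto simp: cod.S.l_distr)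
      then show ?case using insert EC by (simp add: Pi_iff)
    qed
    have E_lin: "E (\<phi>' a \<otimes>\<^bsub>B'\<^esub> \<beta> b) = \<phi>' (\<alpha> s) \<otimes>\<^bsub>B'\<^esub> (\<phi>' a \<otimes>\<^bsub>B'\<^esub> \<beta> b)" if a: "a \<in> carrier A'" and b: "b \<in> carrier B" for a b
    proof -
      have "E (\<phi>' a \<otimes>\<^bsub>B'\<^esub> \<beta> b) = (\<Oplus>\<^bsub>B'\<^esub>i\<in>{..<n}. \<phi>' a \<otimes>\<^bsub>B'\<^esub> (\<phi>' (\<alpha> (g i b)) \<otimes>\<^bsub>B'\<^esub> \<beta> (e i)))"
        unfolding E_def by (rule cod.S.finsum_cong') (use a b in \<open>auto simp: transport_hom[OF g] cod.S.m_assoc\<close>)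
      also have "\<dots> = \<phi>' a \<otimes>\<^bsub>B'\<^esub> (\<phi>' (\<alpha> s) \<otimes>\<^bsub>B'\<^esub> \<beta> b)"
        unfolding hx[OF b, symmetric] by (rule cod.S.finsum_rdistr[symmetric]) (use a b in auto)
      finally show ?thesis using a b by (simp add: cod.S.m_ac)
    qed
    have "E b' = E (\<Oplus>\<^bsub>B'\<^esub>j\<in>{..<m}. \<phi>' (f' j b') \<otimes>\<^bsub>B'\<^esub> x' j)" using b' by (simp add: cod.frame_expand)
    also have "\<dots> = (\<Oplus>\<^bsub>B'\<^esub>j\<in>{..<m}. \<phi>' (\<alpha> s) \<otimes>\<^bsub>B'\<^esub> (\<phi>' (f' j b') \<otimes>\<^bsub>B'\<^esub> x' j))"
      using b' by (subst E_sum) (auto simp: x'_eq E_lin intro!: cod.S.finsum_cong')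
    also have "\<dots> = \<phi>' (\<alpha> s) \<otimes>\<^bsub>B'\<^esub> (\<Oplus>\<^bsub>B'\<^esub>j\<in>{..<m}. \<phi>' (f' j b') \<otimes>\<^bsub>B'\<^esub> x' j)"
      by (rule cod.S.finsum_rdistr[symmetric]) (use b' in auto)
    finally show ?thesis using b' by (simp add: E_def cod.frame_expand)
  qed
  then show ?thesis
    unfolding near_basis_def using dual transport_functional[OF g] by (auto simp: transport_hom[OF g])
qed

lemma loc_free_hom:
  assumes "loc_free n A B \<phi>" shows "loc_free n A' B' \<phi>'"
  unfolding loc_free_def
proof (intro allI impI)
  fix P assume "primeideal P A'"
  then have "primeideal {r \<in> carrier A. \<alpha> r \<in> P} A"
    by (rule base.ring.primeideal_vimage[OF dom.R.cring_axioms])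
  with assms obtain s e g where s: "s \<notin> {r \<in> carrier A. \<alpha> r \<in> P}" "near_basis n A B \<phi> s e g"
    unfolding loc_free_def by blast
  then have "\<alpha> s \<notin> P" by (auto simp: near_basis_def)
  then show "\<exists>s e g. s \<notin> P \<and> near_basis n A' B' \<phi>' s e g" using near_basis_hom[OF s(2)] by blast
qed

end

context framed_algebra
begin

lemma frame_hom_loc:
  assumes V: "V \<subseteq> carrier A"
  shows "frame_hom A B \<phi> m x f (loc A V) (loc B (\<phi> ` V)) (loc_map B (\<phi> ` V) \<phi>)
    (\<lambda>j. frac B (\<phi> ` V) (x j) \<one>\<^bsub>B\<^esub>) (\<lambda>j. loc_functional (f j) V) (\<lambda>a. frac A V a \<one>) (\<lambda>b. frac B (\<phi> ` V) b \<one>\<^bsub>B\<^esub>)"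
proof -
  have V': "\<phi> ` V \<subseteq> carrier B" using V by auto
  interpret L: ring_hom_cring "loc A V" "loc B (\<phi> ` V)" "loc_map B (\<phi> ` V) \<phi>" by (rule loc_map_image_hom[OF V])
  interpret top: ring_hom_cring B "loc B (\<phi> ` V)" "\<lambda>b. frac B (\<phi> ` V) b \<one>\<^bsub>B\<^esub>"
    using S.cring_axioms L.S.cring_axioms S.frac_ring_hom[OF V'] by (simp add: ring_hom_cring_def ring_hom_cring_axioms_def)
  interpret base: ring_hom_cring A "loc A V" "\<lambda>a. frac A V a \<one>"
    using R.cring_axioms L.R.cring_axioms R.frac_ring_hom[OF V] by (simp add: ring_hom_cring_def ring_hom_cring_axioms_def)
  note [simp] = functionalD[OF loc_functional_functional[OF V frame_functional]]
  show ?thesis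
  proof unfold_locales
    fix p assume "p \<in> carrier (loc B (\<phi> ` V))"
    then obtain b s where bs: "b \<in> carrier B" "s \<in> mgen A V" "p = frac B (\<phi> ` V) b (\<phi> s)" by (rule loc_imageE[OF V])
    have s: "s \<in> carrier A" "\<phi> s \<in> mgen B (\<phi> ` V)" using R.mgen_closed[OF V] bs hom_mem_mgen[OF V] by auto
    have "(\<Oplus>\<^bsub>loc B (\<phi> ` V)\<^esub>j\<in>{..<m}. loc_map B (\<phi> ` V) \<phi> (loc_functional (f j) V p) \<otimes>\<^bsub>loc B (\<phi> ` V)\<^esub> frac B (\<phi> ` V) (x j) \<one>\<^bsub>B\<^esub>)
      = (\<Oplus>\<^bsub>loc B (\<phi> ` V)\<^esub>j\<in>{..<m}. frac B (\<phi> ` V) \<one>\<^bsub>B\<^esub> (\<phi> s) \<otimes>\<^bsub>loc B (\<phi> ` V)\<^esub> frac B (\<phi> ` V) (\<phi> (f j b) \<otimes>\<^bsub>B\<^esub> x j) \<one>\<^bsub>B\<^esub>)"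
    proof (rule L.S.finsum_cong'[OF refl])
      have [simp]: "\<phi> s \<in> carrier B" using s by simp
      show "(\<lambda>j. frac B (\<phi> ` V) \<one>\<^bsub>B\<^esub> (\<phi> s) \<otimes>\<^bsub>loc B (\<phi> ` V)\<^esub> frac B (\<phi> ` V) (\<phi> (f j b) \<otimes>\<^bsub>B\<^esub> x j) \<one>\<^bsub>B\<^esub>) \<in> {..<m} \<rightarrow> carrier (loc B (\<phi> ` V))"
      proof (rule Pi_I)
        fix j assume "j \<in> {..<m}"
        then have "\<phi> (f j b) \<otimes>\<^bsub>B\<^esub> x j \<in> carrier B" using bs by simp
        then show "frac B (\<phi> ` V) \<one>\<^bsub>B\<^esub> (\<phi> s) \<otimes>\<^bsub>loc B (\<phi> ` V)\<^esub> frac B (\<phi> ` V) (\<phi> (f j b) \<otimes>\<^bsub>B\<^esub> x j) \<one>\<^bsub>B\<^esub> \<in> carrier (loc B (\<phi> ` V))"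
          by (intro L.S.m_closed S.frac_closed S.mgen_one s S.one_closed)
      qed
      fix j assume "j \<in> {..<m}"
      then have [simp]: "j < m" by simp
      have fb: "f j b \<in> carrier A" "\<phi> (f j b) \<in> carrier B" using bs by simp_all
      have "loc_map B (\<phi> ` V) \<phi> (loc_functional (f j) V p) = frac B (\<phi> ` V) (\<phi> (f j b)) (\<phi> s)"
        unfolding bs(3) using bs fb by (simp add: loc_functional_frac[OF V frame_functional] loc_map_image_frac[OF V])
      moreover have "frac B (\<phi> ` V) (\<phi> (f j b)) (\<phi> s) \<otimes>\<^bsub>loc B (\<phi> ` V)\<^esub> frac B (\<phi> ` V) (x j) \<one>\<^bsub>B\<^esub>
        = frac B (\<phi> ` V) (\<phi> (f j b) \<otimes>\<^bsub>B\<^esub> x j) (\<phi> s \<otimes>\<^bsub>B\<^esub> \<one>\<^bsub>B\<^esub>)"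
        by (rule S.loc_mult[OF V' fb(2) s(2)]) auto
      moreover have "frac B (\<phi> ` V) \<one>\<^bsub>B\<^esub> (\<phi> s) \<otimes>\<^bsub>loc B (\<phi> ` V)\<^esub> frac B (\<phi> ` V) (\<phi> (f j b) \<otimes>\<^bsub>B\<^esub> x j) \<one>\<^bsub>B\<^esub>
        = frac B (\<phi> ` V) (\<one>\<^bsub>B\<^esub> \<otimes>\<^bsub>B\<^esub> (\<phi> (f j b) \<otimes>\<^bsub>B\<^esub> x j)) (\<phi> s \<otimes>\<^bsub>B\<^esub> \<one>\<^bsub>B\<^esub>)"
        by (rule S.loc_mult[OF V' _ s(2)]) (use fb in auto)
      moreover have "\<one>\<^bsub>B\<^esub> \<otimes>\<^bsub>B\<^esub> (\<phi> (f j b) \<otimes>\<^bsub>B\<^esub> x j) = \<phi> (f j b) \<otimes>\<^bsub>B\<^esub> x j" using fb by simp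
      ultimately show "loc_map B (\<phi> ` V) \<phi> (loc_functional (f j) V p) \<otimes>\<^bsub>loc B (\<phi> ` V)\<^esub> frac B (\<phi> ` V) (x j) \<one>\<^bsub>B\<^esub>
        = frac B (\<phi> ` V) \<one>\<^bsub>B\<^esub> (\<phi> s) \<otimes>\<^bsub>loc B (\<phi> ` V)\<^esub> frac B (\<phi> ` V) (\<phi> (f j b) \<otimes>\<^bsub>B\<^esub> x j) \<one>\<^bsub>B\<^esub>"
        by metis
    qed
    also have "\<dots> = frac B (\<phi> ` V) \<one>\<^bsub>B\<^esub> (\<phi> s) \<otimes>\<^bsub>loc B (\<phi> ` V)\<^esub> (\<Oplus>\<^bsub>loc B (\<phi> ` V)\<^esub>j\<in>{..<m}. frac B (\<phi> ` V) (\<phi> (f j b) \<otimes>\<^bsub>B\<^esub> x j) \<one>\<^bsub>B\<^esub>)"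
      by (rule L.S.finsum_rdistr[symmetric]) (use bs s in \<open>auto intro!: S.frac_closed\<close>)
    also have "(\<Oplus>\<^bsub>loc B (\<phi> ` V)\<^esub>j\<in>{..<m}. frac B (\<phi> ` V) (\<phi> (f j b) \<otimes>\<^bsub>B\<^esub> x j) \<one>\<^bsub>B\<^esub>) = frac B (\<phi> ` V) b \<one>\<^bsub>B\<^esub>"
      using top.hom_finsum[of "\<lambda>j. \<phi> (f j b) \<otimes>\<^bsub>B\<^esub> x j" "{..<m}"] bs by (simp add: frame_expand o_def)
    also have "frac B (\<phi> ` V) \<one>\<^bsub>B\<^esub> (\<phi> s) \<otimes>\<^bsub>loc B (\<phi> ` V)\<^esub> frac B (\<phi> ` V) b \<one>\<^bsub>B\<^esub> = p"
      using S.frac_eq_mult[OF V' bs(1) s(2)] bs(3) by simp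
    finally show "(\<Oplus>\<^bsub>loc B (\<phi> ` V)\<^esub>j\<in>{..<m}. loc_map B (\<phi> ` V) \<phi> (loc_functional (f j) V p) \<otimes>\<^bsub>loc B (\<phi> ` V)\<^esub> frac B (\<phi> ` V) (x j) \<one>\<^bsub>B\<^esub>) = p" .
  next
    show "loc_functional (f j) V (frac B (\<phi> ` V) b \<one>\<^bsub>B\<^esub>) = frac A V (f j b) \<one>" if "j < m" "b \<in> carrier B" for j b
      using loc_functional_frac[OF V frame_functional[OF that(1)] that(2) R.mgen_one] by simp
    show "loc_map B (\<phi> ` V) \<phi> (frac A V a \<one>) = frac B (\<phi> ` V) (\<phi> a) \<one>\<^bsub>B\<^esub>" if "a \<in> carrier A" for a
      using loc_map_image_frac[OF V that R.mgen_one] by simp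
  qed (auto intro: loc_functional_functional[OF V frame_functional])
qed

text \<open>\<open>nm\<close> meets the defining description because over each \<open>A[1/a]\<close>
  any basis computes the same determinant as the frame. Conversely the neighbourhoods supplied by
  near bases are numerous enough to determine the value.\<close>

lemma norm_fun_eq:
  assumes lf: "loc_free n A B \<phi>" and b: "b \<in> carrier B"
  shows "norm_fun n A B \<phi> b = nm b"
proof -
  let ?P = "\<lambda>c. c \<in> carrier A \<and> (\<forall>a\<in>carrier A. let V = {a}; Y = \<phi> ` V; \<phi>V = loc_map B Y \<phi> in
       \<forall>e. is_basis (loc A V) (alg_module (loc A V) (loc B Y) \<phi>V) n e \<longrightarrow>
           frac A V c \<one> = mult_det n (loc A V) (loc B Y) \<phi>V e (frac B Y b \<one>\<^bsub>B\<^esub>))"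
  have ex: "?P (nm b)"
    unfolding Let_def
  proof (intro conjI ballI allI impI)
    show "nm b \<in> carrier A" using b by simp
    fix a e assume a: "a \<in> carrier A"
      and e: "is_basis (loc A {a}) (alg_module (loc A {a}) (loc B (\<phi> ` {a})) (loc_map B (\<phi> ` {a}) \<phi>)) n e"
    have V: "{a} \<subseteq> carrier A" using a by auto
    interpret L: frame_hom A B \<phi> m x f "loc A {a}" "loc B (\<phi> ` {a})" "loc_map B (\<phi> ` {a}) \<phi>"
      "\<lambda>j. frac B (\<phi> ` {a}) (x j) \<one>\<^bsub>B\<^esub>" "\<lambda>j. loc_functional (f j) {a}" "\<lambda>c. frac A {a} c \<one>" "\<lambda>b. frac B (\<phi> ` {a}) b \<one>\<^bsub>B\<^esub>"
      by (rule frame_hom_loc[OF V])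
    show "frac A {a} (nm b) \<one> = mult_det n (loc A {a}) (loc B (\<phi> ` {a})) (loc_map B (\<phi> ` {a}) \<phi>) e (frac B (\<phi> ` {a}) b \<one>\<^bsub>B\<^esub>)"
      using L.nm_hom[OF b] L.cod.nm_eq_mult_det[OF e] b by (metis L.top.hom_closed)
  qed
  have uniq: "c = nm b" if c: "?P c" for c
  proof -
    let ?J = "{y \<in> carrier A. y \<otimes> c = y \<otimes> nm b}"
    have cA: "c \<in> carrier A" using c by simp
    have "\<one> \<in> ?J"
    proof (rule R.eq_if_locally_eq_one)
      show "ideal ?J A"
      proof (rule R.idealI_basic)
        show "a \<otimes> y \<in> ?J" if "y \<in> ?J" "a \<in> carrier A" for y a using that b cA by (simp add: R.m_assoc)
        then show "y \<otimes> a \<in> ?J" if "y \<in> ?J" "a \<in> carrier A" for y a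
          using that R.m_comm[of y a] by simp
      qed (use b cA in \<open>auto simp: R.l_distr\<close>)
      fix P assume P: "primeideal P A"
      then obtain s e g where s: "s \<notin> P" and nb: "near_basis n A B \<phi> s e g" using lf by (auto simp: loc_free_def)
      have sA: "s \<in> carrier A" using nb by (simp add: near_basis_def)
      then have V: "{s} \<subseteq> carrier A" by auto
      interpret L: frame_hom A B \<phi> m x f "loc A {s}" "loc B (\<phi> ` {s})" "loc_map B (\<phi> ` {s}) \<phi>"
        "\<lambda>j. frac B (\<phi> ` {s}) (x j) \<one>\<^bsub>B\<^esub>" "\<lambda>j. loc_functional (f j) {s}" "\<lambda>c. frac A {s} c \<one>" "\<lambda>b. frac B (\<phi> ` {s}) b \<one>\<^bsub>B\<^esub>"
        by (rule frame_hom_loc[OF V])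
      have sM: "s \<in> mgen A {s}" using R.mgen_subset[of "{s}"] by auto
      \<comment> \<open>Inverting \<open>s\<close> turns the near basis into a basis, so the
        condition in the description may be used at \<open>a = s\<close>.\<close>
      have bas: "is_basis (loc A {s}) (alg_module (loc A {s}) (loc B (\<phi> ` {s})) (loc_map B (\<phi> ` {s}) \<phi>)) n (\<lambda>i. frac B (\<phi> ` {s}) (e i) \<one>\<^bsub>B\<^esub>)"
        by (rule L.cod.near_basis_unit[OF L.near_basis_hom[OF nb], of "frac A {s} \<one> s"])
          (use sM R.frac_denom_unit[OF V sM] in auto)
      have "frac A {s} c \<one> = frac A {s} (nm b) \<one>"
        using c ex bas sA unfolding Let_def by metis
      then obtain t where t: "t \<in> mgen A {s}" "t \<otimes> c = t \<otimes> nm b"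
        using cA b by (subst (asm) R.frac_eq_iff[OF V]) auto
      have "t \<notin> P" using R.mgen_disjoint_prime[OF P V] s t by auto
      moreover have "t \<in> ?J" using t R.mgen_closed[OF V] by auto
      ultimately show "\<exists>y\<in>?J. y \<notin> P" by auto
    qed
    then show ?thesis using cA b by simp
  qed
  define Q where "Q = ?P"
  have "norm_fun n A B \<phi> b = The Q" unfolding norm_fun_def Q_def ..
  moreover have "Q (nm b)" unfolding Q_def by (rule ex)
  moreover have "\<And>c. Q c \<Longrightarrow> c = nm b" unfolding Q_def by (rule uniq)
  ultimately show ?thesis using the_equality[of Q "nm b"] by metis
qed

end

section \<open>Descent of finitely many relations from a localization\<close>

context cring
begin

lemma common_denominator:
  assumes V: "V \<subseteq> carrier R" and "finite I" "\<And>i. i \<in> I \<Longrightarrow> q i \<in> carrier (loc R V)"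
  shows "\<exists>w\<in>mgen R V. \<forall>i\<in>I. \<exists>c\<in>carrier R. q i \<otimes>\<^bsub>loc R V\<^esub> frac R V w \<one> = frac R V c \<one>"
  using assms(2,3)
proof (induction I)
  case empty
  then show ?case using mgen_one by blast
next
  case (insert j I)
  interpret L: cring "loc R V" by (rule cring_loc[OF V])
  from insert obtain w where w: "w \<in> mgen R V" "\<And>i. i \<in> I \<Longrightarrow> \<exists>c\<in>carrier R. q i \<otimes>\<^bsub>loc R V\<^esub> frac R V w \<one> = frac R V c \<one>"
    by auto
  from insert.prems[of j] obtain r s where rs: "r \<in> carrier R" "s \<in> mgen R V" "q j = frac R V r s" using loc_carrierE by blast
  have c: "w \<in> carrier R" "s \<in> carrier R" using w rs V mgen_closed by auto
  have fr: "frac R V (w \<otimes> s) \<one> = frac R V w \<one> \<otimes>\<^bsub>loc R V\<^esub> frac R V s \<one>"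
    using c V by (simp add: loc_mult)
  have C: "frac R V u \<one> \<in> carrier (loc R V)" if "u \<in> carrier R" for u using that by auto
  have "\<exists>c\<in>carrier R. q i \<otimes>\<^bsub>loc R V\<^esub> frac R V (w \<otimes> s) \<one> = frac R V c \<one>" if i: "i \<in> insert j I" for i
  proof (cases "i \<in> I")
    case True
    then obtain d where d: "d \<in> carrier R" "q i \<otimes>\<^bsub>loc R V\<^esub> frac R V w \<one> = frac R V d \<one>" using w by blast
    have "q i \<otimes>\<^bsub>loc R V\<^esub> frac R V (w \<otimes> s) \<one> = (q i \<otimes>\<^bsub>loc R V\<^esub> frac R V w \<one>) \<otimes>\<^bsub>loc R V\<^esub> frac R V s \<one>"
      unfolding fr using insert.prems[OF i] C c by (simp add: L.m_assoc)
    also have "\<dots> = frac R V (d \<otimes> s) \<one>" unfolding d(2) using d c V by (simp add: loc_mult)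
    finally show ?thesis using d c by blast
  next
    case False
    then have ij: "i = j" using i by simp
    have "q j \<otimes>\<^bsub>loc R V\<^esub> frac R V (w \<otimes> s) \<one> = (q j \<otimes>\<^bsub>loc R V\<^esub> frac R V s \<one>) \<otimes>\<^bsub>loc R V\<^esub> frac R V w \<one>"
      unfolding fr using insert.prems[of j] C c by (simp add: L.m_ac)
    also have "\<dots> = frac R V (r \<otimes> w) \<one>" unfolding rs(3) frac_mult_denom[OF V rs(1,2)] using rs c V by (simp add: loc_mult)
    finally show ?thesis using ij rs c by blast
  qed
  then show ?case using mgen_mult[OF w(1) rs(2)] by blast
qed

lemma common_annihilator:
  assumes V: "V \<subseteq> carrier R" and "finite I"
    and "\<And>i. i \<in> I \<Longrightarrow> p i \<in> carrier R" "\<And>i. i \<in> I \<Longrightarrow> q i \<in> carrier R" "\<And>i. i \<in> I \<Longrightarrow> frac R V (p i) \<one> = frac R V (q i) \<one>"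
  shows "\<exists>t\<in>mgen R V. \<forall>i\<in>I. t \<otimes> p i = t \<otimes> q i"
  using assms(2-)
proof (induction I)
  case empty
  then show ?case using mgen_one by blast
next
  case (insert j I)
  then obtain t where t: "t \<in> mgen R V" "\<And>i. i \<in> I \<Longrightarrow> t \<otimes> p i = t \<otimes> q i" by auto
  have pq: "p j \<in> carrier R" "q j \<in> carrier R" "frac R V (p j) \<one> = frac R V (q j) \<one>" using insert.prems by auto
  obtain u where u: "u \<in> mgen R V" "u \<otimes> p j = u \<otimes> q j"
    using iffD1[OF frac_eq_iff[OF V pq(1) mgen_one pq(2) mgen_one] pq(3)] pq by auto
  have c: "t \<in> carrier R" "u \<in> carrier R" using t u V mgen_closed by auto
  have "(t \<otimes> u) \<otimes> p i = (t \<otimes> u) \<otimes> q i" if i: "i \<in> insert j I" for i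
  proof (cases "i \<in> I")
    case True
    have "(t \<otimes> u) \<otimes> p i = u \<otimes> (t \<otimes> p i)" using c insert.prems(1)[OF i] by (simp add: m_ac)
    also have "\<dots> = (t \<otimes> u) \<otimes> q i" unfolding t(2)[OF True] using c insert.prems(2)[OF i] by (simp add: m_ac)
    finally show ?thesis .
  next
    case False
    then have ij: "i = j" using i by simp
    have "(t \<otimes> u) \<otimes> p j = t \<otimes> (u \<otimes> p j)" using c insert.prems(1)[of j] by (simp add: m_assoc)
    also have "\<dots> = (t \<otimes> u) \<otimes> q j" unfolding u(2) using c insert.prems(2)[of j] by (simp add: m_assoc)
    finally show ?thesis unfolding ij .
  qed
  then show ?case using mgen_mult[OF t(1) u(1)] by blast
qed

end

section \<open>Frames and near bases for algebras of constant rank\<close>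

lemma is_alg_hom: "is_alg A B \<phi> \<Longrightarrow> ring_hom_cring A B \<phi>"
  by (simp add: is_alg_def ring_hom_cring_def ring_hom_cring_axioms_def)

lemma fg_projective_framed:
  assumes "is_alg A B \<phi>" "fg_projective A (alg_module A B \<phi>)"
  obtains m x f where "framed_algebra A B \<phi> m x f"
proof -
  interpret ring_hom_cring A B \<phi> using assms(1) by (rule is_alg_hom)
  obtain m i p where i: "linear_map A (alg_module A B \<phi>) (free_module A m) i"
    and p: "linear_map A (free_module A m) (alg_module A B \<phi>) p"
    and pi: "\<And>b. b \<in> carrier B \<Longrightarrow> p (i b) = b"
    using assms(2) unfolding fg_projective_def by auto
  define E where "E j = (\<lambda>k\<in>{..<m}. if k = j then \<one>\<^bsub>A\<^esub> else \<zero>\<^bsub>A\<^esub>)" for j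
  have am: "b \<oplus>\<^bsub>alg_module A B \<phi>\<^esub> c = b \<oplus>\<^bsub>B\<^esub> c" for b c by (simp add: alg_module_def)
  have E: "E j \<in> carrier (free_module A m)" for j by (auto simp: E_def free_module_def)
  have ib: "i b \<in> {..<m} \<rightarrow>\<^sub>E carrier A" if "b \<in> carrier B" for b
    using i that by (auto simp: linear_map_def free_module_def)
  have ij: "i b j \<in> carrier A" if "b \<in> carrier B" "j < m" for b j
    using ib[OF that(1)] that(2) by auto
  have p_add: "p (v \<oplus>\<^bsub>free_module A m\<^esub> w) = p v \<oplus>\<^bsub>B\<^esub> p w" if "v \<in> carrier (free_module A m)" "w \<in> carrier (free_module A m)" for v w
    using p that by (auto simp: linear_map_def am)
  have p_smult: "p (a \<odot>\<^bsub>free_module A m\<^esub> v) = \<phi> a \<otimes>\<^bsub>B\<^esub> p v" if "a \<in> carrier A" "v \<in> carrier (free_module A m)" for a v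
    using p that by (auto simp: linear_map_def)
  have p_closed: "p v \<in> carrier B" if "v \<in> carrier (free_module A m)" for v
    using p that by (auto simp: linear_map_def)
  have "framed_algebra A B \<phi> m (\<lambda>j. p (E j)) (\<lambda>j b. i b j)"
  proof unfold_locales
    show "p (E j) \<in> carrier B" for j using p_closed E by simp
    show "functional A B \<phi> (\<lambda>b. i b j)" if "j < m" for j
      unfolding functional_def
    proof (intro conjI ballI)
      show "(\<lambda>b. i b j) \<in> carrier B \<rightarrow> carrier A" using ij that by auto
      show "i (b \<oplus>\<^bsub>B\<^esub> c) j = i b j \<oplus>\<^bsub>A\<^esub> i c j" if "b \<in> carrier B" "c \<in> carrier B" for b c
        using i that \<open>j < m\<close> by (simp add: linear_map_def am) (simp add: free_module_def)
      show "i (\<phi> a \<otimes>\<^bsub>B\<^esub> b) j = a \<otimes>\<^bsub>A\<^esub> i b j" if "a \<in> carrier A" "b \<in> carrier B" for a b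
        using i that \<open>j < m\<close> by (simp add: linear_map_def) (simp add: free_module_def)
    qed
    fix b assume b: "b \<in> carrier B"
    \<comment> \<open>\<open>v k\<close> keeps the first \<open>k\<close> coordinates of
      \<open>i b\<close>, so that linearity of \<open>p\<close> is used for one summand at a
      time.\<close>
    define v where "v k = (\<lambda>l\<in>{..<m}. if l < k then i b l else \<zero>\<^bsub>A\<^esub>)" for k
    have vC: "v k \<in> carrier (free_module A m)" for k using ij[OF b] by (auto simp: v_def free_module_def)
    have "p (v k) = (\<Oplus>\<^bsub>B\<^esub>j\<in>{..<k}. \<phi> (i b j) \<otimes>\<^bsub>B\<^esub> p (E j))" if "k \<le> m" for k
      using that
    proof (induction k)
      case 0
      \<comment> \<open>Compatibility with scalars is what \<open>linear_map\<close> offers, so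
        \<open>p (v 0) = 0\<close> is obtained by writing \<open>v 0\<close> as its own zero
        multiple.\<close>
      have "v 0 = \<zero>\<^bsub>A\<^esub> \<odot>\<^bsub>free_module A m\<^esub> v 0" by (auto simp: v_def free_module_def)
      then have "p (v 0) = \<phi> \<zero>\<^bsub>A\<^esub> \<otimes>\<^bsub>B\<^esub> p (v 0)" using p_smult[OF R.zero_closed vC] by metis
      then show ?case using p_closed[OF vC] by simp
    next
      case (Suc k)
      have "v (Suc k) = (i b k \<odot>\<^bsub>free_module A m\<^esub> E k) \<oplus>\<^bsub>free_module A m\<^esub> v k"
        using ij[OF b] Suc.prems by (auto simp: v_def free_module_def E_def less_Suc_eq intro!: restrict_ext)
      moreover have "i b k \<odot>\<^bsub>free_module A m\<^esub> E k \<in> carrier (free_module A m)"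
        using ij[OF b] Suc.prems by (auto simp: free_module_def E_def)
      ultimately have "p (v (Suc k)) = \<phi> (i b k) \<otimes>\<^bsub>B\<^esub> p (E k) \<oplus>\<^bsub>B\<^esub> p (v k)"
        using vC E ij[OF b, of k] Suc.prems by (simp add: p_add p_smult)
      also have "\<dots> = (\<Oplus>\<^bsub>B\<^esub>j\<in>insert k {..<k}. \<phi> (i b j) \<otimes>\<^bsub>B\<^esub> p (E j))"
        using Suc ij[OF b] p_closed[OF E] by (subst S.finsum_insert) auto
      finally show ?case by (simp add: lessThan_Suc)
    qed
    from this[of m] have "p (v m) = (\<Oplus>\<^bsub>B\<^esub>j\<in>{..<m}. \<phi> (i b j) \<otimes>\<^bsub>B\<^esub> p (E j))" by simp
    moreover have "v m = i b" using ib[OF b] by (auto simp: v_def fun_eq_iff PiE_def extensional_def)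
    ultimately show "(\<Oplus>\<^bsub>B\<^esub>j\<in>{..<m}. \<phi> (i b j) \<otimes>\<^bsub>B\<^esub> p (E j)) = b" using pi[OF b] by simp
  qed
  then show ?thesis using that by blast
qed

context framed_algebra
begin

text \<open>It is enough to expand the finitely many elements \<open>s x j\<close>. The functionals
  \<open>G i b = \<Sum> f j b * d i j\<close> extend these expansions linearly along the frame to
  all of \<open>B\<close>.\<close>

lemma functional_lift:
  fixes n :: nat
  assumes \<epsilon>: "\<And>i. i < n \<Longrightarrow> \<epsilon> i \<in> carrier B" and d: "\<And>i j. i < n \<Longrightarrow> j < m \<Longrightarrow> d i j \<in> carrier A"
    and s: "s \<in> carrier A"
    and X: "\<And>j. j < m \<Longrightarrow> (\<Oplus>\<^bsub>B\<^esub>i\<in>{..<n}. \<phi> (d i j) \<otimes>\<^bsub>B\<^esub> \<epsilon> i) = \<phi> s \<otimes>\<^bsub>B\<^esub> x j"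
  obtains G where "\<And>i. i < n \<Longrightarrow> functional A B \<phi> (G i)"
    "\<And>b. b \<in> carrier B \<Longrightarrow> (\<Oplus>\<^bsub>B\<^esub>i\<in>{..<n}. \<phi> (G i b) \<otimes>\<^bsub>B\<^esub> \<epsilon> i) = \<phi> s \<otimes>\<^bsub>B\<^esub> b"
proof
  define G where "G i b = (\<Oplus>j\<in>{..<m}. f j b \<otimes> d i j)" for i b
  show "functional A B \<phi> (G i)" if i: "i < n" for i
    unfolding functional_def
  proof (intro conjI ballI)
    show "G i \<in> carrier B \<rightarrow> carrier A" unfolding G_def using d i by (auto intro!: R.finsum_closed)
    fix y assume y: "y \<in> carrier B"
    show "G i (y \<oplus>\<^bsub>B\<^esub> z) = G i y \<oplus> G i z" if "z \<in> carrier B" for z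
      unfolding G_def by (rule trans[OF R.finsum_cong'[OF refl] R.finsum_addf]) (use y that d i in \<open>auto simp: R.l_distr\<close>)
    show "G i (\<phi> a \<otimes>\<^bsub>B\<^esub> y) = a \<otimes> G i y" if "a \<in> carrier A" for a
      unfolding G_def by (rule trans[OF R.finsum_cong'[OF refl] R.finsum_rdistr[symmetric]]) (use y that d i in \<open>auto simp: R.m_assoc\<close>)
  qed
  fix b assume b: "b \<in> carrier B"
  have "(\<Oplus>\<^bsub>B\<^esub>i\<in>{..<n}. \<phi> (G i b) \<otimes>\<^bsub>B\<^esub> \<epsilon> i) = (\<Oplus>\<^bsub>B\<^esub>i\<in>{..<n}. \<Oplus>\<^bsub>B\<^esub>j\<in>{..<m}. \<phi> (f j b) \<otimes>\<^bsub>B\<^esub> (\<phi> (d i j) \<otimes>\<^bsub>B\<^esub> \<epsilon> i))"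
  proof (rule S.finsum_cong'[OF refl])
    fix i assume "i \<in> {..<n}"
    then have i: "i < n" by simp
    have "\<phi> (G i b) = (\<Oplus>\<^bsub>B\<^esub>j\<in>{..<m}. \<phi> (f j b \<otimes> d i j))"
      unfolding G_def by (subst hom_finsum) (use b d i in \<open>auto simp: o_def\<close>)
    then have "\<phi> (G i b) \<otimes>\<^bsub>B\<^esub> \<epsilon> i = (\<Oplus>\<^bsub>B\<^esub>j\<in>{..<m}. \<phi> (f j b \<otimes> d i j) \<otimes>\<^bsub>B\<^esub> \<epsilon> i)"
      using S.finsum_ldistr[of "{..<m}" "\<epsilon> i" "\<lambda>j. \<phi> (f j b \<otimes> d i j)"] b d i \<epsilon> by auto
    also have "\<dots> = (\<Oplus>\<^bsub>B\<^esub>j\<in>{..<m}. \<phi> (f j b) \<otimes>\<^bsub>B\<^esub> (\<phi> (d i j) \<otimes>\<^bsub>B\<^esub> \<epsilon> i))"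
      by (rule S.finsum_cong'[OF refl]) (use b d i \<epsilon> in \<open>auto simp: S.m_assoc\<close>)
    finally show "\<phi> (G i b) \<otimes>\<^bsub>B\<^esub> \<epsilon> i = (\<Oplus>\<^bsub>B\<^esub>j\<in>{..<m}. \<phi> (f j b) \<otimes>\<^bsub>B\<^esub> (\<phi> (d i j) \<otimes>\<^bsub>B\<^esub> \<epsilon> i))" .
  qed (use b d \<epsilon> in \<open>auto intro!: S.finsum_closed\<close>)
  also have "\<dots> = (\<Oplus>\<^bsub>B\<^esub>j\<in>{..<m}. \<Oplus>\<^bsub>B\<^esub>i\<in>{..<n}. \<phi> (f j b) \<otimes>\<^bsub>B\<^esub> (\<phi> (d i j) \<otimes>\<^bsub>B\<^esub> \<epsilon> i))"
    by (rule S.finsum_finsum_swap) (use b d \<epsilon> in auto)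
  also have "\<dots> = (\<Oplus>\<^bsub>B\<^esub>j\<in>{..<m}. \<phi> s \<otimes>\<^bsub>B\<^esub> (\<phi> (f j b) \<otimes>\<^bsub>B\<^esub> x j))"
  proof (rule S.finsum_cong'[OF refl])
    fix j assume "j \<in> {..<m}"
    then have j: "j < m" by simp
    have "(\<Oplus>\<^bsub>B\<^esub>i\<in>{..<n}. \<phi> (f j b) \<otimes>\<^bsub>B\<^esub> (\<phi> (d i j) \<otimes>\<^bsub>B\<^esub> \<epsilon> i)) = \<phi> (f j b) \<otimes>\<^bsub>B\<^esub> (\<Oplus>\<^bsub>B\<^esub>i\<in>{..<n}. \<phi> (d i j) \<otimes>\<^bsub>B\<^esub> \<epsilon> i)"
      by (rule S.finsum_rdistr[symmetric]) (use b d \<epsilon> j in auto)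
    also have "\<dots> = \<phi> s \<otimes>\<^bsub>B\<^esub> (\<phi> (f j b) \<otimes>\<^bsub>B\<^esub> x j)"
      unfolding X[OF j] using b s j by (simp add: S.m_lcomm)
    finally show "(\<Oplus>\<^bsub>B\<^esub>i\<in>{..<n}. \<phi> (f j b) \<otimes>\<^bsub>B\<^esub> (\<phi> (d i j) \<otimes>\<^bsub>B\<^esub> \<epsilon> i)) = \<phi> s \<otimes>\<^bsub>B\<^esub> (\<phi> (f j b) \<otimes>\<^bsub>B\<^esub> x j)" .
  qed (use b s in auto)
  also have "\<dots> = \<phi> s \<otimes>\<^bsub>B\<^esub> (\<Oplus>\<^bsub>B\<^esub>j\<in>{..<m}. \<phi> (f j b) \<otimes>\<^bsub>B\<^esub> x j)"
    by (rule S.finsum_rdistr[symmetric]) (use b s in auto)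
  finally show "(\<Oplus>\<^bsub>B\<^esub>i\<in>{..<n}. \<phi> (G i b) \<otimes>\<^bsub>B\<^esub> \<epsilon> i) = \<phi> s \<otimes>\<^bsub>B\<^esub> b" using b by (simp add: frame_expand)
qed

text \<open>The expansion is already exact, but duality holds only after multiplication by
  \<open>u\<close>. Multiplying functionals and scalar alike by \<open>u\<close> repairs duality and
  keeps the expansion.\<close>

lemma near_basis_scale:
  fixes n :: nat
  assumes \<epsilon>: "\<And>i. i < n \<Longrightarrow> \<epsilon> i \<in> carrier B" and GF: "\<And>i. i < n \<Longrightarrow> functional A B \<phi> (G i)"
    and Gexp: "\<And>b. b \<in> carrier B \<Longrightarrow> (\<Oplus>\<^bsub>B\<^esub>i\<in>{..<n}. \<phi> (G i b) \<otimes>\<^bsub>B\<^esub> \<epsilon> i) = \<phi> s \<otimes>\<^bsub>B\<^esub> b"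
    and uA: "u \<in> carrier A" and sA: "s \<in> carrier A"
    and u: "\<And>i j. i < n \<Longrightarrow> j < n \<Longrightarrow> u \<otimes> G i (\<epsilon> j) = u \<otimes> (if i = j then s else \<zero>)"
  shows "near_basis n A B \<phi> (u \<otimes> s) \<epsilon> (\<lambda>i b. u \<otimes> G i b)"
  unfolding near_basis_def
proof (intro conjI allI impI ballI)
  show "u \<otimes> s \<in> carrier A" using uA sA by simp
  show "\<epsilon> i \<in> carrier B" if "i < n" for i using \<epsilon> that by simp
  show "functional A B \<phi> (\<lambda>b. u \<otimes> G i b)" if i: "i < n" for i
    unfolding functional_def using functionalD[OF GF[OF i]] uA by (auto simp: R.r_distr R.m_lcomm)
  show "(\<Oplus>\<^bsub>B\<^esub>i\<in>{..<n}. \<phi> (u \<otimes> G i b) \<otimes>\<^bsub>B\<^esub> \<epsilon> i) = \<phi> (u \<otimes> s) \<otimes>\<^bsub>B\<^esub> b" if b: "b \<in> carrier B" for b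
  proof -
    have "(\<Oplus>\<^bsub>B\<^esub>i\<in>{..<n}. \<phi> (u \<otimes> G i b) \<otimes>\<^bsub>B\<^esub> \<epsilon> i) = (\<Oplus>\<^bsub>B\<^esub>i\<in>{..<n}. \<phi> u \<otimes>\<^bsub>B\<^esub> (\<phi> (G i b) \<otimes>\<^bsub>B\<^esub> \<epsilon> i))"
      by (rule S.finsum_cong'[OF refl]) (use functionalD(1)[OF GF] b uA \<epsilon> in \<open>auto simp: S.m_assoc\<close>)
    also have "\<dots> = \<phi> u \<otimes>\<^bsub>B\<^esub> (\<Oplus>\<^bsub>B\<^esub>i\<in>{..<n}. \<phi> (G i b) \<otimes>\<^bsub>B\<^esub> \<epsilon> i)"
      by (rule S.finsum_rdistr[symmetric]) (use functionalD(1)[OF GF] b uA \<epsilon> in auto)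
    finally show ?thesis using b uA sA by (simp add: Gexp S.m_assoc)
  qed
  show "u \<otimes> G i (\<epsilon> j) = (if i = j then u \<otimes> s else \<zero>)" if "i < n" "j < n" for i j
    using u[OF that] uA by simp
qed

end

text \<open>A basis over a localization spreads out. Each finite family of relations costs one
  denominator from \<open>V\<close>: \<open>w\<close> clears the coordinates of the frame elements,
  \<open>t\<close> makes their expansions true in \<open>B\<close>, and \<open>u\<close> makes the
  duality relations true in \<open>A\<close>. The scalar of the near basis is the product of the
  three. For \<open>V\<close> the complement of a prime this passes from the stalk to a
  neighbourhood.\<close>

lemma (in framed_algebra) near_basis_from_stalk:
  assumes V: "V \<subseteq> carrier A" and e: "is_basis (loc A V) (alg_module (loc A V) (loc B (\<phi> ` V)) (loc_map B (\<phi> ` V) \<phi>)) n e"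
  shows "\<exists>s\<in>mgen A V. \<exists>e g. near_basis n A B \<phi> s e g"
proof -
  let ?AV = "loc A V" and ?BV = "loc B (\<phi> ` V)" and ?\<phi> = "loc_map B (\<phi> ` V) \<phi>"
  have V': "\<phi> ` V \<subseteq> carrier B" using V by auto
  interpret L: frame_hom A B \<phi> m x f ?AV ?BV ?\<phi> "\<lambda>j. frac B (\<phi> ` V) (x j) \<one>\<^bsub>B\<^esub>" "\<lambda>j. loc_functional (f j) V"
      "\<lambda>c. frac A V c \<one>" "\<lambda>b. frac B (\<phi> ` V) b \<one>\<^bsub>B\<^esub>"
    by (rule frame_hom_loc[OF V])
  let ?g = "L.cod.coord n e"
  note cl = R.mgen_closed[OF V]
  have eB: "e i \<in> carrier ?BV" if "i < n" for i using e that by (auto simp: is_basis_def)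
  note g = L.cod.coord_functional[OF e] and gexp = L.cod.coord_expand[OF e] and gdual = L.cod.coord_dual[OF e]
  note gD = functionalD[OF g]
  have "\<forall>i\<in>{..<n}. \<exists>b v. b \<in> carrier B \<and> v \<in> mgen A V \<and> e i = frac B (\<phi> ` V) b (\<phi> v)"
  proof
    fix i assume "i \<in> {..<n}"
    then have "e i \<in> carrier ?BV" using eB by simp
    then obtain b v where "b \<in> carrier B" "v \<in> mgen A V" "e i = frac B (\<phi> ` V) b (\<phi> v)" by (rule loc_imageE[OF V])
    then show "\<exists>b v. b \<in> carrier B \<and> v \<in> mgen A V \<and> e i = frac B (\<phi> ` V) b (\<phi> v)" by blast
  qed
  then obtain \<epsilon> v where \<epsilon>: "\<And>i. i < n \<Longrightarrow> \<epsilon> i \<in> carrier B" and v: "\<And>i. i < n \<Longrightarrow> v i \<in> mgen A V"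
    and ev: "\<And>i. i < n \<Longrightarrow> e i = frac B (\<phi> ` V) (\<epsilon> i) (\<phi> (v i))" by (metis lessThan_iff)
  let ?\<epsilon> = "\<lambda>i. frac B (\<phi> ` V) (\<epsilon> i) \<one>\<^bsub>B\<^esub>"
  have \<epsilon>e: "?\<epsilon> i = ?\<phi> (frac A V (v i) \<one>) \<otimes>\<^bsub>?BV\<^esub> e i" if i: "i < n" for i
  proof -
    have vi: "v i \<in> carrier A" using v[OF i] cl by simp
    have "e i \<otimes>\<^bsub>?BV\<^esub> frac B (\<phi> ` V) (\<phi> (v i)) \<one>\<^bsub>B\<^esub> = ?\<epsilon> i"
      unfolding ev[OF i] by (rule S.frac_mult_denom[OF V' \<epsilon>[OF i] hom_mem_mgen[OF V v[OF i]]])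
    moreover have "?\<phi> (frac A V (v i) \<one>) = frac B (\<phi> ` V) (\<phi> (v i)) \<one>\<^bsub>B\<^esub>"
      using loc_map_image_frac[OF V vi R.mgen_one] by simp
    ultimately show ?thesis using L.cod.S.m_comm[OF eB[OF i], of "frac B (\<phi> ` V) (\<phi> (v i)) \<one>\<^bsub>B\<^esub>"] vi by (simp add: S.frac_closed)
  qed
  \<comment> \<open>The numerators \<open>\<epsilon> i\<close> are the basis elements times the
    units \<open>v i\<close>. They form another basis, now in the image of \<open>B\<close>;
    multiplying the coordinate functionals by the inverses \<open>c i\<close> gives its dual basis
    \<open>h i\<close>.\<close>
  define c where "c i = frac A V \<one> (v i)" for i
  have c: "c i \<in> carrier ?AV" "c i \<otimes>\<^bsub>?AV\<^esub> frac A V (v i) \<one> = \<one>\<^bsub>?AV\<^esub>" if "i < n" for i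
    unfolding c_def using R.frac_denom_unit[OF V v[OF that]] v[OF that] by auto
  define h where "h i b = c i \<otimes>\<^bsub>?AV\<^esub> ?g i b" for i b
  have hF: "functional ?AV ?BV ?\<phi> (h i)" if "i < n" for i
    unfolding functional_def h_def using gD[OF that] c[OF that]
    by (auto simp: L.cod.R.r_distr L.cod.R.m_lcomm)
  have h\<epsilon>: "h i (?\<epsilon> j) = (if i = j then \<one>\<^bsub>?AV\<^esub> else \<zero>\<^bsub>?AV\<^esub>)" if ij: "i < n" "j < n" for i j
  proof -
    have vj: "v j \<in> carrier A" using v[OF ij(2)] cl by simp
    have "?g i (?\<epsilon> j) = frac A V (v j) \<one> \<otimes>\<^bsub>?AV\<^esub> (if i = j then \<one>\<^bsub>?AV\<^esub> else \<zero>\<^bsub>?AV\<^esub>)"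
      unfolding \<epsilon>e[OF ij(2)] using gD(3)[OF ij(1) _ eB[OF ij(2)], of "frac A V (v j) \<one>"] gdual[OF ij] vj by (simp add: R.frac_closed)
    then show ?thesis unfolding h_def using c[OF ij(1)] vj by (auto simp: R.frac_closed)
  qed
  have hexp: "(\<Oplus>\<^bsub>?BV\<^esub>i\<in>{..<n}. ?\<phi> (h i b) \<otimes>\<^bsub>?BV\<^esub> ?\<epsilon> i) = b" if b: "b \<in> carrier ?BV" for b
  proof -
    have "(\<Oplus>\<^bsub>?BV\<^esub>i\<in>{..<n}. ?\<phi> (h i b) \<otimes>\<^bsub>?BV\<^esub> ?\<epsilon> i) = (\<Oplus>\<^bsub>?BV\<^esub>i\<in>{..<n}. ?\<phi> (?g i b) \<otimes>\<^bsub>?BV\<^esub> e i)"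
    proof (rule L.cod.S.finsum_cong'[OF refl])
      fix i assume "i \<in> {..<n}"
      then have i: "i < n" by simp
      let ?v = "frac A V (v i) \<one>"
      have vc: "?v \<in> carrier ?AV" using cl[OF v[OF i]] by auto
      have "?\<phi> (h i b) \<otimes>\<^bsub>?BV\<^esub> ?\<epsilon> i = ?\<phi> (c i \<otimes>\<^bsub>?AV\<^esub> ?v) \<otimes>\<^bsub>?BV\<^esub> (?\<phi> (?g i b) \<otimes>\<^bsub>?BV\<^esub> e i)"
        unfolding \<epsilon>e[OF i] h_def using c(1)[OF i] vc gD(1)[OF i b] eB[OF i] by (simp add: L.cod.S.m_ac)
      then show "?\<phi> (h i b) \<otimes>\<^bsub>?BV\<^esub> ?\<epsilon> i = ?\<phi> (?g i b) \<otimes>\<^bsub>?BV\<^esub> e i"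
        using c(2)[OF i] gD(1)[OF i b] eB[OF i] by simp
    qed (use gD b eB in auto)
    then show ?thesis using gexp[OF b] by simp
  qed
  note hD = functionalD[OF hF]
  obtain w where w: "w \<in> mgen A V" "\<And>i j. i < n \<Longrightarrow> j < m \<Longrightarrow> \<exists>d\<in>carrier A. h i (frac B (\<phi> ` V) (x j) \<one>\<^bsub>B\<^esub>) \<otimes>\<^bsub>?AV\<^esub> frac A V w \<one> = frac A V d \<one>"
  proof -
    have "\<exists>w\<in>mgen A V. \<forall>k\<in>{..<n} \<times> {..<m}. \<exists>d\<in>carrier A. h (fst k) (frac B (\<phi> ` V) (x (snd k)) \<one>\<^bsub>B\<^esub>) \<otimes>\<^bsub>?AV\<^esub> frac A V w \<one> = frac A V d \<one>"
      by (rule R.common_denominator[OF V]) (auto intro!: hD(1))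
    then show ?thesis using that by fastforce
  qed
  then obtain d where d: "\<And>i j. i < n \<Longrightarrow> j < m \<Longrightarrow> d i j \<in> carrier A"
    "\<And>i j. i < n \<Longrightarrow> j < m \<Longrightarrow> h i (frac B (\<phi> ` V) (x j) \<one>\<^bsub>B\<^esub>) \<otimes>\<^bsub>?AV\<^esub> frac A V w \<one> = frac A V (d i j) \<one>" by metis
  have wA: "w \<in> carrier A" using w cl by simp
  define X where "X j = (\<Oplus>\<^bsub>B\<^esub>i\<in>{..<n}. \<phi> (d i j) \<otimes>\<^bsub>B\<^esub> \<epsilon> i)" for j
  have XB: "X j \<in> carrier B" if "j < m" for j unfolding X_def using d \<epsilon> that by (auto intro!: S.finsum_closed)
  have Xw: "frac B (\<phi> ` V) (X j) \<one>\<^bsub>B\<^esub> = frac B (\<phi> ` V) (\<phi> w \<otimes>\<^bsub>B\<^esub> x j) \<one>\<^bsub>B\<^esub>" if j: "j < m" for j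
  proof -
    let ?x = "frac B (\<phi> ` V) (x j) \<one>\<^bsub>B\<^esub>" and ?w = "frac A V w \<one>"
    have xc: "?x \<in> carrier ?BV" and wc: "?w \<in> carrier ?AV" using j wA by auto
    have \<phi>f: "?\<phi> (frac A V a \<one>) = frac B (\<phi> ` V) (\<phi> a) \<one>\<^bsub>B\<^esub>" if "a \<in> carrier A" for a
      using loc_map_image_frac[OF V that R.mgen_one] by simp
    have "frac B (\<phi> ` V) (X j) \<one>\<^bsub>B\<^esub> = (\<Oplus>\<^bsub>?BV\<^esub>i\<in>{..<n}. frac B (\<phi> ` V) (\<phi> (d i j) \<otimes>\<^bsub>B\<^esub> \<epsilon> i) \<one>\<^bsub>B\<^esub>)"
      unfolding X_def by (subst L.top.hom_finsum) (use d \<epsilon> j in \<open>auto simp: o_def\<close>)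
    also have "\<dots> = (\<Oplus>\<^bsub>?BV\<^esub>i\<in>{..<n}. ?\<phi> ?w \<otimes>\<^bsub>?BV\<^esub> (?\<phi> (h i ?x) \<otimes>\<^bsub>?BV\<^esub> ?\<epsilon> i))"
    proof (rule L.cod.S.finsum_cong'[OF refl])
      fix i assume "i \<in> {..<n}"
      then have i: "i < n" by simp
      have \<epsilon>c: "?\<epsilon> i \<in> carrier ?BV" using \<epsilon>[OF i] by auto
      have "frac B (\<phi> ` V) (\<phi> (d i j) \<otimes>\<^bsub>B\<^esub> \<epsilon> i) \<one>\<^bsub>B\<^esub> = ?\<phi> (frac A V (d i j) \<one>) \<otimes>\<^bsub>?BV\<^esub> ?\<epsilon> i"
        using L.top.hom_mult[of "\<phi> (d i j)" "\<epsilon> i"] d(1)[OF i j] \<epsilon>[OF i] by (simp add: \<phi>f)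
      also have "\<dots> = ?\<phi> (h i ?x \<otimes>\<^bsub>?AV\<^esub> ?w) \<otimes>\<^bsub>?BV\<^esub> ?\<epsilon> i" using d(2)[OF i j] by simp
      also have "\<dots> = ?\<phi> ?w \<otimes>\<^bsub>?BV\<^esub> (?\<phi> (h i ?x) \<otimes>\<^bsub>?BV\<^esub> ?\<epsilon> i)"
        using wc xc hD(1)[OF i xc] \<epsilon>c L.cod.hom_closed[OF wc] L.cod.hom_closed[OF hD(1)[OF i xc]]
        by (simp only: L.cod.hom_mult L.cod.S.m_ac L.cod.S.m_closed)
      finally show "frac B (\<phi> ` V) (\<phi> (d i j) \<otimes>\<^bsub>B\<^esub> \<epsilon> i) \<one>\<^bsub>B\<^esub> = ?\<phi> ?w \<otimes>\<^bsub>?BV\<^esub> (?\<phi> (h i ?x) \<otimes>\<^bsub>?BV\<^esub> ?\<epsilon> i)" .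
    qed (use wc xc hD(1) \<epsilon> in \<open>auto intro!: L.cod.S.m_closed L.cod.hom_closed\<close>)
    also have "\<dots> = ?\<phi> ?w \<otimes>\<^bsub>?BV\<^esub> (\<Oplus>\<^bsub>?BV\<^esub>i\<in>{..<n}. ?\<phi> (h i ?x) \<otimes>\<^bsub>?BV\<^esub> ?\<epsilon> i)"
      by (rule L.cod.S.finsum_rdistr[symmetric]) (use wc xc hD(1) \<epsilon> in \<open>auto intro!: L.cod.S.m_closed L.cod.hom_closed\<close>)
    also have "\<dots> = ?\<phi> ?w \<otimes>\<^bsub>?BV\<^esub> ?x" using hexp[OF xc] by simp
    also have "\<dots> = frac B (\<phi> ` V) (\<phi> w \<otimes>\<^bsub>B\<^esub> x j) \<one>\<^bsub>B\<^esub>"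
      using L.top.hom_mult[of "\<phi> w" "x j"] wA j by (simp add: \<phi>f)
    finally show ?thesis .
  qed
  have "\<exists>t\<in>mgen B (\<phi> ` V). \<forall>j\<in>{..<m}. t \<otimes>\<^bsub>B\<^esub> X j = t \<otimes>\<^bsub>B\<^esub> (\<phi> w \<otimes>\<^bsub>B\<^esub> x j)"
    by (rule S.common_annihilator[OF V']) (use XB Xw wA in auto)
  then obtain t where t: "t \<in> mgen A V" "\<And>j. j < m \<Longrightarrow> \<phi> t \<otimes>\<^bsub>B\<^esub> X j = \<phi> t \<otimes>\<^bsub>B\<^esub> (\<phi> w \<otimes>\<^bsub>B\<^esub> x j)"
    by (auto simp: mgen_image[OF V])
  have tA: "t \<in> carrier A" using t cl by simp
  let ?s = "t \<otimes> w"
  have sA: "?s \<in> carrier A" using tA wA by simp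
  have tdA: "t \<otimes> d i j \<in> carrier A" if "i < n" "j < m" for i j using d(1)[OF that] tA by simp
  have X': "(\<Oplus>\<^bsub>B\<^esub>i\<in>{..<n}. \<phi> (t \<otimes> d i j) \<otimes>\<^bsub>B\<^esub> \<epsilon> i) = \<phi> ?s \<otimes>\<^bsub>B\<^esub> x j" if j: "j < m" for j
  proof -
    have dB: "\<phi> (d i j) \<in> carrier B" "d i j \<in> carrier A" if "i < n" for i using d(1)[OF that j] by simp_all
    have tB: "\<phi> t \<in> carrier B" using tA by simp
    have "(\<Oplus>\<^bsub>B\<^esub>i\<in>{..<n}. \<phi> (t \<otimes> d i j) \<otimes>\<^bsub>B\<^esub> \<epsilon> i) = (\<Oplus>\<^bsub>B\<^esub>i\<in>{..<n}. \<phi> t \<otimes>\<^bsub>B\<^esub> (\<phi> (d i j) \<otimes>\<^bsub>B\<^esub> \<epsilon> i))"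
      by (rule S.finsum_cong'[OF refl]) (use dB tB tA \<epsilon> in \<open>auto simp: S.m_assoc\<close>)
    also have "\<dots> = \<phi> t \<otimes>\<^bsub>B\<^esub> X j"
      unfolding X_def by (rule S.finsum_rdistr[symmetric]) (use dB tB \<epsilon> in auto)
    finally show ?thesis using tB wA tA j by (simp add: t(2)[OF j] S.m_assoc)
  qed
  obtain G where GF: "\<And>i. i < n \<Longrightarrow> functional A B \<phi> (G i)"
    and Gexp: "\<And>b. b \<in> carrier B \<Longrightarrow> (\<Oplus>\<^bsub>B\<^esub>i\<in>{..<n}. \<phi> (G i b) \<otimes>\<^bsub>B\<^esub> \<epsilon> i) = \<phi> ?s \<otimes>\<^bsub>B\<^esub> b"
  proof (rule functional_lift[of n \<epsilon> "\<lambda>i j. t \<otimes> d i j" ?s])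
    show "\<epsilon> i \<in> carrier B" if "i < n" for i by (rule \<epsilon>[OF that])
    show "t \<otimes> d i j \<in> carrier A" if "i < n" "j < m" for i j by (rule tdA[OF that])
    show "?s \<in> carrier A" by (rule sA)
    show "(\<Oplus>\<^bsub>B\<^esub>i\<in>{..<n}. \<phi> (t \<otimes> d i j) \<otimes>\<^bsub>B\<^esub> \<epsilon> i) = \<phi> ?s \<otimes>\<^bsub>B\<^esub> x j" if "j < m" for j by (rule X'[OF that])
  qed (rule that)
  have Gdual: "frac A V (G i (\<epsilon> j)) \<one> = frac A V (if i = j then ?s else \<zero>) \<one>" if ij: "i < n" "j < n" for i j
  proof -
    have GA: "\<And>k. k < n \<Longrightarrow> G k (\<epsilon> j) \<in> carrier A" using functionalD(1)[OF GF] \<epsilon>[OF ij(2)] by simp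
    have \<phi>f: "?\<phi> (frac A V a \<one>) = frac B (\<phi> ` V) (\<phi> a) \<one>\<^bsub>B\<^esub>" if "a \<in> carrier A" for a
      using loc_map_image_frac[OF V that R.mgen_one] by simp
    have fc: "frac A V a \<one> \<in> carrier ?AV" if "a \<in> carrier A" for a using that by auto
    have \<epsilon>c: "\<And>k. k < n \<Longrightarrow> ?\<epsilon> k \<in> carrier ?BV" using \<epsilon> by auto
    have "?\<phi> (frac A V ?s \<one>) \<otimes>\<^bsub>?BV\<^esub> ?\<epsilon> j = frac B (\<phi> ` V) (\<phi> ?s \<otimes>\<^bsub>B\<^esub> \<epsilon> j) \<one>\<^bsub>B\<^esub>"
      unfolding \<phi>f[OF sA] by (rule L.top.hom_mult[symmetric]) (use sA \<epsilon> ij in auto)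
    also have "\<dots> = frac B (\<phi> ` V) (\<Oplus>\<^bsub>B\<^esub>k\<in>{..<n}. \<phi> (G k (\<epsilon> j)) \<otimes>\<^bsub>B\<^esub> \<epsilon> k) \<one>\<^bsub>B\<^esub>" using Gexp[OF \<epsilon>[OF ij(2)]] by simp
    also have "\<dots> = (\<Oplus>\<^bsub>?BV\<^esub>k\<in>{..<n}. frac B (\<phi> ` V) (\<phi> (G k (\<epsilon> j)) \<otimes>\<^bsub>B\<^esub> \<epsilon> k) \<one>\<^bsub>B\<^esub>)"
      by (subst L.top.hom_finsum) (use GA \<epsilon> in \<open>auto simp: o_def\<close>)
    also have "\<dots> = (\<Oplus>\<^bsub>?BV\<^esub>k\<in>{..<n}. ?\<phi> (frac A V (G k (\<epsilon> j)) \<one>) \<otimes>\<^bsub>?BV\<^esub> ?\<epsilon> k)"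
    proof (rule L.cod.S.finsum_cong'[OF refl])
      fix k assume k: "k \<in> {..<n}"
      show "frac B (\<phi> ` V) (\<phi> (G k (\<epsilon> j)) \<otimes>\<^bsub>B\<^esub> \<epsilon> k) \<one>\<^bsub>B\<^esub> = ?\<phi> (frac A V (G k (\<epsilon> j)) \<one>) \<otimes>\<^bsub>?BV\<^esub> ?\<epsilon> k"
        using L.top.hom_mult[of "\<phi> (G k (\<epsilon> j))" "\<epsilon> k"] GA \<epsilon> k by (simp add: \<phi>f)
    qed (use GA \<epsilon>c fc in \<open>auto intro!: L.cod.S.m_closed L.cod.hom_closed\<close>)
    finally have eq: "?\<phi> (frac A V ?s \<one>) \<otimes>\<^bsub>?BV\<^esub> ?\<epsilon> j = (\<Oplus>\<^bsub>?BV\<^esub>k\<in>{..<n}. ?\<phi> (frac A V (G k (\<epsilon> j)) \<one>) \<otimes>\<^bsub>?BV\<^esub> ?\<epsilon> k)" .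
    have "frac A V ?s \<one> \<otimes>\<^bsub>?AV\<^esub> (if i = j then \<one>\<^bsub>?AV\<^esub> else \<zero>\<^bsub>?AV\<^esub>) = h i (?\<phi> (frac A V ?s \<one>) \<otimes>\<^bsub>?BV\<^esub> ?\<epsilon> j)"
      using hD(3)[OF ij(1) fc[OF sA] \<epsilon>c[OF ij(2)]] h\<epsilon>[OF ij] by simp
    also have "\<dots> = h i (\<Oplus>\<^bsub>?BV\<^esub>k\<in>{..<n}. ?\<phi> (frac A V (G k (\<epsilon> j)) \<one>) \<otimes>\<^bsub>?BV\<^esub> ?\<epsilon> k)" by (simp only: eq)
    also have "h i (\<Oplus>\<^bsub>?BV\<^esub>k\<in>{..<n}. ?\<phi> (frac A V (G k (\<epsilon> j)) \<one>) \<otimes>\<^bsub>?BV\<^esub> ?\<epsilon> k)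
      = (\<Oplus>\<^bsub>?AV\<^esub>k\<in>{..<n}. h i (?\<phi> (frac A V (G k (\<epsilon> j)) \<one>) \<otimes>\<^bsub>?BV\<^esub> ?\<epsilon> k))"
      by (rule L.cod.functional_finsum[OF hF[OF ij(1)]]) (use GA \<epsilon>c fc in \<open>auto intro!: L.cod.S.m_closed L.cod.hom_closed\<close>)
    also have "\<dots> = (\<Oplus>\<^bsub>?AV\<^esub>k\<in>{..<n}. if i = k then frac A V (G k (\<epsilon> j)) \<one> else \<zero>\<^bsub>?AV\<^esub>)"
    proof (rule L.cod.R.finsum_cong'[OF refl])
      fix k assume "k \<in> {..<n}"
      then have k: "k < n" by simp
      have "h i (?\<phi> (frac A V (G k (\<epsilon> j)) \<one>) \<otimes>\<^bsub>?BV\<^esub> ?\<epsilon> k) = frac A V (G k (\<epsilon> j)) \<one> \<otimes>\<^bsub>?AV\<^esub> (if i = k then \<one>\<^bsub>?AV\<^esub> else \<zero>\<^bsub>?AV\<^esub>)"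
        using hD(3)[OF ij(1) fc[OF GA[OF k]] \<epsilon>c[OF k]] h\<epsilon>[OF ij(1) k] by simp
      then show "h i (?\<phi> (frac A V (G k (\<epsilon> j)) \<one>) \<otimes>\<^bsub>?BV\<^esub> ?\<epsilon> k) = (if i = k then frac A V (G k (\<epsilon> j)) \<one> else \<zero>\<^bsub>?AV\<^esub>)"
        using fc[OF GA[OF k]] by simp
    qed (use GA fc in auto)
    also have "\<dots> = frac A V (G i (\<epsilon> j)) \<one>"
      by (rule L.cod.R.add.finprod_singleton) (use GA fc ij in auto)
    finally have "frac A V (G i (\<epsilon> j)) \<one> = frac A V ?s \<one> \<otimes>\<^bsub>?AV\<^esub> (if i = j then \<one>\<^bsub>?AV\<^esub> else \<zero>\<^bsub>?AV\<^esub>)" by (rule sym)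
    then show ?thesis using fc[OF sA] by simp
  qed
  have "\<exists>u\<in>mgen A V. \<forall>k\<in>{..<n} \<times> {..<n}. u \<otimes> G (fst k) (\<epsilon> (snd k)) = u \<otimes> (if fst k = snd k then ?s else \<zero>)"
    by (rule R.common_annihilator[OF V]) (use Gdual functionalD(1)[OF GF] \<epsilon> sA in auto)
  then obtain u where u: "u \<in> mgen A V" "\<And>i j. i < n \<Longrightarrow> j < n \<Longrightarrow> u \<otimes> G i (\<epsilon> j) = u \<otimes> (if i = j then ?s else \<zero>)" by fastforce
  have uA: "u \<in> carrier A" using u cl by simp
  have "near_basis n A B \<phi> (u \<otimes> ?s) \<epsilon> (\<lambda>i b. u \<otimes> G i b)"
    by (rule near_basis_scale[OF \<epsilon> GF Gexp uA sA u(2)])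
  moreover have "u \<otimes> ?s \<in> mgen A V" using u t w R.mgen_mult by auto
  ultimately show ?thesis by blast
qed

lemma rank_algebra_framed:
  assumes "rank_algebra n A B \<phi>"
  obtains m x f where "framed_algebra A B \<phi> m x f" "loc_free n A B \<phi>"
proof -
  have alg: "is_alg A B \<phi>" "fg_projective A (alg_module A B \<phi>)" using assms by (auto simp: rank_algebra_def)
  obtain m x f where fr: "framed_algebra A B \<phi> m x f" by (rule fg_projective_framed[OF alg])
  interpret framed_algebra A B \<phi> m x f by (rule fr)
  have "loc_free n A B \<phi>"
    unfolding loc_free_def
  proof (intro allI impI)
    fix P assume P: "primeideal P A"
    interpret P: primeideal P A by (rule P)
    let ?V = "carrier A - P"
    obtain e where e: "is_basis (loc A ?V) (alg_module (loc A ?V) (loc B (\<phi> ` ?V)) (loc_map B (\<phi> ` ?V) \<phi>)) n e"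
      using assms P unfolding rank_algebra_def Let_def by blast
    obtain s e g where s: "s \<in> mgen A ?V" and nb: "near_basis n A B \<phi> s e g"
      using near_basis_from_stalk[OF _ e] by auto
    have "s \<notin> P" using R.mgen_disjoint_prime[OF P, of ?V] s by auto
    then show "\<exists>s e g. s \<notin> P \<and> near_basis n A B \<phi> s e g" using nb by blast
  qed
  then show ?thesis using that fr by blast
qed

section \<open>Polynomial extensions\<close>

lemma (in ring) UP_mem_iff: "p \<in> carrier (UP R) \<longleftrightarrow> (\<forall>i. p i \<in> carrier R) \<and> (\<exists>n. \<forall>i>n. p i = \<zero>)"
  by (auto simp: UP_def up_def bound_def)

lemma (in ring) UP_coeff: "p \<in> carrier (UP R) \<Longrightarrow> coeff (UP R) p i = p i"
  by (simp add: UP_def)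

lemma (in ring) UP_mult_apply:
  "p \<in> carrier (UP R) \<Longrightarrow> q \<in> carrier (UP R) \<Longrightarrow> (p \<otimes>\<^bsub>UP R\<^esub> q) i = (\<Oplus>j\<in>{..i}. p j \<otimes> q (i - j))"
  by (simp add: UP_def)

lemma (in ring) UP_add_apply:
  "p \<in> carrier (UP R) \<Longrightarrow> q \<in> carrier (UP R) \<Longrightarrow> (p \<oplus>\<^bsub>UP R\<^esub> q) i = p i \<oplus> q i"
  by (simp add: UP_def)

lemma (in ring) UP_monom_apply: "a \<in> carrier R \<Longrightarrow> monom (UP R) a n i = (if i = n then a else \<zero>)"
  by (auto simp: UP_def)

lemma (in ring) UP_zero_apply: "\<zero>\<^bsub>UP R\<^esub> i = \<zero>"
  by (simp add: UP_def)

lemma (in ring) UP_one_apply: "\<one>\<^bsub>UP R\<^esub> i = (if i = 0 then \<one> else \<zero>)"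
  by (simp add: UP_def)

context cring
begin

lemma UP_cring_axiom: "UP_cring R"
  by unfold_locales

lemma cring_UP: "cring (UP R)"
  by (rule UP_cring.UP_cring[OF UP_cring_axiom])

lemma UP_monom_closed [simp]: "a \<in> carrier R \<Longrightarrow> monom (UP R) a n \<in> carrier (UP R)"
  by (rule UP_ring.monom_closed) (unfold_locales)

lemma UP_apply_closed [simp]: "p \<in> carrier (UP R) \<Longrightarrow> p i \<in> carrier R"
  by (simp add: UP_mem_iff)

lemma UP_finsum_apply:
  assumes "finite I" "F \<in> I \<rightarrow> carrier (UP R)"
  shows "finsum (UP R) F I i = (\<Oplus>j\<in>I. F j i)"
proof -
  interpret P: cring "UP R" by (rule cring_UP)
  show ?thesis using assms
  proof (induction I)
    case empty
    then show ?case by (simp add: UP_zero_apply)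
  next
    case (insert j I)
    then show ?case by (simp add: UP_add_apply Pi_iff P.finsum_closed)
  qed
qed

lemma UP_monom0_mult_apply:
  assumes "c \<in> carrier R" "p \<in> carrier (UP R)"
  shows "(p \<otimes>\<^bsub>UP R\<^esub> monom (UP R) c 0) i = p i \<otimes> c"
proof -
  interpret P: cring "UP R" by (rule cring_UP)
  interpret UP: UP_cring R "UP R" by (simp_all add: UP_cring_axiom)
  have "p \<otimes>\<^bsub>UP R\<^esub> monom (UP R) c 0 = c \<odot>\<^bsub>UP R\<^esub> p"
    using P.m_comm[OF assms(2) UP_monom_closed[OF assms(1)]] UP.monom_mult_is_smult[OF assms] by simp
  then show ?thesis using assms UP.coeff_smult[of c p i] by (simp add: UP_coeff m_comm)
qed

lemma UP_monom_mult_apply: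
  assumes "p \<in> carrier (UP R)"
  shows "(p \<otimes>\<^bsub>UP R\<^esub> monom (UP R) \<one> k) (i + k) = p i" "j < k \<Longrightarrow> (p \<otimes>\<^bsub>UP R\<^esub> monom (UP R) \<one> k) j = \<zero>"
proof -
  interpret P: cring "UP R" by (rule cring_UP)
  have "p \<otimes>\<^bsub>UP R\<^esub> monom (UP R) \<one> k = monom (UP R) \<one> k \<otimes>\<^bsub>UP R\<^esub> p"
    using assms by (simp add: P.m_comm)
  note eq = this
  have "(monom (UP R) \<one> k \<otimes>\<^bsub>UP R\<^esub> p) (i + k) = (\<Oplus>j\<in>{..i + k}. if k = j then p (i + k - j) else \<zero>)"
    unfolding UP_mult_apply[OF UP_monom_closed[OF one_closed] assms]
    by (rule finsum_cong') (use assms in \<open>auto simp: UP_monom_apply\<close>)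
  also have "\<dots> = p i" by (subst add.finprod_singleton) (use assms in auto)
  finally show "(p \<otimes>\<^bsub>UP R\<^esub> monom (UP R) \<one> k) (i + k) = p i" unfolding eq .
  show "(p \<otimes>\<^bsub>UP R\<^esub> monom (UP R) \<one> k) j = \<zero>" if "j < k"
  proof -
    have "(monom (UP R) \<one> k \<otimes>\<^bsub>UP R\<^esub> p) j = (\<Oplus>l\<in>{..j}. \<zero>)"
      unfolding UP_mult_apply[OF UP_monom_closed[OF one_closed] assms]
      by (rule finsum_cong') (use assms that in \<open>auto simp: UP_monom_apply\<close>)
    then show ?thesis unfolding eq by simp
  qed
qed

lemma UP_const_hom: "ring_hom_cring R (UP R) (\<lambda>a. monom (UP R) a 0)"
  using UP_ring.const_ring_hom[OF UP_ring.intro[OF ring_axioms]] cring_axioms cring_UP by (simp add: ring_hom_cring_def ring_hom_cring_axioms_def)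

text \<open>Multiplication by the variable shifts coefficients and is therefore injective over any
  coefficient ring. This is the supply of cancellable scalars on which the identities for
  \<open>K\<close> depend.\<close>

lemma UP_var_cancel:
  assumes "p \<in> carrier (UP R)" "q \<in> carrier (UP R)"
    and "monom (UP R) \<one> 1 \<otimes>\<^bsub>UP R\<^esub> p = monom (UP R) \<one> 1 \<otimes>\<^bsub>UP R\<^esub> q"
  shows "p = q"
proof
  fix i
  interpret P: cring "UP R" by (rule cring_UP)
  have "p \<otimes>\<^bsub>UP R\<^esub> monom (UP R) \<one> 1 = q \<otimes>\<^bsub>UP R\<^esub> monom (UP R) \<one> 1"
    using assms by (simp add: P.m_comm)
  then show "p i = q i" using UP_monom_mult_apply(1)[of _ 1 i] assms by metis
qed

end

context ring_hom_cring
begin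

abbreviation "UP_map \<equiv> (\<lambda>p i. h (p i))"

lemma UP_map_closed: "p \<in> carrier (UP R) \<Longrightarrow> UP_map p \<in> carrier (UP S)"
  by (fastforce simp: R.UP_mem_iff S.UP_mem_iff)

lemma UP_map_hom: "ring_hom_cring (UP R) (UP S) UP_map"
proof -
  have "UP_map \<in> ring_hom (UP R) (UP S)"
  proof (rule ring_hom_memI)
    fix p q assume p: "p \<in> carrier (UP R)" and q: "q \<in> carrier (UP R)"
    show "UP_map p \<in> carrier (UP S)" using p by (rule UP_map_closed)
    show "UP_map (p \<oplus>\<^bsub>UP R\<^esub> q) = UP_map p \<oplus>\<^bsub>UP S\<^esub> UP_map q"
      using p q by (auto simp: fun_eq_iff R.UP_add_apply S.UP_add_apply UP_map_closed)
    show "UP_map (p \<otimes>\<^bsub>UP R\<^esub> q) = UP_map p \<otimes>\<^bsub>UP S\<^esub> UP_map q"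
    proof
      fix i
      have "h (\<Oplus>\<^bsub>R\<^esub>j\<in>{..i}. p j \<otimes>\<^bsub>R\<^esub> q (i - j)) = (\<Oplus>\<^bsub>S\<^esub>j\<in>{..i}. h (p j \<otimes>\<^bsub>R\<^esub> q (i - j)))"
        using p q by (subst hom_finsum) (auto simp: o_def)
      also have "\<dots> = (\<Oplus>\<^bsub>S\<^esub>j\<in>{..i}. h (p j) \<otimes>\<^bsub>S\<^esub> h (q (i - j)))"
        by (rule S.finsum_cong') (use p q in auto)
      finally show "h ((p \<otimes>\<^bsub>UP R\<^esub> q) i) = (UP_map p \<otimes>\<^bsub>UP S\<^esub> UP_map q) i"
        using p q by (simp add: R.UP_mult_apply S.UP_mult_apply UP_map_closed)
    qed
  qed (auto simp: fun_eq_iff R.UP_one_apply S.UP_one_apply)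
  then show ?thesis using R.cring_UP S.cring_UP by (simp add: ring_hom_cring_def ring_hom_cring_axioms_def)
qed

lemma UP_map_monom: "a \<in> carrier R \<Longrightarrow> UP_map (monom (UP R) a n) = monom (UP S) (h a) n"
  by (auto simp: fun_eq_iff R.UP_monom_apply S.UP_monom_apply)

lemma UP_eval_hom:
  assumes "s \<in> carrier S" shows "ring_hom_cring (UP R) S (eval R S h s)"
proof -
  interpret E: UP_pre_univ_prop R S h "UP R" by unfold_locales auto
  show ?thesis using E.eval_ring_hom[OF assms] R.cring_UP S.cring_axioms
    by (simp add: ring_hom_cring_def ring_hom_cring_axioms_def)
qed

lemma UP_eval_bound:
  assumes p: "p \<in> carrier (UP R)" and n: "\<And>i. i > n \<Longrightarrow> p i = \<zero>\<^bsub>R\<^esub>" and s: "s \<in> carrier S"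
  shows "eval R S h s p = (\<Oplus>\<^bsub>S\<^esub>i\<in>{..n}. h (p i) \<otimes>\<^bsub>S\<^esub> s [^]\<^bsub>S\<^esub> i)"
proof -
  interpret UP: UP_cring R "UP R" by (simp_all add: R.UP_cring_axiom)
  have "deg R p \<le> n" by (rule UP.deg_aboveI) (use p n in \<open>auto simp: R.UP_coeff\<close>)
  moreover have "p i = \<zero>\<^bsub>R\<^esub>" if "i > deg R p" for i using UP.deg_aboveD[OF that p] p by (simp add: R.UP_coeff)
  ultimately have "(\<Oplus>\<^bsub>S\<^esub>i\<in>{..deg R p}. h (p i) \<otimes>\<^bsub>S\<^esub> s [^]\<^bsub>S\<^esub> i) = (\<Oplus>\<^bsub>S\<^esub>i\<in>{..n}. h (p i) \<otimes>\<^bsub>S\<^esub> s [^]\<^bsub>S\<^esub> i)"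
    by (intro S.add.finprod_mono_neutral_cong_left) (use p s in auto)
  moreover have "eval R S h s p = (\<Oplus>\<^bsub>S\<^esub>i\<in>{..deg R p}. h (p i) \<otimes>\<^bsub>S\<^esub> s [^]\<^bsub>S\<^esub> i)"
    unfolding eval_def using p s by (auto intro!: S.finsum_cong' simp: R.UP_coeff)
  ultimately show ?thesis by simp
qed

lemma UP_eval_monom:
  assumes "a \<in> carrier R" "s \<in> carrier S"
  shows "eval R S h s (monom (UP R) a n) = h a \<otimes>\<^bsub>S\<^esub> s [^]\<^bsub>S\<^esub> n"
proof -
  interpret E: UP_pre_univ_prop R S h "UP R" by unfold_locales auto
  show ?thesis using E.eval_monom[OF assms] .
qed

end

section \<open>Base change of frames to polynomials and by evaluation\<close>

context framed_algebra
begin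

abbreviation "UP\<phi> \<equiv> (\<lambda>p i. \<phi> (p i))"
abbreviation "UPx \<equiv> (\<lambda>j. monom (UP B) (x j) 0)"
abbreviation "UPf \<equiv> (\<lambda>j p i. f j (p i))"

lemma UP_functional:
  assumes g: "functional A B \<phi> g" shows "functional (UP A) (UP B) UP\<phi> (\<lambda>p i. g (p i))"
  unfolding functional_def
proof (intro conjI ballI)
  note [simp] = functionalD[OF g]
  have C: "(\<lambda>i. g (p i)) \<in> carrier (UP A)" if p: "p \<in> carrier (UP B)" for p
  proof -
    obtain n where "\<forall>i>n. p i = \<zero>\<^bsub>B\<^esub>" using p S.UP_mem_iff[of p] by auto
    then have "\<forall>i>n. g (p i) = \<zero>" using functional_zero[OF g] by simp
    then show ?thesis using p by (auto simp: R.UP_mem_iff)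
  qed
  show "(\<lambda>p i. g (p i)) \<in> carrier (UP B) \<rightarrow> carrier (UP A)" using C by auto
  fix p assume p: "p \<in> carrier (UP B)"
  show "(\<lambda>i. g ((p \<oplus>\<^bsub>UP B\<^esub> q) i)) = (\<lambda>i. g (p i)) \<oplus>\<^bsub>UP A\<^esub> (\<lambda>i. g (q i))" if q: "q \<in> carrier (UP B)" for q
    using p q C by (auto simp: fun_eq_iff R.UP_add_apply S.UP_add_apply)
  show "(\<lambda>i. g ((UP\<phi> a \<otimes>\<^bsub>UP B\<^esub> p) i)) = a \<otimes>\<^bsub>UP A\<^esub> (\<lambda>i. g (p i))" if a: "a \<in> carrier (UP A)" for a
  proof
    fix i
    have "g (\<Oplus>\<^bsub>B\<^esub>j\<in>{..i}. \<phi> (a j) \<otimes>\<^bsub>B\<^esub> p (i - j)) = (\<Oplus>j\<in>{..i}. g (\<phi> (a j) \<otimes>\<^bsub>B\<^esub> p (i - j)))"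
      by (rule functional_finsum[OF g]) (use a p in auto)
    also have "\<dots> = (\<Oplus>j\<in>{..i}. a j \<otimes> g (p (i - j)))" by (rule R.finsum_cong') (use a p in auto)
    finally show "g ((UP\<phi> a \<otimes>\<^bsub>UP B\<^esub> p) i) = (a \<otimes>\<^bsub>UP A\<^esub> (\<lambda>i. g (p i))) i"
      using a p C[OF p] UP_map_closed[OF a] by (simp add: R.UP_mult_apply S.UP_mult_apply)
  qed
qed

lemma UP_framed: "framed_algebra (UP A) (UP B) UP\<phi> m UPx UPf"
proof -
  interpret U: ring_hom_cring "UP A" "UP B" UP\<phi> by (rule UP_map_hom)
  show ?thesis
  proof unfold_locales
    show "UPx j \<in> carrier (UP B)" if "j < m" for j using that by simp
    show "functional (UP A) (UP B) UP\<phi> (UPf j)" if "j < m" for j by (rule UP_functional[OF frame_functional[OF that]])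
    fix b assume b: "b \<in> carrier (UP B)"
    have C: "UP\<phi> (UPf j b) \<in> carrier (UP B)" if "j < m" for j
      using functionalD(1)[OF UP_functional[OF frame_functional[OF that]] b] U.hom_closed by simp
    show "(\<Oplus>\<^bsub>UP B\<^esub>j\<in>{..<m}. UP\<phi> (UPf j b) \<otimes>\<^bsub>UP B\<^esub> UPx j) = b"
    proof
      fix i
      have "(\<Oplus>\<^bsub>UP B\<^esub>j\<in>{..<m}. UP\<phi> (UPf j b) \<otimes>\<^bsub>UP B\<^esub> UPx j) i = (\<Oplus>\<^bsub>B\<^esub>j\<in>{..<m}. (UP\<phi> (UPf j b) \<otimes>\<^bsub>UP B\<^esub> UPx j) i)"
        by (rule S.UP_finsum_apply) (use C in auto)
      also have "\<dots> = (\<Oplus>\<^bsub>B\<^esub>j\<in>{..<m}. \<phi> (f j (b i)) \<otimes>\<^bsub>B\<^esub> x j)"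
        by (rule S.finsum_cong') (use C b in \<open>auto simp: S.UP_monom0_mult_apply\<close>)
      finally show "(\<Oplus>\<^bsub>UP B\<^esub>j\<in>{..<m}. UP\<phi> (UPf j b) \<otimes>\<^bsub>UP B\<^esub> UPx j) i = b i" using b by (simp add: frame_expand)
    qed
  qed
qed

lemma frame_hom_const:
  "frame_hom A B \<phi> m x f (UP A) (UP B) UP\<phi> UPx UPf (\<lambda>a. monom (UP A) a 0) (\<lambda>b. monom (UP B) b 0)"
proof -
  interpret U: framed_algebra "UP A" "UP B" UP\<phi> m UPx UPf by (rule UP_framed)
  interpret a: ring_hom_cring A "UP A" "\<lambda>a. monom (UP A) a 0" by (rule R.UP_const_hom)
  interpret b: ring_hom_cring B "UP B" "\<lambda>a. monom (UP B) a 0" by (rule S.UP_const_hom)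
  show ?thesis
    by unfold_locales (auto simp: fun_eq_iff R.UP_monom_apply S.UP_monom_apply functional_zero[OF frame_functional])
qed

lemma frame_hom_id: "frame_hom A B \<phi> m x f A B \<phi> x f (\<lambda>a. a) (\<lambda>b. b)"
  by (intro frame_hom.intro framed_algebra_axioms R.id_hom S.id_hom frame_hom_axioms.intro) simp_all

end

context frame_hom
begin

lemma frame_hom_UP_map:
  "frame_hom (UP A) (UP B) dom.UP\<phi> m dom.UPx dom.UPf (UP A') (UP B') cod.UP\<phi> cod.UPx cod.UPf
     (\<lambda>p i. \<alpha> (p i)) (\<lambda>p i. \<beta> (p i))"
proof -
  interpret U: framed_algebra "UP A" "UP B" dom.UP\<phi> m dom.UPx dom.UPf by (rule dom.UP_framed)
  interpret U': framed_algebra "UP A'" "UP B'" cod.UP\<phi> m cod.UPx cod.UPf by (rule cod.UP_framed)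
  interpret a: ring_hom_cring "UP A" "UP A'" "\<lambda>p i. \<alpha> (p i)" by (rule base.UP_map_hom)
  interpret b: ring_hom_cring "UP B" "UP B'" "\<lambda>p i. \<beta> (p i)" by (rule top.UP_map_hom)
  show ?thesis
    by unfold_locales (auto simp: fun_eq_iff dom.S.UP_monom_apply cod.S.UP_monom_apply x'_eq comm f'_eq)
qed

text \<open>Evaluating the variable at \<open>\<mu>\<close> in the base goes with evaluating it at
  \<open>\<phi>' \<mu>\<close> in the algebra. With the identity for \<open>\<alpha>\<close> and
  \<open>\<beta>\<close> this specializes an identity; with a polynomial ring as target it is a
  substitution of variables.\<close>

lemma frame_hom_eval:
  assumes \<mu>: "\<mu> \<in> carrier A'"
  shows "frame_hom (UP A) (UP B) dom.UP\<phi> m dom.UPx dom.UPf A' B' \<phi>' x' f' (eval A A' \<alpha> \<mu>) (eval B B' \<beta> (\<phi>' \<mu>))"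
proof -
  interpret U: framed_algebra "UP A" "UP B" dom.UP\<phi> m dom.UPx dom.UPf by (rule dom.UP_framed)
  interpret a: ring_hom_cring "UP A" A' "eval A A' \<alpha> \<mu>" by (rule base.UP_eval_hom[OF \<mu>])
  interpret b: ring_hom_cring "UP B" B' "eval B B' \<beta> (\<phi>' \<mu>)" by (rule top.UP_eval_hom) (use \<mu> in simp)
  show ?thesis
  proof unfold_locales
    show "x' j = eval B B' \<beta> (\<phi>' \<mu>) (dom.UPx j)" if "j < m" for j
      using that \<mu> by (simp add: top.UP_eval_monom x'_eq)
    show "\<phi>' (eval A A' \<alpha> \<mu> p) = eval B B' \<beta> (\<phi>' \<mu>) (dom.UP\<phi> p)" if p: "p \<in> carrier (UP A)" for p
    proof -
      obtain n where n: "\<And>i. i > n \<Longrightarrow> p i = \<zero>\<^bsub>A\<^esub>" using p dom.R.UP_mem_iff[of p] by auto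
      have "\<phi>' (eval A A' \<alpha> \<mu> p) = \<phi>' (\<Oplus>\<^bsub>A'\<^esub>i\<in>{..n}. \<alpha> (p i) \<otimes>\<^bsub>A'\<^esub> \<mu> [^]\<^bsub>A'\<^esub> i)"
        using base.UP_eval_bound[OF p n \<mu>] by simp
      also have "\<dots> = (\<Oplus>\<^bsub>B'\<^esub>i\<in>{..n}. \<phi>' (\<alpha> (p i) \<otimes>\<^bsub>A'\<^esub> \<mu> [^]\<^bsub>A'\<^esub> i))"
        by (subst cod.hom_finsum) (use p \<mu> in \<open>auto simp: o_def\<close>)
      also have "\<dots> = (\<Oplus>\<^bsub>B'\<^esub>i\<in>{..n}. \<beta> (\<phi> (p i)) \<otimes>\<^bsub>B'\<^esub> \<phi>' \<mu> [^]\<^bsub>B'\<^esub> i)"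
        by (rule cod.S.finsum_cong') (use p \<mu> in \<open>auto simp: comm cod.hom_pow\<close>)
      also have "\<dots> = eval B B' \<beta> (\<phi>' \<mu>) (dom.UP\<phi> p)"
        by (rule top.UP_eval_bound[symmetric]) (use p \<mu> n dom.UP_map_closed in auto)
      finally show ?thesis .
    qed
    show "f' j (eval B B' \<beta> (\<phi>' \<mu>) b) = eval A A' \<alpha> \<mu> (dom.UPf j b)" if j: "j < m" and b: "b \<in> carrier (UP B)" for j b
    proof -
      obtain n where n: "\<And>i. i > n \<Longrightarrow> b i = \<zero>\<^bsub>B\<^esub>" using b dom.S.UP_mem_iff[of b] by auto
      have \<mu>n: "\<mu> [^]\<^bsub>A'\<^esub> i \<in> carrier A'" for i :: nat using \<mu> by simp
      have "f' j (eval B B' \<beta> (\<phi>' \<mu>) b) = f' j (\<Oplus>\<^bsub>B'\<^esub>i\<in>{..n}. \<beta> (b i) \<otimes>\<^bsub>B'\<^esub> (\<phi>' \<mu>) [^]\<^bsub>B'\<^esub> i)"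
        using top.UP_eval_bound[OF b n] \<mu> by simp
      also have "\<dots> = (\<Oplus>\<^bsub>A'\<^esub>i\<in>{..n}. f' j (\<beta> (b i) \<otimes>\<^bsub>B'\<^esub> (\<phi>' \<mu>) [^]\<^bsub>B'\<^esub> i))"
        by (rule cod.functional_finsum[OF cod.frame_functional[OF j]]) (use b \<mu> in auto)
      also have "\<dots> = (\<Oplus>\<^bsub>A'\<^esub>i\<in>{..n}. \<alpha> (f j (b i)) \<otimes>\<^bsub>A'\<^esub> \<mu> [^]\<^bsub>A'\<^esub> i)"
      proof (rule cod.R.finsum_cong'[OF refl])
        fix i
        have "f' j (\<beta> (b i) \<otimes>\<^bsub>B'\<^esub> \<phi>' (\<mu> [^]\<^bsub>A'\<^esub> i)) = f' j (\<beta> (b i)) \<otimes>\<^bsub>A'\<^esub> \<mu> [^]\<^bsub>A'\<^esub> i"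
          by (rule cod.functional_mult_right[OF cod.frame_functional[OF j] \<mu>n]) (use b in simp)
        then show "f' j (\<beta> (b i) \<otimes>\<^bsub>B'\<^esub> (\<phi>' \<mu>) [^]\<^bsub>B'\<^esub> i) = \<alpha> (f j (b i)) \<otimes>\<^bsub>A'\<^esub> \<mu> [^]\<^bsub>A'\<^esub> i"
          using j b \<mu> by (simp add: f'_eq cod.hom_pow)
      qed (use j b \<mu> in auto)
      also have "\<dots> = eval A A' \<alpha> \<mu> (dom.UPf j b)"
        by (rule base.UP_eval_bound[symmetric])
          (use functionalD(1)[OF dom.UP_functional[OF dom.frame_functional[OF j]] b] n \<mu> dom.functional_zero[OF dom.frame_functional[OF j]] in auto)
      finally show ?thesis .
    qed
  qed
qed

end

section \<open>Polarized forms\<close>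

lemma (in cring) eq_if_frac_eq:
  assumes c: "c \<in> carrier R" and d: "d \<in> carrier R"
    and loc: "\<And>P. primeideal P R \<Longrightarrow> \<exists>s\<in>carrier R. s \<notin> P \<and> frac R {s} c \<one> = frac R {s} d \<one>"
  shows "c = d"
proof -
  let ?J = "{y \<in> carrier R. y \<otimes> c = y \<otimes> d}"
  have "\<one> \<in> ?J"
  proof (rule eq_if_locally_eq_one)
    show "ideal ?J R"
    proof (rule idealI_basic)
      show "a \<otimes> y \<in> ?J" if "y \<in> ?J" "a \<in> carrier R" for y a using that c d by (simp add: m_assoc)
      then show "y \<otimes> a \<in> ?J" if "y \<in> ?J" "a \<in> carrier R" for y a using that m_comm[of y a] by simp
    qed (use c d in \<open>auto simp: l_distr\<close>)
    fix P assume P: "primeideal P R"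
    then obtain s where s: "s \<in> carrier R" "s \<notin> P" "frac R {s} c \<one> = frac R {s} d \<one>" using loc by blast
    then have V: "{s} \<subseteq> carrier R" by auto
    obtain t where t: "t \<in> mgen R {s}" "t \<otimes> c = t \<otimes> d"
      using iffD1[OF frac_eq_iff[OF V c mgen_one d mgen_one] s(3)] c d by auto
    have "t \<notin> P" using mgen_disjoint_prime[OF P V] s t by auto
    moreover have "t \<in> ?J" using t mgen_closed[OF V] by auto
    ultimately show "\<exists>y\<in>?J. y \<notin> P" by auto
  qed
  then show ?thesis using c d by simp
qed

text \<open>Integer powers in \<open>norm_const\<close> and \<open>norm_shift\<close> become powers
  of a ring element, the form in which \<open>K\<close> takes its scalar.\<close>

lemma (in cring) int_pow_mult_eq:
  assumes "a \<in> carrier R" shows "[((z::int) ^ k)] \<cdot> a = ([z] \<cdot> \<one>) [^] k \<otimes> a"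
proof (induction k)
  case 0
  then show ?case using assms by simp
next
  case (Suc k)
  have "[(z ^ Suc k)] \<cdot> a = [z] \<cdot> ([(z ^ k)] \<cdot> a)" using assms by (simp add: add.int_pow_pow mult.commute)
  also have "\<dots> = [z] \<cdot> (\<one> \<otimes> (([z] \<cdot> \<one>) [^] k \<otimes> a))" using assms Suc by simp
  also have "\<dots> = ([z] \<cdot> \<one>) \<otimes> (([z] \<cdot> \<one>) [^] k \<otimes> a)" by (rule add_pow_ldistr_int[symmetric]) (use assms in auto)
  finally show ?case using assms by (simp add: m_ac)
qed

section \<open>Homogeneity of the norm and norms of pencils\<close>

locale rank_framed = framed_algebra A B \<phi> m x f
  for A :: "('a, 'a1) ring_scheme" (structure) and B :: "('b, 'b1) ring_scheme" (structure) and \<phi> m x f +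
  fixes n :: nat
  assumes loc_free: "loc_free n A B \<phi>"
begin

lemma UP_rank_framed: "rank_framed (UP A) (UP B) UP\<phi> m UPx UPf n"
proof -
  interpret F: frame_hom A B \<phi> m x f "UP A" "UP B" UP\<phi> UPx UPf "\<lambda>a. monom (UP A) a 0" "\<lambda>b. monom (UP B) b 0"
    by (rule frame_hom_const)
  show ?thesis
    by (intro rank_framed.intro UP_framed rank_framed_axioms.intro F.loc_free_hom loc_free)
qed

text \<open>The place where the rank \<open>n\<close> enters the norm: in a local basis of
  \<open>n\<close> elements, multiplication by a scalar has a scalar matrix. Equality is checked on
  neighbourhoods of all primes.\<close>

lemma nm_scalar:
  assumes a: "a \<in> carrier A" shows "nm (\<phi> a) = a [^] n"
proof (rule R.eq_if_frac_eq)
  show "nm (\<phi> a) \<in> carrier A" "a [^] n \<in> carrier A" using a by simp_all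
  fix P assume P: "primeideal P A"
  then obtain s e g where s: "s \<notin> P" and nb: "near_basis n A B \<phi> s e g" using loc_free by (auto simp: loc_free_def)
  have sA: "s \<in> carrier A" using nb by (simp add: near_basis_def)
  then have V: "{s} \<subseteq> carrier A" by auto
  interpret L: frame_hom A B \<phi> m x f "loc A {s}" "loc B (\<phi> ` {s})" "loc_map B (\<phi> ` {s}) \<phi>"
    "\<lambda>j. frac B (\<phi> ` {s}) (x j) \<one>\<^bsub>B\<^esub>" "\<lambda>j. loc_functional (f j) {s}" "\<lambda>c. frac A {s} c \<one>" "\<lambda>b. frac B (\<phi> ` {s}) b \<one>\<^bsub>B\<^esub>"
    by (rule frame_hom_loc[OF V])
  have sM: "s \<in> mgen A {s}" using R.mgen_subset[of "{s}"] by auto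
  let ?e = "\<lambda>i. frac B (\<phi> ` {s}) (e i) \<one>\<^bsub>B\<^esub>"
  have bas: "is_basis (loc A {s}) (alg_module (loc A {s}) (loc B (\<phi> ` {s})) (loc_map B (\<phi> ` {s}) \<phi>)) n ?e"
    by (rule L.cod.near_basis_unit[OF L.near_basis_hom[OF nb], of "frac A {s} \<one> s"])
      (use sM R.frac_denom_unit[OF V sM] in auto)
  have eB: "?e i \<in> carrier (loc B (\<phi> ` {s}))" if "i < n" for i using bas that by (auto simp: is_basis_def)
  let ?a = "frac A {s} a \<one>"
  have aC: "?a \<in> carrier (loc A {s})" using a by auto
  have "?a [^]\<^bsub>loc A {s}\<^esub> n = det (loc A {s}) n (\<lambda>i j. if i = j then ?a else \<zero>\<^bsub>loc A {s}\<^esub>)"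
    by (rule L.cod.R.det_scalar[OF aC, symmetric])
  also have "\<dots> = det (loc A {s}) n (\<lambda>i j. L.cod.coord n ?e i (loc_map B (\<phi> ` {s}) \<phi> ?a \<otimes>\<^bsub>loc B (\<phi> ` {s})\<^esub> ?e j))"
  proof (rule L.cod.R.det_cong)
    fix i j assume ij: "i < n" "j < n"
    show "(if i = j then ?a else \<zero>\<^bsub>loc A {s}\<^esub>) = L.cod.coord n ?e i (loc_map B (\<phi> ` {s}) \<phi> ?a \<otimes>\<^bsub>loc B (\<phi> ` {s})\<^esub> ?e j)"
      using functionalD(3)[OF L.cod.coord_functional[OF bas ij(1)] aC eB[OF ij(2)]] L.cod.coord_dual[OF bas ij] aC by simp
    show "L.cod.coord n ?e i (loc_map B (\<phi> ` {s}) \<phi> ?a \<otimes>\<^bsub>loc B (\<phi> ` {s})\<^esub> ?e j) \<in> carrier (loc A {s})"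
      by (rule functionalD(1)[OF L.cod.coord_functional[OF bas ij(1)] L.cod.S.m_closed[OF L.cod.hom_closed[OF aC] eB[OF ij(2)]]])
  qed
  also have "\<dots> = L.cod.nm (loc_map B (\<phi> ` {s}) \<phi> ?a)"
    by (rule L.cod.nm_eq_det[OF eB L.cod.coord_functional[OF bas] L.cod.coord_expand[OF bas] L.cod.coord_dual[OF bas]
          L.cod.hom_closed[OF aC], symmetric])
  also have "loc_map B (\<phi> ` {s}) \<phi> ?a = frac B (\<phi> ` {s}) (\<phi> a) \<one>\<^bsub>B\<^esub>" using L.comm[OF a] .
  also have "L.cod.nm \<dots> = frac A {s} (nm (\<phi> a)) \<one>" by (rule L.nm_hom) (use a in simp)
  finally have "frac A {s} (nm (\<phi> a)) \<one> = frac A {s} (a [^] n) \<one>" using L.base.hom_pow[OF a, of n] by simp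
  then show "\<exists>s\<in>carrier A. s \<notin> P \<and> frac A {s} (nm (\<phi> a)) \<one> = frac A {s} (a [^] n) \<one>" using s sA by blast
qed

text \<open>The element \<open>X b + c\<close> of \<open>B[X]\<close>. By homogeneity its norm, in
  one variable, carries the same coefficients as the two-variable norm in \<open>polar\<close>; see
  \<open>polar_eq\<close>.\<close>

definition pencil :: "'b \<Rightarrow> 'b \<Rightarrow> nat \<Rightarrow> 'b" where
  "pencil b c = monom (UP B) b 1 \<oplus>\<^bsub>UP B\<^esub> monom (UP B) c 0"

definition pencil_norm :: "'b \<Rightarrow> 'b \<Rightarrow> nat \<Rightarrow> 'a" where
  "pencil_norm b c = frame_norm (UP A) (UP B) m UPx UPf (pencil b c)"

lemma pencil_closed [simp]: "b \<in> carrier B \<Longrightarrow> c \<in> carrier B \<Longrightarrow> pencil b c \<in> carrier (UP B)"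
proof -
  interpret P: cring "UP B" by (rule S.cring_UP)
  show "b \<in> carrier B \<Longrightarrow> c \<in> carrier B \<Longrightarrow> pencil b c \<in> carrier (UP B)" by (simp add: pencil_def)
qed

lemma pencil_norm_closed [simp]: "b \<in> carrier B \<Longrightarrow> c \<in> carrier B \<Longrightarrow> pencil_norm b c \<in> carrier (UP A)"
proof -
  interpret U: framed_algebra "UP A" "UP B" UP\<phi> m UPx UPf by (rule UP_framed)
  show "b \<in> carrier B \<Longrightarrow> c \<in> carrier B \<Longrightarrow> pencil_norm b c \<in> carrier (UP A)" by (simp add: pencil_norm_def)
qed

lemma norm_fun_nm: "b \<in> carrier B \<Longrightarrow> norm_fun n A B \<phi> b = nm b"
  by (rule norm_fun_eq[OF loc_free])

end

lemma (in frame_hom) pencil_norm_hom: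
  assumes lf: "loc_free n A B \<phi>" and b: "b \<in> carrier B" "c \<in> carrier B"
  shows "rank_framed.pencil_norm A' B' m x' f' (\<beta> b) (\<beta> c) i = \<alpha> (rank_framed.pencil_norm A B m x f b c i)"
proof -
  interpret X: rank_framed A B \<phi> m x f n by unfold_locales (rule lf)
  interpret X': rank_framed A' B' \<phi>' m x' f' n by unfold_locales (rule loc_free_hom[OF lf])
  interpret F: frame_hom "UP A" "UP B" dom.UP\<phi> m dom.UPx dom.UPf "UP A'" "UP B'" cod.UP\<phi> cod.UPx cod.UPf
    "\<lambda>p i. \<alpha> (p i)" "\<lambda>p i. \<beta> (p i)" by (rule frame_hom_UP_map)
  have "(\<lambda>i. \<beta> (X.pencil b c i)) = X'.pencil (\<beta> b) (\<beta> c)"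
    unfolding X.pencil_def X'.pencil_def using b F.top.hom_add[of "monom (UP B) b 1" "monom (UP B) c 0"]
    by (simp add: top.UP_map_monom)
  then show ?thesis
    unfolding X.pencil_norm_def X'.pencil_norm_def using F.nm_hom[of "X.pencil b c"] b by (simp add: fun_eq_iff)
qed

context rank_framed
begin

text \<open>Let \<open>P(X, Y)\<close> be the norm of \<open>X b + Y c\<close>, with
  \<open>X\<close> the outer and \<open>Y\<close> the inner variable, and let \<open>q(X)\<close> be
  the norm of \<open>X b + c\<close>. Replacing \<open>X\<close> by \<open>X Y\<close> turns
  \<open>X b + Y c\<close> into \<open>Y (X b + c)\<close>, whence
  \<open>P(X Y, Y) = Y^n q(X)\<close>. The coefficient of \<open>X^k\<close> gives
  \<open>P_k(Y) Y^k = q_k Y^n\<close>, which determines \<open>P_k\<close> and forces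
  \<open>q_k = 0\<close> for \<open>k > n\<close>.\<close>

lemma
  assumes b: "b \<in> carrier B" "c \<in> carrier B"
  shows double_pencil: "\<And>k l. rank_framed.pencil_norm (UP A) (UP B) m UPx UPf (monom (UP B) b 0) (monom (UP B) c 1) k l
        = (if k + l = n then pencil_norm b c k else \<zero>)" (is "\<And>k l. ?P k l = _")
    and pencil_norm_bound: "\<And>k. k > n \<Longrightarrow> pencil_norm b c k = \<zero>"
proof -
  interpret U: rank_framed "UP A" "UP B" UP\<phi> m UPx UPf n by (rule UP_rank_framed)
  interpret UU: rank_framed "UP (UP A)" "UP (UP B)" U.UP\<phi> m U.UPx U.UPf n by (rule U.UP_rank_framed)
  interpret C: frame_hom A B \<phi> m x f "UP A" "UP B" UP\<phi> UPx UPf "\<lambda>a. monom (UP A) a 0" "\<lambda>b. monom (UP B) b 0"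
    by (rule frame_hom_const)
  interpret D: frame_hom "UP A" "UP B" UP\<phi> m UPx UPf "UP (UP A)" "UP (UP B)" U.UP\<phi> U.UPx U.UPf
    "\<lambda>p i. monom (UP A) (p i) 0" "\<lambda>p i. monom (UP B) (p i) 0" by (rule C.frame_hom_UP_map)
  interpret E: frame_hom "UP A" "UP B" UP\<phi> m UPx UPf "UP (UP A)" "UP (UP B)" U.UP\<phi> U.UPx U.UPf
    "\<lambda>a. monom (UP (UP A)) a 0" "\<lambda>b. monom (UP (UP B)) b 0" by (rule U.frame_hom_const)
  let ?v = "monom (UP A) \<one> 1" and ?v' = "monom (UP B) \<one>\<^bsub>B\<^esub> 1"
  \<comment> \<open>The product \<open>X Y\<close>. The homomorphism \<open>T\<close> substitutes it
    for \<open>X\<close> and keeps \<open>Y\<close>, because the elements of \<open>UP A\<close> are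
    embedded as constants in the outer variable.\<close>
  let ?\<mu> = "monom (UP (UP A)) ?v 1"
  have vC: "?v \<in> carrier (UP A)" "?v' \<in> carrier (UP B)" by simp_all
  have \<mu>: "?\<mu> \<in> carrier (UP (UP A))" using vC by simp
  interpret T: frame_hom "UP (UP A)" "UP (UP B)" U.UP\<phi> m U.UPx U.UPf "UP (UP A)" "UP (UP B)" U.UP\<phi> U.UPx U.UPf
    "eval (UP A) (UP (UP A)) (\<lambda>a. monom (UP (UP A)) a 0) ?\<mu>"
    "eval (UP B) (UP (UP B)) (\<lambda>a. monom (UP (UP B)) a 0) (U.UP\<phi> ?\<mu>)" by (rule E.frame_hom_eval[OF \<mu>])
  interpret PA: UP_cring "UP A" "UP (UP A)" by (simp_all add: U.R.UP_cring_axiom)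
  interpret PB: UP_cring "UP B" "UP (UP B)" by (simp_all add: U.S.UP_cring_axiom)
  interpret QA: UP_cring A "UP A" by (simp_all add: R.UP_cring_axiom)
  interpret QB: UP_cring B "UP B" by (simp_all add: S.UP_cring_axiom)
  let ?b = "monom (UP B) b 0" and ?c = "monom (UP B) c 0"
  have bc: "?b \<in> carrier (UP B)" "?c \<in> carrier (UP B)" using b by simp_all
  have phi_v: "UP\<phi> ?v = ?v'" by (simp add: UP_map_monom)
  have \<phi>\<mu>: "U.UP\<phi> ?\<mu> = monom (UP (UP B)) ?v' 1" using U.UP_map_monom[OF vC(1), of 1] unfolding phi_v .
  have \<phi>\<nu>: "U.UP\<phi> (monom (UP (UP A)) ?v 0) = monom (UP (UP B)) ?v' 0" using U.UP_map_monom[OF vC(1), of 0] unfolding phi_v .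
  have c1: "monom (UP B) c 1 = ?c \<otimes>\<^bsub>UP B\<^esub> ?v'" using b QB.monom_mult[of c "\<one>\<^bsub>B\<^esub>" 0 1] by simp
  have lhs: "eval (UP B) (UP (UP B)) (\<lambda>a. monom (UP (UP B)) a 0) (U.UP\<phi> ?\<mu>) (U.pencil ?b (monom (UP B) c 1))
    = U.UP\<phi> (monom (UP (UP A)) ?v 0) \<otimes>\<^bsub>UP (UP B)\<^esub> U.pencil ?b ?c"
  proof -
    have "eval (UP B) (UP (UP B)) (\<lambda>a. monom (UP (UP B)) a 0) (U.UP\<phi> ?\<mu>) (U.pencil ?b (monom (UP B) c 1))
      = monom (UP (UP B)) ?b 0 \<otimes>\<^bsub>UP (UP B)\<^esub> U.UP\<phi> ?\<mu> \<oplus>\<^bsub>UP (UP B)\<^esub> monom (UP (UP B)) (monom (UP B) c 1) 0"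
      unfolding U.pencil_def using b vC U.UP_map_closed[OF \<mu>]
      by (subst T.top.hom_add) (simp_all add: E.top.UP_eval_monom)
    also have "\<dots> = monom (UP (UP B)) (?b \<otimes>\<^bsub>UP B\<^esub> ?v') 1 \<oplus>\<^bsub>UP (UP B)\<^esub> monom (UP (UP B)) (?c \<otimes>\<^bsub>UP B\<^esub> ?v') 0"
      unfolding \<phi>\<mu> c1 using PB.monom_mult[OF bc(1) vC(2), of 0 1] by simp
    also have "\<dots> = U.UP\<phi> (monom (UP (UP A)) ?v 0) \<otimes>\<^bsub>UP (UP B)\<^esub> U.pencil ?b ?c"
    proof -
      have e1: "monom (UP (UP B)) (?b \<otimes>\<^bsub>UP B\<^esub> ?v') 1 = monom (UP (UP B)) ?v' 0 \<otimes>\<^bsub>UP (UP B)\<^esub> monom (UP (UP B)) ?b 1"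
        unfolding U.S.m_comm[OF bc(1) vC(2)] using PB.monom_mult[OF vC(2) bc(1), of 0 1] by (simp only: add_0)
      have e2: "monom (UP (UP B)) (?c \<otimes>\<^bsub>UP B\<^esub> ?v') 0 = monom (UP (UP B)) ?v' 0 \<otimes>\<^bsub>UP (UP B)\<^esub> monom (UP (UP B)) ?c 0"
        unfolding U.S.m_comm[OF bc(2) vC(2)] using PB.monom_mult[OF vC(2) bc(2), of 0 0] by (simp only: add_0)
      show ?thesis
        unfolding e1 e2 \<phi>\<nu> U.pencil_def by (rule UU.S.r_distr[symmetric]) (use bc vC in simp_all)
    qed
    finally show ?thesis .
  qed
  \<comment> \<open>The coefficients of \<open>X b + c\<close> do not involve \<open>Y\<close>, so
    its norm over the two-variable ring comes from \<open>q\<close> by embedding the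
    coefficients.\<close>
  have rhs: "(\<lambda>i. monom (UP B) (pencil b c i) 0) = U.pencil ?b ?c"
    unfolding U.pencil_def pencil_def using b D.top.hom_add[of "monom (UP B) b 1" "monom (UP B) c 0"]
    by (simp add: C.top.UP_map_monom)
  let ?q = "pencil_norm b c"
  have q: "?q \<in> carrier (UP A)" using b by simp
  have P: "?P \<in> carrier (UP (UP A))" by (rule U.pencil_norm_closed[OF bc(1)]) (use b in simp)
  have main: "eval (UP A) (UP (UP A)) (\<lambda>a. monom (UP (UP A)) a 0) ?\<mu> ?P
    = monom (UP (UP A)) ?v 0 [^]\<^bsub>UP (UP A)\<^esub> n \<otimes>\<^bsub>UP (UP A)\<^esub> (\<lambda>i. monom (UP A) (?q i) 0)"
  proof -
    have "eval (UP A) (UP (UP A)) (\<lambda>a. monom (UP (UP A)) a 0) ?\<mu> ?P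
      = UU.nm (U.UP\<phi> (monom (UP (UP A)) ?v 0) \<otimes>\<^bsub>UP (UP B)\<^esub> U.pencil ?b ?c)"
      unfolding U.pencil_norm_def lhs[symmetric] by (rule T.nm_hom[symmetric]) (use b in simp)
    also have "\<dots> = UU.nm (U.UP\<phi> (monom (UP (UP A)) ?v 0)) \<otimes>\<^bsub>UP (UP A)\<^esub> UU.nm (U.pencil ?b ?c)"
      by (rule UU.nm_mult) (use bc vC U.UP_map_closed in auto)
    also have "UU.nm (U.UP\<phi> (monom (UP (UP A)) ?v 0)) = monom (UP (UP A)) ?v 0 [^]\<^bsub>UP (UP A)\<^esub> n"
      by (rule UU.nm_scalar) (use vC in simp)
    also have "UU.nm (U.pencil ?b ?c) = (\<lambda>i. monom (UP A) (?q i) 0)"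
      unfolding rhs[symmetric] pencil_norm_def by (rule D.nm_hom) (use b in simp)
    finally show ?thesis .
  qed
  \<comment> \<open>Comparison of the coefficients of \<open>X^k\<close> on both sides of
    \<open>main\<close>.\<close>
  have key: "?P k \<otimes>\<^bsub>UP A\<^esub> monom (UP A) \<one> k = monom (UP A) (?q k) n" for k
  proof -
    have pow: "?v [^]\<^bsub>UP A\<^esub> i = monom (UP A) \<one> i" for i :: nat using QA.monom_pow[OF R.one_closed, of 1 i] by simp
    have Pk: "?P i \<in> carrier (UP A)" for i by (rule U.R.UP_apply_closed[OF P])
    obtain N' where N': "\<And>i. i > N' \<Longrightarrow> ?P i = \<zero>\<^bsub>UP A\<^esub>" using conjunct2[OF iffD1[OF U.R.UP_mem_iff P]] by blast
    \<comment> \<open>At least \<open>k\<close>, so that the coefficient to be read off occurs among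
      the summands.\<close>
    let ?N = "max N' k"
    have summand: "monom (UP (UP A)) (?P i) 0 \<otimes>\<^bsub>UP (UP A)\<^esub> ?\<mu> [^]\<^bsub>UP (UP A)\<^esub> i = monom (UP (UP A)) (?P i \<otimes>\<^bsub>UP A\<^esub> monom (UP A) \<one> i) i" for i :: nat
      unfolding PA.monom_pow[OF vC(1)] pow mult_1
      using PA.monom_mult[OF Pk[of i] R.UP_monom_closed[OF R.one_closed], of i 0 i, symmetric] by (simp only: add_0)
    have "eval (UP A) (UP (UP A)) (\<lambda>a. monom (UP (UP A)) a 0) ?\<mu> ?P
      = (\<Oplus>\<^bsub>UP (UP A)\<^esub>i\<in>{..?N}. monom (UP (UP A)) (?P i) 0 \<otimes>\<^bsub>UP (UP A)\<^esub> ?\<mu> [^]\<^bsub>UP (UP A)\<^esub> i)"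
      by (rule E.base.UP_eval_bound[OF P N' \<mu>]) simp
    also have "\<dots> = (\<Oplus>\<^bsub>UP (UP A)\<^esub>i\<in>{..?N}. monom (UP (UP A)) (?P i \<otimes>\<^bsub>UP A\<^esub> monom (UP A) \<one> i) i)"
      unfolding summand ..
    finally have ev: "eval (UP A) (UP (UP A)) (\<lambda>a. monom (UP (UP A)) a 0) ?\<mu> ?P
      = (\<Oplus>\<^bsub>UP (UP A)\<^esub>i\<in>{..?N}. monom (UP (UP A)) (?P i \<otimes>\<^bsub>UP A\<^esub> monom (UP A) \<one> i) i)" .
    have tC: "?P i \<otimes>\<^bsub>UP A\<^esub> monom (UP A) \<one> i \<in> carrier (UP A)" for i
      by (rule U.R.m_closed[OF Pk R.UP_monom_closed[OF R.one_closed]])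
    have "eval (UP A) (UP (UP A)) (\<lambda>a. monom (UP (UP A)) a 0) ?\<mu> ?P k
      = (\<Oplus>\<^bsub>UP A\<^esub>i\<in>{..?N}. monom (UP (UP A)) (?P i \<otimes>\<^bsub>UP A\<^esub> monom (UP A) \<one> i) i k)"
      unfolding ev by (rule U.R.UP_finsum_apply[OF finite_atMost Pi_I[OF U.R.UP_monom_closed[OF tC]]])
    also have "\<dots> = (\<Oplus>\<^bsub>UP A\<^esub>i\<in>{..?N}. if k = i then ?P i \<otimes>\<^bsub>UP A\<^esub> monom (UP A) \<one> i else \<zero>\<^bsub>UP A\<^esub>)"
      unfolding U.R.UP_monom_apply[OF tC] ..
    also have "\<dots> = ?P k \<otimes>\<^bsub>UP A\<^esub> monom (UP A) \<one> k"
      by (rule U.R.add.finprod_singleton[OF _ finite_atMost Pi_I[OF tC]]) (rule atMost_iff[THEN iffD2], rule max.cobounded2)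
    finally have 1: "eval (UP A) (UP (UP A)) (\<lambda>a. monom (UP (UP A)) a 0) ?\<mu> ?P k = ?P k \<otimes>\<^bsub>UP A\<^esub> monom (UP A) \<one> k" .
    have qc: "(\<lambda>i. monom (UP A) (?q i) 0) \<in> carrier (UP (UP A))" using D.base.hom_closed[OF q] .
    have mC: "monom (UP (UP A)) (monom (UP A) \<one> n) 0 \<in> carrier (UP (UP A))"
      by (rule U.R.UP_monom_closed[OF R.UP_monom_closed[OF R.one_closed]])
    have vn: "monom (UP (UP A)) ?v 0 [^]\<^bsub>UP (UP A)\<^esub> n = monom (UP (UP A)) (monom (UP A) \<one> n) 0"
      by (simp only: PA.monom_pow[OF vC(1)] pow mult_0)
    have "?P k \<otimes>\<^bsub>UP A\<^esub> monom (UP A) \<one> k = (monom (UP (UP A)) (monom (UP A) \<one> n) 0 \<otimes>\<^bsub>UP (UP A)\<^esub> (\<lambda>i. monom (UP A) (?q i) 0)) k"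
      unfolding 1[symmetric] main vn ..
    also have "\<dots> = ((\<lambda>i. monom (UP A) (?q i) 0) \<otimes>\<^bsub>UP (UP A)\<^esub> monom (UP (UP A)) (monom (UP A) \<one> n) 0) k"
      unfolding UU.R.m_comm[OF mC qc] ..
    also have "\<dots> = monom (UP A) (?q k) 0 \<otimes>\<^bsub>UP A\<^esub> monom (UP A) \<one> n"
      by (rule U.R.UP_monom0_mult_apply[OF R.UP_monom_closed[OF R.one_closed] qc])
    also have "\<dots> = monom (UP A) (?q k) n"
      using QA.monom_mult[OF R.UP_apply_closed[OF q] R.one_closed, of k 0 n] R.r_one[OF R.UP_apply_closed[OF q, of k]] by (simp only: add_0)
    finally show ?thesis .
  qed
  have qk: "?q k \<in> carrier A" for k by (rule R.UP_apply_closed[OF q])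
  show "?q k = \<zero>" if k: "k > n" for k
  proof -
    have "(?P k \<otimes>\<^bsub>UP A\<^esub> monom (UP A) \<one> k) n = \<zero>"
      by (rule R.UP_monom_mult_apply(2)[OF U.R.UP_apply_closed[OF P] k])
    then show ?thesis unfolding key R.UP_monom_apply[OF qk] by (simp only: simp_thms if_True)
  qed
  show "?P k l = (if k + l = n then ?q k else \<zero>)" for k l
  proof -
    have "(?P k \<otimes>\<^bsub>UP A\<^esub> monom (UP A) \<one> k) (l + k) = ?P k l"
      by (rule R.UP_monom_mult_apply(1)[OF U.R.UP_apply_closed[OF P]])
    then show ?thesis unfolding key R.UP_monom_apply[OF qk] by (metis add.commute)
  qed
qed

lemma polar_eq:
  assumes b: "b \<in> carrier B" "c \<in> carrier B" and k: "k \<le> n"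
  shows "polar n A B \<phi> k (n - k) b c = pencil_norm b c k"
proof -
  interpret U: rank_framed "UP A" "UP B" UP\<phi> m UPx UPf n by (rule UP_rank_framed)
  interpret UU: rank_framed "UP (UP A)" "UP (UP B)" U.UP\<phi> m U.UPx U.UPf n by (rule U.UP_rank_framed)
  have bc: "monom (UP B) b 0 \<in> carrier (UP B)" "monom (UP B) c 1 \<in> carrier (UP B)" using b by simp_all
  let ?P = "U.pencil_norm (monom (UP B) b 0) (monom (UP B) c 1)"
  have P: "?P \<in> carrier (UP (UP A))" using bc by simp
  have "norm_fun n (UP (UP A)) (UP (UP B)) U.UP\<phi> (U.pencil (monom (UP B) b 0) (monom (UP B) c 1)) = ?P"
    unfolding U.pencil_norm_def by (rule UU.norm_fun_nm) (use bc in simp)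
  then have "polar n A B \<phi> k (n - k) b c = coeff (UP A) (coeff (UP (UP A)) ?P k) (n - k)"
    unfolding polar_def U.pencil_def by simp
  also have "\<dots> = ?P k (n - k)" using P by (simp add: U.R.UP_coeff R.UP_coeff)
  finally show ?thesis using double_pencil[OF b, of k "n - k"] k by simp
qed

text \<open>By \<open>double_pencil\<close> the coefficient of \<open>X^k\<close> in the norm of
  \<open>X b + Y c\<close> is a multiple of \<open>Y^(n - k)\<close>; evaluate \<open>Y\<close> at
  \<open>\<nu>\<close>.\<close>

lemma pencil_norm_scale:
  assumes b: "b \<in> carrier B" "c \<in> carrier B" and \<nu>: "\<nu> \<in> carrier A" and k: "k \<le> n"
  shows "pencil_norm b (\<phi> \<nu> \<otimes>\<^bsub>B\<^esub> c) k = \<nu> [^] (n - k) \<otimes> pencil_norm b c k"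
proof -
  interpret U: rank_framed "UP A" "UP B" UP\<phi> m UPx UPf n by (rule UP_rank_framed)
  interpret E: frame_hom "UP A" "UP B" UP\<phi> m UPx UPf A B \<phi> x f "eval A A (\<lambda>a. a) \<nu>" "eval B B (\<lambda>b. b) (\<phi> \<nu>)"
    by (rule frame_hom.frame_hom_eval[OF frame_hom_id \<nu>])
  have \<nu>B: "\<phi> \<nu> \<in> carrier B" using \<nu> by simp
  have bc: "monom (UP B) b 0 \<in> carrier (UP B)" "monom (UP B) c 1 \<in> carrier (UP B)" using b by simp_all
  have ev: "eval B B (\<lambda>b. b) (\<phi> \<nu>) (monom (UP B) b 0) = b" "eval B B (\<lambda>b. b) (\<phi> \<nu>) (monom (UP B) c 1) = \<phi> \<nu> \<otimes>\<^bsub>B\<^esub> c"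
    using ring_hom_cring.UP_eval_monom[OF S.id_hom b(1) \<nu>B, of 0] ring_hom_cring.UP_eval_monom[OF S.id_hom b(2) \<nu>B, of 1] b \<nu>B
    by (simp_all add: S.m_comm)
  have "pencil_norm b (\<phi> \<nu> \<otimes>\<^bsub>B\<^esub> c) k = eval A A (\<lambda>a. a) \<nu> (U.pencil_norm (monom (UP B) b 0) (monom (UP B) c 1) k)"
    using E.pencil_norm_hom[OF U.loc_free bc, of k] unfolding ev .
  also have "U.pencil_norm (monom (UP B) b 0) (monom (UP B) c 1) k = monom (UP A) (pencil_norm b c k) (n - k)"
    using double_pencil[OF b, of k] k b by (auto simp: fun_eq_iff R.UP_monom_apply)
  also have "eval A A (\<lambda>a. a) \<nu> \<dots> = pencil_norm b c k \<otimes> \<nu> [^] (n - k)"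
    by (rule ring_hom_cring.UP_eval_monom[OF R.id_hom _ \<nu>]) (use b in simp)
  finally show ?thesis using b \<nu> by (simp add: R.m_comm)
qed

definition K :: "'a \<Rightarrow> 'b \<Rightarrow> 'b \<Rightarrow> 'a" where
  "K \<mu> b c = (\<Oplus>k\<in>{1..n}. \<mu> [^] (k - 1) \<otimes> pencil_norm b c k)"

lemma K_closed [simp]:
  "\<mu> \<in> carrier A \<Longrightarrow> b \<in> carrier B \<Longrightarrow> c \<in> carrier B \<Longrightarrow> K \<mu> b c \<in> carrier A"
  unfolding K_def by (auto intro!: R.finsum_closed)

lemma nm_add:
  assumes b: "b \<in> carrier B" "c \<in> carrier B" and \<mu>: "\<mu> \<in> carrier A"
  shows "nm (c \<oplus>\<^bsub>B\<^esub> \<phi> \<mu> \<otimes>\<^bsub>B\<^esub> b) = nm c \<oplus> \<mu> \<otimes> K \<mu> b c"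
proof -
  let ?q = "pencil_norm b c"
  have q: "?q \<in> carrier (UP A)" "\<And>k. ?q k \<in> carrier A" using b by simp_all
  have *: "nm (c \<oplus>\<^bsub>B\<^esub> \<phi> \<mu> \<otimes>\<^bsub>B\<^esub> b) = ?q 0 \<oplus> \<mu> \<otimes> K \<mu> b c" if \<mu>: "\<mu> \<in> carrier A" for \<mu>
  proof -
      interpret E: frame_hom "UP A" "UP B" UP\<phi> m UPx UPf A B \<phi> x f "eval A A (\<lambda>a. a) \<mu>" "eval B B (\<lambda>b. b) (\<phi> \<mu>)"
      by (rule frame_hom.frame_hom_eval[OF frame_hom_id \<mu>])
    have \<mu>B: "\<phi> \<mu> \<in> carrier B" using \<mu> by simp
    have "eval B B (\<lambda>b. b) (\<phi> \<mu>) (pencil b c) = b \<otimes>\<^bsub>B\<^esub> \<phi> \<mu> \<oplus>\<^bsub>B\<^esub> c"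
      unfolding pencil_def using ring_hom_cring.UP_eval_monom[OF S.id_hom b(1) \<mu>B, of 1] ring_hom_cring.UP_eval_monom[OF S.id_hom b(2) \<mu>B, of 0] b \<mu>B
      by (subst E.top.hom_add) simp_all
    also have "\<dots> = c \<oplus>\<^bsub>B\<^esub> \<phi> \<mu> \<otimes>\<^bsub>B\<^esub> b" using b \<mu>B by (simp add: S.m_comm S.a_comm)
    finally have "nm (c \<oplus>\<^bsub>B\<^esub> \<phi> \<mu> \<otimes>\<^bsub>B\<^esub> b) = eval A A (\<lambda>a. a) \<mu> ?q"
      unfolding pencil_norm_def using E.nm_hom[of "pencil b c"] b by simp
    also have "\<dots> = (\<Oplus>k\<in>{..n}. ?q k \<otimes> \<mu> [^] k)"
      by (rule ring_hom_cring.UP_eval_bound[OF R.id_hom q(1) pencil_norm_bound[OF b] \<mu>])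
    also have "{..n} = insert 0 {1..n}" by auto
    also have "(\<Oplus>k\<in>insert 0 {1..n}. ?q k \<otimes> \<mu> [^] k) = ?q 0 \<oplus> (\<Oplus>k\<in>{1..n}. ?q k \<otimes> \<mu> [^] k)"
      using q \<mu> by (subst R.finsum_insert) auto
    also have "(\<Oplus>k\<in>{1..n}. ?q k \<otimes> \<mu> [^] k) = (\<Oplus>k\<in>{1..n}. \<mu> \<otimes> (\<mu> [^] (k - 1) \<otimes> ?q k))"
    proof (rule R.finsum_cong'[OF refl])
      fix k assume "k \<in> {1..n}"
      then obtain l where "k = Suc l" by (cases k) auto
      then show "?q k \<otimes> \<mu> [^] k = \<mu> \<otimes> (\<mu> [^] (k - 1) \<otimes> ?q k)" using q \<mu> by (simp add: R.m_ac)
    qed (use q \<mu> in auto)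
    also have "\<dots> = \<mu> \<otimes> K \<mu> b c" unfolding K_def by (rule R.finsum_rdistr[symmetric]) (use q \<mu> in auto)
    finally show ?thesis .
  qed
  \<comment> \<open>The constant coefficient of the pencil norm is recognized as \<open>nm c\<close>
    by evaluating at zero; for this reason the preceding formula is proved for every scalar.\<close>
  have "nm (c \<oplus>\<^bsub>B\<^esub> \<phi> \<zero> \<otimes>\<^bsub>B\<^esub> b) = ?q 0 \<oplus> \<zero> \<otimes> K \<zero> b c" by (rule *) simp
  then have "nm c = ?q 0" using b q by simp
  then show ?thesis using *[OF \<mu>] by simp
qed

lemma norm_const_eq:
  assumes "T \<in> carrier B" "N \<in> carrier B"
  shows "norm_const n A B \<phi> T N = K ([(- 4 :: int)] \<cdot> \<one>) N (T \<otimes>\<^bsub>B\<^esub> T)"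
  unfolding norm_const_def K_def
proof (rule R.finsum_cong'[OF refl])
  have T2: "T [^]\<^bsub>B\<^esub> (2::nat) = T \<otimes>\<^bsub>B\<^esub> T" using assms by (simp add: numeral_2_eq_2)
  have q: "pencil_norm N (T \<otimes>\<^bsub>B\<^esub> T) k \<in> carrier A" for k
    by (rule R.UP_apply_closed[OF pencil_norm_closed]) (use assms in auto)
  then show "(\<lambda>k. ([(- 4 :: int)] \<cdot> \<one>) [^] (k - 1) \<otimes> pencil_norm N (T \<otimes>\<^bsub>B\<^esub> T) k) \<in> {1..n} \<rightarrow> carrier A"
    by (intro Pi_I R.m_closed R.nat_pow_closed R.add.int_pow_closed R.one_closed)
  fix k assume k: "k \<in> {1..n}"
  have "polar n A B \<phi> k (n - k) N (T [^]\<^bsub>B\<^esub> (2::nat)) = pencil_norm N (T \<otimes>\<^bsub>B\<^esub> T) k"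
    unfolding T2 by (rule polar_eq) (use assms k in auto)
  then show "[((- 4 :: int) ^ (k - 1))] \<cdot> polar n A B \<phi> k (n - k) N (T [^]\<^bsub>B\<^esub> (2::nat))
    = ([(- 4 :: int)] \<cdot> \<one>) [^] (k - 1) \<otimes> pencil_norm N (T \<otimes>\<^bsub>B\<^esub> T) k"
    using R.int_pow_mult_eq[OF q] by metis
qed

lemma norm_shift_eq:
  assumes "T \<in> carrier B" "U \<in> carrier B" "C \<in> carrier B"
  shows "norm_shift n A B \<phi> T U C = K ([(2 :: int)] \<cdot> \<one>) C (U \<otimes>\<^bsub>B\<^esub> T)"
  unfolding norm_shift_def K_def
proof (rule R.finsum_cong'[OF refl])
  have q: "pencil_norm C (U \<otimes>\<^bsub>B\<^esub> T) k \<in> carrier A" for k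
    by (rule R.UP_apply_closed[OF pencil_norm_closed]) (use assms in auto)
  then show "(\<lambda>k. ([(2 :: int)] \<cdot> \<one>) [^] (k - 1) \<otimes> pencil_norm C (U \<otimes>\<^bsub>B\<^esub> T) k) \<in> {1..n} \<rightarrow> carrier A"
    by (intro Pi_I R.m_closed R.nat_pow_closed R.add.int_pow_closed R.one_closed)
  fix k assume k: "k \<in> {1..n}"
  have "polar n A B \<phi> k (n - k) C (U \<otimes>\<^bsub>B\<^esub> T) = pencil_norm C (U \<otimes>\<^bsub>B\<^esub> T) k"
    by (rule polar_eq) (use assms k in auto)
  then show "[((2 :: int) ^ (k - 1))] \<cdot> polar n A B \<phi> k (n - k) C (U \<otimes>\<^bsub>B\<^esub> T)
    = ([(2 :: int)] \<cdot> \<one>) [^] (k - 1) \<otimes> pencil_norm C (U \<otimes>\<^bsub>B\<^esub> T) k"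
    using R.int_pow_mult_eq[OF q] by metis
qed

end

lemma (in frame_hom) K_hom:
  assumes lf: "loc_free n A B \<phi>" and b: "b \<in> carrier B" "c \<in> carrier B" and \<mu>: "\<mu> \<in> carrier A"
  shows "rank_framed.K A' B' m x' f' n (\<alpha> \<mu>) (\<beta> b) (\<beta> c) = \<alpha> (rank_framed.K A B m x f n \<mu> b c)"
proof -
  interpret X: rank_framed A B \<phi> m x f n by unfold_locales (rule lf)
  interpret X': rank_framed A' B' \<phi>' m x' f' n by unfold_locales (rule loc_free_hom[OF lf])
  have q: "X.pencil_norm b c k \<in> carrier A" for k using b by simp
  have "\<alpha> (X.K \<mu> b c) = (\<Oplus>\<^bsub>A'\<^esub>k\<in>{1..n}. \<alpha> (\<mu> [^]\<^bsub>A\<^esub> (k - 1) \<otimes>\<^bsub>A\<^esub> X.pencil_norm b c k))"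
    unfolding X.K_def by (subst base.hom_finsum) (use q \<mu> in \<open>auto simp: o_def\<close>)
  also have "\<dots> = X'.K (\<alpha> \<mu>) (\<beta> b) (\<beta> c)"
    unfolding X'.K_def
  proof (rule cod.R.finsum_cong'[OF refl])
    have \<mu>k: "\<mu> [^]\<^bsub>A\<^esub> k \<in> carrier A" for k :: nat using \<mu> by simp
    fix k
    have "\<alpha> (\<mu> [^]\<^bsub>A\<^esub> (k - 1) \<otimes>\<^bsub>A\<^esub> X.pencil_norm b c k) = \<alpha> (\<mu> [^]\<^bsub>A\<^esub> (k - 1)) \<otimes>\<^bsub>A'\<^esub> \<alpha> (X.pencil_norm b c k)"
      by (rule base.hom_mult[OF \<mu>k q])
    then show "\<alpha> (\<mu> [^]\<^bsub>A\<^esub> (k - 1) \<otimes>\<^bsub>A\<^esub> X.pencil_norm b c k) = \<alpha> \<mu> [^]\<^bsub>A'\<^esub> (k - 1) \<otimes>\<^bsub>A'\<^esub> X'.pencil_norm (\<beta> b) (\<beta> c) k"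
      unfolding pencil_norm_hom[OF lf b] base.hom_pow[OF \<mu>] .
  next
    show "(\<lambda>k. \<alpha> \<mu> [^]\<^bsub>A'\<^esub> (k - 1) \<otimes>\<^bsub>A'\<^esub> X'.pencil_norm (\<beta> b) (\<beta> c) k) \<in> {1..n} \<rightarrow> carrier A'"
      using b \<mu> by auto
  qed
  finally show ?thesis by simp
qed

section \<open>Identities for \<open>K\<close> at a cancellable scalar\<close>

context cring
begin

definition cancels :: "'a \<Rightarrow> bool" where
  "cancels \<mu> \<longleftrightarrow> \<mu> \<in> carrier R \<and> (\<forall>p\<in>carrier R. \<forall>q\<in>carrier R. \<mu> \<otimes> p = \<mu> \<otimes> q \<longrightarrow> p = q)"

lemma cancelsD: "cancels \<mu> \<Longrightarrow> \<mu> \<otimes> p = \<mu> \<otimes> q \<Longrightarrow> p \<in> carrier R \<Longrightarrow> q \<in> carrier R \<Longrightarrow> p = q"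
  by (auto simp: cancels_def)

lemma UP_var_cancels: "cring.cancels (UP R) (monom (UP R) \<one> 1)"
  unfolding cring.cancels_def[OF cring_UP] using UP_var_cancel by auto

lemma add_cancel_left:
  assumes "a \<oplus> b = a \<oplus> c" "a \<in> carrier R" "b \<in> carrier R" "c \<in> carrier R" shows "b = c"
  using arg_cong[OF assms(1), of "\<lambda>x. \<ominus> a \<oplus> x"] assms(2-4) by (simp add: r_neg1)

lemma cancel_mult_aux:
  assumes [simp]: "p \<in> carrier R" "q \<in> carrier R" "L \<in> carrier R" "k \<in> carrier R" "l \<in> carrier R" "\<mu> \<in> carrier R"
    and eq: "p \<otimes> q \<oplus> \<mu> \<otimes> L = (p \<oplus> \<mu> \<otimes> k) \<otimes> (q \<oplus> \<mu> \<otimes> l)"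
  shows "\<mu> \<otimes> L = \<mu> \<otimes> (k \<otimes> q \<oplus> l \<otimes> p \<oplus> \<mu> \<otimes> (k \<otimes> l))"
proof -
  have "p \<otimes> q \<oplus> \<mu> \<otimes> L = p \<otimes> q \<oplus> \<mu> \<otimes> (k \<otimes> q \<oplus> l \<otimes> p \<oplus> \<mu> \<otimes> (k \<otimes> l))" unfolding eq by (simp add: cring_distrib)
  then show ?thesis by (rule add_cancel_left) simp_all
qed

lemma cancel_add_aux:
  assumes [simp]: "p \<in> carrier R" "L \<in> carrier R" "k \<in> carrier R" "l \<in> carrier R" "\<mu> \<in> carrier R"
    and eq: "p \<oplus> \<mu> \<otimes> L = (p \<oplus> \<mu> \<otimes> k) \<oplus> \<mu> \<otimes> l"
  shows "\<mu> \<otimes> L = \<mu> \<otimes> (k \<oplus> l)"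
proof -
  have "p \<oplus> \<mu> \<otimes> L = p \<oplus> \<mu> \<otimes> (k \<oplus> l)" unfolding eq by (simp add: cring_distrib)
  then show ?thesis by (rule add_cancel_left) simp_all
qed

lemma cancel_scale_aux:
  assumes [simp]: "p \<in> carrier R" "L \<in> carrier R" "k \<in> carrier R" "u \<in> carrier R" "\<mu> \<in> carrier R"
    and eq: "u \<otimes> p \<oplus> \<mu> \<otimes> L = u \<otimes> (p \<oplus> \<mu> \<otimes> k)"
  shows "\<mu> \<otimes> L = \<mu> \<otimes> (u \<otimes> k)"
proof -
  have "u \<otimes> p \<oplus> \<mu> \<otimes> L = u \<otimes> p \<oplus> \<mu> \<otimes> (u \<otimes> k)" unfolding eq by (simp add: cring_distrib)
  then show ?thesis by (rule add_cancel_left) simp_all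
qed

lemma cancel_reverse_aux:
  assumes [simp]: "p \<in> carrier R" "L \<in> carrier R" "k \<in> carrier R" "\<mu> \<in> carrier R"
    and eq: "p = (p \<oplus> \<mu> \<otimes> k) \<oplus> (\<ominus> \<mu>) \<otimes> L"
  shows "\<mu> \<otimes> L = \<mu> \<otimes> k"
proof -
  have "p \<oplus> \<mu> \<otimes> L = ((p \<oplus> \<mu> \<otimes> k) \<oplus> (\<ominus> \<mu>) \<otimes> L) \<oplus> \<mu> \<otimes> L" by (simp only: eq[symmetric])
  also have "\<dots> = p \<oplus> \<mu> \<otimes> k" by (simp add: l_minus a_assoc l_neg)
  finally show ?thesis by (rule add_cancel_left) simp_all
qed

lemma cancel_square_aux:
  assumes [simp]: "N \<in> carrier R" "G \<in> carrier R" "L \<in> carrier R" "k \<in> carrier R" "l \<in> carrier R" "d \<in> carrier R" "X \<in> carrier R"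
    and eq: "(G \<otimes> (N \<otimes> N)) \<oplus> (d \<otimes> d) \<otimes> L = (G \<otimes> N \<oplus> d \<otimes> l) \<otimes> (N \<oplus> d \<otimes> k)" and X: "G \<otimes> k \<oplus> l = d \<otimes> X"
  shows "d \<otimes> (d \<otimes> L) = d \<otimes> (d \<otimes> (N \<otimes> X \<oplus> k \<otimes> l))"
proof -
  have "G \<otimes> (N \<otimes> N) \<oplus> d \<otimes> (d \<otimes> L) = (G \<otimes> N \<oplus> d \<otimes> l) \<otimes> (N \<oplus> d \<otimes> k)" by (simp flip: eq add: m_assoc)
  also have "\<dots> = G \<otimes> (N \<otimes> N) \<oplus> d \<otimes> (N \<otimes> (G \<otimes> k \<oplus> l) \<oplus> d \<otimes> (k \<otimes> l))" by (simp add: cring_distrib)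
  also have "\<dots> = G \<otimes> (N \<otimes> N) \<oplus> d \<otimes> (d \<otimes> (N \<otimes> X \<oplus> k \<otimes> l))" unfolding X by (simp add: cring_distrib)
  finally show ?thesis by (rule add_cancel_left) simp_all
qed

lemma pencil_mult_aux:
  assumes [simp]: "b \<in> carrier R" "b' \<in> carrier R" "c \<in> carrier R" "c' \<in> carrier R" "u \<in> carrier R"
  shows "b' \<otimes> c' \<oplus> u \<otimes> (b \<otimes> c' \<oplus> c \<otimes> b' \<oplus> u \<otimes> (b \<otimes> c)) = (b' \<oplus> u \<otimes> b) \<otimes> (c' \<oplus> u \<otimes> c)"
  by (simp add: cring_distrib)

text \<open>The deformation of \<open>P^2 + 4 C (P + C) = (P + 2 C)^2\<close>, which is the case
  \<open>g = 1\<close>. With \<open>d = g + 1\<close>, the mixed term of the right-hand product has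
  coefficient \<open>g d + d = d^2\<close>, matching the factor \<open>d^2\<close> on the
  left.\<close>

lemma pencil_square_aux:
  assumes [simp]: "C \<in> carrier R" "P \<in> carrier R" "g \<in> carrier R"
  shows "g \<otimes> (P \<otimes> P) \<oplus> ((g \<oplus> \<one>) \<otimes> (g \<oplus> \<one>)) \<otimes> (C \<otimes> (P \<oplus> C)) = (g \<otimes> P \<oplus> (g \<oplus> \<one>) \<otimes> C) \<otimes> (P \<oplus> (g \<oplus> \<one>) \<otimes> C)"
  by (simp add: cring_distrib)

end

context rank_framed
begin

text \<open>Expand the norm of \<open>(b' + \<mu> b) (c' + \<mu> c)\<close> once as a product and
  once along the direction on the left, then cancel \<open>\<mu>\<close>. That direction has the
  shape of Voight's formulas: \<open>\<mu> = -4\<close> gives \<open>star_const\<close> and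
  \<open>\<mu> = 2\<close> gives \<open>star_shift\<close>, and the right side has the same shape
  again.\<close>

lemma K_mult_cancel:
  assumes \<mu>: "R.cancels \<mu>" and [simp]: "b \<in> carrier B" "b' \<in> carrier B" "c \<in> carrier B" "c' \<in> carrier B"
  shows "K \<mu> (b \<otimes>\<^bsub>B\<^esub> c' \<oplus>\<^bsub>B\<^esub> c \<otimes>\<^bsub>B\<^esub> b' \<oplus>\<^bsub>B\<^esub> \<phi> \<mu> \<otimes>\<^bsub>B\<^esub> (b \<otimes>\<^bsub>B\<^esub> c)) (b' \<otimes>\<^bsub>B\<^esub> c')
    = K \<mu> b b' \<otimes> nm c' \<oplus> K \<mu> c c' \<otimes> nm b' \<oplus> \<mu> \<otimes> (K \<mu> b b' \<otimes> K \<mu> c c')" (is "?L = _")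
proof -
  have m [simp]: "\<mu> \<in> carrier A" using \<mu> by (simp add: R.cancels_def)
  have u: "\<phi> \<mu> \<in> carrier B" by simp
  have LC: "?L \<in> carrier A" by simp
  have "nm b' \<otimes> nm c' \<oplus> \<mu> \<otimes> ?L = nm (b' \<otimes>\<^bsub>B\<^esub> c') \<oplus> \<mu> \<otimes> ?L" by (simp add: nm_mult)
  also have "\<dots> = nm ((b' \<oplus>\<^bsub>B\<^esub> \<phi> \<mu> \<otimes>\<^bsub>B\<^esub> b) \<otimes>\<^bsub>B\<^esub> (c' \<oplus>\<^bsub>B\<^esub> \<phi> \<mu> \<otimes>\<^bsub>B\<^esub> c))"
    by (subst nm_add[symmetric]) (simp_all add: S.pencil_mult_aux)
  also have "\<dots> = nm (b' \<oplus>\<^bsub>B\<^esub> \<phi> \<mu> \<otimes>\<^bsub>B\<^esub> b) \<otimes> nm (c' \<oplus>\<^bsub>B\<^esub> \<phi> \<mu> \<otimes>\<^bsub>B\<^esub> c)" by (rule nm_mult) simp_all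
  also have "\<dots> = (nm b' \<oplus> \<mu> \<otimes> K \<mu> b b') \<otimes> (nm c' \<oplus> \<mu> \<otimes> K \<mu> c c')" by (simp add: nm_add)
  finally have "\<mu> \<otimes> ?L = \<mu> \<otimes> (K \<mu> b b' \<otimes> nm c' \<oplus> K \<mu> c c' \<otimes> nm b' \<oplus> \<mu> \<otimes> (K \<mu> b b' \<otimes> K \<mu> c c'))"
    by (intro R.cancel_mult_aux) simp_all
  then show ?thesis by (rule R.cancelsD[OF \<mu>]) simp_all
qed

text \<open>The step from \<open>d\<close> to \<open>d + \<mu> (b + c)\<close> is interrupted at
  \<open>d + \<mu> b\<close>, and the two increments of the norm are added.\<close>

lemma K_add_cancel:
  assumes \<mu>: "R.cancels \<mu>" and [simp]: "b \<in> carrier B" "c \<in> carrier B" "d \<in> carrier B"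
  shows "K \<mu> (b \<oplus>\<^bsub>B\<^esub> c) d = K \<mu> b d \<oplus> K \<mu> c (d \<oplus>\<^bsub>B\<^esub> \<phi> \<mu> \<otimes>\<^bsub>B\<^esub> b)"
proof -
  have m [simp]: "\<mu> \<in> carrier A" using \<mu> by (simp add: R.cancels_def)
  have "nm d \<oplus> \<mu> \<otimes> K \<mu> (b \<oplus>\<^bsub>B\<^esub> c) d = nm (d \<oplus>\<^bsub>B\<^esub> \<phi> \<mu> \<otimes>\<^bsub>B\<^esub> (b \<oplus>\<^bsub>B\<^esub> c))" by (simp add: nm_add)
  also have "d \<oplus>\<^bsub>B\<^esub> \<phi> \<mu> \<otimes>\<^bsub>B\<^esub> (b \<oplus>\<^bsub>B\<^esub> c) = (d \<oplus>\<^bsub>B\<^esub> \<phi> \<mu> \<otimes>\<^bsub>B\<^esub> b) \<oplus>\<^bsub>B\<^esub> \<phi> \<mu> \<otimes>\<^bsub>B\<^esub> c" by (simp add: S.r_distr S.a_assoc)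
  also have "nm \<dots> = (nm d \<oplus> \<mu> \<otimes> K \<mu> b d) \<oplus> \<mu> \<otimes> K \<mu> c (d \<oplus>\<^bsub>B\<^esub> \<phi> \<mu> \<otimes>\<^bsub>B\<^esub> b)"
    by (subst nm_add) (simp_all add: nm_add)
  finally have "\<mu> \<otimes> K \<mu> (b \<oplus>\<^bsub>B\<^esub> c) d = \<mu> \<otimes> (K \<mu> b d \<oplus> K \<mu> c (d \<oplus>\<^bsub>B\<^esub> \<phi> \<mu> \<otimes>\<^bsub>B\<^esub> b))"
    by (intro R.cancel_add_aux) simp_all
  then show ?thesis by (rule R.cancelsD[OF \<mu>]) simp_all
qed

lemma K_scale_cancel:
  assumes \<mu>: "R.cancels \<mu>" and [simp]: "b \<in> carrier B" "d \<in> carrier B" "u \<in> carrier B"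
  shows "K \<mu> (u \<otimes>\<^bsub>B\<^esub> b) (u \<otimes>\<^bsub>B\<^esub> d) = nm u \<otimes> K \<mu> b d"
proof -
  have m [simp]: "\<mu> \<in> carrier A" using \<mu> by (simp add: R.cancels_def)
  have "nm u \<otimes> nm d \<oplus> \<mu> \<otimes> K \<mu> (u \<otimes>\<^bsub>B\<^esub> b) (u \<otimes>\<^bsub>B\<^esub> d) = nm (u \<otimes>\<^bsub>B\<^esub> d \<oplus>\<^bsub>B\<^esub> \<phi> \<mu> \<otimes>\<^bsub>B\<^esub> (u \<otimes>\<^bsub>B\<^esub> b))"
    by (simp add: nm_add nm_mult)
  also have "u \<otimes>\<^bsub>B\<^esub> d \<oplus>\<^bsub>B\<^esub> \<phi> \<mu> \<otimes>\<^bsub>B\<^esub> (u \<otimes>\<^bsub>B\<^esub> b) = u \<otimes>\<^bsub>B\<^esub> (d \<oplus>\<^bsub>B\<^esub> \<phi> \<mu> \<otimes>\<^bsub>B\<^esub> b)" by (simp add: S.r_distr S.m_lcomm)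
  also have "nm \<dots> = nm u \<otimes> (nm d \<oplus> \<mu> \<otimes> K \<mu> b d)" by (subst nm_mult) (simp_all add: nm_add)
  finally have "\<mu> \<otimes> K \<mu> (u \<otimes>\<^bsub>B\<^esub> b) (u \<otimes>\<^bsub>B\<^esub> d) = \<mu> \<otimes> (nm u \<otimes> K \<mu> b d)"
    by (intro R.cancel_scale_aux) simp_all
  then show ?thesis by (rule R.cancelsD[OF \<mu>]) simp_all
qed

text \<open>The same step walked backwards, from \<open>d + \<mu> b\<close> to \<open>d\<close> with
  the scalar \<open>-\<mu>\<close>. It serves to exchange the scalars -4 and 4.\<close>

lemma K_reverse_cancel:
  assumes \<mu>: "R.cancels \<mu>" and [simp]: "b \<in> carrier B" "d \<in> carrier B"
  shows "K (\<ominus> \<mu>) b (d \<oplus>\<^bsub>B\<^esub> \<phi> \<mu> \<otimes>\<^bsub>B\<^esub> b) = K \<mu> b d"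
proof -
  have m [simp]: "\<mu> \<in> carrier A" using \<mu> by (simp add: R.cancels_def)
  have "d \<oplus>\<^bsub>B\<^esub> \<phi> \<mu> \<otimes>\<^bsub>B\<^esub> b \<oplus>\<^bsub>B\<^esub> \<phi> (\<ominus> \<mu>) \<otimes>\<^bsub>B\<^esub> b = d"
    by (simp add: S.a_assoc S.l_minus S.r_neg)
  then have "nm d = nm (d \<oplus>\<^bsub>B\<^esub> \<phi> \<mu> \<otimes>\<^bsub>B\<^esub> b) \<oplus> (\<ominus> \<mu>) \<otimes> K (\<ominus> \<mu>) b (d \<oplus>\<^bsub>B\<^esub> \<phi> \<mu> \<otimes>\<^bsub>B\<^esub> b)"
    using nm_add[of b "d \<oplus>\<^bsub>B\<^esub> \<phi> \<mu> \<otimes>\<^bsub>B\<^esub> b" "\<ominus> \<mu>"] by simp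
  then have "nm d = (nm d \<oplus> \<mu> \<otimes> K \<mu> b d) \<oplus> (\<ominus> \<mu>) \<otimes> K (\<ominus> \<mu>) b (d \<oplus>\<^bsub>B\<^esub> \<phi> \<mu> \<otimes>\<^bsub>B\<^esub> b)"
    using nm_add[of b d \<mu>] by simp
  then have "\<mu> \<otimes> K (\<ominus> \<mu>) b (d \<oplus>\<^bsub>B\<^esub> \<phi> \<mu> \<otimes>\<^bsub>B\<^esub> b) = \<mu> \<otimes> K \<mu> b d"
    by (intro R.cancel_reverse_aux) simp_all
  then show ?thesis by (rule R.cancelsD[OF \<mu>]) simp_all
qed

text \<open>
  The quotient of \<open>\<gamma>\<^sup>n K\<^sub>\<delta>(C, P) + K\<^sub>\<delta>(C, \<gamma>P)\<close> by \<open>\<delta> = \<gamma> + 1\<close>; its value at \<open>\<gamma> = 1\<close> is \<open>K\<^sub>2(C, P)\<close>.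
\<close>

definition half_sum :: "'a \<Rightarrow> 'a \<Rightarrow> 'b \<Rightarrow> 'b \<Rightarrow> 'a" where
  "half_sum \<gamma> \<delta> C P = (\<Oplus>k\<in>{1..n}. (if k = 1 then \<gamma> [^] (n - 1)
     else \<delta> [^] (k - 2) \<otimes> (\<gamma> [^] (n - k) \<otimes> (\<gamma> [^] k \<oplus> \<one>))) \<otimes> pencil_norm C P k)"

lemma half_sum_closed [simp]:
  assumes [simp]: "\<gamma> \<in> carrier A" "\<delta> \<in> carrier A" "C \<in> carrier B" "P \<in> carrier B"
  shows "half_sum \<gamma> \<delta> C P \<in> carrier A"
  unfolding half_sum_def by (auto intro!: R.finsum_closed R.m_closed)

text \<open>By \<open>pencil_norm_scale\<close> the \<open>k\<close>-th coefficient
  \<open>q_k\<close> is multiplied by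
  \<open>\<delta>^(k - 1) \<gamma>^(n - k) (\<gamma>^k + 1)\<close>. For \<open>k \<ge> 2\<close>
  the power of \<open>\<delta>\<close> supplies the common factor; for \<open>k = 1\<close> the
  bracket is \<open>\<gamma> + 1 = \<delta>\<close> itself, whence the case distinction in
  \<open>half_sum\<close>.\<close>

lemma half_sum:
  assumes [simp]: "\<gamma> \<in> carrier A" "C \<in> carrier B" "P \<in> carrier B" and \<delta>: "\<delta> = \<gamma> \<oplus> \<one>"
  shows "\<gamma> [^] n \<otimes> K \<delta> C P \<oplus> K \<delta> C (\<phi> \<gamma> \<otimes>\<^bsub>B\<^esub> P) = \<delta> \<otimes> half_sum \<gamma> \<delta> C P"
proof -
  let ?q = "pencil_norm C P"
  have dC [simp]: "\<delta> \<in> carrier A" by (simp add: \<delta>)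
  have q [simp]: "?q k \<in> carrier A" for k by simp
  have "\<gamma> [^] n \<otimes> K \<delta> C P = (\<Oplus>k\<in>{1..n}. \<gamma> [^] n \<otimes> (\<delta> [^] (k - 1) \<otimes> ?q k))"
    unfolding K_def by (rule R.finsum_rdistr) auto
  moreover have "K \<delta> C (\<phi> \<gamma> \<otimes>\<^bsub>B\<^esub> P) = (\<Oplus>k\<in>{1..n}. \<delta> [^] (k - 1) \<otimes> (\<gamma> [^] (n - k) \<otimes> ?q k))"
    unfolding K_def by (rule R.finsum_cong') (auto simp: pencil_norm_scale)
  ultimately have "\<gamma> [^] n \<otimes> K \<delta> C P \<oplus> K \<delta> C (\<phi> \<gamma> \<otimes>\<^bsub>B\<^esub> P)
    = (\<Oplus>k\<in>{1..n}. \<gamma> [^] n \<otimes> (\<delta> [^] (k - 1) \<otimes> ?q k) \<oplus> \<delta> [^] (k - 1) \<otimes> (\<gamma> [^] (n - k) \<otimes> ?q k))"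
    by (simp add: R.finsum_addf)
  also have "\<dots> = (\<Oplus>k\<in>{1..n}. \<delta> \<otimes> ((if k = 1 then \<gamma> [^] (n - 1)
     else \<delta> [^] (k - 2) \<otimes> (\<gamma> [^] (n - k) \<otimes> (\<gamma> [^] k \<oplus> \<one>))) \<otimes> ?q k))"
  proof (rule R.finsum_cong'[OF refl])
    fix k assume k: "k \<in> {1..n}"
    have gn: "\<gamma> [^] n = \<gamma> [^] (n - k) \<otimes> \<gamma> [^] k" using k by (simp add: R.nat_pow_mult)
    have e: "\<gamma> [^] n \<otimes> (\<delta> [^] (k - 1) \<otimes> ?q k) \<oplus> \<delta> [^] (k - 1) \<otimes> (\<gamma> [^] (n - k) \<otimes> ?q k)
      = \<delta> [^] (k - 1) \<otimes> ((\<gamma> [^] (n - k) \<otimes> (\<gamma> [^] k \<oplus> \<one>)) \<otimes> ?q k)"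
    proof -
      have "x \<otimes> y \<otimes> (z \<otimes> w) \<oplus> z \<otimes> (x \<otimes> w) = z \<otimes> ((x \<otimes> (y \<oplus> \<one>)) \<otimes> w)"
        if [simp]: "x \<in> carrier A" "y \<in> carrier A" "z \<in> carrier A" "w \<in> carrier A" for x y z w
        by (simp add: R.cring_distrib)
      from this[of "\<gamma> [^] (n - k)" "\<gamma> [^] k" "\<delta> [^] (k - 1)" "?q k"] show ?thesis unfolding gn by simp
    qed
    show "\<gamma> [^] n \<otimes> (\<delta> [^] (k - 1) \<otimes> ?q k) \<oplus> \<delta> [^] (k - 1) \<otimes> (\<gamma> [^] (n - k) \<otimes> ?q k)
      = \<delta> \<otimes> ((if k = 1 then \<gamma> [^] (n - 1) else \<delta> [^] (k - 2) \<otimes> (\<gamma> [^] (n - k) \<otimes> (\<gamma> [^] k \<oplus> \<one>))) \<otimes> ?q k)"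
    proof (cases "k = 1")
      case True
      have "x \<otimes> (\<delta> \<otimes> y) = \<delta> \<otimes> (x \<otimes> y)" if "x \<in> carrier A" "y \<in> carrier A" for x y using that by (simp add: R.m_lcomm)
      then show ?thesis unfolding e using True k by (simp add: \<delta>[symmetric] R.m_assoc)
    next
      case False
      then obtain l where "k = Suc (Suc l)" using k by (metis One_nat_def atLeastAtMost_iff not0_implies_Suc not_one_le_zero)
      then show ?thesis unfolding e by (simp add: R.m_ac)
    qed
  qed auto
  also have "\<dots> = \<delta> \<otimes> half_sum \<gamma> \<delta> C P"
    unfolding half_sum_def by (rule R.finsum_rdistr[symmetric]) (auto intro!: R.m_closed)
  finally show ?thesis .
qed

text \<open>Take norms in \<open>pencil_square_aux\<close>. The part linear in
  \<open>\<delta>\<close> is \<open>nm P\<close> times the sum treated in the lemma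
  \<open>half_sum\<close>, so it contains a second factor \<open>\<delta>\<close>, and
  \<open>\<delta>\<close> can be cancelled twice.\<close>

lemma K_square_cancel:
  assumes \<delta>: "R.cancels \<delta>" "\<delta> = \<gamma> \<oplus> \<one>" and [simp]: "\<gamma> \<in> carrier A" "C \<in> carrier B" "P \<in> carrier B"
  shows "K (\<delta> \<otimes> \<delta>) (C \<otimes>\<^bsub>B\<^esub> (P \<oplus>\<^bsub>B\<^esub> C)) (\<phi> \<gamma> \<otimes>\<^bsub>B\<^esub> (P \<otimes>\<^bsub>B\<^esub> P))
    = nm P \<otimes> half_sum \<gamma> \<delta> C P \<oplus> K \<delta> C P \<otimes> K \<delta> C (\<phi> \<gamma> \<otimes>\<^bsub>B\<^esub> P)" (is "?L = ?R")
proof -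
  have dC [simp]: "\<delta> \<in> carrier A" using \<delta>(1) by (simp add: R.cancels_def)
  have \<phi>\<delta>: "\<phi> \<delta> = \<phi> \<gamma> \<oplus>\<^bsub>B\<^esub> \<one>\<^bsub>B\<^esub>" by (simp add: \<delta>(2))
  have "\<gamma> [^] n \<otimes> (nm P \<otimes> nm P) \<oplus> (\<delta> \<otimes> \<delta>) \<otimes> ?L = nm (\<phi> \<gamma> \<otimes>\<^bsub>B\<^esub> (P \<otimes>\<^bsub>B\<^esub> P)) \<oplus> (\<delta> \<otimes> \<delta>) \<otimes> ?L"
    by (simp add: nm_mult nm_scalar)
  also have "\<dots> = nm (\<phi> \<gamma> \<otimes>\<^bsub>B\<^esub> (P \<otimes>\<^bsub>B\<^esub> P) \<oplus>\<^bsub>B\<^esub> \<phi> (\<delta> \<otimes> \<delta>) \<otimes>\<^bsub>B\<^esub> (C \<otimes>\<^bsub>B\<^esub> (P \<oplus>\<^bsub>B\<^esub> C)))"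
    by (rule nm_add[symmetric]) simp_all
  also have "\<phi> \<gamma> \<otimes>\<^bsub>B\<^esub> (P \<otimes>\<^bsub>B\<^esub> P) \<oplus>\<^bsub>B\<^esub> \<phi> (\<delta> \<otimes> \<delta>) \<otimes>\<^bsub>B\<^esub> (C \<otimes>\<^bsub>B\<^esub> (P \<oplus>\<^bsub>B\<^esub> C))
    = (\<phi> \<gamma> \<otimes>\<^bsub>B\<^esub> P \<oplus>\<^bsub>B\<^esub> \<phi> \<delta> \<otimes>\<^bsub>B\<^esub> C) \<otimes>\<^bsub>B\<^esub> (P \<oplus>\<^bsub>B\<^esub> \<phi> \<delta> \<otimes>\<^bsub>B\<^esub> C)"
    using S.pencil_square_aux[of C P "\<phi> \<gamma>"] by (simp add: \<phi>\<delta>)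
  also have "nm \<dots> = nm (\<phi> \<gamma> \<otimes>\<^bsub>B\<^esub> P \<oplus>\<^bsub>B\<^esub> \<phi> \<delta> \<otimes>\<^bsub>B\<^esub> C) \<otimes> nm (P \<oplus>\<^bsub>B\<^esub> \<phi> \<delta> \<otimes>\<^bsub>B\<^esub> C)"
    by (rule nm_mult) simp_all
  also have "\<dots> = (\<gamma> [^] n \<otimes> nm P \<oplus> \<delta> \<otimes> K \<delta> C (\<phi> \<gamma> \<otimes>\<^bsub>B\<^esub> P)) \<otimes> (nm P \<oplus> \<delta> \<otimes> K \<delta> C P)"
    by (subst (1 2) nm_add) (simp_all add: nm_mult nm_scalar)
  finally have "\<delta> \<otimes> (\<delta> \<otimes> ?L) = \<delta> \<otimes> (\<delta> \<otimes> ?R)"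
    by (intro R.cancel_square_aux[where G = "\<gamma> [^] n"] half_sum[OF _ _ _ \<delta>(2)]) simp_all
  then have "\<delta> \<otimes> ?L = \<delta> \<otimes> ?R" by (rule R.cancelsD[OF \<delta>(1)]) simp_all
  then show ?thesis by (rule R.cancelsD[OF \<delta>(1)]) simp_all
qed

section \<open>Specialization of the identities to arbitrary scalars\<close>

lemma frame_hom_eval_id:
  assumes "\<mu> \<in> carrier A"
  shows "frame_hom (UP A) (UP B) UP\<phi> m UPx UPf A B \<phi> x f (eval A A (\<lambda>a. a) \<mu>) (eval B B (\<lambda>b. b) (\<phi> \<mu>))"
  by (rule frame_hom.frame_hom_eval[OF frame_hom_id assms])

lemma eval_const_id:
  assumes "\<mu> \<in> carrier A"
  shows "a \<in> carrier A \<Longrightarrow> eval A A (\<lambda>a. a) \<mu> (monom (UP A) a 0) = a"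
    "eval A A (\<lambda>a. a) \<mu> (monom (UP A) \<one> 1) = \<mu>"
    "b \<in> carrier B \<Longrightarrow> eval B B (\<lambda>b. b) (\<phi> \<mu>) (monom (UP B) b 0) = b"
  using assms ring_hom_cring.UP_eval_monom[OF R.id_hom, of _ \<mu>] ring_hom_cring.UP_eval_monom[OF S.id_hom, of _ "\<phi> \<mu>"]
  by simp_all

text \<open>Each identity is taken over \<open>A[X]\<close> for constant arguments and the
  cancellable scalar \<open>X\<close>, then evaluated at \<open>X = \<mu>\<close>. So
  \<open>\<mu>\<close> may be a zero divisor, as 2 and -4 may be.\<close>

lemma
  assumes m: "\<mu> \<in> carrier A" and b: "b \<in> carrier B" "b' \<in> carrier B" "c \<in> carrier B" "c' \<in> carrier B"
  shows K_mult: "K \<mu> (b \<otimes>\<^bsub>B\<^esub> c' \<oplus>\<^bsub>B\<^esub> c \<otimes>\<^bsub>B\<^esub> b' \<oplus>\<^bsub>B\<^esub> \<phi> \<mu> \<otimes>\<^bsub>B\<^esub> (b \<otimes>\<^bsub>B\<^esub> c)) (b' \<otimes>\<^bsub>B\<^esub> c')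
    = K \<mu> b b' \<otimes> nm c' \<oplus> K \<mu> c c' \<otimes> nm b' \<oplus> \<mu> \<otimes> (K \<mu> b b' \<otimes> K \<mu> c c')" (is ?th1)
  and K_add: "K \<mu> (b \<oplus>\<^bsub>B\<^esub> c) b' = K \<mu> b b' \<oplus> K \<mu> c (b' \<oplus>\<^bsub>B\<^esub> \<phi> \<mu> \<otimes>\<^bsub>B\<^esub> b)" (is ?th2)
  and K_scale: "K \<mu> (c \<otimes>\<^bsub>B\<^esub> b) (c \<otimes>\<^bsub>B\<^esub> b') = nm c \<otimes> K \<mu> b b'" (is ?th3)
  and K_reverse: "K (\<ominus> \<mu>) b (b' \<oplus>\<^bsub>B\<^esub> \<phi> \<mu> \<otimes>\<^bsub>B\<^esub> b) = K \<mu> b b'" (is ?th4)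
proof -
  interpret U: rank_framed "UP A" "UP B" UP\<phi> m UPx UPf n by (rule UP_rank_framed)
  let ?e = "eval A A (\<lambda>a. a) \<mu>" and ?E = "eval B B (\<lambda>b. b) (\<phi> \<mu>)"
  interpret E: frame_hom "UP A" "UP B" UP\<phi> m UPx UPf A B \<phi> x f ?e ?E by (rule frame_hom_eval_id[OF m])
  let ?d = "monom (UP A) \<one> 1"
  have d: "?d \<in> carrier (UP A)" "U.R.cancels ?d" "?e ?d = \<mu>" "UP\<phi> ?d \<in> carrier (UP B)" "?E (UP\<phi> ?d) = \<phi> \<mu>"
    using R.UP_var_cancels eval_const_id(2)[OF m] UP_map_closed E.comm[of ?d] by simp_all
  let ?c = "\<lambda>b. monom (UP B) b 0"
  have c: "?c y \<in> carrier (UP B)" "?E (?c y) = y" if "y \<in> carrier B" for y using that eval_const_id(3)[OF m] by simp_all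
  have KE: "?e (U.K p y z) = K (?e p) (?E y) (?E z)" if "p \<in> carrier (UP A)" "y \<in> carrier (UP B)" "z \<in> carrier (UP B)" for p y z
    using E.K_hom[OF U.loc_free that(2,3,1)] by simp
  have NE: "?e (U.nm y) = nm (?E y)" if "y \<in> carrier (UP B)" for y using E.nm_hom[OF that] by simp
  note s = c[OF b(1)] c[OF b(2)] c[OF b(3)] c[OF b(4)] d
  show ?th1
    using arg_cong[OF U.K_mult_cancel[OF d(2) c(1)[OF b(1)] c(1)[OF b(2)] c(1)[OF b(3)] c(1)[OF b(4)]], of ?e]
    by (simp add: KE NE s del: One_nat_def)
  show ?th2
    using arg_cong[OF U.K_add_cancel[OF d(2) c(1)[OF b(1)] c(1)[OF b(3)] c(1)[OF b(2)]], of ?e]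
    by (simp add: KE NE s del: One_nat_def)
  show ?th3
    using arg_cong[OF U.K_scale_cancel[OF d(2) c(1)[OF b(1)] c(1)[OF b(2)] c(1)[OF b(3)]], of ?e]
    by (simp add: KE NE s del: One_nat_def)
  show ?th4
    using arg_cong[OF U.K_reverse_cancel[OF d(2) c(1)[OF b(1)] c(1)[OF b(2)]], of ?e]
    by (simp add: KE NE s del: One_nat_def)
qed

text \<open>The increment of the norm from \<open>P^2\<close> to \<open>(P + 2 C)^2\<close>, divided
  by 4, in terms of the increment from \<open>P\<close> to \<open>P + 2 C\<close>, divided by 2. It
  accounts for the change of the constant under a shift of the generator.\<close>

lemma K_square:
  assumes C: "C \<in> carrier B" and P: "P \<in> carrier B" and t: "t = \<one> \<oplus> \<one>"
  shows "K (t \<otimes> t) (C \<otimes>\<^bsub>B\<^esub> (P \<oplus>\<^bsub>B\<^esub> C)) (P \<otimes>\<^bsub>B\<^esub> P) = nm P \<otimes> K t C P \<oplus> K t C P \<otimes> K t C P"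
proof -
  interpret U: rank_framed "UP A" "UP B" UP\<phi> m UPx UPf n by (rule UP_rank_framed)
  have m: "t \<in> carrier A" by (simp add: t)
  let ?e = "eval A A (\<lambda>a. a) t" and ?E = "eval B B (\<lambda>b. b) (\<phi> t)"
  interpret E: frame_hom "UP A" "UP B" UP\<phi> m UPx UPf A B \<phi> x f ?e ?E by (rule frame_hom_eval_id[OF m])
  let ?d = "monom (UP A) \<one> 1"
  \<comment> \<open>With \<open>g = X - 1\<close> the variable is \<open>g + 1\<close>, as
    \<open>K_square_cancel\<close> demands, and \<open>g\<close> becomes \<open>\<one>\<close> when
    \<open>X\<close> is evaluated at 2.\<close>
  define g where "g = ?d \<ominus>\<^bsub>UP A\<^esub> \<one>\<^bsub>UP A\<^esub>"
  have d: "?d \<in> carrier (UP A)" "U.R.cancels ?d" "?e ?d = t"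
    using R.UP_var_cancels eval_const_id(2)[OF m] by simp_all
  have g: "g \<in> carrier (UP A)" using d by (simp add: g_def)
  have dg: "?d = g \<oplus>\<^bsub>UP A\<^esub> \<one>\<^bsub>UP A\<^esub>" using d(1) by (simp add: g_def a_minus_def U.R.a_assoc U.R.l_neg)
  have "?e g = t \<ominus> \<one>" unfolding g_def a_minus_def using d by (simp del: One_nat_def)
  also have "\<dots> = \<one>" by (simp add: t a_minus_def R.a_assoc R.r_neg)
  finally have eg: "?e g = \<one>" .
  have ug: "UP\<phi> g \<in> carrier (UP B)" "?E (UP\<phi> g) = \<one>\<^bsub>B\<^esub>"
    using UP_map_closed[OF g] E.comm[OF g, symmetric] unfolding eg hom_one .
  let ?c = "\<lambda>b. monom (UP B) b 0"
  have c: "?c y \<in> carrier (UP B)" "?E (?c y) = y" if "y \<in> carrier B" for y using that eval_const_id(3)[OF m] by simp_all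
  have KE: "?e (U.K p y z) = K (?e p) (?E y) (?E z)" if "p \<in> carrier (UP A)" "y \<in> carrier (UP B)" "z \<in> carrier (UP B)" for p y z
    using E.K_hom[OF U.loc_free that(2,3,1)] by simp
  have NE: "?e (U.nm y) = nm (?E y)" if "y \<in> carrier (UP B)" for y using E.nm_hom[OF that] by simp
  have q: "U.pencil_norm (?c C) (?c P) k \<in> carrier (UP A)" "?e (U.pencil_norm (?c C) (?c P) k) = pencil_norm C P k" for k
    using E.pencil_norm_hom[OF U.loc_free c(1)[OF C] c(1)[OF P], of k] c C P U.R.UP_apply_closed[OF U.pencil_norm_closed[OF c(1)[OF C] c(1)[OF P]], of k]
    by simp_all
  \<comment> \<open>At \<open>\<gamma> = 1\<close> the bracket \<open>\<gamma>^k + 1\<close> becomes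
    2 and raises the power \<open>t^(k - 2)\<close> to the \<open>t^(k - 1)\<close> of
    \<open>K\<close>. The term \<open>k = 1\<close> has coefficient 1 on both sides.\<close>
  have HE: "?e (U.half_sum g ?d (?c C) (?c P)) = K t C P"
  proof -
    have F: "(if k = 1 then g [^]\<^bsub>UP A\<^esub> (n - 1) else ?d [^]\<^bsub>UP A\<^esub> (k - 2) \<otimes>\<^bsub>UP A\<^esub> (g [^]\<^bsub>UP A\<^esub> (n - k) \<otimes>\<^bsub>UP A\<^esub> (g [^]\<^bsub>UP A\<^esub> k \<oplus>\<^bsub>UP A\<^esub> \<one>\<^bsub>UP A\<^esub>)))
       \<otimes>\<^bsub>UP A\<^esub> U.pencil_norm (?c C) (?c P) k \<in> carrier (UP A)" (is "?F k \<in> _") for k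
      using q d g by auto
    have "?e (U.half_sum g ?d (?c C) (?c P)) = (\<Oplus>k\<in>{1..n}. ?e (?F k))"
      unfolding U.half_sum_def by (subst E.base.hom_finsum) (use F in \<open>auto simp: o_def\<close>)
    also have "\<dots> = K t C P"
      unfolding K_def
    proof (rule R.finsum_cong'[OF refl])
      fix k assume k: "k \<in> {1..n}"
      have qk: "pencil_norm C P k \<in> carrier A" using C P by simp
      show "?e (?F k) = t [^] (k - 1) \<otimes> pencil_norm C P k"
      proof (cases "k = 1")
        case True
        then show ?thesis using q d(1) g eg E.base.hom_pow[OF g, of "n - 1"] qk C P by simp
      next
        case False
        then obtain l where l: "k = Suc (Suc l)" using k by (metis One_nat_def atLeastAtMost_iff not0_implies_Suc not_one_le_zero)
        have "?e (?F k) = t [^] l \<otimes> (\<one> \<otimes> (\<one> \<oplus> \<one>)) \<otimes> pencil_norm C P k"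
          using q d g eg E.base.hom_pow[OF g] E.base.hom_pow[OF d(1)] l by (simp del: One_nat_def)
        then show ?thesis using m qk by (simp add: l t[symmetric])
      qed
    qed (use m C P in auto)
    finally show ?thesis .
  qed
  show ?thesis
    using arg_cong[OF U.K_square_cancel[OF d(2) dg g c(1)[OF C] c(1)[OF P]], of ?e]
    by (simp add: KE NE HE c C P d ug g del: One_nat_def)
qed

end

section \<open>Quadratic algebras with a generator\<close>

text \<open>\<open>1\<close> and \<open>y\<close> form a basis and \<open>y^2 - t y + m = 0\<close>,
  hence \<open>x |-> y\<close> identifies \<open>Q(t, m)\<close> with \<open>D\<close>. This
  replaces the quotient of the polynomial ring by conditions on \<open>y\<close> that can be
  localized and glued; the relation is arranged to be free of subtraction.\<close>

definition qgen ::
  "('a, 'm) ring_scheme \<Rightarrow> ('d, 'n) ring_scheme \<Rightarrow> ('a \<Rightarrow> 'd) \<Rightarrow> 'a \<Rightarrow> 'a \<Rightarrow> 'd \<Rightarrow> bool" where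
  "qgen R D \<rho> t m y \<longleftrightarrow> t \<in> carrier R \<and> m \<in> carrier R \<and> y \<in> carrier D \<and>
     (\<forall>d\<in>carrier D. \<exists>p\<in>carrier R. \<exists>q\<in>carrier R. d = \<rho> p \<oplus>\<^bsub>D\<^esub> \<rho> q \<otimes>\<^bsub>D\<^esub> y) \<and>
     (\<forall>p\<in>carrier R. \<forall>q\<in>carrier R. \<rho> p \<oplus>\<^bsub>D\<^esub> \<rho> q \<otimes>\<^bsub>D\<^esub> y = \<zero>\<^bsub>D\<^esub> \<longrightarrow> p = \<zero>\<^bsub>R\<^esub> \<and> q = \<zero>\<^bsub>R\<^esub>) \<and>
     y \<otimes>\<^bsub>D\<^esub> y \<oplus>\<^bsub>D\<^esub> \<rho> m = \<rho> t \<otimes>\<^bsub>D\<^esub> y"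

lemma qgenD:
  assumes "qgen R D \<rho> t m y"
  shows "t \<in> carrier R" "m \<in> carrier R" "y \<in> carrier D"
    "y \<otimes>\<^bsub>D\<^esub> y \<oplus>\<^bsub>D\<^esub> \<rho> m = \<rho> t \<otimes>\<^bsub>D\<^esub> y"
    "\<And>p q. p \<in> carrier R \<Longrightarrow> q \<in> carrier R \<Longrightarrow> \<rho> p \<oplus>\<^bsub>D\<^esub> \<rho> q \<otimes>\<^bsub>D\<^esub> y = \<zero>\<^bsub>D\<^esub> \<Longrightarrow> p = \<zero>\<^bsub>R\<^esub> \<and> q = \<zero>\<^bsub>R\<^esub>"
  using assms by (auto simp: qgen_def)

lemma qgenE:
  assumes "qgen R D \<rho> t m y" "d \<in> carrier D"
  obtains p q where "p \<in> carrier R" "q \<in> carrier R" "d = \<rho> p \<oplus>\<^bsub>D\<^esub> \<rho> q \<otimes>\<^bsub>D\<^esub> y"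
  using assms by (auto simp: qgen_def)

context cring
begin

lemma lin_quad_aux:
  assumes [simp]: "p \<in> carrier R" "q \<in> carrier R" "m \<in> carrier R" "t \<in> carrier R" "y \<in> carrier R"
    and eq: "y \<otimes> y \<oplus> m = t \<otimes> y"
  shows "(p \<oplus> q \<otimes> y) \<otimes> y = \<ominus> (q \<otimes> m) \<oplus> (p \<oplus> q \<otimes> t) \<otimes> y"
proof -
  have "(p \<oplus> q \<otimes> y) \<otimes> y = p \<otimes> y \<oplus> q \<otimes> (y \<otimes> y \<oplus> m) \<ominus> q \<otimes> m" using assms(1-5) by algebra
  also have "\<dots> = \<ominus> (q \<otimes> m) \<oplus> (p \<oplus> q \<otimes> t) \<otimes> y" unfolding eq using assms(1-5) by algebra
  finally show ?thesis .
qed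

lemma lin_diff_aux:
  assumes [simp]: "p \<in> carrier R" "q \<in> carrier R" "p' \<in> carrier R" "q' \<in> carrier R" "y \<in> carrier R"
    and eq: "p \<oplus> q \<otimes> y = p' \<oplus> q' \<otimes> y"
  shows "(p \<ominus> p') \<oplus> (q \<ominus> q') \<otimes> y = \<zero>"
proof -
  have "(p \<ominus> p') \<oplus> (q \<ominus> q') \<otimes> y = (p \<oplus> q \<otimes> y) \<ominus> (p' \<oplus> q' \<otimes> y)" using assms(1-5) by algebra
  also have "\<dots> = \<zero>" unfolding eq by (simp add: r_neg a_minus_def)
  finally show ?thesis .
qed

lemma diff_quad_aux:
  assumes a[simp]: "a \<in> carrier R" and b[simp]: "b \<in> carrier R" and c[simp]: "c \<in> carrier R" and "(a \<ominus> b) \<oplus> c = \<zero>"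
  shows "a \<oplus> c = b"
proof -
  have "(a \<oplus> c) \<ominus> b = (a \<ominus> b) \<oplus> c" using a b c by algebra
  then have "(a \<oplus> c) \<ominus> b = \<zero>" unfolding assms(4) .
  from eq_by_diff[OF this a_closed[OF a c] b] show ?thesis .
qed

lemma lin_mult_aux:
  assumes [simp]: "p \<in> carrier R" "q \<in> carrier R" "c \<in> carrier R" "y \<in> carrier R"
  shows "p \<otimes> c \<oplus> (q \<otimes> c) \<otimes> y = (p \<oplus> q \<otimes> y) \<otimes> c"
  by (simp add: cring_distrib)

lemma change_quad_aux:
  assumes [simp]: "t \<in> carrier R" "m \<in> carrier R" "u \<in> carrier R" "c \<in> carrier R" "y \<in> carrier R"
    and eq: "y \<otimes> y \<oplus> m = t \<otimes> y"
  shows "(u \<otimes> y \<oplus> c) \<otimes> (u \<otimes> y \<oplus> c) \<oplus> (u \<otimes> u \<otimes> m \<oplus> u \<otimes> c \<otimes> t \<oplus> c \<otimes> c) = (u \<otimes> t \<oplus> (c \<oplus> c)) \<otimes> (u \<otimes> y \<oplus> c)"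
proof -
  have "(u \<otimes> y \<oplus> c) \<otimes> (u \<otimes> y \<oplus> c) \<oplus> (u \<otimes> u \<otimes> m \<oplus> u \<otimes> c \<otimes> t \<oplus> c \<otimes> c)
    = u \<otimes> u \<otimes> (y \<otimes> y \<oplus> m) \<oplus> (c \<oplus> c) \<otimes> u \<otimes> y \<oplus> c \<otimes> c \<oplus> (u \<otimes> c \<otimes> t \<oplus> c \<otimes> c)"
    by (simp add: cring_distrib)
  also have "\<dots> = (u \<otimes> t \<oplus> (c \<oplus> c)) \<otimes> (u \<otimes> y \<oplus> c)" unfolding eq by (simp add: cring_distrib)
  finally show ?thesis .
qed

end

context ring_hom_cring
begin

lemma qgen_unique:
  assumes y: "qgen R S h t m y" and pq: "p \<in> carrier R" "q \<in> carrier R" "p' \<in> carrier R" "q' \<in> carrier R"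
    and eq: "h p \<oplus>\<^bsub>S\<^esub> h q \<otimes>\<^bsub>S\<^esub> y = h p' \<oplus>\<^bsub>S\<^esub> h q' \<otimes>\<^bsub>S\<^esub> y"
  shows "p = p' \<and> q = q'"
proof -
  have minus: "h (a \<ominus> b) = h a \<ominus>\<^bsub>S\<^esub> h b" if "a \<in> carrier R" "b \<in> carrier R" for a b
    using that by (simp add: a_minus_def)
  have "h (p \<ominus> p') \<oplus>\<^bsub>S\<^esub> h (q \<ominus> q') \<otimes>\<^bsub>S\<^esub> y = \<zero>\<^bsub>S\<^esub>"
    unfolding minus[OF pq(1,3)] minus[OF pq(2,4)] by (rule S.lin_diff_aux) (use pq qgenD(3)[OF y] eq in auto)
  then have "p \<ominus> p' = \<zero> \<and> q \<ominus> q' = \<zero>" using pq by (intro qgenD(5)[OF y]) auto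
  then show ?thesis using pq R.eq_by_diff by blast
qed

text \<open>The parameters are read off from the coordinates \<open>-m\<close> and \<open>t\<close>
  of \<open>y^2\<close> in the basis \<open>1, y\<close>.\<close>

lemma qgen_params_unique:
  assumes y: "qgen R S h t m y" and tm: "t' \<in> carrier R" "m' \<in> carrier R"
    and eq: "y \<otimes>\<^bsub>S\<^esub> y \<oplus>\<^bsub>S\<^esub> h m' = h t' \<otimes>\<^bsub>S\<^esub> y"
  shows "t' = t \<and> m' = m"
proof -
  note [simp] = qgenD(1-3)[OF y] tm
  have aux: "\<ominus>\<^bsub>S\<^esub> a \<oplus>\<^bsub>S\<^esub> b \<otimes>\<^bsub>S\<^esub> y = y \<otimes>\<^bsub>S\<^esub> y" if "a \<in> carrier S" "b \<in> carrier S" "y \<otimes>\<^bsub>S\<^esub> y \<oplus>\<^bsub>S\<^esub> a = b \<otimes>\<^bsub>S\<^esub> y" for a b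
    using that by (simp flip: that(3) add: S.a_ac S.l_neg S.r_neg1 S.r_neg2 S.a_lcomm)
  have "h (\<ominus> m') \<oplus>\<^bsub>S\<^esub> h t' \<otimes>\<^bsub>S\<^esub> y = h (\<ominus> m) \<oplus>\<^bsub>S\<^esub> h t \<otimes>\<^bsub>S\<^esub> y"
    using aux[of "h m'" "h t'"] aux[of "h m" "h t"] eq qgenD(4)[OF y] by simp
  from qgen_unique[OF y _ _ _ _ this] have "\<ominus> m' = \<ominus> m" "t' = t" by auto
  then show ?thesis using R.minus_minus[OF tm(2)] R.minus_minus[OF qgenD(2)[OF y]] by metis
qed

lemma qgen_change:
  assumes y: "qgen R S h t m y" and u: "u \<in> carrier R" "v \<in> carrier R" "v \<otimes> u = \<one>" and c: "c \<in> carrier R"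
  shows "qgen R S h (u \<otimes> t \<oplus> (c \<oplus> c)) (u \<otimes> u \<otimes> m \<oplus> u \<otimes> c \<otimes> t \<oplus> c \<otimes> c) (h u \<otimes>\<^bsub>S\<^esub> y \<oplus>\<^bsub>S\<^esub> h c)"
proof -
  note [simp] = qgenD(1-3)[OF y] u(1,2) c
  have hvu: "h v \<otimes>\<^bsub>S\<^esub> h u = \<one>\<^bsub>S\<^esub>" using hom_mult[of v u] u(3) by simp
  have expand: "h p \<oplus>\<^bsub>S\<^esub> h q \<otimes>\<^bsub>S\<^esub> (h u \<otimes>\<^bsub>S\<^esub> y \<oplus>\<^bsub>S\<^esub> h c) = h (p \<oplus> q \<otimes> c) \<oplus>\<^bsub>S\<^esub> h (q \<otimes> u) \<otimes>\<^bsub>S\<^esub> y"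
    if "p \<in> carrier R" "q \<in> carrier R" for p q
    using that by (simp add: S.r_distr S.m_assoc S.a_ac)
  show ?thesis
    unfolding qgen_def
  proof (intro conjI ballI impI)
    fix d assume "d \<in> carrier S"
    then obtain p q where pq: "p \<in> carrier R" "q \<in> carrier R" "d = h p \<oplus>\<^bsub>S\<^esub> h q \<otimes>\<^bsub>S\<^esub> y" by (rule qgenE[OF y])
    have e1: "p \<ominus> q \<otimes> v \<otimes> c \<oplus> q \<otimes> v \<otimes> c = p" using pq by (simp add: a_minus_def R.a_assoc R.l_neg)
    have e2: "q \<otimes> v \<otimes> u = q" using pq u by (simp add: R.m_assoc)
    have "d = h (p \<ominus> q \<otimes> v \<otimes> c) \<oplus>\<^bsub>S\<^esub> h (q \<otimes> v) \<otimes>\<^bsub>S\<^esub> (h u \<otimes>\<^bsub>S\<^esub> y \<oplus>\<^bsub>S\<^esub> h c)"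
      using pq by (subst expand) (simp_all only: R.m_closed R.minus_closed u(1,2) c e1 e2)
    then show "\<exists>p\<in>carrier R. \<exists>q\<in>carrier R. d = h p \<oplus>\<^bsub>S\<^esub> h q \<otimes>\<^bsub>S\<^esub> (h u \<otimes>\<^bsub>S\<^esub> y \<oplus>\<^bsub>S\<^esub> h c)"
      using pq by (intro bexI[of _ "p \<ominus> q \<otimes> v \<otimes> c"] bexI[of _ "q \<otimes> v"]) auto
  next
    fix p q assume pq: "p \<in> carrier R" "q \<in> carrier R" and "h p \<oplus>\<^bsub>S\<^esub> h q \<otimes>\<^bsub>S\<^esub> (h u \<otimes>\<^bsub>S\<^esub> y \<oplus>\<^bsub>S\<^esub> h c) = \<zero>\<^bsub>S\<^esub>"
    then have z: "p \<oplus> q \<otimes> c = \<zero> \<and> q \<otimes> u = \<zero>" unfolding expand[OF pq] by (intro qgenD(5)[OF y]) auto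
    have "q = (q \<otimes> u) \<otimes> v" using pq u by (simp add: R.m_assoc R.m_comm[of u v])
    then have "q = \<zero>" using z by simp
    then show "p = \<zero>" "q = \<zero>" using z pq by auto
  next
    show "(h u \<otimes>\<^bsub>S\<^esub> y \<oplus>\<^bsub>S\<^esub> h c) \<otimes>\<^bsub>S\<^esub> (h u \<otimes>\<^bsub>S\<^esub> y \<oplus>\<^bsub>S\<^esub> h c) \<oplus>\<^bsub>S\<^esub> h (u \<otimes> u \<otimes> m \<oplus> u \<otimes> c \<otimes> t \<oplus> c \<otimes> c)
      = h (u \<otimes> t \<oplus> (c \<oplus> c)) \<otimes>\<^bsub>S\<^esub> (h u \<otimes>\<^bsub>S\<^esub> y \<oplus>\<^bsub>S\<^esub> h c)"
      using S.change_quad_aux[of "h t" "h m" "h u" "h c" y] qgenD(4)[OF y] by simp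
  qed auto
qed

text \<open>Writing \<open>y\<close> in terms of \<open>y'\<close> and substituting, uniqueness of
  coordinates makes the two linear coefficients inverse to each other.\<close>

lemma qgen_transition_unit:
  assumes y: "qgen R S h t m y" and y': "qgen R S h t' m' y'" and u: "u \<in> carrier R" "c \<in> carrier R"
    and eq: "y' = h u \<otimes>\<^bsub>S\<^esub> y \<oplus>\<^bsub>S\<^esub> h c"
  obtains v where "v \<in> carrier R" "v \<otimes> u = \<one>"
proof -
  note [simp] = qgenD(3)[OF y] u
  obtain p q where pq: "p \<in> carrier R" "q \<in> carrier R" "y = h p \<oplus>\<^bsub>S\<^esub> h q \<otimes>\<^bsub>S\<^esub> y'"
    by (rule qgenE[OF y' qgenD(3)[OF y]])
  have "h (p \<oplus> q \<otimes> c) \<oplus>\<^bsub>S\<^esub> h (q \<otimes> u) \<otimes>\<^bsub>S\<^esub> y = h p \<oplus>\<^bsub>S\<^esub> h q \<otimes>\<^bsub>S\<^esub> y'"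
    unfolding eq using pq(1,2) by (simp add: S.r_distr S.m_assoc S.a_ac)
  also have "\<dots> = h \<zero> \<oplus>\<^bsub>S\<^esub> h \<one> \<otimes>\<^bsub>S\<^esub> y" unfolding pq(3)[symmetric] by simp
  finally have "q \<otimes> u = \<one>" using qgen_unique[OF y, of "p \<oplus> q \<otimes> c" "q \<otimes> u" \<zero> \<one>] pq(1,2) by simp
  then show ?thesis using that pq by blast
qed

text \<open>Spanning survives because every element is a fraction with a denominator from
  \<open>R\<close> over an element already spanned. For independence, a relation over
  \<open>W\<close> is multiplied by the denominators of its coefficients and then by a further
  element of \<open>mgen R W\<close>, which yields a relation valid over \<open>V\<close>.\<close>

lemma qgen_loc_res:
  assumes VW: "V \<subseteq> W" and W: "W \<subseteq> carrier R"
    and y: "qgen (loc R V) (loc S (h ` V)) (loc_map S (h ` V) h) t m y"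
  shows "qgen (loc R W) (loc S (h ` W)) (loc_map S (h ` W) h) (loc_res R W t) (loc_res R W m) (loc_res S (h ` W) y)"
proof -
  let ?hV = "loc_map S (h ` V) h" and ?hW = "loc_map S (h ` W) h"
  let ?r = "loc_res R W" and ?d = "loc_res S (h ` W)"
  have V: "V \<subseteq> carrier R" using VW W by simp
  have V': "h ` V \<subseteq> carrier S" and W': "h ` W \<subseteq> carrier S" and VW': "h ` V \<subseteq> h ` W" using V W VW by auto
  interpret HV: ring_hom_cring "loc R V" "loc S (h ` V)" ?hV by (rule loc_map_image_hom[OF V])
  interpret HW: ring_hom_cring "loc R W" "loc S (h ` W)" ?hW by (rule loc_map_image_hom[OF W])
  interpret r: ring_hom_cring "loc R V" "loc R W" ?r by (rule R.loc_res_hom[OF VW W])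
  interpret d: ring_hom_cring "loc S (h ` V)" "loc S (h ` W)" ?d by (rule S.loc_res_hom[OF VW' W'])
  note comm = loc_map_res[OF VW W]
  note yD = qgenD[OF y]
  have lin: "?d (?hV p \<oplus>\<^bsub>loc S (h ` V)\<^esub> ?hV q \<otimes>\<^bsub>loc S (h ` V)\<^esub> y) = ?hW (?r p) \<oplus>\<^bsub>loc S (h ` W)\<^esub> ?hW (?r q) \<otimes>\<^bsub>loc S (h ` W)\<^esub> ?d y"
    if "p \<in> carrier (loc R V)" "q \<in> carrier (loc R V)" for p q
  proof -
    have "?d (?hV p \<oplus>\<^bsub>loc S (h ` V)\<^esub> ?hV q \<otimes>\<^bsub>loc S (h ` V)\<^esub> y) = ?d (?hV p) \<oplus>\<^bsub>loc S (h ` W)\<^esub> ?d (?hV q) \<otimes>\<^bsub>loc S (h ` W)\<^esub> ?d y"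
      using that yD(3) by simp
    then show ?thesis unfolding comm[OF that(1)] comm[OF that(2)] .
  qed
  show ?thesis
    unfolding qgen_def
  proof (intro conjI)
    show "?r t \<in> carrier (loc R W)" "?r m \<in> carrier (loc R W)" "?d y \<in> carrier (loc S (h ` W))" using yD by simp_all
    show "?d y \<otimes>\<^bsub>loc S (h ` W)\<^esub> ?d y \<oplus>\<^bsub>loc S (h ` W)\<^esub> ?hW (?r m) = ?hW (?r t) \<otimes>\<^bsub>loc S (h ` W)\<^esub> ?d y"
      using arg_cong[OF yD(4), of ?d] yD(1-3) unfolding comm[OF yD(1), symmetric] comm[OF yD(2), symmetric] by simp
    show "\<forall>b\<in>carrier (loc S (h ` W)). \<exists>p\<in>carrier (loc R W). \<exists>q\<in>carrier (loc R W). b = ?hW p \<oplus>\<^bsub>loc S (h ` W)\<^esub> ?hW q \<otimes>\<^bsub>loc S (h ` W)\<^esub> ?d y"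
    proof
      fix b assume "b \<in> carrier (loc S (h ` W))"
      then obtain b0 s where b: "b0 \<in> carrier S" "s \<in> mgen R W" "b = frac S (h ` W) b0 (h s)" by (rule loc_imageE[OF W])
      have bV: "frac S (h ` V) b0 \<one>\<^bsub>S\<^esub> \<in> carrier (loc S (h ` V))" using b(1) by (rule S.frac_closed) (rule S.mgen_one)
      obtain p q where pq: "p \<in> carrier (loc R V)" "q \<in> carrier (loc R V)"
        "frac S (h ` V) b0 \<one>\<^bsub>S\<^esub> = ?hV p \<oplus>\<^bsub>loc S (h ` V)\<^esub> ?hV q \<otimes>\<^bsub>loc S (h ` V)\<^esub> y" by (rule qgenE[OF y bV])
      let ?s = "frac R W \<one> s"
      have sC: "?s \<in> carrier (loc R W)" using b(2) by (intro R.frac_closed) auto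
      have "frac S (h ` W) b0 \<one>\<^bsub>S\<^esub> = ?d (frac S (h ` V) b0 \<one>\<^bsub>S\<^esub>)" using S.loc_res_frac[OF VW' W' b(1) S.mgen_one] by simp
      also have "\<dots> = ?hW (?r p) \<oplus>\<^bsub>loc S (h ` W)\<^esub> ?hW (?r q) \<otimes>\<^bsub>loc S (h ` W)\<^esub> ?d y" unfolding pq(3) by (rule lin[OF pq(1,2)])
      finally have *: "frac S (h ` W) b0 \<one>\<^bsub>S\<^esub> = ?hW (?r p) \<oplus>\<^bsub>loc S (h ` W)\<^esub> ?hW (?r q) \<otimes>\<^bsub>loc S (h ` W)\<^esub> ?d y" .
      have hs: "?hW ?s = frac S (h ` W) \<one>\<^bsub>S\<^esub> (h s)" using loc_map_image_frac[OF W R.one_closed b(2)] by simp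
      have "b = ?hW ?s \<otimes>\<^bsub>loc S (h ` W)\<^esub> frac S (h ` W) b0 \<one>\<^bsub>S\<^esub>"
        unfolding b(3) hs by (rule S.frac_eq_mult[OF W' b(1) hom_mem_mgen[OF W b(2)]])
      also have "\<dots> = ?hW (?s \<otimes>\<^bsub>loc R W\<^esub> ?r p) \<oplus>\<^bsub>loc S (h ` W)\<^esub> ?hW (?s \<otimes>\<^bsub>loc R W\<^esub> ?r q) \<otimes>\<^bsub>loc S (h ` W)\<^esub> ?d y"
        unfolding * using sC pq(1,2) yD(3) by (simp add: HW.S.r_distr HW.S.m_assoc)
      finally show "\<exists>p\<in>carrier (loc R W). \<exists>q\<in>carrier (loc R W). b = ?hW p \<oplus>\<^bsub>loc S (h ` W)\<^esub> ?hW q \<otimes>\<^bsub>loc S (h ` W)\<^esub> ?d y"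
        using sC pq(1,2) by (intro bexI[of _ "?s \<otimes>\<^bsub>loc R W\<^esub> ?r p"] bexI[of _ "?s \<otimes>\<^bsub>loc R W\<^esub> ?r q"]) auto
    qed
    show "\<forall>p\<in>carrier (loc R W). \<forall>q\<in>carrier (loc R W). ?hW p \<oplus>\<^bsub>loc S (h ` W)\<^esub> ?hW q \<otimes>\<^bsub>loc S (h ` W)\<^esub> ?d y = \<zero>\<^bsub>loc S (h ` W)\<^esub>
        \<longrightarrow> p = \<zero>\<^bsub>loc R W\<^esub> \<and> q = \<zero>\<^bsub>loc R W\<^esub>"
    proof (intro ballI impI)
      fix p q assume p: "p \<in> carrier (loc R W)" and q: "q \<in> carrier (loc R W)"
        and z: "?hW p \<oplus>\<^bsub>loc S (h ` W)\<^esub> ?hW q \<otimes>\<^bsub>loc S (h ` W)\<^esub> ?d y = \<zero>\<^bsub>loc S (h ` W)\<^esub>"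
      obtain p0 s where p0: "p0 \<in> carrier R" "s \<in> mgen R W" "p = frac R W p0 s" by (rule R.loc_carrierE[OF p])
      obtain q0 s' where q0: "q0 \<in> carrier R" "s' \<in> mgen R W" "q = frac R W q0 s'" by (rule R.loc_carrierE[OF q])
      have s: "s \<in> carrier R" "s' \<in> carrier R" using p0 q0 R.mgen_closed[OF W] by auto
      let ?f = "\<lambda>a. frac R W a \<one>" and ?g = "\<lambda>a. frac R V a \<one>"
      have fC: "?f a \<in> carrier (loc R W)" "?g a \<in> carrier (loc R V)" if "a \<in> carrier R" for a using that by auto
      have rg: "?r (?g a) = ?f a" if "a \<in> carrier R" for a using R.loc_res_frac[OF VW W that R.mgen_one] .
      have pp: "p \<otimes>\<^bsub>loc R W\<^esub> ?f (s \<otimes> s') = ?f (p0 \<otimes> s')"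
        unfolding p0(3) using p0 q0 s by (simp add: R.loc_mult[OF W]) (rule R.frac_eqI[OF W], simp_all add: R.m_ac)
      have qq: "q \<otimes>\<^bsub>loc R W\<^esub> ?f (s \<otimes> s') = ?f (q0 \<otimes> s)"
        unfolding q0(3) using p0 q0 s by (simp add: R.loc_mult[OF W]) (rule R.frac_eqI[OF W], simp_all add: R.m_ac)
      let ?p = "?g (p0 \<otimes> s')" and ?q = "?g (q0 \<otimes> s)"
      have C: "?p \<in> carrier (loc R V)" "?q \<in> carrier (loc R V)" using fC p0 q0 s by simp_all
      let ?z = "?hV ?p \<oplus>\<^bsub>loc S (h ` V)\<^esub> ?hV ?q \<otimes>\<^bsub>loc S (h ` V)\<^esub> y"
      have zC: "?z \<in> carrier (loc S (h ` V))" using C yD(3) by simp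
      have ssC: "?f (s \<otimes> s') \<in> carrier (loc R W)" using fC s by simp
      have "?d ?z = ?hW (p \<otimes>\<^bsub>loc R W\<^esub> ?f (s \<otimes> s')) \<oplus>\<^bsub>loc S (h ` W)\<^esub> ?hW (q \<otimes>\<^bsub>loc R W\<^esub> ?f (s \<otimes> s')) \<otimes>\<^bsub>loc S (h ` W)\<^esub> ?d y"
        unfolding lin[OF C] pp qq using rg p0 q0 s by simp
      also have "\<dots> = (?hW p \<oplus>\<^bsub>loc S (h ` W)\<^esub> ?hW q \<otimes>\<^bsub>loc S (h ` W)\<^esub> ?d y) \<otimes>\<^bsub>loc S (h ` W)\<^esub> ?hW (?f (s \<otimes> s'))"
        unfolding HW.hom_mult[OF p ssC] HW.hom_mult[OF q ssC]
        by (rule HW.S.lin_mult_aux[OF HW.hom_closed[OF p] HW.hom_closed[OF q] HW.hom_closed[OF ssC] d.hom_closed[OF yD(3)]])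
      also have "\<dots> = \<zero>\<^bsub>loc S (h ` W)\<^esub>" unfolding z by (rule HW.S.l_null[OF HW.hom_closed[OF ssC]])
      finally have dz: "?d ?z = \<zero>\<^bsub>loc S (h ` W)\<^esub>" .
      obtain b v where b: "b \<in> carrier S" "v \<in> mgen R V" "?z = frac S (h ` V) b (h v)" by (rule loc_imageE[OF V zC])
      have hvV: "h v \<in> mgen S (h ` V)" by (rule hom_mem_mgen[OF V b(2)])
      then have hvW: "h v \<in> mgen S (h ` W)" using S.mgen_mono[OF VW'] by auto
      have "frac S (h ` W) b (h v) = frac S (h ` W) \<zero>\<^bsub>S\<^esub> \<one>\<^bsub>S\<^esub>"
        using dz S.loc_res_frac[OF VW' W' b(1) hvV] unfolding b(3) S.loc_zero by simp
      then obtain w' where w': "w' \<in> mgen S (h ` W)" "w' \<otimes>\<^bsub>S\<^esub> (b \<otimes>\<^bsub>S\<^esub> \<one>\<^bsub>S\<^esub>) = w' \<otimes>\<^bsub>S\<^esub> (\<zero>\<^bsub>S\<^esub> \<otimes>\<^bsub>S\<^esub> h v)"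
        using iffD1[OF S.frac_eq_iff[OF W' b(1) hvW S.zero_closed S.mgen_one]] by blast
      then obtain w where w: "w \<in> mgen R W" "w' = h w" by (auto simp: mgen_image[OF W])
      have wC: "w \<in> carrier R" using w R.mgen_closed[OF W] by simp
      have wb: "h w \<otimes>\<^bsub>S\<^esub> b = \<zero>\<^bsub>S\<^esub>" using w'(2) w(2) b(1) wC R.mgen_closed[OF V b(2)] by simp
      have "?hV (?g w) \<otimes>\<^bsub>loc S (h ` V)\<^esub> ?z = frac S (h ` V) (h w \<otimes>\<^bsub>S\<^esub> b) (\<one>\<^bsub>S\<^esub> \<otimes>\<^bsub>S\<^esub> h v)"
        unfolding b(3) loc_map_image_frac[OF V wC R.mgen_one] hom_one
        by (rule S.loc_mult[OF V' _ S.mgen_one b(1) hvV]) (use wC in simp)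
      also have "\<dots> = \<zero>\<^bsub>loc S (h ` V)\<^esub>"
        unfolding wb S.loc_zero by (rule S.frac_eqI[OF V' S.zero_closed _ S.zero_closed S.mgen_one])
          (use hvV S.mgen_closed[OF V' hvV] in simp_all)
      finally have "?hV (?g w \<otimes>\<^bsub>loc R V\<^esub> ?p) \<oplus>\<^bsub>loc S (h ` V)\<^esub> ?hV (?g w \<otimes>\<^bsub>loc R V\<^esub> ?q) \<otimes>\<^bsub>loc S (h ` V)\<^esub> y = \<zero>\<^bsub>loc S (h ` V)\<^esub>"
        using C fC(2)[OF wC] yD(3) by (simp add: HV.S.r_distr HV.S.m_assoc)
      then have gz: "?g w \<otimes>\<^bsub>loc R V\<^esub> ?p = \<zero>\<^bsub>loc R V\<^esub> \<and> ?g w \<otimes>\<^bsub>loc R V\<^esub> ?q = \<zero>\<^bsub>loc R V\<^esub>"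
        using C fC(2)[OF wC] by (intro yD(5)) simp_all
      \<comment> \<open>The multipliers used to descend to \<open>V\<close> are units over
        \<open>W\<close> and can be removed again.\<close>
      have kill: "a = \<zero>\<^bsub>loc R W\<^esub>" if a: "a \<in> carrier (loc R W)" and u: "u \<in> mgen R W" and au: "?f u \<otimes>\<^bsub>loc R W\<^esub> a = \<zero>\<^bsub>loc R W\<^esub>" for a u
      proof -
        have uC: "u \<in> carrier R" using u R.mgen_closed[OF W] by simp
        have iC: "frac R W \<one> u \<in> carrier (loc R W)" using u by (intro R.frac_closed) auto
        have "a = (frac R W \<one> u \<otimes>\<^bsub>loc R W\<^esub> ?f u) \<otimes>\<^bsub>loc R W\<^esub> a" unfolding R.frac_denom_unit[OF W u] using a by simp
        also have "\<dots> = frac R W \<one> u \<otimes>\<^bsub>loc R W\<^esub> (?f u \<otimes>\<^bsub>loc R W\<^esub> a)" using a iC fC(1)[OF uC] by (simp add: HW.R.m_assoc)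
        finally show ?thesis unfolding au using iC by simp
      qed
      have rgz: "?f w \<otimes>\<^bsub>loc R W\<^esub> ?f a = \<zero>\<^bsub>loc R W\<^esub>" if "a \<in> carrier R" "?g w \<otimes>\<^bsub>loc R V\<^esub> ?g a = \<zero>\<^bsub>loc R V\<^esub>" for a
        using r.hom_mult[OF fC(2)[OF wC] fC(2)[OF that(1)]] that(2) r.hom_zero rg[OF wC] rg[OF that(1)] by simp
      have "?f (p0 \<otimes> s') = \<zero>\<^bsub>loc R W\<^esub>" "?f (q0 \<otimes> s) = \<zero>\<^bsub>loc R W\<^esub>"
        using kill[OF fC(1) w(1) rgz] gz p0 q0 s by simp_all
      then have "?f (s \<otimes> s') \<otimes>\<^bsub>loc R W\<^esub> p = \<zero>\<^bsub>loc R W\<^esub>" "?f (s \<otimes> s') \<otimes>\<^bsub>loc R W\<^esub> q = \<zero>\<^bsub>loc R W\<^esub>"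
        using pp qq p q ssC by (simp_all add: HW.R.m_comm)
      then show "p = \<zero>\<^bsub>loc R W\<^esub> \<and> q = \<zero>\<^bsub>loc R W\<^esub>"
        using kill[OF p R.mgen_mult[OF p0(2) q0(2)]] kill[OF q R.mgen_mult[OF p0(2) q0(2)]] by simp
    qed
  qed
qed

text \<open>Powers of \<open>y\<close> reduce to the span of \<open>1, y\<close> by the quadratic
  relation, which gives spanning. Independence is division by a monic polynomial: a multiple of
  \<open>x^2 - t x + m\<close> of degree at most 1 vanishes, since the leading coefficient of the
  cofactor survives.\<close>

lemma Q_chart_qgen:
  assumes Q: "Q_chart R S h t m y"
  shows "qgen R S h t m y"
proof -
  have tm: "t \<in> carrier R" "m \<in> carrier R" using Q by (auto simp: Q_chart_def)
  obtain k where k: "alg_iso R (Q_alg R t m) (Q_struct R t m) S h k" "k (Q_gen R t m) = y" using Q by (auto simp: Q_chart_def)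
  interpret P: cring "UP R" by (rule R.cring_UP)
  interpret UP: UP_cring R "UP R" by (simp_all add: R.UP_cring_axiom)
  define g where "g = (monom (UP R) \<one> 2 \<ominus>\<^bsub>UP R\<^esub> monom (UP R) t 1) \<oplus>\<^bsub>UP R\<^esub> monom (UP R) m 0"
  have gC: "g \<in> carrier (UP R)" using tm by (simp add: g_def)
  have I: "Q_ideal R t m = PIdl\<^bsub>UP R\<^esub> g" by (simp add: Q_ideal_def g_def)
  have idl: "ideal (Q_ideal R t m) (UP R)" unfolding I by (rule P.cgenideal_ideal[OF gC])
  interpret I: ideal "Q_ideal R t m" "UP R" by (rule idl)
  have kiso: "k \<in> ring_iso (Q_alg R t m) S" and kh: "\<And>a. a \<in> carrier R \<Longrightarrow> k (Q_struct R t m a) = h a"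
    using k by (auto simp: alg_iso_def)
  have khom: "k \<in> ring_hom (Q_alg R t m) S" and kbij: "bij_betw k (carrier (Q_alg R t m)) (carrier S)"
    using kiso by (auto simp: ring_iso_def)
  let ?\<pi> = "\<lambda>p. k (Q_ideal R t m +>\<^bsub>UP R\<^esub> p)"
  have proj: "(\<lambda>p. Q_ideal R t m +>\<^bsub>UP R\<^esub> p) \<in> ring_hom (UP R) (Q_alg R t m)"
    unfolding Q_alg_def by (rule I.rcos_ring_hom)
  have "?\<pi> \<in> ring_hom (UP R) S" using ring_hom_trans[OF proj khom] by (simp add: o_def)
  then interpret \<pi>: ring_hom_cring "UP R" S ?\<pi>
    using P.is_cring S.is_cring by (simp add: ring_hom_cring_def ring_hom_cring_axioms_def)
  have \<pi>c: "?\<pi> (monom (UP R) a 0) = h a" if "a \<in> carrier R" for a using kh[OF that] by (simp add: Q_struct_def)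
  have \<pi>x: "?\<pi> (monom (UP R) \<one> 1) = y" using k(2) by (simp add: Q_gen_def)
  have yC: "y \<in> carrier S" using \<pi>.hom_closed[of "monom (UP R) \<one> 1"] unfolding \<pi>x by simp
  have \<pi>m: "?\<pi> (monom (UP R) a i) = h a \<otimes>\<^bsub>S\<^esub> y [^]\<^bsub>S\<^esub> i" if a: "a \<in> carrier R" for a and i :: nat
  proof -
    have "monom (UP R) a i = monom (UP R) a 0 \<otimes>\<^bsub>UP R\<^esub> monom (UP R) \<one> 1 [^]\<^bsub>UP R\<^esub> i"
      using UP.monom_pow[OF R.one_closed, of 1 i] UP.monom_mult[OF a R.one_closed, of 0 i] a by simp
    then show ?thesis using \<pi>.hom_mult[of "monom (UP R) a 0" "monom (UP R) \<one> 1 [^]\<^bsub>UP R\<^esub> i"] \<pi>.hom_pow[of "monom (UP R) \<one> 1" i] \<pi>c[OF a] \<pi>x a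
      by simp
  qed
  have "g \<in> Q_ideal R t m" unfolding I by (rule P.cgenideal_self[OF gC])
  then have "Q_ideal R t m +>\<^bsub>UP R\<^esub> g = Q_ideal R t m +>\<^bsub>UP R\<^esub> \<zero>\<^bsub>UP R\<^esub>"
    using I.a_rcos_const[OF \<open>g \<in> Q_ideal R t m\<close>] I.a_rcos_const[OF I.zero_closed] by simp
  then have "?\<pi> g = \<zero>\<^bsub>S\<^esub>" using \<pi>.hom_zero by simp
  moreover have "?\<pi> g = (y \<otimes>\<^bsub>S\<^esub> y \<ominus>\<^bsub>S\<^esub> h t \<otimes>\<^bsub>S\<^esub> y) \<oplus>\<^bsub>S\<^esub> h m"
    unfolding g_def a_minus_def using tm yC \<pi>m[OF R.one_closed, of 2] \<pi>m[OF tm(1), of 1] \<pi>c[OF tm(2)]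
    by (simp add: numeral_2_eq_2)
  ultimately have "(y \<otimes>\<^bsub>S\<^esub> y \<ominus>\<^bsub>S\<^esub> h t \<otimes>\<^bsub>S\<^esub> y) \<oplus>\<^bsub>S\<^esub> h m = \<zero>\<^bsub>S\<^esub>" by simp
  then have rel: "y \<otimes>\<^bsub>S\<^esub> y \<oplus>\<^bsub>S\<^esub> h m = h t \<otimes>\<^bsub>S\<^esub> y"
    using S.diff_quad_aux[of "y \<otimes>\<^bsub>S\<^esub> y" "h t \<otimes>\<^bsub>S\<^esub> y" "h m"] tm yC by simp
  have pow: "\<exists>p\<in>carrier R. \<exists>q\<in>carrier R. y [^]\<^bsub>S\<^esub> i = h p \<oplus>\<^bsub>S\<^esub> h q \<otimes>\<^bsub>S\<^esub> y" for i :: nat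
  proof (induction i)
    case 0
    have "y [^]\<^bsub>S\<^esub> (0::nat) = h \<one> \<oplus>\<^bsub>S\<^esub> h \<zero> \<otimes>\<^bsub>S\<^esub> y" using yC by simp
    then show ?case by blast
  next
    case (Suc i)
    then obtain p q where pq: "p \<in> carrier R" "q \<in> carrier R" "y [^]\<^bsub>S\<^esub> i = h p \<oplus>\<^bsub>S\<^esub> h q \<otimes>\<^bsub>S\<^esub> y" by blast
    have "y [^]\<^bsub>S\<^esub> Suc i = \<ominus>\<^bsub>S\<^esub> (h q \<otimes>\<^bsub>S\<^esub> h m) \<oplus>\<^bsub>S\<^esub> (h p \<oplus>\<^bsub>S\<^esub> h q \<otimes>\<^bsub>S\<^esub> h t) \<otimes>\<^bsub>S\<^esub> y"
      unfolding S.nat_pow_Suc pq(3) by (rule S.lin_quad_aux) (use pq tm yC rel in auto)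
    also have "\<dots> = h (\<ominus> (q \<otimes> m)) \<oplus>\<^bsub>S\<^esub> h (p \<oplus> q \<otimes> t) \<otimes>\<^bsub>S\<^esub> y" using pq tm by simp
    finally show ?case using pq(1,2) tm by blast
  qed
  show ?thesis
    unfolding qgen_def
  proof (intro conjI)
    show "\<forall>d\<in>carrier S. \<exists>p\<in>carrier R. \<exists>q\<in>carrier R. d = h p \<oplus>\<^bsub>S\<^esub> h q \<otimes>\<^bsub>S\<^esub> y"
    proof
      fix d assume "d \<in> carrier S"
      then obtain c where "c \<in> carrier (Q_alg R t m)" "d = k c" using kbij by (auto simp: bij_betw_def)
      then obtain p where p: "p \<in> carrier (UP R)" "d = ?\<pi> p" by (auto simp: Q_alg_def FactRing_def A_RCOSETS_def')
      let ?F = "\<lambda>i. monom (UP R) (coeff (UP R) p i) i"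
      have pi: "coeff (UP R) p i \<in> carrier R" for i using p by (simp add: R.UP_coeff)
      have "d = ?\<pi> (\<Oplus>\<^bsub>UP R\<^esub>i\<in>{..deg R p}. ?F i)" using UP.up_repr[OF p(1)] p(2) by simp
      also have "\<dots> = (\<Oplus>\<^bsub>S\<^esub>i\<in>{..deg R p}. ?\<pi> (?F i))" by (subst \<pi>.hom_finsum) (use pi in \<open>auto simp: o_def\<close>)
      finally have d: "d = (\<Oplus>\<^bsub>S\<^esub>i\<in>{..deg R p}. h (coeff (UP R) p i) \<otimes>\<^bsub>S\<^esub> y [^]\<^bsub>S\<^esub> i)" unfolding \<pi>m[OF pi] .
      have "\<exists>a\<in>carrier R. \<exists>b\<in>carrier R. (\<Oplus>\<^bsub>S\<^esub>i\<in>J. h (coeff (UP R) p i) \<otimes>\<^bsub>S\<^esub> y [^]\<^bsub>S\<^esub> i) = h a \<oplus>\<^bsub>S\<^esub> h b \<otimes>\<^bsub>S\<^esub> y" if "finite J" for J :: "nat set"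
        using that
      proof (induction J)
        case empty
        have "\<zero>\<^bsub>S\<^esub> = h \<zero> \<oplus>\<^bsub>S\<^esub> h \<zero> \<otimes>\<^bsub>S\<^esub> y" using yC by simp
        then show ?case unfolding S.finsum_empty by blast
      next
        case (insert j J)
        obtain a b where ab: "a \<in> carrier R" "b \<in> carrier R" "(\<Oplus>\<^bsub>S\<^esub>i\<in>J. h (coeff (UP R) p i) \<otimes>\<^bsub>S\<^esub> y [^]\<^bsub>S\<^esub> i) = h a \<oplus>\<^bsub>S\<^esub> h b \<otimes>\<^bsub>S\<^esub> y"
          using insert.IH by blast
        obtain e f where ef: "e \<in> carrier R" "f \<in> carrier R" "y [^]\<^bsub>S\<^esub> j = h e \<oplus>\<^bsub>S\<^esub> h f \<otimes>\<^bsub>S\<^esub> y" using pow by blast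
        let ?c = "coeff (UP R) p j"
        have "(\<Oplus>\<^bsub>S\<^esub>i\<in>insert j J. h (coeff (UP R) p i) \<otimes>\<^bsub>S\<^esub> y [^]\<^bsub>S\<^esub> i)
          = h ?c \<otimes>\<^bsub>S\<^esub> (h e \<oplus>\<^bsub>S\<^esub> h f \<otimes>\<^bsub>S\<^esub> y) \<oplus>\<^bsub>S\<^esub> (h a \<oplus>\<^bsub>S\<^esub> h b \<otimes>\<^bsub>S\<^esub> y)"
          unfolding ef(3)[symmetric] ab(3)[symmetric] using insert.hyps pi yC by (intro S.finsum_insert) auto
        also have "\<dots> = h (?c \<otimes> e \<oplus> a) \<oplus>\<^bsub>S\<^esub> h (?c \<otimes> f \<oplus> b) \<otimes>\<^bsub>S\<^esub> y"
          using ab(1,2) ef(1,2) pi[of j] yC by (simp add: S.r_distr S.l_distr S.m_assoc S.a_ac)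
        finally show ?case using ab(1,2) ef(1,2) pi[of j] by blast
      qed
      from this[of "{..deg R p}"] show "\<exists>p\<in>carrier R. \<exists>q\<in>carrier R. d = h p \<oplus>\<^bsub>S\<^esub> h q \<otimes>\<^bsub>S\<^esub> y" unfolding d by simp
    qed
    show "\<forall>p\<in>carrier R. \<forall>q\<in>carrier R. h p \<oplus>\<^bsub>S\<^esub> h q \<otimes>\<^bsub>S\<^esub> y = \<zero>\<^bsub>S\<^esub> \<longrightarrow> p = \<zero> \<and> q = \<zero>"
    proof (intro ballI impI)
      fix p q assume p: "p \<in> carrier R" and q: "q \<in> carrier R" and z: "h p \<oplus>\<^bsub>S\<^esub> h q \<otimes>\<^bsub>S\<^esub> y = \<zero>\<^bsub>S\<^esub>"
      let ?l = "monom (UP R) p 0 \<oplus>\<^bsub>UP R\<^esub> monom (UP R) q 1"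
      have lC: "?l \<in> carrier (UP R)" using p q by simp
      have "?\<pi> ?l = \<zero>\<^bsub>S\<^esub>" using \<pi>c[OF p] \<pi>m[OF q, of 1] p q yC z \<pi>.hom_add[of "monom (UP R) p 0" "monom (UP R) q 1"] by simp
      then have "k (Q_ideal R t m +>\<^bsub>UP R\<^esub> ?l) = k (Q_ideal R t m +>\<^bsub>UP R\<^esub> \<zero>\<^bsub>UP R\<^esub>)" using \<pi>.hom_zero by simp
      then have "Q_ideal R t m +>\<^bsub>UP R\<^esub> ?l = Q_ideal R t m +>\<^bsub>UP R\<^esub> \<zero>\<^bsub>UP R\<^esub>"
        using kbij ring_hom_closed[OF proj lC] ring_hom_closed[OF proj P.zero_closed] by (auto simp: bij_betw_def inj_on_def)
      then have "?l \<in> Q_ideal R t m" using I.a_rcos_self[OF lC] I.a_rcos_const[OF I.zero_closed] by simp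
      then obtain s where s: "s \<in> carrier (UP R)" "?l = s \<otimes>\<^bsub>UP R\<^esub> g" unfolding I cgenideal_def by auto
      have sc: "s i \<in> carrier R" for i using s(1) by simp
      \<comment> \<open>Only coefficients from degree 2 on are compared; there the linear polynomial
        \<open>?l\<close> contributes nothing, and the cofactor satisfies a recursion that yields
        \<open>s i\<close> from the two coefficients above it.\<close>
      have coef: "?l (i + 2) = (s i \<ominus> t \<otimes> s (i + 1)) \<oplus> m \<otimes> s (i + 2)" for i
      proof -
        have x2: "(s \<otimes>\<^bsub>UP R\<^esub> monom (UP R) \<one> 2) (i + 2) = s i" by (rule R.UP_monom_mult_apply(1)[OF s(1)])
        have tx: "monom (UP R) t 1 = monom (UP R) \<one> 1 \<otimes>\<^bsub>UP R\<^esub> monom (UP R) t 0" using UP.monom_mult[OF R.one_closed tm(1), of 1 0] tm by simp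
        have sx: "s \<otimes>\<^bsub>UP R\<^esub> monom (UP R) \<one> 1 \<in> carrier (UP R)" using s(1) by simp
        have "(s \<otimes>\<^bsub>UP R\<^esub> monom (UP R) t 1) (i + 2) = ((s \<otimes>\<^bsub>UP R\<^esub> monom (UP R) \<one> 1) \<otimes>\<^bsub>UP R\<^esub> monom (UP R) t 0) (i + 2)"
          unfolding tx using s(1) tm by (simp add: P.m_assoc)
        also have "\<dots> = (s \<otimes>\<^bsub>UP R\<^esub> monom (UP R) \<one> 1) (i + 2) \<otimes> t" by (rule R.UP_monom0_mult_apply[OF tm(1) sx])
        also have "(s \<otimes>\<^bsub>UP R\<^esub> monom (UP R) \<one> 1) (i + 2) = s (i + 1)" using R.UP_monom_mult_apply(1)[OF s(1), of 1 "i + 1"] by simp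
        finally have x1: "(s \<otimes>\<^bsub>UP R\<^esub> monom (UP R) t 1) (i + 2) = t \<otimes> s (i + 1)" using sc tm by (simp add: R.m_comm)
        have x0: "(s \<otimes>\<^bsub>UP R\<^esub> monom (UP R) m 0) (i + 2) = m \<otimes> s (i + 2)"
          using R.UP_monom0_mult_apply[OF tm(2) s(1), of "i + 2"] sc tm by (simp add: R.m_comm)
        have neg: "(\<ominus>\<^bsub>UP R\<^esub> z) j = \<ominus> z j" if "z \<in> carrier (UP R)" for z j
          using UP.coeff_a_inv[OF that, of j] that by (simp add: R.UP_coeff)
        have "s \<otimes>\<^bsub>UP R\<^esub> g = (s \<otimes>\<^bsub>UP R\<^esub> monom (UP R) \<one> 2 \<oplus>\<^bsub>UP R\<^esub> \<ominus>\<^bsub>UP R\<^esub> (s \<otimes>\<^bsub>UP R\<^esub> monom (UP R) t 1)) \<oplus>\<^bsub>UP R\<^esub> s \<otimes>\<^bsub>UP R\<^esub> monom (UP R) m 0"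
          unfolding g_def a_minus_def using s(1) tm by (simp add: P.r_distr P.r_minus)
        then have "(s \<otimes>\<^bsub>UP R\<^esub> g) (i + 2) = ((s \<otimes>\<^bsub>UP R\<^esub> monom (UP R) \<one> 2) (i + 2) \<oplus> \<ominus> (s \<otimes>\<^bsub>UP R\<^esub> monom (UP R) t 1) (i + 2)) \<oplus> (s \<otimes>\<^bsub>UP R\<^esub> monom (UP R) m 0) (i + 2)"
          using s(1) tm by (simp only: R.UP_add_apply neg P.m_closed P.a_closed P.a_inv_closed R.UP_monom_closed R.one_closed)
        then show ?thesis unfolding s(2) x2 x1 x0 a_minus_def .
      qed
      have lz: "?l (i + 2) = \<zero>" for i using p q by (simp add: R.UP_add_apply R.UP_monom_apply)
      obtain N where N: "\<And>i. i > N \<Longrightarrow> s i = \<zero>" using conjunct2[OF iffD1[OF R.UP_mem_iff s(1)]] by blast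
      \<comment> \<open>The recursion needs two consecutive zeros and is run downwards from beyond
        the bound \<open>N\<close>. By truncated subtraction the index stays at 0 once
        \<open>i\<close> exceeds \<open>N\<close>, where the claim repeats what is known.\<close>
      have "s (N + 1 - i) = \<zero> \<and> s (N + 2 - i) = \<zero>" for i
      proof (induction i)
        case 0
        then show ?case using N by simp
      next
        case (Suc i)
        show ?case
        proof (cases "i \<le> N")
          case True
          then have e: "N + 1 - i = (N - i) + 1" "N + 2 - i = (N - i) + 2" "N + 1 - Suc i = N - i" "N + 2 - Suc i = N + 1 - i" by auto
          have "(s (N - i) \<ominus> t \<otimes> s (N - i + 1)) \<oplus> m \<otimes> s (N - i + 2) = \<zero>" using coef[of "N - i"] lz by simp
          then have "s (N - i) = \<zero>" using Suc e tm sc[of "N - i"] by (simp add: a_minus_def)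
          then show ?thesis using Suc e by simp
        next
          case False
          then have "N + 1 - Suc i = 0" "N + 1 - i = 0" "N + 2 - Suc i = N + 1 - i" by auto
          then show ?thesis using Suc by simp
        qed
      qed
      note down = this
      have "s i = \<zero>" for i
      proof (cases "i \<le> N")
        case True
        then have "N + 1 - (N + 1 - i) = i" by simp
        then show ?thesis using down[of "N + 1 - i"] by simp
      qed (use N in simp)
      then have "s = \<zero>\<^bsub>UP R\<^esub>" by (auto simp: fun_eq_iff R.UP_zero_apply)
      then have l0: "?l = \<zero>\<^bsub>UP R\<^esub>" using s(2) gC by simp
      have "?l 0 = p" "?l 1 = q" using p q by (simp_all add: R.UP_add_apply R.UP_monom_apply)
      then show "p = \<zero> \<and> q = \<zero>" unfolding l0 R.UP_zero_apply by simp
    qed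
  qed (use tm yC rel in auto)
qed

end

section \<open>Transitions and glueing of generators\<close>

text \<open>The coefficients of a transition as functions of the two elements. The choice is
  determined whenever \<open>y\<close> is a generator, by \<open>transition_unique\<close>.\<close>

definition tr_lin where
  "tr_lin R S h y' y = (SOME u. \<exists>c. transition R S h y' y u c)"

definition tr_const where
  "tr_const R S h y' y = (SOME c. \<exists>u. transition R S h y' y u c)"

context cring
begin

lemma quad_mult_aux:
  assumes [simp]: "t \<in> carrier R" "m \<in> carrier R" "u \<in> carrier R" "c \<in> carrier R" "u' \<in> carrier R" "c' \<in> carrier R" "y \<in> carrier R"
    and eq: "y \<otimes> y \<oplus> m = t \<otimes> y"
  shows "(u \<otimes> y \<oplus> c) \<otimes> (u' \<otimes> y \<oplus> c') = (u \<otimes> u' \<otimes> t \<oplus> (u \<otimes> c' \<oplus> u' \<otimes> c)) \<otimes> y \<oplus> (c \<otimes> c' \<oplus> \<ominus> (u \<otimes> u' \<otimes> m))"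
proof -
  have "(u \<otimes> y \<oplus> c) \<otimes> (u' \<otimes> y \<oplus> c') = u \<otimes> u' \<otimes> (y \<otimes> y \<oplus> m) \<oplus> (u \<otimes> c' \<oplus> u' \<otimes> c) \<otimes> y \<oplus> (c \<otimes> c' \<oplus> \<ominus> (u \<otimes> u' \<otimes> m))"
    using assms(1-7) by algebra
  also have "\<dots> = (u \<otimes> u' \<otimes> t \<oplus> (u \<otimes> c' \<oplus> u' \<otimes> c)) \<otimes> y \<oplus> (c \<otimes> c' \<oplus> \<ominus> (u \<otimes> u' \<otimes> m))"
    unfolding eq by (simp add: cring_distrib)
  finally show ?thesis .
qed

lemma lin_add_aux:
  assumes [simp]: "u \<in> carrier R" "c \<in> carrier R" "u' \<in> carrier R" "c' \<in> carrier R" "y \<in> carrier R"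
  shows "(u \<otimes> y \<oplus> c) \<oplus> (u' \<otimes> y \<oplus> c') = (u \<oplus> u') \<otimes> y \<oplus> (c \<oplus> c')"
  by (simp add: cring_distrib)

lemma lin_lin_aux:
  assumes [simp]: "u \<in> carrier R" "c \<in> carrier R" "u' \<in> carrier R" "c' \<in> carrier R" "y \<in> carrier R"
  shows "u' \<otimes> (u \<otimes> y \<oplus> c) \<oplus> c' = (u' \<otimes> u) \<otimes> y \<oplus> (u' \<otimes> c \<oplus> c')"
  by (simp add: cring_distrib)

text \<open>Over the empty set the only denominator is \<open>\<one>\<close>, so global elements are
  handled as the case \<open>V = {}\<close> of the glueing lemmas.\<close>

lemma mgen_empty: "mgen R {} = {\<one>}"
proof -
  have "submonoid {\<one>} R" by unfold_locales auto
  then show ?thesis using mgen_least[of "{\<one>}" "{}"] mgen_one[of "{}"] by blast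
qed

end

context ring_hom_cring
begin

lemma transitionD:
  assumes "transition R S h y' y u c"
  shows "u \<in> carrier R" "c \<in> carrier R" "y' = h u \<otimes>\<^bsub>S\<^esub> y \<oplus>\<^bsub>S\<^esub> h c"
  using assms by (auto simp: transition_def)

lemma transition_trans:
  assumes y': "transition R S h y'' y' u' c'" and y: "transition R S h y' y u c" and yS: "y \<in> carrier S"
  shows "transition R S h y'' y (u' \<otimes> u) (u' \<otimes> c \<oplus> c')"
proof -
  note t = transitionD[OF y'] transitionD[OF y]
  have "y'' = (h u' \<otimes>\<^bsub>S\<^esub> h u) \<otimes>\<^bsub>S\<^esub> y \<oplus>\<^bsub>S\<^esub> (h u' \<otimes>\<^bsub>S\<^esub> h c \<oplus>\<^bsub>S\<^esub> h c')"
    unfolding t(3,6) by (rule S.lin_lin_aux) (use t yS in simp_all)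
  then show ?thesis unfolding transition_def using t(1,2,4,5) by simp
qed

lemma transition_unique:
  assumes y: "qgen R S h t m y" and u: "transition R S h y' y u c" "transition R S h y' y u' c'"
  shows "u = u' \<and> c = c'"
proof -
  note t = transitionD[OF u(1)] transitionD[OF u(2)]
  have "h c \<oplus>\<^bsub>S\<^esub> h u \<otimes>\<^bsub>S\<^esub> y = h c' \<oplus>\<^bsub>S\<^esub> h u' \<otimes>\<^bsub>S\<^esub> y"
    using t qgenD(3)[OF y] by (simp add: S.a_comm)
  then show ?thesis using qgen_unique[OF y t(2,1,5,4)] by simp
qed

lemma transition_fun: "transition R S h y' y u c \<Longrightarrow> transition R S h y'' y u c \<Longrightarrow> y' = y''"
  by (auto simp: transition_def)

lemma transition_tr:
  assumes y: "qgen R S h t m y" and d: "d \<in> carrier S"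
  shows "transition R S h d y (tr_lin R S h d y) (tr_const R S h d y)"
proof -
  obtain p q where "p \<in> carrier R" "q \<in> carrier R" "d = h p \<oplus>\<^bsub>S\<^esub> h q \<otimes>\<^bsub>S\<^esub> y" by (rule qgenE[OF y d])
  then have tr: "transition R S h d y q p" unfolding transition_def using qgenD(3)[OF y] by (simp add: S.a_comm)
  have "tr_lin R S h d y = q" unfolding tr_lin_def
    by (rule some_equality) (use tr transition_unique[OF y tr] in blast)+
  moreover have "tr_const R S h d y = p" unfolding tr_const_def
    by (rule some_equality) (use tr transition_unique[OF y tr] in blast)+
  ultimately show ?thesis using tr by simp
qed

lemma tr_eq:
  assumes y: "qgen R S h t m y" and tr: "transition R S h d y u c"
  shows "tr_lin R S h d y = u" "tr_const R S h d y = c"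
proof -
  have "d \<in> carrier S" using transitionD[OF tr] qgenD(3)[OF y] by simp
  from transition_unique[OF y transition_tr[OF y this] tr]
  show "tr_lin R S h d y = u" "tr_const R S h d y = c" by auto
qed

lemma transition_params:
  assumes y: "qgen R S h t m y" and y': "qgen R S h t' m' y'" and tr: "transition R S h y' y u c"
  shows "t' = u \<otimes> t \<oplus> (c \<oplus> c)" "m' = u \<otimes> u \<otimes> m \<oplus> u \<otimes> c \<otimes> t \<oplus> c \<otimes> c"
proof -
  note u = transitionD[OF tr]
  obtain v where v: "v \<in> carrier R" "v \<otimes> u = \<one>" by (rule qgen_transition_unit[OF y y' u])
  have q: "qgen R S h (u \<otimes> t \<oplus> (c \<oplus> c)) (u \<otimes> u \<otimes> m \<oplus> u \<otimes> c \<otimes> t \<oplus> c \<otimes> c) y'"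
    unfolding u(3) by (rule qgen_change[OF y u(1) v u(2)])
  from qgen_params_unique[OF q qgenD(1,2,4)[OF y']]
  show "t' = u \<otimes> t \<oplus> (c \<oplus> c)" "m' = u \<otimes> u \<otimes> m \<oplus> u \<otimes> c \<otimes> t \<oplus> c \<otimes> c" by auto
qed

text \<open>The coordinates of a product depend only on the coordinates of the factors and on the
  parameters. Hence a map that preserves coordinates between algebras with equal parameters is
  multiplicative.\<close>

lemma transition_mult:
  assumes y: "qgen R S h t m y" and u: "transition R S h x y u c" "transition R S h x' y u' c'"
  shows "transition R S h (x \<otimes>\<^bsub>S\<^esub> x') y (u \<otimes> u' \<otimes> t \<oplus> (u \<otimes> c' \<oplus> u' \<otimes> c)) (c \<otimes> c' \<oplus> \<ominus> (u \<otimes> u' \<otimes> m))"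
proof -
  note t = transitionD[OF u(1)] transitionD[OF u(2)] qgenD[OF y]
  show ?thesis
    unfolding transition_def t(3,6) using t(1,2,4,5,7,8,9)
      S.quad_mult_aux[of "h t" "h m" "h u" "h c" "h u'" "h c'" y] t(10) by simp
qed

lemma transition_add:
  assumes y: "y \<in> carrier S" and u: "transition R S h x y u c" "transition R S h x' y u' c'"
  shows "transition R S h (x \<oplus>\<^bsub>S\<^esub> x') y (u \<oplus> u') (c \<oplus> c')"
proof -
  note t = transitionD[OF u(1)] transitionD[OF u(2)]
  show ?thesis
    unfolding transition_def t(3,6) using t(1,2,4,5) y S.lin_add_aux[of "h u" "h c" "h u'" "h c'" y] by simp
qed

lemma transition_scalar: "y \<in> carrier S \<Longrightarrow> a \<in> carrier R \<Longrightarrow> transition R S h (h a) y \<zero> a"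
  by (simp add: transition_def)

abbreviation "locS V \<equiv> loc S (h ` V)"
abbreviation "loch V \<equiv> loc_map S (h ` V) h"
abbreviation "resS V \<equiv> loc_res S (h ` V)"

lemma transition_loc_res:
  assumes VW: "V \<subseteq> W" and W: "W \<subseteq> carrier R" and y: "y \<in> carrier (locS V)"
    and tr: "transition (loc R V) (locS V) (loch V) y' y u c"
  shows "transition (loc R W) (locS W) (loch W) (resS W y') (resS W y) (loc_res R W u) (loc_res R W c)"
proof -
  have V: "V \<subseteq> carrier R" using VW W by simp
  interpret HV: ring_hom_cring "loc R V" "locS V" "loch V" by (rule loc_map_image_hom[OF V])
  interpret HW: ring_hom_cring "loc R W" "locS W" "loch W" by (rule loc_map_image_hom[OF W])
  interpret r: ring_hom_cring "loc R V" "loc R W" "loc_res R W" by (rule R.loc_res_hom[OF VW W])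
  interpret d: ring_hom_cring "locS V" "locS W" "resS W"
    by (rule S.loc_res_hom) (use VW W in auto)
  note u = HV.transitionD[OF tr]
  have hu: "loch V u \<in> carrier (locS V)" "loch V c \<in> carrier (locS V)" using HV.hom_closed u(1,2) by auto
  have "resS W y' = resS W (loch V u) \<otimes>\<^bsub>locS W\<^esub> resS W y \<oplus>\<^bsub>locS W\<^esub> resS W (loch V c)"
    unfolding u(3) using hu y by simp
  also have "\<dots> = loch W (loc_res R W u) \<otimes>\<^bsub>locS W\<^esub> resS W y \<oplus>\<^bsub>locS W\<^esub> loch W (loc_res R W c)"
    unfolding loc_map_res[OF VW W u(1)] loc_map_res[OF VW W u(2)] ..
  finally show ?thesis unfolding transition_def using r.hom_closed u(1,2) by blast
qed

lemma loc_image_separated: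
  assumes cov: "pcover R I V" and W: "W \<subseteq> carrier R" and p: "p \<in> carrier (locS W)" and q: "q \<in> carrier (locS W)"
    and eq: "\<And>i. i \<in> I \<Longrightarrow> resS (W \<union> V i) p = resS (W \<union> V i) q"
  shows "p = q"
  by (rule S.loc_separated[OF pcover_image[OF cov] _ p q]) (use W eq in \<open>auto simp flip: image_Un\<close>)

lemma loc_image_glue:
  assumes cov: "pcover R I V" and fin: "finite I" and W: "W \<subseteq> carrier R"
    and p: "\<And>i. i \<in> I \<Longrightarrow> p i \<in> carrier (locS (W \<union> V i))"
    and eq: "\<And>i j. i \<in> I \<Longrightarrow> j \<in> I \<Longrightarrow> resS (W \<union> V i \<union> V j) (p i) = resS (W \<union> V i \<union> V j) (p j)"
  obtains q where "q \<in> carrier (locS W)" "\<And>i. i \<in> I \<Longrightarrow> resS (W \<union> V i) q = p i"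
proof -
  have W': "h ` W \<subseteq> carrier S" using W by auto
  obtain q where "q \<in> carrier (locS W)" "\<And>i. i \<in> I \<Longrightarrow> loc_res S (h ` W \<union> h ` V i) q = p i"
    by (rule S.loc_glue[OF pcover_image[OF cov] fin W', of p]) (use p eq in \<open>simp_all flip: image_Un\<close>)
  then show ?thesis using that by (simp add: image_Un)
qed

text \<open>Over the pieces each element has unique coordinates. Uniqueness makes them agree on
  overlaps, so they glue; independence and the quadratic relation follow because equality is
  local.\<close>

lemma qgen_local:
  assumes cov: "pcover R I V" and fin: "finite I" and W: "W \<subseteq> carrier R"
    and tm: "t \<in> carrier (loc R W)" "m \<in> carrier (loc R W)" and y: "y \<in> carrier (locS W)"
    and loc: "\<And>i. i \<in> I \<Longrightarrow> qgen (loc R (W \<union> V i)) (locS (W \<union> V i)) (loch (W \<union> V i))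
      (loc_res R (W \<union> V i) t) (loc_res R (W \<union> V i) m) (resS (W \<union> V i) y)"
  shows "qgen (loc R W) (locS W) (loch W) t m y"
proof -
  interpret H: ring_hom_cring "loc R W" "locS W" "loch W" by (rule loc_map_image_hom[OF W])
  have X: "W \<union> V i \<subseteq> carrier R" if "i \<in> I" for i using that cov W by (auto simp: pcover_def)
  have WX: "W \<subseteq> W \<union> V i" "h ` W \<subseteq> h ` (W \<union> V i)" for i by auto
  have hX: "h ` (W \<union> V i) \<subseteq> carrier S" if "i \<in> I" for i using X[OF that] by auto
  have HX: "ring_hom_cring (loc R (W \<union> V i)) (locS (W \<union> V i)) (loch (W \<union> V i))" if "i \<in> I" for i
    by (rule loc_map_image_hom[OF X[OF that]])
  have dX: "ring_hom_cring (locS W) (locS (W \<union> V i)) (resS (W \<union> V i))" if "i \<in> I" for i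
    by (rule S.loc_res_hom[OF WX(2) hX[OF that]])
  show ?thesis
    unfolding qgen_def
  proof (intro conjI ballI impI)
    fix d assume d: "d \<in> carrier (locS W)"
    let ?u = "\<lambda>i. tr_lin (loc R (W \<union> V i)) (locS (W \<union> V i)) (loch (W \<union> V i)) (resS (W \<union> V i) d) (resS (W \<union> V i) y)"
    let ?c = "\<lambda>i. tr_const (loc R (W \<union> V i)) (locS (W \<union> V i)) (loch (W \<union> V i)) (resS (W \<union> V i) d) (resS (W \<union> V i) y)"
    have tr: "transition (loc R (W \<union> V i)) (locS (W \<union> V i)) (loch (W \<union> V i)) (resS (W \<union> V i) d) (resS (W \<union> V i) y) (?u i) (?c i)"
      if i: "i \<in> I" for i
      by (rule ring_hom_cring.transition_tr[OF HX[OF i] loc[OF i] S.loc_res_closed[OF WX(2) hX[OF i] d]])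
    \<comment> \<open>Both families restrict to coordinates of the same element with respect to the
      same generator over the overlap.\<close>
    have overlap: "loc_res R (W \<union> V i \<union> V j) (?u i) = loc_res R (W \<union> V i \<union> V j) (?u j) \<and>
        loc_res R (W \<union> V i \<union> V j) (?c i) = loc_res R (W \<union> V i \<union> V j) (?c j)" if ij: "i \<in> I" "j \<in> I" for i j
    proof -
      let ?X = "W \<union> V i \<union> V j"
      have XC: "?X \<subseteq> carrier R" using X[OF ij(1)] X[OF ij(2)] by auto
      have hXC: "h ` ?X \<subseteq> carrier S" using XC by auto
      have tX: "transition (loc R ?X) (locS ?X) (loch ?X) (resS ?X d) (resS ?X y) (loc_res R ?X (?u l)) (loc_res R ?X (?c l))"
        if l: "l \<in> I" "W \<union> V l \<subseteq> ?X" for l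
      proof -
        have "h ` (W \<union> V l) \<subseteq> h ` ?X" using l(2) by (rule image_mono)
        note rr = S.loc_res_res[OF WX(2) this hXC]
        show ?thesis
          using transition_loc_res[OF l(2) XC qgenD(3)[OF loc[OF l(1)]] tr[OF l(1)]] unfolding rr[OF d] rr[OF y] .
      qed
      have q: "qgen (loc R ?X) (locS ?X) (loch ?X) (loc_res R ?X (loc_res R (W \<union> V i) t)) (loc_res R ?X (loc_res R (W \<union> V i) m)) (resS ?X (resS (W \<union> V i) y))"
        by (rule qgen_loc_res[OF _ XC loc[OF ij(1)]]) auto
      have yy: "resS ?X (resS (W \<union> V i) y) = resS ?X y"
        by (rule S.loc_res_res[OF WX(2) _ hXC y]) auto
      show ?thesis
        by (rule ring_hom_cring.transition_unique[OF loc_map_image_hom[OF XC] q[unfolded yy] tX tX]) (use ij in auto)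
    qed
    have uc: "?u i \<in> carrier (loc R (W \<union> V i))" "?c i \<in> carrier (loc R (W \<union> V i))" if "i \<in> I" for i
      using ring_hom_cring.transitionD(1,2)[OF HX[OF that] tr[OF that]] by auto
    obtain u where u: "u \<in> carrier (loc R W)" "\<And>i. i \<in> I \<Longrightarrow> loc_res R (W \<union> V i) u = ?u i"
      by (rule R.loc_glue[OF cov fin W, of ?u]) (use uc(1) conjunct1[OF overlap] in blast)+
    obtain c where c: "c \<in> carrier (loc R W)" "\<And>i. i \<in> I \<Longrightarrow> loc_res R (W \<union> V i) c = ?c i"
      by (rule R.loc_glue[OF cov fin W, of ?c]) (use uc(2) conjunct2[OF overlap] in blast)+
    let ?e = "loch W u \<otimes>\<^bsub>locS W\<^esub> y \<oplus>\<^bsub>locS W\<^esub> loch W c"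
    have e: "transition (loc R W) (locS W) (loch W) ?e y u c" using u c by (simp add: transition_def)
    have "d = ?e"
    proof (rule loc_image_separated[OF cov W d])
      show "?e \<in> carrier (locS W)" using u(1) c(1) y by simp
      show "resS (W \<union> V i) d = resS (W \<union> V i) ?e" if i: "i \<in> I" for i
        using ring_hom_cring.transition_fun[OF HX[OF i] tr[OF i]]
          transition_loc_res[OF WX(1) X[OF i] y e] unfolding u(2)[OF i] c(2)[OF i] by blast
    qed
    also have "\<dots> = loch W c \<oplus>\<^bsub>locS W\<^esub> loch W u \<otimes>\<^bsub>locS W\<^esub> y" using u(1) c(1) y by (simp add: H.S.a_comm)
    finally show "\<exists>p\<in>carrier (loc R W). \<exists>q\<in>carrier (loc R W). d = loch W p \<oplus>\<^bsub>locS W\<^esub> loch W q \<otimes>\<^bsub>locS W\<^esub> y"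
      using u(1) c(1) by blast
  next
    fix p q assume pq: "p \<in> carrier (loc R W)" "q \<in> carrier (loc R W)"
      and z: "loch W p \<oplus>\<^bsub>locS W\<^esub> loch W q \<otimes>\<^bsub>locS W\<^esub> y = \<zero>\<^bsub>locS W\<^esub>"
    have tr0: "transition (loc R W) (locS W) (loch W) \<zero>\<^bsub>locS W\<^esub> y q p"
      unfolding transition_def z[symmetric] using pq y by (simp add: H.S.a_comm)
    have tr1: "transition (loc R W) (locS W) (loch W) \<zero>\<^bsub>locS W\<^esub> y \<zero>\<^bsub>loc R W\<^esub> \<zero>\<^bsub>loc R W\<^esub>"
      unfolding transition_def using y by simp
    have "loc_res R (W \<union> V i) q = loc_res R (W \<union> V i) \<zero>\<^bsub>loc R W\<^esub> \<and> loc_res R (W \<union> V i) p = loc_res R (W \<union> V i) \<zero>\<^bsub>loc R W\<^esub>" if i: "i \<in> I" for i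
      by (rule ring_hom_cring.transition_unique[OF HX[OF i] loc[OF i]
          transition_loc_res[OF WX(1) X[OF i] y tr0] transition_loc_res[OF WX(1) X[OF i] y tr1]])
    then show "p = \<zero>\<^bsub>loc R W\<^esub>" "q = \<zero>\<^bsub>loc R W\<^esub>"
      using R.loc_separated[OF cov W pq(1) H.R.zero_closed] R.loc_separated[OF cov W pq(2) H.R.zero_closed] by blast+
  next
    show "y \<otimes>\<^bsub>locS W\<^esub> y \<oplus>\<^bsub>locS W\<^esub> loch W m = loch W t \<otimes>\<^bsub>locS W\<^esub> y"
    proof (rule loc_image_separated[OF cov W])
      show "resS (W \<union> V i) (y \<otimes>\<^bsub>locS W\<^esub> y \<oplus>\<^bsub>locS W\<^esub> loch W m) = resS (W \<union> V i) (loch W t \<otimes>\<^bsub>locS W\<^esub> y)" if i: "i \<in> I" for i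
      proof -
        interpret d: ring_hom_cring "locS W" "locS (W \<union> V i)" "resS (W \<union> V i)" by (rule dX[OF i])
        have hm: "loch W m \<in> carrier (locS W)" "loch W t \<in> carrier (locS W)" using tm by auto
        show ?thesis
          unfolding d.hom_add[OF H.S.m_closed[OF y y] hm(1)] d.hom_mult[OF y y] d.hom_mult[OF hm(2) y]
            loc_map_res[OF WX(1) X[OF i] tm(1)] loc_map_res[OF WX(1) X[OF i] tm(2)]
          by (rule qgenD(4)[OF loc[OF i]])
      qed
    qed (use y tm in simp_all)
  qed (use tm y in auto)
qed

end


section \<open>Glueing an isomorphism from local generators\<close>

context cring
begin

text \<open>Read off the local coordinates of \<open>x\<close> with respect to the
  \<open>e i\<close> and form the elements of \<open>F\<close> with these coordinates with respect
  to the \<open>f i\<close>. Since both families have equal transitions on overlaps, the local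
  elements agree there and glue to one \<open>y\<close>.\<close>

lemma corr_ex1:
  assumes E: "ring_hom_cring R E \<chi>" and F: "ring_hom_cring R F \<eta>"
    and cov: "pcover R I V" and fin: "finite I"
    and e: "\<And>i. i \<in> I \<Longrightarrow> qgen (loc R (V i)) (loc E (\<chi> ` V i)) (loc_map E (\<chi> ` V i) \<chi>) (t i) (m i) (e i)"
    and f: "\<And>i. i \<in> I \<Longrightarrow> qgen (loc R (V i)) (loc F (\<eta> ` V i)) (loc_map F (\<eta> ` V i) \<eta>) (t i) (m i) (f i)"
    and tr: "\<And>i j. i \<in> I \<Longrightarrow> j \<in> I \<Longrightarrow> \<exists>u c.
      transition (loc R (V i \<union> V j)) (loc E (\<chi> ` (V i \<union> V j))) (loc_map E (\<chi> ` (V i \<union> V j)) \<chi>)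
        (loc_res E (\<chi> ` (V i \<union> V j)) (e i)) (loc_res E (\<chi> ` (V i \<union> V j)) (e j)) u c \<and>
      transition (loc R (V i \<union> V j)) (loc F (\<eta> ` (V i \<union> V j))) (loc_map F (\<eta> ` (V i \<union> V j)) \<eta>)
        (loc_res F (\<eta> ` (V i \<union> V j)) (f i)) (loc_res F (\<eta> ` (V i \<union> V j)) (f j)) u c"
    and x: "x \<in> carrier E"
  shows "\<exists>!y. y \<in> carrier F \<and> (\<forall>i\<in>I. \<exists>u c.
      transition (loc R (V i)) (loc E (\<chi> ` V i)) (loc_map E (\<chi> ` V i) \<chi>) (frac E (\<chi> ` V i) x \<one>\<^bsub>E\<^esub>) (e i) u c \<and>
      transition (loc R (V i)) (loc F (\<eta> ` V i)) (loc_map F (\<eta> ` V i) \<eta>) (frac F (\<eta> ` V i) y \<one>\<^bsub>F\<^esub>) (f i) u c)"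
proof -
  interpret E: ring_hom_cring R E \<chi> by (rule E)
  interpret F: ring_hom_cring R F \<eta> by (rule F)
  have VC: "V i \<subseteq> carrier R" if "i \<in> I" for i using cov that by (auto simp: pcover_def)
  have VF: "\<eta> ` V i \<subseteq> carrier F" "\<chi> ` V i \<subseteq> carrier E" if "i \<in> I" for i using VC[OF that] by auto
  note HE = E.loc_map_image_hom[OF VC] and HF = F.loc_map_image_hom[OF VC]
  have x0: "frac E (\<chi> ` V i) x \<one>\<^bsub>E\<^esub> \<in> carrier (loc E (\<chi> ` V i))" for i using x by (rule E.S.frac_closed) (rule E.S.mgen_one)
  let ?u = "\<lambda>i. tr_lin (loc R (V i)) (loc E (\<chi> ` V i)) (loc_map E (\<chi> ` V i) \<chi>) (frac E (\<chi> ` V i) x \<one>\<^bsub>E\<^esub>) (e i)"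
  let ?c = "\<lambda>i. tr_const (loc R (V i)) (loc E (\<chi> ` V i)) (loc_map E (\<chi> ` V i) \<chi>) (frac E (\<chi> ` V i) x \<one>\<^bsub>E\<^esub>) (e i)"
  have tre: "transition (loc R (V i)) (loc E (\<chi> ` V i)) (loc_map E (\<chi> ` V i) \<chi>) (frac E (\<chi> ` V i) x \<one>\<^bsub>E\<^esub>) (e i) (?u i) (?c i)" if i: "i \<in> I" for i
    by (rule ring_hom_cring.transition_tr[OF HE[OF i] e[OF i] x0])
  let ?p = "\<lambda>i. loc_map F (\<eta> ` V i) \<eta> (?u i) \<otimes>\<^bsub>loc F (\<eta> ` V i)\<^esub> f i \<oplus>\<^bsub>loc F (\<eta> ` V i)\<^esub> loc_map F (\<eta> ` V i) \<eta> (?c i)"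
  have trf: "transition (loc R (V i)) (loc F (\<eta> ` V i)) (loc_map F (\<eta> ` V i) \<eta>) (?p i) (f i) (?u i) (?c i)" if i: "i \<in> I" for i
    using ring_hom_cring.transitionD(1,2)[OF HE[OF i] tre[OF i]] by (simp add: transition_def)
  have pC: "?p i \<in> carrier (loc F (\<eta> ` V i))" if i: "i \<in> I" for i
  proof -
    interpret H: ring_hom_cring "loc R (V i)" "loc F (\<eta> ` V i)" "loc_map F (\<eta> ` V i) \<eta>" by (rule HF[OF i])
    show ?thesis using ring_hom_cring.transitionD(1,2)[OF HE[OF i] tre[OF i]] qgenD(3)[OF f[OF i]] by simp
  qed
  have overlap: "loc_res F (\<eta> ` (V i \<union> V j)) (?p i) = loc_res F (\<eta> ` (V i \<union> V j)) (?p j)" if ij: "i \<in> I" "j \<in> I" for i j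
  proof -
    let ?X = "V i \<union> V j"
    have XC: "?X \<subseteq> carrier R" using VC ij by auto
    have sub: "V i \<subseteq> ?X" "V j \<subseteq> ?X" by auto
    have sE: "\<chi> ` V l \<subseteq> \<chi> ` ?X" if "V l \<subseteq> ?X" for l using that by (rule image_mono)
    have XE: "\<chi> ` ?X \<subseteq> carrier E" "\<eta> ` ?X \<subseteq> carrier F" using XC by auto
    have xr: "loc_res E (\<chi> ` ?X) (frac E (\<chi> ` V l) x \<one>\<^bsub>E\<^esub>) = frac E (\<chi> ` ?X) x \<one>\<^bsub>E\<^esub>" if "V l \<subseteq> ?X" for l
      by (rule E.S.loc_res_frac[OF sE[OF that] XE(1) x E.S.mgen_one])
    obtain u c where u: "transition (loc R ?X) (loc E (\<chi> ` ?X)) (loc_map E (\<chi> ` ?X) \<chi>)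
        (loc_res E (\<chi> ` ?X) (e i)) (loc_res E (\<chi> ` ?X) (e j)) u c"
      "transition (loc R ?X) (loc F (\<eta> ` ?X)) (loc_map F (\<eta> ` ?X) \<eta>)
        (loc_res F (\<eta> ` ?X) (f i)) (loc_res F (\<eta> ` ?X) (f j)) u c" using tr[OF ij] by blast
    note ei = E.transition_loc_res[OF sub(1) XC qgenD(3)[OF e[OF ij(1)]] tre[OF ij(1)], unfolded xr[OF sub(1)]]
    note ej = E.transition_loc_res[OF sub(2) XC qgenD(3)[OF e[OF ij(2)]] tre[OF ij(2)], unfolded xr[OF sub(2)]]
    note fi = F.transition_loc_res[OF sub(1) XC qgenD(3)[OF f[OF ij(1)]] trf[OF ij(1)]]
    note fj = F.transition_loc_res[OF sub(2) XC qgenD(3)[OF f[OF ij(2)]] trf[OF ij(2)]]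
    note HEX = E.loc_map_image_hom[OF XC] and HFX = F.loc_map_image_hom[OF XC]
    have qe: "qgen (loc R ?X) (loc E (\<chi> ` ?X)) (loc_map E (\<chi> ` ?X) \<chi>) (loc_res R ?X (t j)) (loc_res R ?X (m j)) (loc_res E (\<chi> ` ?X) (e j))"
      by (rule E.qgen_loc_res[OF sub(2) XC e[OF ij(2)]])
    have qf: "qgen (loc R ?X) (loc F (\<eta> ` ?X)) (loc_map F (\<eta> ` ?X) \<eta>) (loc_res R ?X (t j)) (loc_res R ?X (m j)) (loc_res F (\<eta> ` ?X) (f j))"
      by (rule F.qgen_loc_res[OF sub(2) XC f[OF ij(2)]])
    note ee = ring_hom_cring.transition_unique[OF HEX qe ring_hom_cring.transition_trans[OF HEX ei u(1) qgenD(3)[OF qe]] ej]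
    note ff = ring_hom_cring.transition_trans[OF HFX fi u(2) qgenD(3)[OF qf]]
    show ?thesis
      by (rule ring_hom_cring.transition_fun[OF HFX ff[unfolded conjunct1[OF ee] conjunct2[OF ee]] fj])
  qed
  \<comment> \<open>Glueing over the empty set of denominators produces a fraction over
    \<open>\<one>\<close>, that is, an element of \<open>F\<close>.\<close>
  have e0: "{} \<subseteq> carrier R" by simp
  obtain q where q: "q \<in> carrier (loc F (\<eta> ` {}))" "\<And>i. i \<in> I \<Longrightarrow> loc_res F (\<eta> ` ({} \<union> V i)) q = ?p i"
    by (rule F.loc_image_glue[OF cov fin e0, of ?p]) (use pC overlap in simp_all)
  obtain y s where y: "y \<in> carrier F" "s \<in> mgen F {}" "q = frac F {} y s" by (rule F.S.loc_carrierE[of q "{}"]) (use q(1) in auto)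
  have s: "s = \<one>\<^bsub>F\<^esub>" using y(2) by (simp add: F.S.mgen_empty)
  have yres: "loc_res F (\<eta> ` V i) (frac F {} y' \<one>\<^bsub>F\<^esub>) = frac F (\<eta> ` V i) y' \<one>\<^bsub>F\<^esub>" if "i \<in> I" "y' \<in> carrier F" for i y'
    by (rule F.S.loc_res_frac[OF empty_subsetI VF(1)[OF that(1)] that(2) F.S.mgen_one])
  have yp: "frac F (\<eta> ` V i) y \<one>\<^bsub>F\<^esub> = ?p i" if "i \<in> I" for i
    using yres[OF that y(1)] q(2)[OF that] unfolding y(3) s by simp
  show ?thesis
  proof (rule ex1I[of _ y], intro conjI ballI)
    show "y \<in> carrier F" by (rule y(1))
    show "\<exists>u c.
      transition (loc R (V i)) (loc E (\<chi> ` V i)) (loc_map E (\<chi> ` V i) \<chi>) (frac E (\<chi> ` V i) x \<one>\<^bsub>E\<^esub>) (e i) u c \<and>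
      transition (loc R (V i)) (loc F (\<eta> ` V i)) (loc_map F (\<eta> ` V i) \<eta>) (frac F (\<eta> ` V i) y \<one>\<^bsub>F\<^esub>) (f i) u c" if i: "i \<in> I" for i
      using tre[OF i] trf[OF i] unfolding yp[OF i] by blast
    fix y' assume y': "y' \<in> carrier F \<and> (\<forall>i\<in>I. \<exists>u c.
      transition (loc R (V i)) (loc E (\<chi> ` V i)) (loc_map E (\<chi> ` V i) \<chi>) (frac E (\<chi> ` V i) x \<one>\<^bsub>E\<^esub>) (e i) u c \<and>
      transition (loc R (V i)) (loc F (\<eta> ` V i)) (loc_map F (\<eta> ` V i) \<eta>) (frac F (\<eta> ` V i) y' \<one>\<^bsub>F\<^esub>) (f i) u c)"
    have eq: "frac F (\<eta> ` V i) y' \<one>\<^bsub>F\<^esub> = frac F (\<eta> ` V i) y \<one>\<^bsub>F\<^esub>" if i: "i \<in> I" for i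
    proof -
      obtain u c where u: "transition (loc R (V i)) (loc E (\<chi> ` V i)) (loc_map E (\<chi> ` V i) \<chi>) (frac E (\<chi> ` V i) x \<one>\<^bsub>E\<^esub>) (e i) u c"
        "transition (loc R (V i)) (loc F (\<eta> ` V i)) (loc_map F (\<eta> ` V i) \<eta>) (frac F (\<eta> ` V i) y' \<one>\<^bsub>F\<^esub>) (f i) u c"
        using y' i by blast
      note w = ring_hom_cring.transition_unique[OF HE[OF i] e[OF i] u(1) tre[OF i]]
      show ?thesis unfolding yp[OF i]
        by (rule ring_hom_cring.transition_fun[OF HF[OF i] u(2)[unfolded conjunct1[OF w] conjunct2[OF w]] trf[OF i]])
    qed
    have fy: "frac F {} z \<one>\<^bsub>F\<^esub> \<in> carrier (loc F (\<eta> ` {}))" if "z \<in> carrier F" for z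
      using F.S.frac_closed[OF that F.S.mgen_one, of "{}"] by simp
    have "frac F {} y' \<one>\<^bsub>F\<^esub> = frac F {} y \<one>\<^bsub>F\<^esub>"
      by (rule F.loc_image_separated[OF cov e0 fy fy]) (use y' y(1) eq yres in simp_all)
    then have "\<exists>t\<in>mgen F {}. t \<otimes>\<^bsub>F\<^esub> (y' \<otimes>\<^bsub>F\<^esub> \<one>\<^bsub>F\<^esub>) = t \<otimes>\<^bsub>F\<^esub> (y \<otimes>\<^bsub>F\<^esub> \<one>\<^bsub>F\<^esub>)"
      using F.S.frac_eq_iff[OF empty_subsetI _ F.S.mgen_one y(1) F.S.mgen_one, of y'] y' by blast
    then show "y' = y" using y' y(1) by (simp add: F.S.mgen_empty)
  qed
qed

text \<open>The relation of having equal local coordinates is symmetric in \<open>E\<close> and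
  \<open>F\<close>, so \<open>corr_ex1\<close> applied in both directions makes it a bijection.
  Sums, products and scalars have coordinates given by formulas common to both sides, which makes it
  an algebra isomorphism.\<close>

lemma alg_iso_glue:
  assumes E: "ring_hom_cring R E \<chi>" and F: "ring_hom_cring R F \<eta>"
    and cov: "pcover R I V" and fin: "finite I"
    and e: "\<And>i. i \<in> I \<Longrightarrow> qgen (loc R (V i)) (loc E (\<chi> ` V i)) (loc_map E (\<chi> ` V i) \<chi>) (t i) (m i) (e i)"
    and f: "\<And>i. i \<in> I \<Longrightarrow> qgen (loc R (V i)) (loc F (\<eta> ` V i)) (loc_map F (\<eta> ` V i) \<eta>) (t i) (m i) (f i)"
    and tr: "\<And>i j. i \<in> I \<Longrightarrow> j \<in> I \<Longrightarrow> \<exists>u c.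
      transition (loc R (V i \<union> V j)) (loc E (\<chi> ` (V i \<union> V j))) (loc_map E (\<chi> ` (V i \<union> V j)) \<chi>)
        (loc_res E (\<chi> ` (V i \<union> V j)) (e i)) (loc_res E (\<chi> ` (V i \<union> V j)) (e j)) u c \<and>
      transition (loc R (V i \<union> V j)) (loc F (\<eta> ` (V i \<union> V j))) (loc_map F (\<eta> ` (V i \<union> V j)) \<eta>)
        (loc_res F (\<eta> ` (V i \<union> V j)) (f i)) (loc_res F (\<eta> ` (V i \<union> V j)) (f j)) u c"
  shows "\<exists>h. alg_iso R E \<chi> F \<eta> h"
proof -
  define corr where "corr x y \<longleftrightarrow> x \<in> carrier E \<and> y \<in> carrier F \<and> (\<forall>i\<in>I. \<exists>u c.
      transition (loc R (V i)) (loc E (\<chi> ` V i)) (loc_map E (\<chi> ` V i) \<chi>) (frac E (\<chi> ` V i) x \<one>\<^bsub>E\<^esub>) (e i) u c \<and>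
      transition (loc R (V i)) (loc F (\<eta> ` V i)) (loc_map F (\<eta> ` V i) \<eta>) (frac F (\<eta> ` V i) y \<one>\<^bsub>F\<^esub>) (f i) u c)" for x y
  have ex: "\<exists>!y. y \<in> carrier F \<and> (\<forall>i\<in>I. \<exists>u c.
      transition (loc R (V i)) (loc E (\<chi> ` V i)) (loc_map E (\<chi> ` V i) \<chi>) (frac E (\<chi> ` V i) x \<one>\<^bsub>E\<^esub>) (e i) u c \<and>
      transition (loc R (V i)) (loc F (\<eta> ` V i)) (loc_map F (\<eta> ` V i) \<eta>) (frac F (\<eta> ` V i) y \<one>\<^bsub>F\<^esub>) (f i) u c)"
    if x: "x \<in> carrier E" for x
    by (rule corr_ex1[OF E F cov fin e f tr x])
  have swap: "\<exists>u c. P u c \<and> Q u c \<Longrightarrow> \<exists>u c. Q u c \<and> P u c" for P Q :: "'x \<Rightarrow> 'y \<Rightarrow> bool" by blast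
  have ex': "\<exists>!x. x \<in> carrier E \<and> (\<forall>i\<in>I. \<exists>u c.
      transition (loc R (V i)) (loc F (\<eta> ` V i)) (loc_map F (\<eta> ` V i) \<eta>) (frac F (\<eta> ` V i) y \<one>\<^bsub>F\<^esub>) (f i) u c \<and>
      transition (loc R (V i)) (loc E (\<chi> ` V i)) (loc_map E (\<chi> ` V i) \<chi>) (frac E (\<chi> ` V i) x \<one>\<^bsub>E\<^esub>) (e i) u c)"
    if y: "y \<in> carrier F" for y
    by (rule corr_ex1[OF F E cov fin f e swap[OF tr] y])
  define k where "k x = (THE y. corr x y)" for x
  have kc: "corr x y \<longleftrightarrow> y = k x" if x: "x \<in> carrier E" for x y
  proof -
    have "\<exists>!y. corr x y" using ex[OF x] x unfolding corr_def by simp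
    then show ?thesis unfolding k_def by (metis theI_unique)
  qed
  have kF: "k x \<in> carrier F" if "x \<in> carrier E" for x using kc[OF that, of "k x"] by (simp add: corr_def)
  have bij: "bij_betw k (carrier E) (carrier F)"
  proof (rule bij_betwI')
    fix x x' assume x: "x \<in> carrier E" "x' \<in> carrier E"
    have "corr x (k x)" "corr x' (k x')" using kc x by simp_all
    then show "k x = k x' \<longleftrightarrow> x = x'" using ex'[OF kF[OF x(1)]] unfolding corr_def by metis
  next
    show "k x \<in> carrier F" if "x \<in> carrier E" for x using kF that .
    fix y assume y: "y \<in> carrier F"
    then obtain x where "corr x y" using ex'[OF y] y unfolding corr_def by blast
    then show "\<exists>x\<in>carrier E. y = k x" using kc unfolding corr_def by blast
  qed
  have VC: "V i \<subseteq> carrier R" if "i \<in> I" for i using cov that by (auto simp: pcover_def)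
  interpret E: ring_hom_cring R E \<chi> by (rule E)
  interpret F: ring_hom_cring R F \<eta> by (rule F)
  have alg: "corr (x \<oplus>\<^bsub>E\<^esub> x') (y \<oplus>\<^bsub>F\<^esub> y') \<and> corr (x \<otimes>\<^bsub>E\<^esub> x') (y \<otimes>\<^bsub>F\<^esub> y')" if c: "corr x y" "corr x' y'" for x x' y y'
  proof -
    have C: "x \<in> carrier E" "x' \<in> carrier E" "y \<in> carrier F" "y' \<in> carrier F" using c by (auto simp: corr_def)
    have "(\<exists>u c. transition (loc R (V i)) (loc E (\<chi> ` V i)) (loc_map E (\<chi> ` V i) \<chi>) (frac E (\<chi> ` V i) (x \<oplus>\<^bsub>E\<^esub> x') \<one>\<^bsub>E\<^esub>) (e i) u c \<and>
        transition (loc R (V i)) (loc F (\<eta> ` V i)) (loc_map F (\<eta> ` V i) \<eta>) (frac F (\<eta> ` V i) (y \<oplus>\<^bsub>F\<^esub> y') \<one>\<^bsub>F\<^esub>) (f i) u c) \<and>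
      (\<exists>u c. transition (loc R (V i)) (loc E (\<chi> ` V i)) (loc_map E (\<chi> ` V i) \<chi>) (frac E (\<chi> ` V i) (x \<otimes>\<^bsub>E\<^esub> x') \<one>\<^bsub>E\<^esub>) (e i) u c \<and>
        transition (loc R (V i)) (loc F (\<eta> ` V i)) (loc_map F (\<eta> ` V i) \<eta>) (frac F (\<eta> ` V i) (y \<otimes>\<^bsub>F\<^esub> y') \<one>\<^bsub>F\<^esub>) (f i) u c)"
      if i: "i \<in> I" for i
    proof -
      have hom: "ring_hom_cring (loc R (V i)) (loc E (\<chi> ` V i)) (loc_map E (\<chi> ` V i) \<chi>)"
        "ring_hom_cring (loc R (V i)) (loc F (\<eta> ` V i)) (loc_map F (\<eta> ` V i) \<eta>)"
        using E.loc_map_image_hom[OF VC[OF i]] F.loc_map_image_hom[OF VC[OF i]] by auto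
      have fE: "(\<lambda>x. frac E (\<chi> ` V i) x \<one>\<^bsub>E\<^esub>) \<in> ring_hom E (loc E (\<chi> ` V i))"
        and fF: "(\<lambda>x. frac F (\<eta> ` V i) x \<one>\<^bsub>F\<^esub>) \<in> ring_hom F (loc F (\<eta> ` V i))"
        using VC[OF i] by (auto intro!: E.S.frac_ring_hom F.S.frac_ring_hom)
      obtain u c where u: "transition (loc R (V i)) (loc E (\<chi> ` V i)) (loc_map E (\<chi> ` V i) \<chi>) (frac E (\<chi> ` V i) x \<one>\<^bsub>E\<^esub>) (e i) u c"
        "transition (loc R (V i)) (loc F (\<eta> ` V i)) (loc_map F (\<eta> ` V i) \<eta>) (frac F (\<eta> ` V i) y \<one>\<^bsub>F\<^esub>) (f i) u c"
        using c(1) i unfolding corr_def by blast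
      obtain u' c' where u': "transition (loc R (V i)) (loc E (\<chi> ` V i)) (loc_map E (\<chi> ` V i) \<chi>) (frac E (\<chi> ` V i) x' \<one>\<^bsub>E\<^esub>) (e i) u' c'"
        "transition (loc R (V i)) (loc F (\<eta> ` V i)) (loc_map F (\<eta> ` V i) \<eta>) (frac F (\<eta> ` V i) y' \<one>\<^bsub>F\<^esub>) (f i) u' c'"
        using c(2) i unfolding corr_def by blast
      show ?thesis
        unfolding ring_hom_add[OF fE C(1,2)] ring_hom_add[OF fF C(3,4)] ring_hom_mult[OF fE C(1,2)] ring_hom_mult[OF fF C(3,4)]
        using ring_hom_cring.transition_add[OF hom(1) qgenD(3)[OF e[OF i]] u(1) u'(1)]
          ring_hom_cring.transition_add[OF hom(2) qgenD(3)[OF f[OF i]] u(2) u'(2)]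
          ring_hom_cring.transition_mult[OF hom(1) e[OF i] u(1) u'(1)]
          ring_hom_cring.transition_mult[OF hom(2) f[OF i] u(2) u'(2)] by blast
    qed
    then show ?thesis unfolding corr_def using C by simp
  qed
  have scal: "corr (\<chi> a) (\<eta> a)" if a: "a \<in> carrier R" for a
  proof -
    have "\<exists>u c. transition (loc R (V i)) (loc E (\<chi> ` V i)) (loc_map E (\<chi> ` V i) \<chi>) (frac E (\<chi> ` V i) (\<chi> a) \<one>\<^bsub>E\<^esub>) (e i) u c \<and>
        transition (loc R (V i)) (loc F (\<eta> ` V i)) (loc_map F (\<eta> ` V i) \<eta>) (frac F (\<eta> ` V i) (\<eta> a) \<one>\<^bsub>F\<^esub>) (f i) u c"
      if i: "i \<in> I" for i
    proof -
      have aV: "frac R (V i) a \<one> \<in> carrier (loc R (V i))" using a by (rule frac_closed) (rule mgen_one)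
      have h: "loc_map E (\<chi> ` V i) \<chi> (frac R (V i) a \<one>) = frac E (\<chi> ` V i) (\<chi> a) \<one>\<^bsub>E\<^esub>"
        "loc_map F (\<eta> ` V i) \<eta> (frac R (V i) a \<one>) = frac F (\<eta> ` V i) (\<eta> a) \<one>\<^bsub>F\<^esub>"
        using E.loc_map_image_frac[OF VC[OF i] a mgen_one] F.loc_map_image_frac[OF VC[OF i] a mgen_one] by simp_all
      show ?thesis
        using ring_hom_cring.transition_scalar[OF E.loc_map_image_hom[OF VC[OF i]] qgenD(3)[OF e[OF i]] aV]
          ring_hom_cring.transition_scalar[OF F.loc_map_image_hom[OF VC[OF i]] qgenD(3)[OF f[OF i]] aV]
        unfolding h by blast
    qed
    then show ?thesis unfolding corr_def using a by simp
  qed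
  have kh: "k (\<chi> a) = \<eta> a" if "a \<in> carrier R" for a using kc[OF E.hom_closed[OF that], of "\<eta> a"] scal[OF that] by simp
  have kk: "corr x (k x)" if "x \<in> carrier E" for x using kc[OF that] by simp
  have "k \<in> ring_hom E F"
  proof (rule ring_hom_memI)
    show "k x \<in> carrier F" if "x \<in> carrier E" for x using kF that .
    show "k (x \<otimes>\<^bsub>E\<^esub> y) = k x \<otimes>\<^bsub>F\<^esub> k y" if "x \<in> carrier E" "y \<in> carrier E" for x y
      using alg[OF kk[OF that(1)] kk[OF that(2)]] kc[OF E.S.m_closed[OF that]] by simp
    show "k (x \<oplus>\<^bsub>E\<^esub> y) = k x \<oplus>\<^bsub>F\<^esub> k y" if "x \<in> carrier E" "y \<in> carrier E" for x y
      using alg[OF kk[OF that(1)] kk[OF that(2)]] kc[OF E.S.a_closed[OF that]] by simp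
    show "k \<one>\<^bsub>E\<^esub> = \<one>\<^bsub>F\<^esub>" using kh[OF one_closed] by simp
  qed
  then have "alg_iso R E \<chi> F \<eta> k" unfolding alg_iso_def ring_iso_def using bij kh by simp
  then show ?thesis by blast
qed

end

text \<open>
  A cocycle of affine transitions: \<open>gen V g\<close> says that \<open>g\<close> is a local generator over \<open>V\<close> of the
  source, \<open>rs\<close> restricts generators, and the quadratic algebra with parameters \<open>t V g\<close>, \<open>m V g\<close>
  is attached to \<open>g\<close>, with transitions \<open>x \<mapsto> lin V g' g \<cdot> x + con V g' g\<close>. Both the norm
  and the operation \<open>*\<close> are of this kind.
\<close>

locale generator_cocycle = ring_hom_cring R S h
  for R :: "('a, 'r) ring_scheme" (structure) and S :: "('s, 's1) ring_scheme" and h +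
  fixes gen :: "'a set \<Rightarrow> 'g \<Rightarrow> bool" and rs :: "'a set \<Rightarrow> 'g \<Rightarrow> 'g"
    and t m :: "'a set \<Rightarrow> 'g \<Rightarrow> ('a \<times> 'a) set" and lin con :: "'a set \<Rightarrow> 'g \<Rightarrow> 'g \<Rightarrow> ('a \<times> 'a) set"
  assumes gen_rs: "\<lbrakk>V \<subseteq> W; W \<subseteq> carrier R; gen V g\<rbrakk> \<Longrightarrow> gen W (rs W g)"
    and rs_rs: "\<lbrakk>V \<subseteq> W; W \<subseteq> X; X \<subseteq> carrier R; gen V g\<rbrakk> \<Longrightarrow> rs X (rs W g) = rs X g"
    and t_rs: "\<lbrakk>V \<subseteq> W; W \<subseteq> carrier R; gen V g\<rbrakk> \<Longrightarrow> t W (rs W g) = loc_res R W (t V g)"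
    and m_rs: "\<lbrakk>V \<subseteq> W; W \<subseteq> carrier R; gen V g\<rbrakk> \<Longrightarrow> m W (rs W g) = loc_res R W (m V g)"
    and lin_rs: "\<lbrakk>V \<subseteq> W; W \<subseteq> carrier R; gen V g; gen V g'\<rbrakk> \<Longrightarrow> lin W (rs W g) (rs W g') = loc_res R W (lin V g g')"
    and con_rs: "\<lbrakk>V \<subseteq> W; W \<subseteq> carrier R; gen V g; gen V g'\<rbrakk> \<Longrightarrow> con W (rs W g) (rs W g') = loc_res R W (con V g g')"
    and t_closed: "\<lbrakk>V \<subseteq> carrier R; gen V g\<rbrakk> \<Longrightarrow> t V g \<in> carrier (loc R V)"
    and m_closed: "\<lbrakk>V \<subseteq> carrier R; gen V g\<rbrakk> \<Longrightarrow> m V g \<in> carrier (loc R V)"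
    and lin_closed: "\<lbrakk>V \<subseteq> carrier R; gen V g; gen V g'\<rbrakk> \<Longrightarrow> lin V g g' \<in> carrier (loc R V)"
    and con_closed: "\<lbrakk>V \<subseteq> carrier R; gen V g; gen V g'\<rbrakk> \<Longrightarrow> con V g g' \<in> carrier (loc R V)"
    and lin_self: "\<lbrakk>V \<subseteq> carrier R; gen V g\<rbrakk> \<Longrightarrow> lin V g g = \<one>\<^bsub>loc R V\<^esub>"
    and lin_comp: "\<lbrakk>V \<subseteq> carrier R; gen V g; gen V g'; gen V g''\<rbrakk> \<Longrightarrow>
      lin V g'' g = lin V g'' g' \<otimes>\<^bsub>loc R V\<^esub> lin V g' g"
    and con_comp: "\<lbrakk>V \<subseteq> carrier R; gen V g; gen V g'; gen V g''\<rbrakk> \<Longrightarrow>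
      con V g'' g = lin V g'' g' \<otimes>\<^bsub>loc R V\<^esub> con V g' g \<oplus>\<^bsub>loc R V\<^esub> con V g'' g'"
    and t_change: "\<lbrakk>V \<subseteq> carrier R; gen V g; gen V g'\<rbrakk> \<Longrightarrow>
      t V g' = lin V g' g \<otimes>\<^bsub>loc R V\<^esub> t V g \<oplus>\<^bsub>loc R V\<^esub> (con V g' g \<oplus>\<^bsub>loc R V\<^esub> con V g' g)"
    and m_change: "\<lbrakk>V \<subseteq> carrier R; gen V g; gen V g'\<rbrakk> \<Longrightarrow>
      m V g' = lin V g' g \<otimes>\<^bsub>loc R V\<^esub> lin V g' g \<otimes>\<^bsub>loc R V\<^esub> m V g
        \<oplus>\<^bsub>loc R V\<^esub> lin V g' g \<otimes>\<^bsub>loc R V\<^esub> con V g' g \<otimes>\<^bsub>loc R V\<^esub> t V g \<oplus>\<^bsub>loc R V\<^esub> con V g' g \<otimes>\<^bsub>loc R V\<^esub> con V g' g"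
begin

abbreviation "tr V \<equiv> transition (loc R V) (locS V) (loch V)"
abbreviation "qg V \<equiv> qgen (loc R V) (locS V) (loch V)"

lemma rs_mono:
  assumes "V \<subseteq> X" "V' \<subseteq> X" "X \<subseteq> Y" "Y \<subseteq> carrier R" "gen V g" "gen V' g'"
  shows "loc_res R Y (lin X (rs X g) (rs X g')) = lin Y (rs Y g) (rs Y g')"
    "loc_res R Y (con X (rs X g) (rs X g')) = con Y (rs Y g) (rs Y g')"
proof -
  have X: "X \<subseteq> carrier R" using assms by auto
  note G = gen_rs[OF assms(1) X assms(5)] gen_rs[OF assms(2) X assms(6)]
  show "loc_res R Y (lin X (rs X g) (rs X g')) = lin Y (rs Y g) (rs Y g')"
    using lin_rs[OF assms(3,4) G] rs_rs[OF assms(1,3,4,5)] rs_rs[OF assms(2,3,4,6)] by simp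
  show "loc_res R Y (con X (rs X g) (rs X g')) = con Y (rs Y g) (rs Y g')"
    using con_rs[OF assms(3,4) G] rs_rs[OF assms(1,3,4,5)] rs_rs[OF assms(2,3,4,6)] by simp
qed

end

text \<open>An algebra that realizes the cocycle on one chosen cover: the element \<open>w i\<close>
  plays the role of the generator attached to \<open>g i\<close>. This is the information contained
  in \<open>is_Nm\<close> and \<open>is_star\<close>.\<close>

locale glued_cocycle = generator_cocycle +
  fixes k :: nat and a g w
  assumes cov: "covers R k a"
    and g: "\<And>i. i < k \<Longrightarrow> gen {a i} (g i)"
    and w: "\<And>i. i < k \<Longrightarrow> qg {a i} (t {a i} (g i)) (m {a i} (g i)) (w i)"
    and w_tr: "\<And>i j. i < k \<Longrightarrow> j < k \<Longrightarrow> tr {a i, a j} (resS {a i, a j} (w i)) (resS {a i, a j} (w j))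
      (lin {a i, a j} (rs {a i, a j} (g i)) (rs {a i, a j} (g j)))
      (con {a i, a j} (rs {a i, a j} (g i)) (rs {a i, a j} (g j)))"
begin

lemma cov': "pcover R {..<k} (\<lambda>i. {a i})"
  by (rule R.covers_pcover[OF cov])

lemma a_closed: "i < k \<Longrightarrow> a i \<in> carrier R"
  using cov by (auto simp: covers_def)

text \<open>Extends the attachment of \<open>w i\<close> to \<open>g i\<close> to every local
  generator \<open>\<gamma>\<close> over every \<open>V\<close>: \<open>e\<close> is the element
  whose position relative to each \<open>w i\<close> is the one that the cocycle prescribes for
  \<open>\<gamma>\<close> relative to \<open>g i\<close>. The dependence on the chosen cover and
  charts is thereby removed.\<close>

definition img where
  "img V \<gamma> e \<longleftrightarrow> e \<in> carrier (locS V) \<and> (\<forall>i<k.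
     tr (V \<union> {a i}) (resS (V \<union> {a i}) e) (resS (V \<union> {a i}) (w i))
       (lin (V \<union> {a i}) (rs (V \<union> {a i}) \<gamma>) (rs (V \<union> {a i}) (g i)))
       (con (V \<union> {a i}) (rs (V \<union> {a i}) \<gamma>) (rs (V \<union> {a i}) (g i))))"

lemma resS_resS:
  assumes "V \<subseteq> W" "W \<subseteq> X" "X \<subseteq> carrier R" "p \<in> carrier (locS V)"
  shows "resS X (resS W p) = resS X p"
  by (rule S.loc_res_res[OF image_mono[OF assms(1)] image_mono[OF assms(2)] _ assms(4)]) (use assms in auto)

lemma w_closed: "i < k \<Longrightarrow> w i \<in> carrier (locS {a i})"
  by (rule qgenD(3)[OF w])

lemma resS_closed:
  assumes "V \<subseteq> W" "W \<subseteq> carrier R" "p \<in> carrier (locS V)"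
  shows "resS W p \<in> carrier (locS W)"
  by (rule S.loc_res_closed[OF image_mono[OF assms(1)] _ assms(3)]) (use assms in auto)

lemma w_tr_on:
  assumes ij: "i < k" "j < k" and Y: "a i \<in> Y" "a j \<in> Y" "Y \<subseteq> carrier R"
  shows "tr Y (resS Y (w i)) (resS Y (w j)) (lin Y (rs Y (g i)) (rs Y (g j))) (con Y (rs Y (g i)) (rs Y (g j)))"
proof -
  let ?X = "{a i, a j}"
  have X: "?X \<subseteq> Y" "?X \<subseteq> carrier R" "{a i} \<subseteq> ?X" "{a j} \<subseteq> ?X" using Y by auto
  note rr = resS_resS[OF X(3) X(1) Y(3) w_closed[OF ij(1)]] resS_resS[OF X(4) X(1) Y(3) w_closed[OF ij(2)]]
  show ?thesis
    using transition_loc_res[OF X(1) Y(3) resS_closed[OF X(4,2) w_closed[OF ij(2)]] w_tr[OF ij]]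
    unfolding rr rs_mono[OF X(3,4) X(1) Y(3) g[OF ij(1)] g[OF ij(2)]] .
qed

lemma cocycle_trans:
  assumes V: "V \<subseteq> carrier R" and G: "gen V g1" "gen V g2" "gen V g3"
    and t: "tr V e1 e2 (lin V g1 g2) (con V g1 g2)" "tr V e2 e3 (lin V g2 g3) (con V g2 g3)" and e3: "e3 \<in> carrier (locS V)"
  shows "tr V e1 e3 (lin V g1 g3) (con V g1 g3)"
  using ring_hom_cring.transition_trans[OF loc_map_image_hom[OF V] t e3]
  unfolding lin_comp[OF V G(3,2,1), symmetric] con_comp[OF V G(3,2,1), symmetric] .

text \<open>Over \<open>V\<close> and \<open>a i\<close> together the element is forced to be an
  affine expression in \<open>w i\<close>. The composition rules of the cocycle show that these
  expressions agree on overlaps, and \<open>qgen_local\<close> makes the glued element a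
  generator.\<close>

lemma img_ex:
  assumes V: "V \<subseteq> carrier R" and \<gamma>: "gen V \<gamma>"
  obtains e where "qg V (t V \<gamma>) (m V \<gamma>) e" "img V \<gamma> e"
proof -
  let ?X = "\<lambda>i. V \<union> {a i}"
  have X: "?X i \<subseteq> carrier R" "V \<subseteq> ?X i" "{a i} \<subseteq> ?X i" if "i < k" for i using V a_closed[OF that] by auto
  note H = loc_map_image_hom[OF X(1)]
  let ?l = "\<lambda>i. lin (?X i) (rs (?X i) \<gamma>) (rs (?X i) (g i))" and ?c = "\<lambda>i. con (?X i) (rs (?X i) \<gamma>) (rs (?X i) (g i))"
  have G: "gen (?X i) (rs (?X i) \<gamma>)" "gen (?X i) (rs (?X i) (g i))" if i: "i < k" for i
    by (rule gen_rs[OF X(2)[OF i] X(1)[OF i] \<gamma>], rule gen_rs[OF X(3)[OF i] X(1)[OF i] g[OF i]])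
  have lc: "?l i \<in> carrier (loc R (?X i))" "?c i \<in> carrier (loc R (?X i))" if i: "i < k" for i
    by (rule lin_closed[OF X(1)[OF i] G[OF i]], rule con_closed[OF X(1)[OF i] G[OF i]])
  let ?w = "\<lambda>i. resS (?X i) (w i)"
  have wq: "qg (?X i) (t (?X i) (rs (?X i) (g i))) (m (?X i) (rs (?X i) (g i))) (?w i)" if i: "i < k" for i
    using qgen_loc_res[OF X(3)[OF i] X(1)[OF i] w[OF i]]
    unfolding t_rs[OF X(3)[OF i] X(1)[OF i] g[OF i]] m_rs[OF X(3)[OF i] X(1)[OF i] g[OF i]] .
  let ?p = "\<lambda>i. loch (?X i) (?l i) \<otimes>\<^bsub>locS (?X i)\<^esub> ?w i \<oplus>\<^bsub>locS (?X i)\<^esub> loch (?X i) (?c i)"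
  have trp: "tr (?X i) (?p i) (?w i) (?l i) (?c i)" if i: "i < k" for i
    using lc[OF i] by (simp add: transition_def)
  have pq: "qg (?X i) (loc_res R (?X i) (t V \<gamma>)) (loc_res R (?X i) (m V \<gamma>)) (?p i)" if i: "i < k" for i
  proof -
    \<comment> \<open>The linear coefficient is invertible: its product with that of the opposite
      transition is the coefficient from \<open>g i\<close> to itself.\<close>
    have u: "lin (?X i) (rs (?X i) (g i)) (rs (?X i) \<gamma>) \<otimes>\<^bsub>loc R (?X i)\<^esub> ?l i = \<one>\<^bsub>loc R (?X i)\<^esub>"
      using lin_comp[OF X(1)[OF i] G(2)[OF i] G(1)[OF i] G(2)[OF i]] lin_self[OF X(1)[OF i] G(2)[OF i]] by simp
    show ?thesis
      unfolding t_rs[OF X(2)[OF i] X(1)[OF i] \<gamma>, symmetric] m_rs[OF X(2)[OF i] X(1)[OF i] \<gamma>, symmetric]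
        t_change[OF X(1)[OF i] G(2)[OF i] G(1)[OF i]] m_change[OF X(1)[OF i] G(2)[OF i] G(1)[OF i]]
      by (rule ring_hom_cring.qgen_change[OF H[OF i] wq[OF i] lc(1)[OF i] lin_closed[OF X(1)[OF i] G(2)[OF i] G(1)[OF i]] u lc(2)[OF i]])
  qed
  have trY: "tr Y (resS Y (?p i)) (resS Y (w i)) (lin Y (rs Y \<gamma>) (rs Y (g i))) (con Y (rs Y \<gamma>) (rs Y (g i)))"
    if i: "i < k" and Y: "?X i \<subseteq> Y" "Y \<subseteq> carrier R" for i Y
    using transition_loc_res[OF Y qgenD(3)[OF wq[OF i]] trp[OF i]]
    unfolding resS_resS[OF X(3)[OF i] Y w_closed[OF i]] rs_mono[OF X(2)[OF i] X(3)[OF i] Y \<gamma> g[OF i]] .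
  have overlap: "resS (V \<union> {a i} \<union> {a j}) (?p i) = resS (V \<union> {a i} \<union> {a j}) (?p j)" if ij: "i < k" "j < k" for i j
  proof -
    let ?Y = "V \<union> {a i} \<union> {a j}"
    have Y: "?Y \<subseteq> carrier R" "?X i \<subseteq> ?Y" "?X j \<subseteq> ?Y" "a i \<in> ?Y" "a j \<in> ?Y" "V \<subseteq> ?Y" "{a i} \<subseteq> ?Y" "{a j} \<subseteq> ?Y"
      using V a_closed[OF ij(1)] a_closed[OF ij(2)] by auto
    have c: "tr ?Y (resS ?Y (?p i)) (resS ?Y (w j)) (lin ?Y (rs ?Y \<gamma>) (rs ?Y (g j))) (con ?Y (rs ?Y \<gamma>) (rs ?Y (g j)))"
      by (rule cocycle_trans[OF Y(1) gen_rs[OF Y(6,1) \<gamma>] gen_rs[OF Y(7,1) g[OF ij(1)]] gen_rs[OF Y(8,1) g[OF ij(2)]]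
          trY[OF ij(1) Y(2,1)] w_tr_on[OF ij Y(4,5,1)] resS_closed[OF Y(8,1) w_closed[OF ij(2)]]])
    show ?thesis by (rule ring_hom_cring.transition_fun[OF loc_map_image_hom[OF Y(1)] c trY[OF ij(2) Y(3,1)]])
  qed
  obtain e where e: "e \<in> carrier (locS V)" "\<And>i. i \<in> {..<k} \<Longrightarrow> resS (V \<union> {a i}) e = ?p i"
    by (rule loc_image_glue[OF cov' finite_lessThan V, of ?p]) (use qgenD(3)[OF pq] overlap in simp_all)
  have "qg V (t V \<gamma>) (m V \<gamma>) e"
    by (rule qgen_local[OF cov' finite_lessThan V t_closed[OF V \<gamma>] m_closed[OF V \<gamma>] e(1)]) (simp only: e(2) lessThan_iff pq)
  moreover have "img V \<gamma> e" unfolding img_def using e trp by simp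
  ultimately show ?thesis by (rule that)
qed

text \<open>Both elements are compared with each \<open>w i\<close>; the composition rule of the
  cocycle yields the claimed relation over the pieces, and equality is local.\<close>

lemma img_transition:
  assumes V: "V \<subseteq> carrier R" and G: "gen V \<gamma>" "gen V \<gamma>'" and e: "img V \<gamma> e" "img V \<gamma>' e'"
  shows "tr V e e' (lin V \<gamma> \<gamma>') (con V \<gamma> \<gamma>')"
proof -
  interpret H: ring_hom_cring "loc R V" "locS V" "loch V" by (rule loc_map_image_hom[OF V])
  have eC: "e \<in> carrier (locS V)" "e' \<in> carrier (locS V)" using e by (auto simp: img_def)
  have l: "lin V \<gamma> \<gamma>' \<in> carrier (loc R V)" "con V \<gamma> \<gamma>' \<in> carrier (loc R V)"
    by (rule lin_closed[OF V G], rule con_closed[OF V G])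
  let ?e = "loch V (lin V \<gamma> \<gamma>') \<otimes>\<^bsub>locS V\<^esub> e' \<oplus>\<^bsub>locS V\<^esub> loch V (con V \<gamma> \<gamma>')"
  have tr0: "tr V ?e e' (lin V \<gamma> \<gamma>') (con V \<gamma> \<gamma>')" using l by (simp add: transition_def)
  have "e = ?e"
  proof (rule loc_image_separated[OF cov' V eC(1)])
    show "?e \<in> carrier (locS V)" using l eC by simp
    fix i assume "i \<in> {..<k}"
    then have i: "i < k" by simp
    let ?X = "V \<union> {a i}"
    have X: "?X \<subseteq> carrier R" "V \<subseteq> ?X" "{a i} \<subseteq> ?X" using V a_closed[OF i] by auto
    have 1: "tr ?X (resS ?X ?e) (resS ?X e') (lin ?X (rs ?X \<gamma>) (rs ?X \<gamma>')) (con ?X (rs ?X \<gamma>) (rs ?X \<gamma>'))"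
      unfolding lin_rs[OF X(2,1) G] con_rs[OF X(2,1) G] by (rule transition_loc_res[OF X(2,1) eC(2) tr0])
    have 2: "tr ?X (resS ?X e') (resS ?X (w i)) (lin ?X (rs ?X \<gamma>') (rs ?X (g i))) (con ?X (rs ?X \<gamma>') (rs ?X (g i)))"
      "tr ?X (resS ?X e) (resS ?X (w i)) (lin ?X (rs ?X \<gamma>) (rs ?X (g i))) (con ?X (rs ?X \<gamma>) (rs ?X (g i)))"
      using e i by (auto simp: img_def)
    show "resS ?X e = resS ?X ?e"
      by (rule ring_hom_cring.transition_fun[OF loc_map_image_hom[OF X(1)] 2(2)
          cocycle_trans[OF X(1) gen_rs[OF X(2,1) G(1)] gen_rs[OF X(2,1) G(2)] gen_rs[OF X(3,1) g[OF i]] 1 2(1) resS_closed[OF X(3,1) w_closed[OF i]]]])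
  qed
  then show ?thesis using tr0 by simp
qed

text \<open>Lets images defined over different localizations be compared on their overlap.\<close>

lemma img_res:
  assumes VW: "V \<subseteq> W" and W: "W \<subseteq> carrier R" and G: "gen V \<gamma>" and e: "img V \<gamma> e"
  shows "img W (rs W \<gamma>) (resS W e)"
  unfolding img_def
proof (intro conjI allI impI)
  have eC: "e \<in> carrier (locS V)" using e by (simp add: img_def)
  show "resS W e \<in> carrier (locS W)" by (rule resS_closed[OF VW W eC])
  fix i assume i: "i < k"
  let ?X = "V \<union> {a i}" and ?Y = "W \<union> {a i}"
  have s: "V \<subseteq> ?X" "{a i} \<subseteq> ?X" "?X \<subseteq> ?Y" "?Y \<subseteq> carrier R" "?X \<subseteq> carrier R" "W \<subseteq> ?Y" using VW W a_closed[OF i] by auto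
  have "tr ?X (resS ?X e) (resS ?X (w i)) (lin ?X (rs ?X \<gamma>) (rs ?X (g i))) (con ?X (rs ?X \<gamma>) (rs ?X (g i)))"
    using e i by (simp add: img_def)
  from transition_loc_res[OF s(3,4) resS_closed[OF s(2,5) w_closed[OF i]] this]
  show "tr ?Y (resS ?Y (resS W e)) (resS ?Y (w i)) (lin ?Y (rs ?Y (rs W \<gamma>)) (rs ?Y (g i))) (con ?Y (rs ?Y (rs W \<gamma>)) (rs ?Y (g i)))"
    unfolding rs_mono[OF s(1,2,3,4) G g[OF i]] resS_resS[OF s(1,3,4) eC] resS_resS[OF s(2,3,4) w_closed[OF i]]
      resS_resS[OF VW s(6,4) eC] rs_rs[OF VW s(6,4) G] .
qed

end

section \<open>Norms of transitions\<close>

context cring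
begin

lemma add_pow_2: "x \<in> carrier R \<Longrightarrow> [(2::int)] \<cdot> x = x \<oplus> x"
  by (simp add: add_pow_def int_pow_def2 numeral_2_eq_2)

lemma add_pow_4: "x \<in> carrier R \<Longrightarrow> [(4::int)] \<cdot> x = (\<one> \<oplus> \<one>) \<otimes> (\<one> \<oplus> \<one>) \<otimes> x"
  by (simp add: add_pow_def int_pow_def2 eval_nat_numeral l_distr r_distr a_ac)

lemma add_pow_minus_4: "[(- 4::int)] \<cdot> \<one> = \<ominus> ((\<one> \<oplus> \<one>) \<otimes> (\<one> \<oplus> \<one>))"
  by (simp add: add_pow_def int_pow_def2 eval_nat_numeral l_distr r_distr a_ac a_inv_def)

text \<open>The form \<open>m t^2 + p s^2 + \<mu> m p\<close> with \<open>\<mu> = -4\<close> is the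
  direction occurring in \<open>K_mult\<close>. The formula expresses that the discriminants
  \<open>s^2 - 4 m\<close> and \<open>t^2 - 4 p\<close> are multiplied.\<close>

lemma star_const_eq:
  assumes "s \<in> carrier R" "m \<in> carrier R" "t \<in> carrier R" "p \<in> carrier R"
  shows "star_const R s m t p = m \<otimes> (t \<otimes> t) \<oplus> p \<otimes> (s \<otimes> s) \<oplus> \<ominus> ((\<one> \<oplus> \<one>) \<otimes> (\<one> \<oplus> \<one>)) \<otimes> (m \<otimes> p)"
  unfolding star_const_def using assms by (simp add: add_pow_4 numeral_2_eq_2 a_minus_def l_minus)

lemma star_shift_eq:
  assumes "s \<in> carrier R" "t \<in> carrier R" "u \<in> carrier R" "c \<in> carrier R" "v \<in> carrier R" "d \<in> carrier R"
  shows "star_shift R s t u c v d = c \<otimes> (v \<otimes> t) \<oplus> d \<otimes> (u \<otimes> s) \<oplus> (\<one> \<oplus> \<one>) \<otimes> (c \<otimes> d)"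
  unfolding star_shift_def using assms by (simp add: add_pow_2 l_distr m_assoc)

lemma star_closed:
  "\<lbrakk>s \<in> carrier R; m \<in> carrier R; t \<in> carrier R; p \<in> carrier R\<rbrakk> \<Longrightarrow> star_const R s m t p \<in> carrier R"
  "\<lbrakk>s \<in> carrier R; t \<in> carrier R; u \<in> carrier R; c \<in> carrier R; v \<in> carrier R; d \<in> carrier R\<rbrakk> \<Longrightarrow> star_shift R s t u c v d \<in> carrier R"
  by (simp_all add: star_const_eq star_shift_eq)

lemma star_trace:
  assumes [simp]: "s \<in> carrier R" "t \<in> carrier R" "u \<in> carrier R" "c \<in> carrier R" "v \<in> carrier R" "d \<in> carrier R"
  shows "(u \<otimes> s \<oplus> (c \<oplus> c)) \<otimes> (v \<otimes> t \<oplus> (d \<oplus> d))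
    = (u \<otimes> v) \<otimes> (s \<otimes> t) \<oplus> (star_shift R s t u c v d \<oplus> star_shift R s t u c v d)"
  unfolding star_shift_eq[OF assms] by (simp add: cring_distrib)

text \<open>Put \<open>a = u s\<close>, \<open>b = v t\<close>, \<open>q = a c + c^2\<close> and
  \<open>r = b d + d^2\<close>. The new constants are \<open>u^2 m + q\<close> and
  \<open>v^2 p + r\<close>, the squares of the new traces are \<open>a^2 + 4 q\<close> and
  \<open>b^2 + 4 r\<close>. In the star constant the terms mixing \<open>m\<close> with
  \<open>r\<close> and \<open>p\<close> with \<open>q\<close> cancel, and what is left over,
  \<open>q b^2 + r a^2 + 4 q r\<close>, equals \<open>h a b + h^2\<close> for the star shift
  \<open>h\<close>.\<close>

lemma star_const_change:
  assumes [simp]: "s \<in> carrier R" "m \<in> carrier R" "t \<in> carrier R" "p \<in> carrier R"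
    "u \<in> carrier R" "c \<in> carrier R" "v \<in> carrier R" "d \<in> carrier R"
  shows "star_const R (u \<otimes> s \<oplus> (c \<oplus> c)) (u \<otimes> u \<otimes> m \<oplus> u \<otimes> c \<otimes> s \<oplus> c \<otimes> c)
      (v \<otimes> t \<oplus> (d \<oplus> d)) (v \<otimes> v \<otimes> p \<oplus> v \<otimes> d \<otimes> t \<oplus> d \<otimes> d)
    = (u \<otimes> v) \<otimes> (u \<otimes> v) \<otimes> star_const R s m t p \<oplus> (u \<otimes> v) \<otimes> star_shift R s t u c v d \<otimes> (s \<otimes> t)
      \<oplus> star_shift R s t u c v d \<otimes> star_shift R s t u c v d"
proof -
  let ?s = "u \<otimes> s \<oplus> (c \<oplus> c)" and ?m = "u \<otimes> u \<otimes> m \<oplus> u \<otimes> c \<otimes> s \<oplus> c \<otimes> c"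
  let ?t = "v \<otimes> t \<oplus> (d \<oplus> d)" and ?p = "v \<otimes> v \<otimes> p \<oplus> v \<otimes> d \<otimes> t \<oplus> d \<otimes> d"
  let ?f = "(\<one> \<oplus> \<one>) \<otimes> (\<one> \<oplus> \<one>)" and ?w = "(u \<otimes> v) \<otimes> (u \<otimes> v)" and ?h = "star_shift R s t u c v d"
  \<comment> \<open>The part of the product of the two new constants beyond
    \<open>u^2 v^2 m p\<close>. Four times it appears in \<open>pos\<close> and is removed by the
    last term of \<open>star_const\<close>.\<close>
  let ?y = "(u \<otimes> u \<otimes> m) \<otimes> (v \<otimes> d \<otimes> t \<oplus> d \<otimes> d) \<oplus> (u \<otimes> c \<otimes> s \<oplus> c \<otimes> c) \<otimes> ?p"
  let ?q = "m \<otimes> (t \<otimes> t) \<oplus> p \<otimes> (s \<otimes> s)"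
  have C: "?s \<in> carrier R" "?m \<in> carrier R" "?t \<in> carrier R" "?p \<in> carrier R" "?f \<in> carrier R" "?w \<in> carrier R" "?y \<in> carrier R"
    "?q \<in> carrier R" "m \<otimes> p \<in> carrier R" "?w \<otimes> (m \<otimes> p) \<in> carrier R" by simp_all
  have h: "?h \<in> carrier R" by (rule star_closed) simp_all
  have mp: "?m \<otimes> ?p = ?w \<otimes> (m \<otimes> p) \<oplus> ?y" by (simp add: cring_distrib)
  let ?q1 = "(u \<otimes> s) \<otimes> c \<oplus> c \<otimes> c" and ?r1 = "(v \<otimes> t) \<otimes> d \<oplus> d \<otimes> d"
  have dist: "(M \<oplus> q) \<otimes> (b \<otimes> b \<oplus> f \<otimes> r) \<oplus> (P \<oplus> r) \<otimes> (a \<otimes> a \<oplus> f \<otimes> q)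
    = (M \<otimes> (b \<otimes> b) \<oplus> P \<otimes> (a \<otimes> a)) \<oplus> (q \<otimes> (b \<otimes> b) \<oplus> r \<otimes> (a \<otimes> a) \<oplus> f \<otimes> (q \<otimes> r)) \<oplus> f \<otimes> (M \<otimes> r \<oplus> q \<otimes> (P \<oplus> r))"
    if "M \<in> carrier R" "q \<in> carrier R" "b \<in> carrier R" "f \<in> carrier R" "r \<in> carrier R" "P \<in> carrier R" "a \<in> carrier R" for M q b f r P a
    using that by (simp add: cring_distrib)
  have quad: "(a \<otimes> c \<oplus> c \<otimes> c) \<otimes> (b \<otimes> b) \<oplus> (b \<otimes> d \<oplus> d \<otimes> d) \<otimes> (a \<otimes> a) \<oplus> ?f \<otimes> ((a \<otimes> c \<oplus> c \<otimes> c) \<otimes> (b \<otimes> d \<oplus> d \<otimes> d))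
    = (c \<otimes> b \<oplus> d \<otimes> a \<oplus> (\<one> \<oplus> \<one>) \<otimes> (c \<otimes> d)) \<otimes> (a \<otimes> b)
      \<oplus> (c \<otimes> b \<oplus> d \<otimes> a \<oplus> (\<one> \<oplus> \<one>) \<otimes> (c \<otimes> d)) \<otimes> (c \<otimes> b \<oplus> d \<otimes> a \<oplus> (\<one> \<oplus> \<one>) \<otimes> (c \<otimes> d))"
    if "a \<in> carrier R" "b \<in> carrier R" for a b
    using that by (simp add: cring_distrib)
  have sq: "(a \<oplus> (e \<oplus> e)) \<otimes> (a \<oplus> (e \<oplus> e)) = a \<otimes> a \<oplus> ?f \<otimes> (a \<otimes> e \<oplus> e \<otimes> e)" if "a \<in> carrier R" "e \<in> carrier R" for a e
    using that by (simp add: cring_distrib)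
  have qr: "u \<otimes> c \<otimes> s \<oplus> c \<otimes> c = ?q1" "v \<otimes> d \<otimes> t \<oplus> d \<otimes> d = ?r1" by (simp_all add: m_ac)
  have MP: "?m = u \<otimes> u \<otimes> m \<oplus> ?q1" "?p = v \<otimes> v \<otimes> p \<oplus> ?r1" unfolding qr[symmetric] by (simp_all add: a_assoc)
  have tot: "(u \<otimes> u \<otimes> m) \<otimes> ((v \<otimes> t) \<otimes> (v \<otimes> t)) \<oplus> (v \<otimes> v \<otimes> p) \<otimes> ((u \<otimes> s) \<otimes> (u \<otimes> s)) = ?w \<otimes> ?q"
    "g \<otimes> ((u \<otimes> s) \<otimes> (v \<otimes> t)) = (u \<otimes> v) \<otimes> g \<otimes> (s \<otimes> t)" if "g \<in> carrier R" for g using that by (simp_all add: r_distr m_ac)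
  have pos: "?m \<otimes> (?t \<otimes> ?t) \<oplus> ?p \<otimes> (?s \<otimes> ?s) = (?w \<otimes> ?q \<oplus> (u \<otimes> v) \<otimes> ?h \<otimes> (s \<otimes> t) \<oplus> ?h \<otimes> ?h) \<oplus> ?f \<otimes> ?y"
  proof -
    have "?m \<otimes> (?t \<otimes> ?t) \<oplus> ?p \<otimes> (?s \<otimes> ?s) = ?w \<otimes> ?q \<oplus> (?h \<otimes> ((u \<otimes> s) \<otimes> (v \<otimes> t)) \<oplus> ?h \<otimes> ?h) \<oplus> ?f \<otimes> ?y"
      unfolding star_shift_eq[OF assms(1,3,5-8)] MP qr sq[OF m_closed[OF assms(5,1)] assms(6)] sq[OF m_closed[OF assms(7,3)] assms(8)]
      by (subst dist) (simp_all only: quad tot(1)[OF one_closed] m_closed assms a_closed one_closed)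
    then show ?thesis unfolding tot(2)[OF h] using h by (simp add: a_assoc)
  qed
  have cancel: "(z \<oplus> f \<otimes> y) \<oplus> \<ominus> f \<otimes> (x \<oplus> y) = z \<oplus> \<ominus> f \<otimes> x"
    if "x \<in> carrier R" "y \<in> carrier R" "z \<in> carrier R" "f \<in> carrier R" for x y z f using that by algebra
  have comb: "w \<otimes> (q \<oplus> f \<otimes> r) \<oplus> a \<oplus> b = (w \<otimes> q \<oplus> a \<oplus> b) \<oplus> f \<otimes> (w \<otimes> r)"
    if "w \<in> carrier R" "q \<in> carrier R" "f \<in> carrier R" "r \<in> carrier R" "a \<in> carrier R" "b \<in> carrier R" for w q f r a b
    using that by (simp add: cring_distrib)
  have zC: "?w \<otimes> ?q \<oplus> (u \<otimes> v) \<otimes> ?h \<otimes> (s \<otimes> t) \<oplus> ?h \<otimes> ?h \<in> carrier R" using h by simp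
  have "star_const R ?s ?m ?t ?p = (?w \<otimes> ?q \<oplus> (u \<otimes> v) \<otimes> ?h \<otimes> (s \<otimes> t) \<oplus> ?h \<otimes> ?h) \<oplus> \<ominus> ?f \<otimes> (?w \<otimes> (m \<otimes> p))"
    unfolding star_const_eq[OF C(1-4)] pos mp by (rule cancel[OF C(10,7) zC C(5)])
  also have "\<dots> = ?w \<otimes> (?q \<oplus> \<ominus> ?f \<otimes> (m \<otimes> p)) \<oplus> (u \<otimes> v) \<otimes> ?h \<otimes> (s \<otimes> t) \<oplus> ?h \<otimes> ?h"
    by (rule comb[symmetric, OF C(6,8) a_inv_closed[OF C(5)] C(9)]) (use h in simp_all)
  finally show ?thesis unfolding star_const_eq[OF assms(1-4)] .
qed

lemma star_shift_comp:
  assumes [simp]: "s \<in> carrier R" "t \<in> carrier R" "u \<in> carrier R" "c \<in> carrier R" "v \<in> carrier R" "d \<in> carrier R"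
    "u' \<in> carrier R" "c' \<in> carrier R" "v' \<in> carrier R" "d' \<in> carrier R"
  shows "star_shift R s t (u' \<otimes> u) (u' \<otimes> c \<oplus> c') (v' \<otimes> v) (v' \<otimes> d \<oplus> d')
    = (u' \<otimes> v') \<otimes> star_shift R s t u c v d \<oplus> star_shift R (u \<otimes> s \<oplus> (c \<oplus> c)) (v \<otimes> t \<oplus> (d \<oplus> d)) u' c' v' d'"
proof -
  have C: "u \<otimes> s \<oplus> (c \<oplus> c) \<in> carrier R" "v \<otimes> t \<oplus> (d \<oplus> d) \<in> carrier R"
    "u' \<otimes> u \<in> carrier R" "u' \<otimes> c \<oplus> c' \<in> carrier R" "v' \<otimes> v \<in> carrier R" "v' \<otimes> d \<oplus> d' \<in> carrier R" by simp_all
  show ?thesis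
    unfolding star_shift_eq[OF assms(1-6)] star_shift_eq[OF assms(1,2) C(3-6)] star_shift_eq[OF C(1,2) assms(7-10)]
    by (simp add: cring_distrib)
qed

lemma lin_comm_aux:
  assumes [simp]: "u \<in> carrier R" "v \<in> carrier R" "u' \<in> carrier R" "v' \<in> carrier R"
  shows "(u' \<otimes> u) \<otimes> (v' \<otimes> v) = (u' \<otimes> v') \<otimes> (u \<otimes> v)"
  by (simp add: m_ac)

text \<open>With \<open>P = u t\<close>, the shift by \<open>c\<close> alters the constant by
  \<open>c (P + c)\<close>, and moving from \<open>(P + 2 c)^2\<close> by -4 times this amount leads
  back to \<open>P^2\<close>. Both facts are needed to chain the identities for \<open>K\<close> in
  \<open>norm_const_change\<close>.\<close>

lemma pencil_aux:
  assumes [simp]: "u \<in> carrier R" "t \<in> carrier R" "c \<in> carrier R"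
  shows "u \<otimes> c \<otimes> t \<oplus> c \<otimes> c = c \<otimes> (u \<otimes> t \<oplus> c)"
    "(u \<otimes> t \<oplus> (c \<oplus> c)) \<otimes> (u \<otimes> t \<oplus> (c \<oplus> c)) = (u \<otimes> t) \<otimes> (u \<otimes> t) \<oplus> (\<one> \<oplus> \<one>) \<otimes> (\<one> \<oplus> \<one>) \<otimes> (c \<otimes> (u \<otimes> t \<oplus> c))" (is ?sq)
    "(u \<otimes> t \<oplus> (c \<oplus> c)) \<otimes> (u \<otimes> t \<oplus> (c \<oplus> c)) \<oplus> \<ominus> ((\<one> \<oplus> \<one>) \<otimes> (\<one> \<oplus> \<one>)) \<otimes> (c \<otimes> (u \<otimes> t \<oplus> c)) = (u \<otimes> u) \<otimes> (t \<otimes> t)"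
proof -
  show sq: ?sq by (simp add: cring_distrib)
  have cancel: "(x \<oplus> f \<otimes> y) \<oplus> \<ominus> f \<otimes> y = x" if "x \<in> carrier R" "y \<in> carrier R" "f \<in> carrier R" for x y f
    using that by algebra
  show "(u \<otimes> t \<oplus> (c \<oplus> c)) \<otimes> (u \<otimes> t \<oplus> (c \<oplus> c)) \<oplus> \<ominus> ((\<one> \<oplus> \<one>) \<otimes> (\<one> \<oplus> \<one>)) \<otimes> (c \<otimes> (u \<otimes> t \<oplus> c)) = (u \<otimes> u) \<otimes> (t \<otimes> t)"
    unfolding sq by (subst cancel) (simp_all add: m_ac)
qed (simp add: cring_distrib)

end

lemma (in ring_hom_cring) star_hom:
  "\<lbrakk>s \<in> carrier R; m \<in> carrier R; t \<in> carrier R; p \<in> carrier R\<rbrakk> \<Longrightarrow> star_const S (h s) (h m) (h t) (h p) = h (star_const R s m t p)"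
  "\<lbrakk>s \<in> carrier R; t \<in> carrier R; u \<in> carrier R; c \<in> carrier R; v \<in> carrier R; d \<in> carrier R\<rbrakk> \<Longrightarrow>
    star_shift S (h s) (h t) (h u) (h c) (h v) (h d) = h (star_shift R s t u c v d)"
  by (simp_all add: R.star_const_eq S.star_const_eq R.star_shift_eq S.star_shift_eq)

section \<open>Functoriality of the norm formulas and compatibility with the star formulas\<close>

context rank_framed
begin

lemma two_smult: "b \<in> carrier B \<Longrightarrow> \<phi> (\<one> \<oplus> \<one>) \<otimes>\<^bsub>B\<^esub> b = b \<oplus>\<^bsub>B\<^esub> b"
  by (simp add: S.l_distr)

lemma norm_shift_K:
  "\<lbrakk>T \<in> carrier B; U \<in> carrier B; C \<in> carrier B\<rbrakk> \<Longrightarrow> norm_shift n A B \<phi> T U C = K (\<one> \<oplus> \<one>) C (U \<otimes>\<^bsub>B\<^esub> T)"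
  by (simp add: norm_shift_eq R.add_pow_2)

lemma norm_const_K:
  "\<lbrakk>T \<in> carrier B; N \<in> carrier B\<rbrakk> \<Longrightarrow> norm_const n A B \<phi> T N = K (\<ominus> ((\<one> \<oplus> \<one>) \<otimes> (\<one> \<oplus> \<one>))) N (T \<otimes>\<^bsub>B\<^esub> T)"
  by (simp add: norm_const_eq R.add_pow_minus_4)

lemma norm_data_closed:
  "b \<in> carrier B \<Longrightarrow> norm_fun n A B \<phi> b \<in> carrier A"
  "\<lbrakk>T \<in> carrier B; U \<in> carrier B; C \<in> carrier B\<rbrakk> \<Longrightarrow> norm_shift n A B \<phi> T U C \<in> carrier A"
  "\<lbrakk>T \<in> carrier B; N \<in> carrier B\<rbrakk> \<Longrightarrow> norm_const n A B \<phi> T N \<in> carrier A"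
  by (simp_all add: norm_shift_K norm_const_K norm_fun_nm)

lemma norm_fun_mult:
  "\<lbrakk>b \<in> carrier B; c \<in> carrier B\<rbrakk> \<Longrightarrow> norm_fun n A B \<phi> (b \<otimes>\<^bsub>B\<^esub> c) = norm_fun n A B \<phi> b \<otimes> norm_fun n A B \<phi> c"
  "norm_fun n A B \<phi> \<one>\<^bsub>B\<^esub> = \<one>"
  by (simp_all add: norm_fun_nm nm_mult)

lemma norm_trace_change:
  assumes C: "T \<in> carrier B" "U \<in> carrier B" "C \<in> carrier B"
  shows "norm_fun n A B \<phi> (U \<otimes>\<^bsub>B\<^esub> T \<oplus>\<^bsub>B\<^esub> (C \<oplus>\<^bsub>B\<^esub> C))
    = norm_fun n A B \<phi> U \<otimes> norm_fun n A B \<phi> T \<oplus> (norm_shift n A B \<phi> T U C \<oplus> norm_shift n A B \<phi> T U C)"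
proof -
  have "nm (U \<otimes>\<^bsub>B\<^esub> T \<oplus>\<^bsub>B\<^esub> \<phi> (\<one> \<oplus> \<one>) \<otimes>\<^bsub>B\<^esub> C) = nm (U \<otimes>\<^bsub>B\<^esub> T) \<oplus> (\<one> \<oplus> \<one>) \<otimes> K (\<one> \<oplus> \<one>) C (U \<otimes>\<^bsub>B\<^esub> T)"
    using C by (intro nm_add) auto
  then show ?thesis
    unfolding two_smult[OF C(3)] norm_shift_K[OF C] using C by (simp add: norm_fun_nm nm_mult R.l_distr)
qed

text \<open>\<open>K_add\<close> for the scalar 2, starting at \<open>U' U T\<close>: the
  intermediate point \<open>U' (U T + 2 C)\<close> is \<open>U'\<close> times the trace of the
  intermediate algebra, and \<open>K_scale\<close> extracts the norm of \<open>U'\<close> from the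
  first summand.\<close>

lemma norm_shift_comp:
  assumes C: "T \<in> carrier B" "U \<in> carrier B" "C \<in> carrier B" "U' \<in> carrier B" "C' \<in> carrier B"
  shows "norm_shift n A B \<phi> T (U' \<otimes>\<^bsub>B\<^esub> U) (U' \<otimes>\<^bsub>B\<^esub> C \<oplus>\<^bsub>B\<^esub> C')
    = norm_fun n A B \<phi> U' \<otimes> norm_shift n A B \<phi> T U C \<oplus> norm_shift n A B \<phi> (U \<otimes>\<^bsub>B\<^esub> T \<oplus>\<^bsub>B\<^esub> (C \<oplus>\<^bsub>B\<^esub> C)) U' C'"
proof -
  let ?t = "\<one> \<oplus> \<one>"
  have t: "?t \<in> carrier A" by simp
  have b: "U' \<otimes>\<^bsub>B\<^esub> C \<in> carrier B" "U \<otimes>\<^bsub>B\<^esub> T \<in> carrier B" using C by auto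
  have e: "U' \<otimes>\<^bsub>B\<^esub> (U \<otimes>\<^bsub>B\<^esub> T) \<oplus>\<^bsub>B\<^esub> (U' \<otimes>\<^bsub>B\<^esub> C \<oplus>\<^bsub>B\<^esub> U' \<otimes>\<^bsub>B\<^esub> C) = U' \<otimes>\<^bsub>B\<^esub> (U \<otimes>\<^bsub>B\<^esub> T \<oplus>\<^bsub>B\<^esub> (C \<oplus>\<^bsub>B\<^esub> C))"
    using C by (simp add: S.r_distr)
  have "K ?t (U' \<otimes>\<^bsub>B\<^esub> C \<oplus>\<^bsub>B\<^esub> C') (U' \<otimes>\<^bsub>B\<^esub> (U \<otimes>\<^bsub>B\<^esub> T))
    = K ?t (U' \<otimes>\<^bsub>B\<^esub> C) (U' \<otimes>\<^bsub>B\<^esub> (U \<otimes>\<^bsub>B\<^esub> T)) \<oplus> K ?t C' (U' \<otimes>\<^bsub>B\<^esub> (U \<otimes>\<^bsub>B\<^esub> T) \<oplus>\<^bsub>B\<^esub> \<phi> ?t \<otimes>\<^bsub>B\<^esub> (U' \<otimes>\<^bsub>B\<^esub> C))"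
    by (rule K_add[OF t b(1) S.m_closed[OF C(4) b(2)] C(5) C(5)])
  also have "K ?t (U' \<otimes>\<^bsub>B\<^esub> C) (U' \<otimes>\<^bsub>B\<^esub> (U \<otimes>\<^bsub>B\<^esub> T)) = nm U' \<otimes> K ?t C (U \<otimes>\<^bsub>B\<^esub> T)"
    by (rule K_scale[OF t C(3) b(2) C(4) C(4)])
  finally show ?thesis
    unfolding two_smult[OF b(1)] e using C b by (simp add: norm_shift_K norm_fun_nm S.m_assoc)
qed

text \<open>Put \<open>P = U T\<close>, \<open>b = C (P + C)\<close> and let
  \<open>T' = P + 2 C\<close> be the new trace, so that the new constant is
  \<open>b + U^2 N\<close>. \<open>K_add\<close> for -4, starting at \<open>T'^2\<close>, stops at
  \<open>T'^2 - 4 b = U^2 T^2\<close>, and \<open>K_scale\<close> settles the second summand. In the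
  first, \<open>T'^2 = P^2 + 4 b\<close> lets \<open>K_reverse\<close> pass to the scalar 4 and the
  base point \<open>P^2\<close>, where \<open>K_square\<close> evaluates it.\<close>

lemma norm_const_change:
  assumes C: "T \<in> carrier B" "U \<in> carrier B" "C \<in> carrier B" and N: "N \<in> carrier B"
  shows "norm_const n A B \<phi> (U \<otimes>\<^bsub>B\<^esub> T \<oplus>\<^bsub>B\<^esub> (C \<oplus>\<^bsub>B\<^esub> C)) (U \<otimes>\<^bsub>B\<^esub> U \<otimes>\<^bsub>B\<^esub> N \<oplus>\<^bsub>B\<^esub> U \<otimes>\<^bsub>B\<^esub> C \<otimes>\<^bsub>B\<^esub> T \<oplus>\<^bsub>B\<^esub> C \<otimes>\<^bsub>B\<^esub> C)
    = norm_fun n A B \<phi> U \<otimes> norm_fun n A B \<phi> U \<otimes> norm_const n A B \<phi> T N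
      \<oplus> norm_fun n A B \<phi> U \<otimes> norm_shift n A B \<phi> T U C \<otimes> norm_fun n A B \<phi> T
      \<oplus> norm_shift n A B \<phi> T U C \<otimes> norm_shift n A B \<phi> T U C"
proof -
  let ?t = "\<one> \<oplus> \<one>" and ?P = "U \<otimes>\<^bsub>B\<^esub> T"
  let ?T' = "?P \<oplus>\<^bsub>B\<^esub> (C \<oplus>\<^bsub>B\<^esub> C)" and ?b = "C \<otimes>\<^bsub>B\<^esub> (U \<otimes>\<^bsub>B\<^esub> T \<oplus>\<^bsub>B\<^esub> C)" and ?c = "U \<otimes>\<^bsub>B\<^esub> U \<otimes>\<^bsub>B\<^esub> N" and ?mu = "\<ominus> ((\<one> \<oplus> \<one>) \<otimes> (\<one> \<oplus> \<one>))"
  have m: "?t \<otimes> ?t \<in> carrier A" "?mu \<in> carrier A" by simp_all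
  have cl: "?P \<in> carrier B" "?T' \<otimes>\<^bsub>B\<^esub> ?T' \<in> carrier B" "?b \<in> carrier B" "?c \<in> carrier B" "?P \<otimes>\<^bsub>B\<^esub> ?P \<in> carrier B"
    "U \<otimes>\<^bsub>B\<^esub> U \<in> carrier B" "T \<otimes>\<^bsub>B\<^esub> T \<in> carrier B" using C N by auto
  have N': "?c \<oplus>\<^bsub>B\<^esub> U \<otimes>\<^bsub>B\<^esub> C \<otimes>\<^bsub>B\<^esub> T \<oplus>\<^bsub>B\<^esub> C \<otimes>\<^bsub>B\<^esub> C = ?b \<oplus>\<^bsub>B\<^esub> ?c"
    using S.pencil_aux(1)[OF C(2,1,3)] C N cl by (simp add: S.a_assoc S.a_comm[of ?b])
  have four: "\<phi> (?t \<otimes> ?t) = (\<one>\<^bsub>B\<^esub> \<oplus>\<^bsub>B\<^esub> \<one>\<^bsub>B\<^esub>) \<otimes>\<^bsub>B\<^esub> (\<one>\<^bsub>B\<^esub> \<oplus>\<^bsub>B\<^esub> \<one>\<^bsub>B\<^esub>)"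
    "\<phi> ?mu = \<ominus>\<^bsub>B\<^esub> ((\<one>\<^bsub>B\<^esub> \<oplus>\<^bsub>B\<^esub> \<one>\<^bsub>B\<^esub>) \<otimes>\<^bsub>B\<^esub> (\<one>\<^bsub>B\<^esub> \<oplus>\<^bsub>B\<^esub> \<one>\<^bsub>B\<^esub>))" by simp_all
  have "K ?mu (?b \<oplus>\<^bsub>B\<^esub> ?c) (?T' \<otimes>\<^bsub>B\<^esub> ?T') = K ?mu ?b (?T' \<otimes>\<^bsub>B\<^esub> ?T') \<oplus> K ?mu ?c (?T' \<otimes>\<^bsub>B\<^esub> ?T' \<oplus>\<^bsub>B\<^esub> \<phi> ?mu \<otimes>\<^bsub>B\<^esub> ?b)"
    by (rule K_add[OF m(2) cl(3) cl(2) cl(4) cl(4)])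
  also have "?T' \<otimes>\<^bsub>B\<^esub> ?T' \<oplus>\<^bsub>B\<^esub> \<phi> ?mu \<otimes>\<^bsub>B\<^esub> ?b = (U \<otimes>\<^bsub>B\<^esub> U) \<otimes>\<^bsub>B\<^esub> (T \<otimes>\<^bsub>B\<^esub> T)"
    unfolding four(2) by (rule S.pencil_aux(3)[OF C(2,1,3)])
  also have "K ?mu ?c ((U \<otimes>\<^bsub>B\<^esub> U) \<otimes>\<^bsub>B\<^esub> (T \<otimes>\<^bsub>B\<^esub> T)) = nm (U \<otimes>\<^bsub>B\<^esub> U) \<otimes> K ?mu N (T \<otimes>\<^bsub>B\<^esub> T)"
    by (rule K_scale[OF m(2) N cl(7) cl(6) cl(6)])
  also have "K ?mu ?b (?T' \<otimes>\<^bsub>B\<^esub> ?T') = K ?mu ?b (?P \<otimes>\<^bsub>B\<^esub> ?P \<oplus>\<^bsub>B\<^esub> \<phi> (?t \<otimes> ?t) \<otimes>\<^bsub>B\<^esub> ?b)"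
    unfolding four(1) S.pencil_aux(2)[OF C(2,1,3)] ..
  also have "\<dots> = K (?t \<otimes> ?t) ?b (?P \<otimes>\<^bsub>B\<^esub> ?P)"
    by (rule K_reverse[OF m(1) cl(3) cl(5) cl(3) cl(3)])
  also have "\<dots> = nm ?P \<otimes> K ?t C ?P \<oplus> K ?t C ?P \<otimes> K ?t C ?P"
    by (rule K_square[OF C(3) cl(1) refl])
  finally have "K ?mu (?b \<oplus>\<^bsub>B\<^esub> ?c) (?T' \<otimes>\<^bsub>B\<^esub> ?T')
    = (nm ?P \<otimes> K ?t C ?P \<oplus> K ?t C ?P \<otimes> K ?t C ?P) \<oplus> nm (U \<otimes>\<^bsub>B\<^esub> U) \<otimes> K ?mu N (T \<otimes>\<^bsub>B\<^esub> T)" .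
  moreover have "norm_const n A B \<phi> ?T' (?c \<oplus>\<^bsub>B\<^esub> U \<otimes>\<^bsub>B\<^esub> C \<otimes>\<^bsub>B\<^esub> T \<oplus>\<^bsub>B\<^esub> C \<otimes>\<^bsub>B\<^esub> C) = K ?mu (?b \<oplus>\<^bsub>B\<^esub> ?c) (?T' \<otimes>\<^bsub>B\<^esub> ?T')"
    unfolding N' by (rule norm_const_K) (use C cl in auto)
  ultimately show ?thesis
    unfolding norm_shift_K[OF C] norm_const_K[OF C(1) N] norm_fun_nm[OF C(2)] norm_fun_nm[OF C(1)] nm_mult[OF C(2,1)] nm_mult[OF C(2,2)]
    using C N cl by (simp add: R.a_ac R.m_ac)
qed

text \<open>\<open>K_mult\<close> for the scalar -4 at the base points \<open>T^2\<close> and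
  \<open>T'^2\<close>: the star constant over \<open>B\<close> is the direction on its left, the
  star constant over \<open>A\<close> its right side.\<close>

lemma norm_star_const:
  assumes C: "T \<in> carrier B" "N \<in> carrier B" "T' \<in> carrier B" "N' \<in> carrier B"
  shows "norm_const n A B \<phi> (T \<otimes>\<^bsub>B\<^esub> T') (star_const B T N T' N')
    = star_const A (norm_fun n A B \<phi> T) (norm_const n A B \<phi> T N) (norm_fun n A B \<phi> T') (norm_const n A B \<phi> T' N')"
proof -
  let ?mu = "\<ominus> ((\<one> \<oplus> \<one>) \<otimes> (\<one> \<oplus> \<one>))"
  have m: "?mu \<in> carrier A" by simp
  have four: "\<phi> ?mu = \<ominus>\<^bsub>B\<^esub> ((\<one>\<^bsub>B\<^esub> \<oplus>\<^bsub>B\<^esub> \<one>\<^bsub>B\<^esub>) \<otimes>\<^bsub>B\<^esub> (\<one>\<^bsub>B\<^esub> \<oplus>\<^bsub>B\<^esub> \<one>\<^bsub>B\<^esub>))" by simp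
  have cl: "T \<otimes>\<^bsub>B\<^esub> T' \<in> carrier B" "T \<otimes>\<^bsub>B\<^esub> T \<in> carrier B" "T' \<otimes>\<^bsub>B\<^esub> T' \<in> carrier B" using C by auto
  have e: "(T \<otimes>\<^bsub>B\<^esub> T') \<otimes>\<^bsub>B\<^esub> (T \<otimes>\<^bsub>B\<^esub> T') = (T \<otimes>\<^bsub>B\<^esub> T) \<otimes>\<^bsub>B\<^esub> (T' \<otimes>\<^bsub>B\<^esub> T')" using C by (simp add: S.m_ac)
  have k: "K ?mu (N \<otimes>\<^bsub>B\<^esub> (T' \<otimes>\<^bsub>B\<^esub> T') \<oplus>\<^bsub>B\<^esub> N' \<otimes>\<^bsub>B\<^esub> (T \<otimes>\<^bsub>B\<^esub> T) \<oplus>\<^bsub>B\<^esub> \<phi> ?mu \<otimes>\<^bsub>B\<^esub> (N \<otimes>\<^bsub>B\<^esub> N')) ((T \<otimes>\<^bsub>B\<^esub> T) \<otimes>\<^bsub>B\<^esub> (T' \<otimes>\<^bsub>B\<^esub> T'))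
    = K ?mu N (T \<otimes>\<^bsub>B\<^esub> T) \<otimes> nm (T' \<otimes>\<^bsub>B\<^esub> T') \<oplus> K ?mu N' (T' \<otimes>\<^bsub>B\<^esub> T') \<otimes> nm (T \<otimes>\<^bsub>B\<^esub> T)
      \<oplus> ?mu \<otimes> (K ?mu N (T \<otimes>\<^bsub>B\<^esub> T) \<otimes> K ?mu N' (T' \<otimes>\<^bsub>B\<^esub> T'))"
    by (rule K_mult[OF m C(2) cl(2) C(4) cl(3)])
  have s: "star_const B T N T' N' = N \<otimes>\<^bsub>B\<^esub> (T' \<otimes>\<^bsub>B\<^esub> T') \<oplus>\<^bsub>B\<^esub> N' \<otimes>\<^bsub>B\<^esub> (T \<otimes>\<^bsub>B\<^esub> T) \<oplus>\<^bsub>B\<^esub> \<phi> ?mu \<otimes>\<^bsub>B\<^esub> (N \<otimes>\<^bsub>B\<^esub> N')"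
    unfolding four by (rule S.star_const_eq[OF C])
  have r: "star_const A (nm T) (K ?mu N (T \<otimes>\<^bsub>B\<^esub> T)) (nm T') (K ?mu N' (T' \<otimes>\<^bsub>B\<^esub> T'))
    = K ?mu N (T \<otimes>\<^bsub>B\<^esub> T) \<otimes> nm (T' \<otimes>\<^bsub>B\<^esub> T') \<oplus> K ?mu N' (T' \<otimes>\<^bsub>B\<^esub> T') \<otimes> nm (T \<otimes>\<^bsub>B\<^esub> T)
      \<oplus> ?mu \<otimes> (K ?mu N (T \<otimes>\<^bsub>B\<^esub> T) \<otimes> K ?mu N' (T' \<otimes>\<^bsub>B\<^esub> T'))"
    unfolding nm_mult[OF C(3,3)] nm_mult[OF C(1,1)] by (rule R.star_const_eq) (use C cl in simp_all)
  have "norm_const n A B \<phi> (T \<otimes>\<^bsub>B\<^esub> T') (star_const B T N T' N') = K ?mu (star_const B T N T' N') ((T \<otimes>\<^bsub>B\<^esub> T) \<otimes>\<^bsub>B\<^esub> (T' \<otimes>\<^bsub>B\<^esub> T'))"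
    using norm_const_K[OF cl(1) S.star_closed(1)[OF C]] unfolding e .
  also have "\<dots> = star_const A (nm T) (K ?mu N (T \<otimes>\<^bsub>B\<^esub> T)) (nm T') (K ?mu N' (T' \<otimes>\<^bsub>B\<^esub> T'))"
    unfolding s k r ..
  finally show ?thesis
    unfolding norm_const_K[OF C(1,2)] norm_const_K[OF C(3,4)] norm_fun_nm[OF C(1)] norm_fun_nm[OF C(3)] .
qed

text \<open>\<open>K_mult\<close> for the scalar 2 at the base points \<open>U T\<close> and
  \<open>V T'\<close>.\<close>

lemma norm_star_shift:
  assumes C: "T \<in> carrier B" "T' \<in> carrier B" "U \<in> carrier B" "C \<in> carrier B" "V \<in> carrier B" "E \<in> carrier B"
  shows "norm_shift n A B \<phi> (T \<otimes>\<^bsub>B\<^esub> T') (U \<otimes>\<^bsub>B\<^esub> V) (star_shift B T T' U C V E)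
    = star_shift A (norm_fun n A B \<phi> T) (norm_fun n A B \<phi> T') (norm_fun n A B \<phi> U) (norm_shift n A B \<phi> T U C)
        (norm_fun n A B \<phi> V) (norm_shift n A B \<phi> T' V E)"
proof -
  let ?t = "\<one> \<oplus> \<one>"
  have m: "?t \<in> carrier A" by simp
  have two: "\<phi> ?t = \<one>\<^bsub>B\<^esub> \<oplus>\<^bsub>B\<^esub> \<one>\<^bsub>B\<^esub>" by simp
  have cl: "U \<otimes>\<^bsub>B\<^esub> T \<in> carrier B" "V \<otimes>\<^bsub>B\<^esub> T' \<in> carrier B" "T \<otimes>\<^bsub>B\<^esub> T' \<in> carrier B" "U \<otimes>\<^bsub>B\<^esub> V \<in> carrier B" using C by auto
  have e: "(U \<otimes>\<^bsub>B\<^esub> V) \<otimes>\<^bsub>B\<^esub> (T \<otimes>\<^bsub>B\<^esub> T') = (U \<otimes>\<^bsub>B\<^esub> T) \<otimes>\<^bsub>B\<^esub> (V \<otimes>\<^bsub>B\<^esub> T')" using C by (simp add: S.m_ac)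
  have k: "K ?t (C \<otimes>\<^bsub>B\<^esub> (V \<otimes>\<^bsub>B\<^esub> T') \<oplus>\<^bsub>B\<^esub> E \<otimes>\<^bsub>B\<^esub> (U \<otimes>\<^bsub>B\<^esub> T) \<oplus>\<^bsub>B\<^esub> \<phi> ?t \<otimes>\<^bsub>B\<^esub> (C \<otimes>\<^bsub>B\<^esub> E)) ((U \<otimes>\<^bsub>B\<^esub> T) \<otimes>\<^bsub>B\<^esub> (V \<otimes>\<^bsub>B\<^esub> T'))
    = K ?t C (U \<otimes>\<^bsub>B\<^esub> T) \<otimes> nm (V \<otimes>\<^bsub>B\<^esub> T') \<oplus> K ?t E (V \<otimes>\<^bsub>B\<^esub> T') \<otimes> nm (U \<otimes>\<^bsub>B\<^esub> T)
      \<oplus> ?t \<otimes> (K ?t C (U \<otimes>\<^bsub>B\<^esub> T) \<otimes> K ?t E (V \<otimes>\<^bsub>B\<^esub> T'))"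
    by (rule K_mult[OF m C(4) cl(1) C(6) cl(2)])
  have s: "star_shift B T T' U C V E = C \<otimes>\<^bsub>B\<^esub> (V \<otimes>\<^bsub>B\<^esub> T') \<oplus>\<^bsub>B\<^esub> E \<otimes>\<^bsub>B\<^esub> (U \<otimes>\<^bsub>B\<^esub> T) \<oplus>\<^bsub>B\<^esub> \<phi> ?t \<otimes>\<^bsub>B\<^esub> (C \<otimes>\<^bsub>B\<^esub> E)"
    unfolding two by (rule S.star_shift_eq[OF C])
  have r: "star_shift A (nm T) (nm T') (nm U) (K ?t C (U \<otimes>\<^bsub>B\<^esub> T)) (nm V) (K ?t E (V \<otimes>\<^bsub>B\<^esub> T'))
    = K ?t C (U \<otimes>\<^bsub>B\<^esub> T) \<otimes> nm (V \<otimes>\<^bsub>B\<^esub> T') \<oplus> K ?t E (V \<otimes>\<^bsub>B\<^esub> T') \<otimes> nm (U \<otimes>\<^bsub>B\<^esub> T)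
      \<oplus> ?t \<otimes> (K ?t C (U \<otimes>\<^bsub>B\<^esub> T) \<otimes> K ?t E (V \<otimes>\<^bsub>B\<^esub> T'))"
    unfolding nm_mult[OF C(3,1)] nm_mult[OF C(5,2)] by (rule R.star_shift_eq) (use C cl in simp_all)
  have "norm_shift n A B \<phi> (T \<otimes>\<^bsub>B\<^esub> T') (U \<otimes>\<^bsub>B\<^esub> V) (star_shift B T T' U C V E) = K ?t (star_shift B T T' U C V E) ((U \<otimes>\<^bsub>B\<^esub> T) \<otimes>\<^bsub>B\<^esub> (V \<otimes>\<^bsub>B\<^esub> T'))"
    using norm_shift_K[OF cl(3,4) S.star_closed(2)[OF C]] unfolding e .
  also have "\<dots> = star_shift A (nm T) (nm T') (nm U) (K ?t C (U \<otimes>\<^bsub>B\<^esub> T)) (nm V) (K ?t E (V \<otimes>\<^bsub>B\<^esub> T'))"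
    unfolding s k r ..
  finally show ?thesis
    unfolding norm_shift_K[OF C(1,3,4)] norm_shift_K[OF C(2,5,6)] norm_fun_nm[OF C(1)] norm_fun_nm[OF C(2)] norm_fun_nm[OF C(3)] norm_fun_nm[OF C(5)] .
qed

end

context frame_hom
begin

lemma norm_data_hom:
  assumes lf: "loc_free n A B \<phi>"
  shows "b \<in> carrier B \<Longrightarrow> norm_fun n A' B' \<phi>' (\<beta> b) = \<alpha> (norm_fun n A B \<phi> b)"
    "\<lbrakk>T \<in> carrier B; N \<in> carrier B\<rbrakk> \<Longrightarrow> norm_const n A' B' \<phi>' (\<beta> T) (\<beta> N) = \<alpha> (norm_const n A B \<phi> T N)"
    "\<lbrakk>T \<in> carrier B; U \<in> carrier B; C \<in> carrier B\<rbrakk> \<Longrightarrow> norm_shift n A' B' \<phi>' (\<beta> T) (\<beta> U) (\<beta> C) = \<alpha> (norm_shift n A B \<phi> T U C)"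
proof -
  interpret X: rank_framed A B \<phi> m x f n by unfold_locales (rule lf)
  interpret X': rank_framed A' B' \<phi>' m x' f' n by unfold_locales (rule loc_free_hom[OF lf])
  show "b \<in> carrier B \<Longrightarrow> norm_fun n A' B' \<phi>' (\<beta> b) = \<alpha> (norm_fun n A B \<phi> b)"
    using nm_hom[of b] X.norm_fun_nm[of b] X'.norm_fun_nm[OF top.hom_closed[of b]] by simp
  show "norm_const n A' B' \<phi>' (\<beta> T) (\<beta> N) = \<alpha> (norm_const n A B \<phi> T N)" if TN: "T \<in> carrier B" "N \<in> carrier B"
  proof -
    have mu: "\<ominus>\<^bsub>A\<^esub> ((\<one>\<^bsub>A\<^esub> \<oplus>\<^bsub>A\<^esub> \<one>\<^bsub>A\<^esub>) \<otimes>\<^bsub>A\<^esub> (\<one>\<^bsub>A\<^esub> \<oplus>\<^bsub>A\<^esub> \<one>\<^bsub>A\<^esub>)) \<in> carrier A" by simp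
    show ?thesis
      using K_hom[OF lf TN(2) dom.S.m_closed[OF TN(1,1)] mu]
        X.norm_const_K[OF TN] X'.norm_const_K[OF top.hom_closed[OF TN(1)] top.hom_closed[OF TN(2)]] top.hom_mult[OF TN(1,1)] by simp
  qed
  show "norm_shift n A' B' \<phi>' (\<beta> T) (\<beta> U) (\<beta> C) = \<alpha> (norm_shift n A B \<phi> T U C)" if TN: "T \<in> carrier B" "U \<in> carrier B" "C \<in> carrier B"
  proof -
    have mu: "\<one>\<^bsub>A\<^esub> \<oplus>\<^bsub>A\<^esub> \<one>\<^bsub>A\<^esub> \<in> carrier A" by simp
    show ?thesis
      using K_hom[OF lf TN(3) dom.S.m_closed[OF TN(2,1)] mu]
        X.norm_shift_K[OF TN] X'.norm_shift_K[OF top.hom_closed[OF TN(1)] top.hom_closed[OF TN(2)] top.hom_closed[OF TN(3)]] top.hom_mult[OF TN(2,1)] by simp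
  qed
qed

end

context framed_algebra
begin

lemma frame_hom_loc_res:
  assumes VW: "V \<subseteq> W" and W: "W \<subseteq> carrier A"
  shows "frame_hom (loc A V) (locS V) (loch V) m (\<lambda>j. frac B (\<phi> ` V) (x j) \<one>\<^bsub>B\<^esub>) (\<lambda>j. loc_functional (f j) V)
    (loc A W) (locS W) (loch W) (\<lambda>j. frac B (\<phi> ` W) (x j) \<one>\<^bsub>B\<^esub>) (\<lambda>j. loc_functional (f j) W) (loc_res A W) (resS W)"
proof (intro frame_hom.intro frame_hom_axioms.intro)
  have V: "V \<subseteq> carrier A" using VW W by simp
  have VW': "\<phi> ` V \<subseteq> \<phi> ` W" "\<phi> ` W \<subseteq> carrier B" using VW W by auto
  show "framed_algebra (loc A V) (locS V) (loch V) m (\<lambda>j. frac B (\<phi> ` V) (x j) \<one>\<^bsub>B\<^esub>) (\<lambda>j. loc_functional (f j) V)"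
    using frame_hom.axioms(2)[OF frame_hom_loc[OF V]] .
  show "framed_algebra (loc A W) (locS W) (loch W) m (\<lambda>j. frac B (\<phi> ` W) (x j) \<one>\<^bsub>B\<^esub>) (\<lambda>j. loc_functional (f j) W)"
    using frame_hom.axioms(2)[OF frame_hom_loc[OF W]] .
  show "ring_hom_cring (loc A V) (loc A W) (loc_res A W)" by (rule R.loc_res_hom[OF VW W])
  show "ring_hom_cring (locS V) (locS W) (resS W)" by (rule S.loc_res_hom[OF VW'])
  show "frac B (\<phi> ` W) (x j) \<one>\<^bsub>B\<^esub> = resS W (frac B (\<phi> ` V) (x j) \<one>\<^bsub>B\<^esub>)" if "j < m" for j
    using S.loc_res_frac[OF VW' frame_closed[OF that] S.mgen_one] by simp
  show "loch W (loc_res A W a) = resS W (loch V a)" if "a \<in> carrier (loc A V)" for a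
    by (rule loc_map_res[OF VW W that, symmetric])
  show "loc_functional (f j) W (resS W b) = loc_res A W (loc_functional (f j) V b)" if j: "j < m" and b: "b \<in> carrier (locS V)" for j b
  proof -
    obtain b0 s where b0: "b0 \<in> carrier B" "s \<in> mgen A V" "b = frac B (\<phi> ` V) b0 (\<phi> s)" by (rule loc_imageE[OF V b])
    have s: "s \<in> mgen A W" using R.mgen_mono[OF VW] b0(2) by auto
    have fb: "f j b0 \<in> carrier A" using functionalD(1)[OF frame_functional[OF j]] b0(1) by auto
    show ?thesis
      unfolding b0(3) S.loc_res_frac[OF VW' b0(1) hom_mem_mgen[OF V b0(2)]]
        loc_functional_frac[OF V frame_functional[OF j] b0(1,2)] loc_functional_frac[OF W frame_functional[OF j] b0(1) s]
        R.loc_res_frac[OF VW W fb b0(2)] ..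
  qed
qed

end

context rank_framed
begin

lemma loc_rank_framed:
  assumes V: "V \<subseteq> carrier A"
  shows "rank_framed (loc A V) (locS V) (loch V) m (\<lambda>j. frac B (\<phi> ` V) (x j) \<one>\<^bsub>B\<^esub>) (\<lambda>j. loc_functional (f j) V) n"
  by (intro rank_framed.intro rank_framed_axioms.intro frame_hom.loc_free_hom[OF frame_hom_loc[OF V] loc_free]
      frame_hom.axioms(2)[OF frame_hom_loc[OF V]])

lemmas norm_data_res = frame_hom.norm_data_hom[OF frame_hom_loc_res rank_framed.loc_free[OF loc_rank_framed]]

end

section \<open>The norm and star cocycles\<close>

text \<open>A local generator is packaged with its two parameters as a triple, so that the formulas
  of a cocycle can read the parameters off the generator.\<close>

definition qgens where
  "qgens R D \<rho> V g = (case g of (t, m, y) \<Rightarrow> qgen (loc R V) (loc D (\<rho> ` V)) (loc_map D (\<rho> ` V) \<rho>) t m y)"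

definition qres where
  "qres R D \<rho> W g = (case g of (t, m, y) \<Rightarrow> (loc_res R W t, loc_res R W m, loc_res D (\<rho> ` W) y))"

definition qlin where
  "qlin R D \<rho> V g' g = tr_lin (loc R V) (loc D (\<rho> ` V)) (loc_map D (\<rho> ` V) \<rho>) (snd (snd g')) (snd (snd g))"

definition qcon where
  "qcon R D \<rho> V g' g = tr_const (loc R V) (loc D (\<rho> ` V)) (loc_map D (\<rho> ` V) \<rho>) (snd (snd g')) (snd (snd g))"

text \<open>The tautological cocycle of a quadratic algebra: transitions are those of its own
  generators. The norm and star cocycles result from applying their formulas to these data.\<close>

lemma (in ring_hom_cring) quad_cocycle:
  "generator_cocycle R S h (qgens R S h) (qres R S h) (\<lambda>V g. fst g) (\<lambda>V g. fst (snd g)) (qlin R S h) (qcon R S h)"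
proof (intro generator_cocycle.intro generator_cocycle_axioms.intro ring_hom_cring_axioms)
  have gD: "qgen (loc R V) (locS V) (loch V) (fst g) (fst (snd g)) (snd (snd g))" if "qgens R S h V g" for V g
    using that by (auto simp: qgens_def split: prod.splits)
  have tr: "transition (loc R V) (locS V) (loch V) (snd (snd g')) (snd (snd g)) (qlin R S h V g' g) (qcon R S h V g' g)"
    if "V \<subseteq> carrier R" "qgens R S h V g" "qgens R S h V g'" for V g g'
    unfolding qlin_def qcon_def
    by (rule ring_hom_cring.transition_tr[OF loc_map_image_hom[OF that(1)] gD[OF that(2)] qgenD(3)[OF gD[OF that(3)]]])
  have eq: "qlin R S h V g' g = u" "qcon R S h V g' g = c"
    if "V \<subseteq> carrier R" "qgens R S h V g" "transition (loc R V) (locS V) (loch V) (snd (snd g')) (snd (snd g)) u c" for V g g' u c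
    unfolding qlin_def qcon_def using ring_hom_cring.tr_eq[OF loc_map_image_hom[OF that(1)] gD[OF that(2)] that(3)] by auto
  have qr: "fst (qres R S h W g) = loc_res R W (fst g)" "fst (snd (qres R S h W g)) = loc_res R W (fst (snd g))"
    "snd (snd (qres R S h W g)) = resS W (snd (snd g))" for W g by (auto simp: qres_def split: prod.splits)
  have qi: "qgens R S h V g \<longleftrightarrow> qgen (loc R V) (locS V) (loch V) (fst g) (fst (snd g)) (snd (snd g))" for V g
    by (auto simp: qgens_def split: prod.splits)
  show res: "qgens R S h W (qres R S h W g)" if "V \<subseteq> W" "W \<subseteq> carrier R" "qgens R S h V g" for V W g
    unfolding qi qr by (rule qgen_loc_res[OF that(1,2) gD[OF that(3)]])
  show "qres R S h X (qres R S h W g) = qres R S h X g"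
    if "V \<subseteq> W" "W \<subseteq> X" "X \<subseteq> carrier R" "qgens R S h V g" for V W X g
  proof -
    have hX: "h ` X \<subseteq> carrier S" using that by auto
    note q = qgenD(1,2,3)[OF gD[OF that(4)]]
    show ?thesis
      unfolding prod_eq_iff qr R.loc_res_res[OF that(1-3) q(1)] R.loc_res_res[OF that(1-3) q(2)]
        S.loc_res_res[OF image_mono[OF that(1)] image_mono[OF that(2)] hX q(3)] by simp
  qed
  show "fst (qres R S h W g) = loc_res R W (fst g)" "fst (snd (qres R S h W g)) = loc_res R W (fst (snd g))" for W g by (rule qr)+
  have trr: "transition (loc R W) (locS W) (loch W) (snd (snd (qres R S h W g))) (snd (snd (qres R S h W g')))
      (loc_res R W (qlin R S h V g g')) (loc_res R W (qcon R S h V g g'))"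
    if "V \<subseteq> W" "W \<subseteq> carrier R" "qgens R S h V g" "qgens R S h V g'" for V W g g'
    unfolding qr by (rule transition_loc_res[OF that(1,2) qgenD(3)[OF gD[OF that(4)]] tr[OF order_trans[OF that(1,2)] that(4,3)]])
  show "qlin R S h W (qres R S h W g) (qres R S h W g') = loc_res R W (qlin R S h V g g')"
    "qcon R S h W (qres R S h W g) (qres R S h W g') = loc_res R W (qcon R S h V g g')"
    if "V \<subseteq> W" "W \<subseteq> carrier R" "qgens R S h V g" "qgens R S h V g'" for V W g g'
    by (rule eq[OF that(2) res[OF that(1,2,4)] trr[OF that]])+
  fix V assume V: "V \<subseteq> carrier R"
  note H = loc_map_image_hom[OF V]
  interpret H: ring_hom_cring "loc R V" "locS V" "loch V" by (rule H)
  show "fst g \<in> carrier (loc R V)" "fst (snd g) \<in> carrier (loc R V)" if "qgens R S h V g" for g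
    by (rule qgenD(1)[OF gD[OF that]], rule qgenD(2)[OF gD[OF that]])
  show "qlin R S h V g g' \<in> carrier (loc R V)" "qcon R S h V g g' \<in> carrier (loc R V)"
    if "qgens R S h V g" "qgens R S h V g'" for g g'
    by (rule H.transitionD(1)[OF tr[OF V that(2,1)]], rule H.transitionD(2)[OF tr[OF V that(2,1)]])
  show "qlin R S h V g g = \<one>\<^bsub>loc R V\<^esub>" if g: "qgens R S h V g" for g
    by (rule eq(1)[OF V g, of _ _ "\<zero>\<^bsub>loc R V\<^esub>"]) (simp add: transition_def qgenD(3)[OF gD[OF g]])
  fix g g' assume g: "qgens R S h V g" "qgens R S h V g'"
  show "qlin R S h V g'' g = qlin R S h V g'' g' \<otimes>\<^bsub>loc R V\<^esub> qlin R S h V g' g"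
    "qcon R S h V g'' g = qlin R S h V g'' g' \<otimes>\<^bsub>loc R V\<^esub> qcon R S h V g' g \<oplus>\<^bsub>loc R V\<^esub> qcon R S h V g'' g'"
    if g'': "qgens R S h V g''" for g''
    by (rule eq[OF V g(1) H.transition_trans[OF tr[OF V g(2) g''] tr[OF V g(1,2)] qgenD(3)[OF gD[OF g(1)]]]])+
  show "fst g' = qlin R S h V g' g \<otimes>\<^bsub>loc R V\<^esub> fst g \<oplus>\<^bsub>loc R V\<^esub> (qcon R S h V g' g \<oplus>\<^bsub>loc R V\<^esub> qcon R S h V g' g)"
    "fst (snd g') = qlin R S h V g' g \<otimes>\<^bsub>loc R V\<^esub> qlin R S h V g' g \<otimes>\<^bsub>loc R V\<^esub> fst (snd g)
        \<oplus>\<^bsub>loc R V\<^esub> qlin R S h V g' g \<otimes>\<^bsub>loc R V\<^esub> qcon R S h V g' g \<otimes>\<^bsub>loc R V\<^esub> fst g \<oplus>\<^bsub>loc R V\<^esub> qcon R S h V g' g \<otimes>\<^bsub>loc R V\<^esub> qcon R S h V g' g"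
    by (rule H.transition_params[OF gD[OF g(1)] gD[OF g(2)] tr[OF V g]])+
qed

lemma (in rank_framed) norm_cocycle:
  assumes D: "ring_hom_cring B D \<psi>" and E: "ring_hom_cring A E \<chi>"
  shows "generator_cocycle A E \<chi> (\<lambda>V. qgens B D \<psi> (\<phi> ` V)) (\<lambda>V. qres B D \<psi> (\<phi> ` V))
    (\<lambda>V g. norm_fun n (loc A V) (locS V) (loch V) (fst g))
    (\<lambda>V g. norm_const n (loc A V) (locS V) (loch V) (fst g) (fst (snd g)))
    (\<lambda>V g' g. norm_fun n (loc A V) (locS V) (loch V) (qlin B D \<psi> (\<phi> ` V) g' g))
    (\<lambda>V g' g. norm_shift n (loc A V) (locS V) (loch V) (fst g) (qlin B D \<psi> (\<phi> ` V) g' g) (qcon B D \<psi> (\<phi> ` V) g' g))"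
proof -
  note Q = ring_hom_cring.quad_cocycle[OF D]
  have im: "\<phi> ` V \<subseteq> carrier B" if "V \<subseteq> carrier A" for V using that by auto
  note F = loc_rank_framed
  note cl = generator_cocycle.t_closed[OF Q im] generator_cocycle.m_closed[OF Q im] generator_cocycle.lin_closed[OF Q im] generator_cocycle.con_closed[OF Q im]
  note rsQ = generator_cocycle.t_rs[OF Q image_mono im] generator_cocycle.m_rs[OF Q image_mono im]
    generator_cocycle.lin_rs[OF Q image_mono im] generator_cocycle.con_rs[OF Q image_mono im]
  show ?thesis
  proof (intro generator_cocycle.intro generator_cocycle_axioms.intro E, goal_cases)
    case (1 V W g)
    then show ?case by (intro generator_cocycle.gen_rs[OF Q image_mono im])
  next
    case (2 V W X g)
    then show ?case by (intro generator_cocycle.rs_rs[OF Q image_mono image_mono im])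
  next
    case (3 V W g)
    then have V: "V \<subseteq> carrier A" by auto
    show ?case unfolding rsQ(1)[OF 3] by (rule norm_data_res(1)[OF 3(1,2) V cl(1)[OF V 3(3)]])
  next
    case (4 V W g)
    then have V: "V \<subseteq> carrier A" by auto
    show ?case unfolding rsQ(1)[OF 4] rsQ(2)[OF 4] by (rule norm_data_res(2)[OF 4(1,2) V cl(1)[OF V 4(3)] cl(2)[OF V 4(3)]])
  next
    case (5 V W g g')
    then have V: "V \<subseteq> carrier A" by auto
    show ?case unfolding rsQ(3)[OF 5] by (rule norm_data_res(1)[OF 5(1,2) V cl(3)[OF V 5(3,4)]])
  next
    case (6 V W g g')
    then have V: "V \<subseteq> carrier A" by auto
    show ?case unfolding rsQ(1)[OF 6(1,2,4)] rsQ(3)[OF 6] rsQ(4)[OF 6]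
      by (rule norm_data_res(3)[OF 6(1,2) V cl(1)[OF V 6(4)] cl(3)[OF V 6(3,4)] cl(4)[OF V 6(3,4)]])
  next
    case (7 V g)
    show ?case by (rule rank_framed.norm_data_closed(1)[OF F[OF 7(1)] cl(1)[OF 7]])
  next
    case (8 V g)
    show ?case by (rule rank_framed.norm_data_closed(3)[OF F[OF 8(1)] cl(1)[OF 8] cl(2)[OF 8]])
  next
    case (9 V g g')
    show ?case by (rule rank_framed.norm_data_closed(1)[OF F[OF 9(1)] cl(3)[OF 9]])
  next
    case (10 V g g')
    show ?case by (rule rank_framed.norm_data_closed(2)[OF F[OF 10(1)] cl(1)[OF 10(1,3)] cl(3)[OF 10] cl(4)[OF 10]])
  next
    case (11 V g)
    show ?case unfolding generator_cocycle.lin_self[OF Q im[OF 11(1)] 11(2)] by (rule rank_framed.norm_fun_mult(2)[OF F[OF 11(1)]])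
  next
    case (12 V g g' g'')
    show ?case unfolding generator_cocycle.lin_comp[OF Q im[OF 12(1)] 12(2-4)]
      by (rule rank_framed.norm_fun_mult(1)[OF F[OF 12(1)] cl(3)[OF 12(1,4,3)] cl(3)[OF 12(1,3,2)]])
  next
    case (13 V g g' g'')
    show ?case
      unfolding generator_cocycle.lin_comp[OF Q im[OF 13(1)] 13(2-4)] generator_cocycle.con_comp[OF Q im[OF 13(1)] 13(2-4)]
        rank_framed.norm_shift_comp[OF F[OF 13(1)] cl(1)[OF 13(1,2)] cl(3)[OF 13(1,3,2)] cl(4)[OF 13(1,3,2)] cl(3)[OF 13(1,4,3)] cl(4)[OF 13(1,4,3)]]
        generator_cocycle.t_change[OF Q im[OF 13(1)] 13(2,3), symmetric] ..
  next
    case (14 V g g')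
    show ?case
      unfolding rank_framed.norm_trace_change[OF F[OF 14(1)] cl(1)[OF 14(1,2)] cl(3)[OF 14(1,3,2)] cl(4)[OF 14(1,3,2)], symmetric]
        generator_cocycle.t_change[OF Q im[OF 14(1)] 14(2,3), symmetric] ..
  next
    case (15 V g g')
    show ?case
      unfolding rank_framed.norm_const_change[OF F[OF 15(1)] cl(1)[OF 15(1,2)] cl(3)[OF 15(1,3,2)] cl(4)[OF 15(1,3,2)] cl(2)[OF 15(1,2)], symmetric]
        generator_cocycle.t_change[OF Q im[OF 15(1)] 15(2,3), symmetric] generator_cocycle.m_change[OF Q im[OF 15(1)] 15(2,3), symmetric] ..
  qed
qed

text \<open>A generator is a pair of generators of the two factors. The laws reduce in the same way
  to the identities for \<open>star_const\<close> and \<open>star_shift\<close>.\<close>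

lemma (in cring) star_cocycle:
  assumes D: "ring_hom_cring R D \<rho>" and D': "ring_hom_cring R D' \<rho>'" and F: "ring_hom_cring R F \<sigma>"
  shows "generator_cocycle R F \<sigma> (\<lambda>V g. qgens R D \<rho> V (fst g) \<and> qgens R D' \<rho>' V (snd g))
    (\<lambda>V g. (qres R D \<rho> V (fst g), qres R D' \<rho>' V (snd g)))
    (\<lambda>V g. fst (fst g) \<otimes>\<^bsub>loc R V\<^esub> fst (snd g))
    (\<lambda>V g. star_const (loc R V) (fst (fst g)) (fst (snd (fst g))) (fst (snd g)) (fst (snd (snd g))))
    (\<lambda>V g' g. qlin R D \<rho> V (fst g') (fst g) \<otimes>\<^bsub>loc R V\<^esub> qlin R D' \<rho>' V (snd g') (snd g))
    (\<lambda>V g' g. star_shift (loc R V) (fst (fst g)) (fst (snd g)) (qlin R D \<rho> V (fst g') (fst g)) (qcon R D \<rho> V (fst g') (fst g))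
       (qlin R D' \<rho>' V (snd g') (snd g)) (qcon R D' \<rho>' V (snd g') (snd g)))"
proof -
  note Q = ring_hom_cring.quad_cocycle[OF D] and Q' = ring_hom_cring.quad_cocycle[OF D']
  note c = generator_cocycle.t_closed[OF Q] generator_cocycle.m_closed[OF Q] generator_cocycle.lin_closed[OF Q] generator_cocycle.con_closed[OF Q]
  note c' = generator_cocycle.t_closed[OF Q'] generator_cocycle.m_closed[OF Q'] generator_cocycle.lin_closed[OF Q'] generator_cocycle.con_closed[OF Q']
  note r = generator_cocycle.t_rs[OF Q] generator_cocycle.m_rs[OF Q] generator_cocycle.lin_rs[OF Q] generator_cocycle.con_rs[OF Q]
  note r' = generator_cocycle.t_rs[OF Q'] generator_cocycle.m_rs[OF Q'] generator_cocycle.lin_rs[OF Q'] generator_cocycle.con_rs[OF Q']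
  show ?thesis
  proof (intro generator_cocycle.intro generator_cocycle_axioms.intro F, unfold fst_conv snd_conv, goal_cases)
    case (1 V W g)
    then show ?case using generator_cocycle.gen_rs[OF Q 1(1,2)] generator_cocycle.gen_rs[OF Q' 1(1,2)] by blast
  next
    case (2 V W X g)
    then show ?case using generator_cocycle.rs_rs[OF Q 2(1-3)] generator_cocycle.rs_rs[OF Q' 2(1-3)] by simp
  next
    case (3 V W g)
    then have V: "V \<subseteq> carrier R" and g: "qgens R D \<rho> V (fst g)" "qgens R D' \<rho>' V (snd g)" by auto
    show ?case unfolding r(1)[OF 3(1,2) g(1)] r'(1)[OF 3(1,2) g(2)]
      by (rule ring_hom_mult[OF ring_hom_cring.homh[OF loc_res_hom[OF 3(1,2)]] c(1)[OF V g(1)] c'(1)[OF V g(2)], symmetric])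
  next
    case (4 V W g)
    then have V: "V \<subseteq> carrier R" and g: "qgens R D \<rho> V (fst g)" "qgens R D' \<rho>' V (snd g)" by auto
    show ?case unfolding r(1,2)[OF 4(1,2) g(1)] r'(1,2)[OF 4(1,2) g(2)]
      by (rule ring_hom_cring.star_hom(1)[OF loc_res_hom[OF 4(1,2)] c(1,2)[OF V g(1)] c'(1,2)[OF V g(2)]])
  next
    case (5 V W g h)
    then have V: "V \<subseteq> carrier R" and g: "qgens R D \<rho> V (fst g)" "qgens R D' \<rho>' V (snd g)"
      and h: "qgens R D \<rho> V (fst h)" "qgens R D' \<rho>' V (snd h)" by auto
    show ?case unfolding r(3)[OF 5(1,2) g(1) h(1)] r'(3)[OF 5(1,2) g(2) h(2)]
      by (rule ring_hom_mult[OF ring_hom_cring.homh[OF loc_res_hom[OF 5(1,2)]] c(3)[OF V g(1) h(1)] c'(3)[OF V g(2) h(2)], symmetric])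
  next
    case (6 V W g h)
    then have V: "V \<subseteq> carrier R" and g: "qgens R D \<rho> V (fst g)" "qgens R D' \<rho>' V (snd g)"
      and h: "qgens R D \<rho> V (fst h)" "qgens R D' \<rho>' V (snd h)" by auto
    show ?case
      unfolding r(1)[OF 6(1,2) h(1)] r'(1)[OF 6(1,2) h(2)] r(3,4)[OF 6(1,2) g(1) h(1)] r'(3,4)[OF 6(1,2) g(2) h(2)]
      by (rule ring_hom_cring.star_hom(2)[OF loc_res_hom[OF 6(1,2)] c(1)[OF V h(1)] c'(1)[OF V h(2)]
            c(3,4)[OF V g(1) h(1)] c'(3,4)[OF V g(2) h(2)]])
  next
    case (7 V g)
    then have g: "qgens R D \<rho> V (fst g)" "qgens R D' \<rho>' V (snd g)" by auto
    interpret L: cring "loc R V" by (rule cring_loc[OF 7(1)])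
    show ?case by (rule L.m_closed[OF c(1)[OF 7(1) g(1)] c'(1)[OF 7(1) g(2)]])
  next
    case (8 V g)
    then have g: "qgens R D \<rho> V (fst g)" "qgens R D' \<rho>' V (snd g)" by auto
    show ?case by (rule cring.star_closed(1)[OF cring_loc[OF 8(1)] c(1,2)[OF 8(1) g(1)] c'(1,2)[OF 8(1) g(2)]])
  next
    case (9 V g h)
    then have g: "qgens R D \<rho> V (fst g)" "qgens R D' \<rho>' V (snd g)" "qgens R D \<rho> V (fst h)" "qgens R D' \<rho>' V (snd h)" by auto
    interpret L: cring "loc R V" by (rule cring_loc[OF 9(1)])
    show ?case by (rule L.m_closed[OF c(3)[OF 9(1) g(1,3)] c'(3)[OF 9(1) g(2,4)]])
  next
    case (10 V g h)
    then have g: "qgens R D \<rho> V (fst g)" "qgens R D' \<rho>' V (snd g)" "qgens R D \<rho> V (fst h)" "qgens R D' \<rho>' V (snd h)" by auto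
    show ?case by (rule cring.star_closed(2)[OF cring_loc[OF 10(1)] c(1)[OF 10(1) g(3)] c'(1)[OF 10(1) g(4)]
          c(3,4)[OF 10(1) g(1,3)] c'(3,4)[OF 10(1) g(2,4)]])
  next
    case (11 V g)
    then have g: "qgens R D \<rho> V (fst g)" "qgens R D' \<rho>' V (snd g)" by auto
    interpret L: cring "loc R V" by (rule cring_loc[OF 11(1)])
    show ?case unfolding generator_cocycle.lin_self[OF Q 11(1) g(1)] generator_cocycle.lin_self[OF Q' 11(1) g(2)] by simp
  next
    case (12 V g h i)
    then have g: "qgens R D \<rho> V (fst g)" "qgens R D \<rho> V (fst h)" "qgens R D \<rho> V (fst i)"
      and g': "qgens R D' \<rho>' V (snd g)" "qgens R D' \<rho>' V (snd h)" "qgens R D' \<rho>' V (snd i)" by auto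
    show ?case
      unfolding generator_cocycle.lin_comp[OF Q 12(1) g] generator_cocycle.lin_comp[OF Q' 12(1) g']
      by (rule cring.lin_comm_aux[OF cring_loc[OF 12(1)] c(3)[OF 12(1) g(2,1)] c'(3)[OF 12(1) g'(2,1)] c(3)[OF 12(1) g(3,2)] c'(3)[OF 12(1) g'(3,2)]])
  next
    case (13 V g h i)
    then have g: "qgens R D \<rho> V (fst g)" "qgens R D \<rho> V (fst h)" "qgens R D \<rho> V (fst i)"
      and g': "qgens R D' \<rho>' V (snd g)" "qgens R D' \<rho>' V (snd h)" "qgens R D' \<rho>' V (snd i)" by auto
    note V = 13(1)
    show ?case
      unfolding generator_cocycle.lin_comp[OF Q V g] generator_cocycle.lin_comp[OF Q' V g']
        generator_cocycle.con_comp[OF Q V g] generator_cocycle.con_comp[OF Q' V g']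
        cring.star_shift_comp[OF cring_loc[OF V] c(1)[OF V g(1)] c'(1)[OF V g'(1)] c(3,4)[OF V g(2,1)] c'(3,4)[OF V g'(2,1)]
          c(3,4)[OF V g(3,2)] c'(3,4)[OF V g'(3,2)]]
        generator_cocycle.t_change[OF Q V g(1,2), symmetric] generator_cocycle.t_change[OF Q' V g'(1,2), symmetric] ..
  next
    case (14 V g h)
    then have g: "qgens R D \<rho> V (fst g)" "qgens R D \<rho> V (fst h)"
      and g': "qgens R D' \<rho>' V (snd g)" "qgens R D' \<rho>' V (snd h)" by auto
    note V = 14(1)
    show ?case
      unfolding cring.star_trace[OF cring_loc[OF V] c(1)[OF V g(1)] c'(1)[OF V g'(1)] c(3,4)[OF V g(2,1)] c'(3,4)[OF V g'(2,1)], symmetric]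
        generator_cocycle.t_change[OF Q V g(1,2), symmetric] generator_cocycle.t_change[OF Q' V g'(1,2), symmetric] ..
  next
    case (15 V g h)
    then have g: "qgens R D \<rho> V (fst g)" "qgens R D \<rho> V (fst h)"
      and g': "qgens R D' \<rho>' V (snd g)" "qgens R D' \<rho>' V (snd h)" by auto
    note V = 15(1)
    show ?case
      unfolding cring.star_const_change[OF cring_loc[OF V] c(1,2)[OF V g(1)] c'(1,2)[OF V g'(1)] c(3,4)[OF V g(2,1)] c'(3,4)[OF V g'(2,1)], symmetric]
        generator_cocycle.t_change[OF Q V g(1,2), symmetric] generator_cocycle.t_change[OF Q' V g'(1,2), symmetric]
        generator_cocycle.m_change[OF Q V g(1,2), symmetric] generator_cocycle.m_change[OF Q' V g'(1,2), symmetric] ..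
  qed
qed

section \<open>From the defining data of norm and star to glued cocycles\<close>

context glued_cocycle
begin

lemma img_w: "i < k \<Longrightarrow> img {a i} (g i) (w i)"
  unfolding img_def
  by (intro conjI allI impI w_closed w_tr_on) (use a_closed in auto)

lemma img_qgen:
  assumes V: "V \<subseteq> carrier R" and \<gamma>: "gen V \<gamma>" and e: "img V \<gamma> e"
  shows "qg V (t V \<gamma>) (m V \<gamma>) e"
proof -
  obtain e' where e': "qg V (t V \<gamma>) (m V \<gamma>) e'" "img V \<gamma> e'" by (rule img_ex[OF V \<gamma>])
  have "e = e'"
    by (rule ring_hom_cring.transition_fun[OF loc_map_image_hom[OF V] img_transition[OF V \<gamma> \<gamma> e e'(2)] img_transition[OF V \<gamma> \<gamma> e'(2) e'(2)]])
  then show ?thesis using e'(1) by simp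
qed

end

lemma qres_sel:
  "fst (qres R D \<rho> W g) = loc_res R W (fst g)" "fst (snd (qres R D \<rho> W g)) = loc_res R W (fst (snd g))"
  "snd (snd (qres R D \<rho> W g)) = loc_res D (\<rho> ` W) (snd (snd g))"
  by (auto simp: qres_def split: prod.splits)

lemma qgens_sel:
  "qgens R D \<rho> V g \<longleftrightarrow> qgen (loc R V) (loc D (\<rho> ` V)) (loc_map D (\<rho> ` V) \<rho>) (fst g) (fst (snd g)) (snd (snd g))"
  by (auto simp: qgens_def split: prod.splits)

context ring_hom_cring
begin

lemma qlin_eq:
  assumes V: "V \<subseteq> carrier R" and g: "qgens R S h V g"
    and tr: "transition (loc R V) (locS V) (loch V) (snd (snd g')) (snd (snd g)) u c"
  shows "qlin R S h V g' g = u" "qcon R S h V g' g = c"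
  unfolding qlin_def qcon_def using ring_hom_cring.tr_eq[OF loc_map_image_hom[OF V] g[unfolded qgens_sel] tr] by auto

lemma qlin_transition:
  assumes V: "V \<subseteq> carrier R" and g: "qgens R S h V g" "qgens R S h V g'"
  shows "transition (loc R V) (locS V) (loch V) (snd (snd g')) (snd (snd g)) (qlin R S h V g' g) (qcon R S h V g' g)"
  unfolding qlin_def qcon_def
  by (rule ring_hom_cring.transition_tr[OF loc_map_image_hom[OF V] g(1)[unfolded qgens_sel] qgenD(3)[OF g(2)[unfolded qgens_sel]]])

lemma chart_qgens:
  assumes V: "V \<subseteq> carrier R" and c: "Q_chart (loc R V) (locS V) (loch V) t m y"
  shows "qgens R S h V (t, m, y)"
  unfolding qgens_sel fst_conv snd_conv by (rule ring_hom_cring.Q_chart_qgen[OF loc_map_image_hom[OF V] c])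

end

text \<open>The charts provide the generators \<open>(T i, N i, y i)\<close>, and the overlap
  condition of \<open>is_Nm\<close>, instantiated at the actual transition coefficients
  \<open>qlin\<close> and \<open>qcon\<close>, is the glueing condition of the locale.\<close>

lemma (in rank_framed) is_Nm_glued:
  assumes Nm: "is_Nm n A B \<phi> D \<psi> E \<chi>" and D: "ring_hom_cring B D \<psi>"
  obtains k a g z where "glued_cocycle A E \<chi> (\<lambda>V. qgens B D \<psi> (\<phi> ` V)) (\<lambda>V. qres B D \<psi> (\<phi> ` V))
    (\<lambda>V g. norm_fun n (loc A V) (locS V) (loch V) (fst g))
    (\<lambda>V g. norm_const n (loc A V) (locS V) (loch V) (fst g) (fst (snd g)))
    (\<lambda>V g' g. norm_fun n (loc A V) (locS V) (loch V) (qlin B D \<psi> (\<phi> ` V) g' g))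
    (\<lambda>V g' g. norm_shift n (loc A V) (locS V) (loch V) (fst g) (qlin B D \<psi> (\<phi> ` V) g' g) (qcon B D \<psi> (\<phi> ` V) g' g)) k a g z"
proof -
  from Nm obtain k a T N y z where cov: "covers A k a"
    and ch: "\<forall>i<k. Q_chart (locS {a i}) (loc D (\<psi> ` \<phi> ` {a i})) (loc_map D (\<psi> ` \<phi> ` {a i}) \<psi>) (T i) (N i) (y i) \<and>
      Q_chart (loc A {a i}) (loc E (\<chi> ` {a i})) (loc_map E (\<chi> ` {a i}) \<chi>)
        (norm_fun n (loc A {a i}) (locS {a i}) (loch {a i}) (T i)) (norm_const n (loc A {a i}) (locS {a i}) (loch {a i}) (T i) (N i)) (z i)"
    and tr: "\<forall>i<k. \<forall>j<k. \<forall>U C. transition (locS {a i, a j}) (loc D (\<psi> ` \<phi> ` {a i, a j})) (loc_map D (\<psi> ` \<phi> ` {a i, a j}) \<psi>)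
        (loc_res D (\<psi> ` \<phi> ` {a i, a j}) (y i)) (loc_res D (\<psi> ` \<phi> ` {a i, a j}) (y j)) U C \<longrightarrow>
      transition (loc A {a i, a j}) (loc E (\<chi> ` {a i, a j})) (loc_map E (\<chi> ` {a i, a j}) \<chi>)
        (loc_res E (\<chi> ` {a i, a j}) (z i)) (loc_res E (\<chi> ` {a i, a j}) (z j))
        (norm_fun n (loc A {a i, a j}) (locS {a i, a j}) (loch {a i, a j}) U)
        (norm_shift n (loc A {a i, a j}) (locS {a i, a j}) (loch {a i, a j}) (resS {a i, a j} (T j)) U C)"
    unfolding is_Nm_def Let_def by blast
  have E: "ring_hom_cring A E \<chi>" using Nm unfolding is_Nm_def by (blast intro: is_alg_hom)
  have ac: "a i \<in> carrier A" if "i < k" for i using cov that by (auto simp: covers_def)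
  have V: "{a i} \<subseteq> carrier A" if "i < k" for i using ac[OF that] by simp
  have V': "\<phi> ` {a i} \<subseteq> carrier B" if "i < k" for i using ac[OF that] by simp
  have G: "qgens B D \<psi> (\<phi> ` {a i}) (T i, N i, y i)" if i: "i < k" for i
    by (rule ring_hom_cring.chart_qgens[OF D V'[OF i]]) (use ch i in blast)
  have Z: "qgens A E \<chi> {a i} (norm_fun n (loc A {a i}) (locS {a i}) (loch {a i}) (T i), norm_const n (loc A {a i}) (locS {a i}) (loch {a i}) (T i) (N i), z i)"
    if i: "i < k" for i
    by (rule ring_hom_cring.chart_qgens[OF E V[OF i]]) (use ch i in blast)
  show ?thesis
  proof (rule that[of k a "\<lambda>i. (T i, N i, y i)" z], intro glued_cocycle.intro glued_cocycle_axioms.intro norm_cocycle[OF D E] cov)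
    show "qgens B D \<psi> (\<phi> ` {a i}) (T i, N i, y i)" if "i < k" for i by (rule G[OF that])
    show "qgen (loc A {a i}) (loc E (\<chi> ` {a i})) (loc_map E (\<chi> ` {a i}) \<chi>)
        (norm_fun n (loc A {a i}) (locS {a i}) (loch {a i}) (fst (T i, N i, y i)))
        (norm_const n (loc A {a i}) (locS {a i}) (loch {a i}) (fst (T i, N i, y i)) (fst (snd (T i, N i, y i)))) (z i)" if "i < k" for i
      using Z[OF that] unfolding qgens_sel fst_conv snd_conv .
    fix i j assume i: "i < k" and j: "j < k"
    let ?X = "{a i, a j}" and ?g = "\<lambda>i. (T i, N i, y i)"
    have X: "?X \<subseteq> carrier A" "\<phi> ` ?X \<subseteq> carrier B" using ac[OF i] ac[OF j] by auto
    have sub: "\<phi> ` {a i} \<subseteq> \<phi> ` ?X" "\<phi> ` {a j} \<subseteq> \<phi> ` ?X" by auto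
    note Q = ring_hom_cring.quad_cocycle[OF D]
    note t = ring_hom_cring.qlin_transition[OF D X(2) generator_cocycle.gen_rs[OF Q sub(2) X(2) G[OF j]] generator_cocycle.gen_rs[OF Q sub(1) X(2) G[OF i]],
        unfolded qres_sel snd_conv]
    show "transition (loc A ?X) (loc E (\<chi> ` ?X)) (loc_map E (\<chi> ` ?X) \<chi>) (loc_res E (\<chi> ` ?X) (z i)) (loc_res E (\<chi> ` ?X) (z j))
      (norm_fun n (loc A ?X) (locS ?X) (loch ?X) (qlin B D \<psi> (\<phi> ` ?X) (qres B D \<psi> (\<phi> ` ?X) (?g i)) (qres B D \<psi> (\<phi> ` ?X) (?g j))))
      (norm_shift n (loc A ?X) (locS ?X) (loch ?X) (fst (qres B D \<psi> (\<phi> ` ?X) (?g j)))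
        (qlin B D \<psi> (\<phi> ` ?X) (qres B D \<psi> (\<phi> ` ?X) (?g i)) (qres B D \<psi> (\<phi> ` ?X) (?g j)))
        (qcon B D \<psi> (\<phi> ` ?X) (qres B D \<psi> (\<phi> ` ?X) (?g i)) (qres B D \<psi> (\<phi> ` ?X) (?g j))))"
      unfolding qres_sel fst_conv by (rule tr[rule_format, OF i j t])
  qed
qed

lemma (in cring) is_star_glued:
  assumes st: "is_star R D \<rho> D' \<rho>' F \<sigma>" and D: "ring_hom_cring R D \<rho>" and D': "ring_hom_cring R D' \<rho>'"
  obtains k a g w where "glued_cocycle R F \<sigma> (\<lambda>V g. qgens R D \<rho> V (fst g) \<and> qgens R D' \<rho>' V (snd g))
    (\<lambda>V g. (qres R D \<rho> V (fst g), qres R D' \<rho>' V (snd g)))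
    (\<lambda>V g. fst (fst g) \<otimes>\<^bsub>loc R V\<^esub> fst (snd g))
    (\<lambda>V g. star_const (loc R V) (fst (fst g)) (fst (snd (fst g))) (fst (snd g)) (fst (snd (snd g))))
    (\<lambda>V g' g. qlin R D \<rho> V (fst g') (fst g) \<otimes>\<^bsub>loc R V\<^esub> qlin R D' \<rho>' V (snd g') (snd g))
    (\<lambda>V g' g. star_shift (loc R V) (fst (fst g)) (fst (snd g)) (qlin R D \<rho> V (fst g') (fst g)) (qcon R D \<rho> V (fst g') (fst g))
       (qlin R D' \<rho>' V (snd g') (snd g)) (qcon R D' \<rho>' V (snd g') (snd g))) k a g w"
proof -
  from st obtain k a s m y t p y' w where cov: "covers R k a"
    and ch: "\<forall>i<k. Q_chart (loc R {a i}) (loc D (\<rho> ` {a i})) (loc_map D (\<rho> ` {a i}) \<rho>) (s i) (m i) (y i) \<and>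
      Q_chart (loc R {a i}) (loc D' (\<rho>' ` {a i})) (loc_map D' (\<rho>' ` {a i}) \<rho>') (t i) (p i) (y' i) \<and>
      Q_chart (loc R {a i}) (loc F (\<sigma> ` {a i})) (loc_map F (\<sigma> ` {a i}) \<sigma>) (s i \<otimes>\<^bsub>loc R {a i}\<^esub> t i) (star_const (loc R {a i}) (s i) (m i) (t i) (p i)) (w i)"
    and tr: "\<forall>i<k. \<forall>j<k. \<forall>u c v d.
      transition (loc R {a i, a j}) (loc D (\<rho> ` {a i, a j})) (loc_map D (\<rho> ` {a i, a j}) \<rho>)
        (loc_res D (\<rho> ` {a i, a j}) (y i)) (loc_res D (\<rho> ` {a i, a j}) (y j)) u c \<and>
      transition (loc R {a i, a j}) (loc D' (\<rho>' ` {a i, a j})) (loc_map D' (\<rho>' ` {a i, a j}) \<rho>')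
        (loc_res D' (\<rho>' ` {a i, a j}) (y' i)) (loc_res D' (\<rho>' ` {a i, a j}) (y' j)) v d \<longrightarrow>
      transition (loc R {a i, a j}) (loc F (\<sigma> ` {a i, a j})) (loc_map F (\<sigma> ` {a i, a j}) \<sigma>)
        (loc_res F (\<sigma> ` {a i, a j}) (w i)) (loc_res F (\<sigma> ` {a i, a j}) (w j)) (u \<otimes>\<^bsub>loc R {a i, a j}\<^esub> v)
        (star_shift (loc R {a i, a j}) (loc_res R {a i, a j} (s j)) (loc_res R {a i, a j} (t j)) u c v d)"
    unfolding is_star_def Let_def by blast
  have F: "ring_hom_cring R F \<sigma>" using st unfolding is_star_def by (blast intro: is_alg_hom)
  have ac: "a i \<in> carrier R" if "i < k" for i using cov that by (auto simp: covers_def)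
  have V: "{a i} \<subseteq> carrier R" if "i < k" for i using ac[OF that] by simp
  let ?g = "\<lambda>i. ((s i, m i, y i), (t i, p i, y' i))"
  have G: "qgens R D \<rho> {a i} (s i, m i, y i)" if i: "i < k" for i
    by (rule ring_hom_cring.chart_qgens[OF D V[OF i]]) (use ch i in blast)
  have G': "qgens R D' \<rho>' {a i} (t i, p i, y' i)" if i: "i < k" for i
    by (rule ring_hom_cring.chart_qgens[OF D' V[OF i]]) (use ch i in blast)
  have Z: "qgens R F \<sigma> {a i} (s i \<otimes>\<^bsub>loc R {a i}\<^esub> t i, star_const (loc R {a i}) (s i) (m i) (t i) (p i), w i)" if i: "i < k" for i
    by (rule ring_hom_cring.chart_qgens[OF F V[OF i]]) (use ch i in blast)
  show ?thesis
  proof (rule that[of k a ?g w], intro glued_cocycle.intro glued_cocycle_axioms.intro star_cocycle[OF D D' F] cov, unfold fst_conv snd_conv)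
    show "qgens R D \<rho> {a i} (s i, m i, y i) \<and> qgens R D' \<rho>' {a i} (t i, p i, y' i)" if "i < k" for i
      using G[OF that] G'[OF that] by blast
    show "qgen (loc R {a i}) (loc F (\<sigma> ` {a i})) (loc_map F (\<sigma> ` {a i}) \<sigma>)
        (s i \<otimes>\<^bsub>loc R {a i}\<^esub> t i) (star_const (loc R {a i}) (s i) (m i) (t i) (p i)) (w i)" if "i < k" for i
      using Z[OF that] unfolding qgens_sel fst_conv snd_conv .
    fix i j assume i: "i < k" and j: "j < k"
    let ?X = "{a i, a j}"
    have X: "?X \<subseteq> carrier R" using ac[OF i] ac[OF j] by auto
    have sub: "{a i} \<subseteq> ?X" "{a j} \<subseteq> ?X" by auto
    note Q = ring_hom_cring.quad_cocycle[OF D] and Q' = ring_hom_cring.quad_cocycle[OF D']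
    note t = ring_hom_cring.qlin_transition[OF D X generator_cocycle.gen_rs[OF Q sub(2) X G[OF j]] generator_cocycle.gen_rs[OF Q sub(1) X G[OF i]],
        unfolded qres_sel snd_conv]
      and t' = ring_hom_cring.qlin_transition[OF D' X generator_cocycle.gen_rs[OF Q' sub(2) X G'[OF j]] generator_cocycle.gen_rs[OF Q' sub(1) X G'[OF i]],
        unfolded qres_sel snd_conv]
    show "transition (loc R ?X) (loc F (\<sigma> ` ?X)) (loc_map F (\<sigma> ` ?X) \<sigma>) (loc_res F (\<sigma> ` ?X) (w i)) (loc_res F (\<sigma> ` ?X) (w j))
      (qlin R D \<rho> ?X (qres R D \<rho> ?X (s i, m i, y i)) (qres R D \<rho> ?X (s j, m j, y j)) \<otimes>\<^bsub>loc R ?X\<^esub>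
       qlin R D' \<rho>' ?X (qres R D' \<rho>' ?X (t i, p i, y' i)) (qres R D' \<rho>' ?X (t j, p j, y' j)))
      (star_shift (loc R ?X) (fst (qres R D \<rho> ?X (s j, m j, y j))) (fst (qres R D' \<rho>' ?X (t j, p j, y' j)))
        (qlin R D \<rho> ?X (qres R D \<rho> ?X (s i, m i, y i)) (qres R D \<rho> ?X (s j, m j, y j)))
        (qcon R D \<rho> ?X (qres R D \<rho> ?X (s i, m i, y i)) (qres R D \<rho> ?X (s j, m j, y j)))
        (qlin R D' \<rho>' ?X (qres R D' \<rho>' ?X (t i, p i, y' i)) (qres R D' \<rho>' ?X (t j, p j, y' j)))
        (qcon R D' \<rho>' ?X (qres R D' \<rho>' ?X (t i, p i, y' i)) (qres R D' \<rho>' ?X (t j, p j, y' j))))"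
      unfolding qres_sel fst_conv by (rule tr[rule_format, OF i j conjI[OF t t']])
  qed
qed

text \<open>Start from a pair of local generators of \<open>D\<close> and \<open>D'\<close>. One
  route forms a generator of \<open>DD'\<close> and then of its norm \<open>E\<close>; the other
  forms generators of the norms \<open>P\<close> and \<open>P'\<close> and then of their product
  \<open>F\<close>. The norm formulas turn star formulas over \<open>B\<close> into star formulas
  over \<open>A\<close>, so both routes end with equal parameters and equal transitions, and
  \<open>alg_iso_glue\<close> applies.\<close>

lemma (in rank_framed) norm_star_iso:
  assumes D: "ring_hom_cring B D \<psi>" and D': "ring_hom_cring B D' \<psi>'"
    and st: "is_star B D \<psi> D' \<psi>' DD' \<sigma>"
    and nm3: "is_Nm n A B \<phi> DD' \<sigma> E \<gamma>" and nm1: "is_Nm n A B \<phi> D \<psi> P \<chi>" and nm2: "is_Nm n A B \<phi> D' \<psi>' P' \<chi>'"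
    and stA: "is_star A P \<chi> P' \<chi>' F \<eta>"
  shows "\<exists>h. alg_iso A E \<gamma> F \<eta> h"
proof -
  have DD': "ring_hom_cring B DD' \<sigma>" using st unfolding is_star_def by (blast intro: is_alg_hom)
  have E: "ring_hom_cring A E \<gamma>" using nm3 unfolding is_Nm_def by (blast intro: is_alg_hom)
  have P: "ring_hom_cring A P \<chi>" using nm1 unfolding is_Nm_def by (blast intro: is_alg_hom)
  have P': "ring_hom_cring A P' \<chi>'" using nm2 unfolding is_Nm_def by (blast intro: is_alg_hom)
  have F: "ring_hom_cring A F \<eta>" using stA unfolding is_star_def by (blast intro: is_alg_hom)
  obtain k1 a1 g1 z1 where N1: "glued_cocycle A P \<chi> (\<lambda>V. qgens B D \<psi> (\<phi> ` V)) (\<lambda>V. qres B D \<psi> (\<phi> ` V))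
    (\<lambda>V g. norm_fun n (loc A V) (locS V) (loch V) (fst g))
    (\<lambda>V g. norm_const n (loc A V) (locS V) (loch V) (fst g) (fst (snd g)))
    (\<lambda>V g' g. norm_fun n (loc A V) (locS V) (loch V) (qlin B D \<psi> (\<phi> ` V) g' g))
    (\<lambda>V g' g. norm_shift n (loc A V) (locS V) (loch V) (fst g) (qlin B D \<psi> (\<phi> ` V) g' g) (qcon B D \<psi> (\<phi> ` V) g' g)) k1 a1 g1 z1"
    by (rule is_Nm_glued[OF nm1 D])
  obtain k2 a2 g2 z2 where N2: "glued_cocycle A P' \<chi>' (\<lambda>V. qgens B D' \<psi>' (\<phi> ` V)) (\<lambda>V. qres B D' \<psi>' (\<phi> ` V))
    (\<lambda>V g. norm_fun n (loc A V) (locS V) (loch V) (fst g))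
    (\<lambda>V g. norm_const n (loc A V) (locS V) (loch V) (fst g) (fst (snd g)))
    (\<lambda>V g' g. norm_fun n (loc A V) (locS V) (loch V) (qlin B D' \<psi>' (\<phi> ` V) g' g))
    (\<lambda>V g' g. norm_shift n (loc A V) (locS V) (loch V) (fst g) (qlin B D' \<psi>' (\<phi> ` V) g' g) (qcon B D' \<psi>' (\<phi> ` V) g' g)) k2 a2 g2 z2"
    by (rule is_Nm_glued[OF nm2 D'])
  obtain k3 a3 g3 z3 where N3: "glued_cocycle A E \<gamma> (\<lambda>V. qgens B DD' \<sigma> (\<phi> ` V)) (\<lambda>V. qres B DD' \<sigma> (\<phi> ` V))
    (\<lambda>V g. norm_fun n (loc A V) (locS V) (loch V) (fst g))
    (\<lambda>V g. norm_const n (loc A V) (locS V) (loch V) (fst g) (fst (snd g)))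
    (\<lambda>V g' g. norm_fun n (loc A V) (locS V) (loch V) (qlin B DD' \<sigma> (\<phi> ` V) g' g))
    (\<lambda>V g' g. norm_shift n (loc A V) (locS V) (loch V) (fst g) (qlin B DD' \<sigma> (\<phi> ` V) g' g) (qcon B DD' \<sigma> (\<phi> ` V) g' g)) k3 a3 g3 z3"
    by (rule is_Nm_glued[OF nm3 DD'])
  obtain k4 a4 g4 z4 where SB: "glued_cocycle B DD' \<sigma> (\<lambda>V g. qgens B D \<psi> V (fst g) \<and> qgens B D' \<psi>' V (snd g))
    (\<lambda>V g. (qres B D \<psi> V (fst g), qres B D' \<psi>' V (snd g)))
    (\<lambda>V g. fst (fst g) \<otimes>\<^bsub>loc B V\<^esub> fst (snd g))
    (\<lambda>V g. star_const (loc B V) (fst (fst g)) (fst (snd (fst g))) (fst (snd g)) (fst (snd (snd g))))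
    (\<lambda>V g' g. qlin B D \<psi> V (fst g') (fst g) \<otimes>\<^bsub>loc B V\<^esub> qlin B D' \<psi>' V (snd g') (snd g))
    (\<lambda>V g' g. star_shift (loc B V) (fst (fst g)) (fst (snd g)) (qlin B D \<psi> V (fst g') (fst g)) (qcon B D \<psi> V (fst g') (fst g))
       (qlin B D' \<psi>' V (snd g') (snd g)) (qcon B D' \<psi>' V (snd g') (snd g))) k4 a4 g4 z4"
    by (rule S.is_star_glued[OF st D D'])
  obtain k5 a5 g5 z5 where SA: "glued_cocycle A F \<eta> (\<lambda>V g. qgens A P \<chi> V (fst g) \<and> qgens A P' \<chi>' V (snd g))
    (\<lambda>V g. (qres A P \<chi> V (fst g), qres A P' \<chi>' V (snd g)))
    (\<lambda>V g. fst (fst g) \<otimes>\<^bsub>loc A V\<^esub> fst (snd g))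
    (\<lambda>V g. star_const (loc A V) (fst (fst g)) (fst (snd (fst g))) (fst (snd g)) (fst (snd (snd g))))
    (\<lambda>V g' g. qlin A P \<chi> V (fst g') (fst g) \<otimes>\<^bsub>loc A V\<^esub> qlin A P' \<chi>' V (snd g') (snd g))
    (\<lambda>V g' g. star_shift (loc A V) (fst (fst g)) (fst (snd g)) (qlin A P \<chi> V (fst g') (fst g)) (qcon A P \<chi> V (fst g') (fst g))
       (qlin A P' \<chi>' V (snd g') (snd g)) (qcon A P' \<chi>' V (snd g') (snd g))) k5 a5 g5 z5"
    by (rule R.is_star_glued[OF stA P P'])
  interpret N1: glued_cocycle A P \<chi> "\<lambda>V. qgens B D \<psi> (\<phi> ` V)" "\<lambda>V. qres B D \<psi> (\<phi> ` V)"
    "\<lambda>V g. norm_fun n (loc A V) (locS V) (loch V) (fst g)"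
    "\<lambda>V g. norm_const n (loc A V) (locS V) (loch V) (fst g) (fst (snd g))"
    "\<lambda>V g' g. norm_fun n (loc A V) (locS V) (loch V) (qlin B D \<psi> (\<phi> ` V) g' g)"
    "\<lambda>V g' g. norm_shift n (loc A V) (locS V) (loch V) (fst g) (qlin B D \<psi> (\<phi> ` V) g' g) (qcon B D \<psi> (\<phi> ` V) g' g)" k1 a1 g1 z1
    by (rule N1)
  interpret N2: glued_cocycle A P' \<chi>' "\<lambda>V. qgens B D' \<psi>' (\<phi> ` V)" "\<lambda>V. qres B D' \<psi>' (\<phi> ` V)"
    "\<lambda>V g. norm_fun n (loc A V) (locS V) (loch V) (fst g)"
    "\<lambda>V g. norm_const n (loc A V) (locS V) (loch V) (fst g) (fst (snd g))"
    "\<lambda>V g' g. norm_fun n (loc A V) (locS V) (loch V) (qlin B D' \<psi>' (\<phi> ` V) g' g)"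
    "\<lambda>V g' g. norm_shift n (loc A V) (locS V) (loch V) (fst g) (qlin B D' \<psi>' (\<phi> ` V) g' g) (qcon B D' \<psi>' (\<phi> ` V) g' g)" k2 a2 g2 z2
    by (rule N2)
  interpret N3: glued_cocycle A E \<gamma> "\<lambda>V. qgens B DD' \<sigma> (\<phi> ` V)" "\<lambda>V. qres B DD' \<sigma> (\<phi> ` V)"
    "\<lambda>V g. norm_fun n (loc A V) (locS V) (loch V) (fst g)"
    "\<lambda>V g. norm_const n (loc A V) (locS V) (loch V) (fst g) (fst (snd g))"
    "\<lambda>V g' g. norm_fun n (loc A V) (locS V) (loch V) (qlin B DD' \<sigma> (\<phi> ` V) g' g)"
    "\<lambda>V g' g. norm_shift n (loc A V) (locS V) (loch V) (fst g) (qlin B DD' \<sigma> (\<phi> ` V) g' g) (qcon B DD' \<sigma> (\<phi> ` V) g' g)" k3 a3 g3 z3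
    by (rule N3)
  interpret SB: glued_cocycle B DD' \<sigma> "\<lambda>V g. qgens B D \<psi> V (fst g) \<and> qgens B D' \<psi>' V (snd g)"
    "\<lambda>V g. (qres B D \<psi> V (fst g), qres B D' \<psi>' V (snd g))"
    "\<lambda>V g. fst (fst g) \<otimes>\<^bsub>loc B V\<^esub> fst (snd g)"
    "\<lambda>V g. star_const (loc B V) (fst (fst g)) (fst (snd (fst g))) (fst (snd g)) (fst (snd (snd g)))"
    "\<lambda>V g' g. qlin B D \<psi> V (fst g') (fst g) \<otimes>\<^bsub>loc B V\<^esub> qlin B D' \<psi>' V (snd g') (snd g)"
    "\<lambda>V g' g. star_shift (loc B V) (fst (fst g)) (fst (snd g)) (qlin B D \<psi> V (fst g') (fst g)) (qcon B D \<psi> V (fst g') (fst g))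
       (qlin B D' \<psi>' V (snd g') (snd g)) (qcon B D' \<psi>' V (snd g') (snd g))" k4 a4 g4 z4
    by (rule SB)
  interpret SA: glued_cocycle A F \<eta> "\<lambda>V g. qgens A P \<chi> V (fst g) \<and> qgens A P' \<chi>' V (snd g)"
    "\<lambda>V g. (qres A P \<chi> V (fst g), qres A P' \<chi>' V (snd g))"
    "\<lambda>V g. fst (fst g) \<otimes>\<^bsub>loc A V\<^esub> fst (snd g)"
    "\<lambda>V g. star_const (loc A V) (fst (fst g)) (fst (snd (fst g))) (fst (snd g)) (fst (snd (snd g)))"
    "\<lambda>V g' g. qlin A P \<chi> V (fst g') (fst g) \<otimes>\<^bsub>loc A V\<^esub> qlin A P' \<chi>' V (snd g') (snd g)"
    "\<lambda>V g' g. star_shift (loc A V) (fst (fst g)) (fst (snd g)) (qlin A P \<chi> V (fst g') (fst g)) (qcon A P \<chi> V (fst g') (fst g))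
       (qlin A P' \<chi>' V (snd g') (snd g)) (qcon A P' \<chi>' V (snd g') (snd g))" k5 a5 g5 z5
    by (rule SA)
  note Q = ring_hom_cring.quad_cocycle[OF D] and Q' = ring_hom_cring.quad_cocycle[OF D']
  \<comment> \<open>The working cover refines those of the two norms \<open>P\<close> and
    \<open>P'\<close>. The covers behind \<open>DD'\<close>, \<open>E\<close> and \<open>F\<close>
    enter through \<open>img_ex\<close>, which supplies generators over any localization.\<close>
  define I where "I = {..<k1} \<times> {..<k2}"
  define V where "V = (\<lambda>(i, j). {a1 i} \<union> {a2 j})"
  define G where "G v = (qres B D \<psi> (\<phi> ` V v) (g1 (fst v)), qres B D' \<psi>' (\<phi> ` V v) (g2 (snd v)))" for v
  define y where "y v = loc_res P (\<chi> ` V v) (z1 (fst v))" for v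
  define y' where "y' v = loc_res P' (\<chi>' ` V v) (z2 (snd v))" for v
  define nf where "nf X = norm_fun n (loc A X) (locS X) (loch X)" for X
  define nc where "nc X = norm_const n (loc A X) (locS X) (loch X)" for X
  define ns where "ns X = norm_shift n (loc A X) (locS X) (loch X)" for X
  note folds = nf_def[symmetric] nc_def[symmetric] ns_def[symmetric]
  define Z where "Z v = ((nf (V v) (fst (fst (G v))), nc (V v) (fst (fst (G v))) (fst (snd (fst (G v)))), y v),
    (nf (V v) (fst (snd (G v))), nc (V v) (fst (snd (G v))) (fst (snd (snd (G v)))), y' v))" for v
  define w where "w v = (SOME x. SB.img (\<phi> ` V v) (G v) x)" for v
  define H where "H v = (fst (fst (G v)) \<otimes>\<^bsub>locS (V v)\<^esub> fst (snd (G v)),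
    star_const (locS (V v)) (fst (fst (G v))) (fst (snd (fst (G v)))) (fst (snd (G v))) (fst (snd (snd (G v)))), w v)" for v
  define e where "e v = (SOME x. N3.img (V v) (H v) x)" for v
  define f where "f v = (SOME x. SA.img (V v) (Z v) x)" for v
  have cov: "pcover A I V" unfolding I_def V_def by (rule R.pcover_prod[OF N1.cov' N2.cov'])
  have fin: "finite I" by (simp add: I_def)
  have ij: "fst v < k1" "snd v < k2" "{a1 (fst v)} \<subseteq> V v" "{a2 (snd v)} \<subseteq> V v" if "v \<in> I" for v
    using that by (auto simp: I_def V_def)
  have VA: "V v \<subseteq> carrier A" if "v \<in> I" for v using cov that by (auto simp: pcover_def)
  have im: "\<phi> ` X \<subseteq> carrier B" if "X \<subseteq> carrier A" for X using that by auto
  have G1: "qgens B D \<psi> (\<phi> ` V v) (fst (G v))" if v: "v \<in> I" for v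
    unfolding G_def fst_conv by (rule N1.gen_rs[OF ij(3)[OF v] VA[OF v] N1.g[OF ij(1)[OF v]]])
  have G2: "qgens B D' \<psi>' (\<phi> ` V v) (snd (G v))" if v: "v \<in> I" for v
    unfolding G_def snd_conv by (rule N2.gen_rs[OF ij(4)[OF v] VA[OF v] N2.g[OF ij(2)[OF v]]])
  have i1: "N1.img (V v) (fst (G v)) (y v)" if v: "v \<in> I" for v
    unfolding G_def fst_conv y_def by (rule N1.img_res[OF ij(3)[OF v] VA[OF v] N1.g[OF ij(1)[OF v]] N1.img_w[OF ij(1)[OF v]]])
  have i2: "N2.img (V v) (snd (G v)) (y' v)" if v: "v \<in> I" for v
    unfolding G_def snd_conv y'_def by (rule N2.img_res[OF ij(4)[OF v] VA[OF v] N2.g[OF ij(2)[OF v]] N2.img_w[OF ij(2)[OF v]]])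
  have Z1: "qgens A P \<chi> (V v) (fst (Z v))" if v: "v \<in> I" for v
    unfolding Z_def qgens_sel fst_conv snd_conv nf_def nc_def by (rule N1.img_qgen[OF VA[OF v] G1[OF v] i1[OF v]])
  have Z2: "qgens A P' \<chi>' (V v) (snd (Z v))" if v: "v \<in> I" for v
    unfolding Z_def qgens_sel fst_conv snd_conv nf_def nc_def by (rule N2.img_qgen[OF VA[OF v] G2[OF v] i2[OF v]])
  have iw: "SB.img (\<phi> ` V v) (G v) (w v)" if v: "v \<in> I" for v
    unfolding w_def by (rule SB.img_ex[OF im[OF VA[OF v]] conjI[OF G1[OF v] G2[OF v]]]) (rule someI)
  have HG: "qgens B DD' \<sigma> (\<phi> ` V v) (H v)" if v: "v \<in> I" for v
    unfolding H_def qgens_sel fst_conv snd_conv by (rule SB.img_qgen[OF im[OF VA[OF v]] conjI[OF G1[OF v] G2[OF v]] iw[OF v]])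
  have ie: "N3.img (V v) (H v) (e v)" if v: "v \<in> I" for v
    unfolding e_def by (rule N3.img_ex[OF VA[OF v] HG[OF v]]) (rule someI)
  have if': "SA.img (V v) (Z v) (f v)" if v: "v \<in> I" for v
    unfolding f_def by (rule SA.img_ex[OF VA[OF v] conjI[OF Z1[OF v] Z2[OF v]]]) (rule someI)
  note c1 = generator_cocycle.t_closed[OF Q im] generator_cocycle.m_closed[OF Q im] generator_cocycle.lin_closed[OF Q im] generator_cocycle.con_closed[OF Q im]
  note c2 = generator_cocycle.t_closed[OF Q' im] generator_cocycle.m_closed[OF Q' im] generator_cocycle.lin_closed[OF Q' im] generator_cocycle.con_closed[OF Q' im]
  show ?thesis
  proof (rule R.alg_iso_glue[OF E F cov fin])
    fix v assume v: "v \<in> I"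
    note X = VA[OF v]
    show "qgen (loc A (V v)) (loc E (\<gamma> ` V v)) (loc_map E (\<gamma> ` V v) \<gamma>) (nf (V v) (fst (H v))) (nc (V v) (fst (H v)) (fst (snd (H v)))) (e v)"
      unfolding nf_def nc_def by (rule N3.img_qgen[OF X HG[OF v] ie[OF v]])
    have t: "nf (V v) (fst (H v)) = fst (fst (Z v)) \<otimes>\<^bsub>loc A (V v)\<^esub> fst (snd (Z v))"
      unfolding H_def Z_def fst_conv snd_conv nf_def
      by (rule rank_framed.norm_fun_mult(1)[OF loc_rank_framed[OF X] c1(1)[OF X G1[OF v]] c2(1)[OF X G2[OF v]]])
    have m: "nc (V v) (fst (H v)) (fst (snd (H v))) = star_const (loc A (V v)) (fst (fst (Z v))) (fst (snd (fst (Z v)))) (fst (snd (Z v))) (fst (snd (snd (Z v))))"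
      unfolding H_def Z_def fst_conv snd_conv nf_def nc_def
      by (rule rank_framed.norm_star_const[OF loc_rank_framed[OF X] c1(1,2)[OF X G1[OF v]] c2(1,2)[OF X G2[OF v]]])
    show "qgen (loc A (V v)) (loc F (\<eta> ` V v)) (loc_map F (\<eta> ` V v) \<eta>) (nf (V v) (fst (H v))) (nc (V v) (fst (H v)) (fst (snd (H v)))) (f v)"
      unfolding t m by (rule SA.img_qgen[OF X conjI[OF Z1[OF v] Z2[OF v]] if'[OF v]])
    fix v' assume v': "v' \<in> I"
    let ?X = "V v \<union> V v'"
    have XA: "?X \<subseteq> carrier A" using VA[OF v] VA[OF v'] by auto
    have sub: "V v \<subseteq> ?X" "V v' \<subseteq> ?X" by auto
    note XB = im[OF XA] and subB = image_mono[OF sub(1), of \<phi>] image_mono[OF sub(2), of \<phi>]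
    \<comment> \<open>On overlaps everything is expressed through the restricted generators
      \<open>p\<close> of \<open>D\<close> and \<open>q\<close> of \<open>D'\<close>, whose
      transition coefficients determine those of both routes.\<close>
    define p where "p = (\<lambda>v. qres B D \<psi> (\<phi> ` ?X) (fst (G v)))"
    define q where "q = (\<lambda>v. qres B D' \<psi>' (\<phi> ` ?X) (snd (G v)))"
    have pg: "qgens B D \<psi> (\<phi> ` ?X) (p v)" "qgens B D \<psi> (\<phi> ` ?X) (p v')"
      unfolding p_def by (rule N1.gen_rs[OF sub(1) XA G1[OF v]], rule N1.gen_rs[OF sub(2) XA G1[OF v']])
    have qg: "qgens B D' \<psi>' (\<phi> ` ?X) (q v)" "qgens B D' \<psi>' (\<phi> ` ?X) (q v')"
      unfolding q_def by (rule N2.gen_rs[OF sub(1) XA G2[OF v]], rule N2.gen_rs[OF sub(2) XA G2[OF v']])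
    let ?u = "qlin B D \<psi> (\<phi> ` ?X) (p v) (p v')" and ?c = "qcon B D \<psi> (\<phi> ` ?X) (p v) (p v')"
    let ?u' = "qlin B D' \<psi>' (\<phi> ` ?X) (q v) (q v')" and ?c' = "qcon B D' \<psi>' (\<phi> ` ?X) (q v) (q v')"
    have wt: "transition (locS ?X) (loc DD' (\<sigma> ` \<phi> ` ?X)) (loc_map DD' (\<sigma> ` \<phi> ` ?X) \<sigma>)
        (loc_res DD' (\<sigma> ` \<phi> ` ?X) (w v)) (loc_res DD' (\<sigma> ` \<phi> ` ?X) (w v'))
        (?u \<otimes>\<^bsub>locS ?X\<^esub> ?u') (star_shift (locS ?X) (fst (p v')) (fst (q v')) ?u ?c ?u' ?c')"
      using SB.img_transition[OF XB _ _ SB.img_res[OF subB(1) XB conjI[OF G1[OF v] G2[OF v]] iw[OF v]] SB.img_res[OF subB(2) XB conjI[OF G1[OF v'] G2[OF v']] iw[OF v']]]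
        pg qg unfolding fst_conv snd_conv p_def q_def by blast
    let ?h = "\<lambda>v. qres B DD' \<sigma> (\<phi> ` ?X) (H v)"
    have hg: "qgens B DD' \<sigma> (\<phi> ` ?X) (?h v)" "qgens B DD' \<sigma> (\<phi> ` ?X) (?h v')"
      by (rule N3.gen_rs[OF sub(1) XA HG[OF v]], rule N3.gen_rs[OF sub(2) XA HG[OF v']])
    have hw: "snd (snd (?h v)) = loc_res DD' (\<sigma> ` \<phi> ` ?X) (w v)" for v unfolding qres_sel H_def snd_conv ..
    \<comment> \<open>The transition between the elements \<open>w\<close> is now known by the star
      formula; uniqueness of coefficients identifies it with the \<open>qlin\<close> and
      \<open>qcon\<close> that the norm cocycle of \<open>DD'\<close> uses.\<close>
    note hl = ring_hom_cring.qlin_eq[OF DD' XB hg(2) wt[folded hw]]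
    have et: "transition (loc A ?X) (loc E (\<gamma> ` ?X)) (loc_map E (\<gamma> ` ?X) \<gamma>) (loc_res E (\<gamma> ` ?X) (e v)) (loc_res E (\<gamma> ` ?X) (e v'))
        (nf ?X (?u \<otimes>\<^bsub>locS ?X\<^esub> ?u')) (ns ?X (fst (?h v')) (?u \<otimes>\<^bsub>locS ?X\<^esub> ?u') (star_shift (locS ?X) (fst (p v')) (fst (q v')) ?u ?c ?u' ?c'))"
      using N3.img_transition[OF XA hg N3.img_res[OF sub(1) XA HG[OF v] ie[OF v]] N3.img_res[OF sub(2) XA HG[OF v'] ie[OF v']]]
      unfolding hl folds .
    have hT: "fst (?h v') = fst (p v') \<otimes>\<^bsub>locS ?X\<^esub> fst (q v')"
      unfolding qres_sel H_def fst_conv p_def q_def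
      by (rule ring_hom_mult[OF ring_hom_cring.homh[OF S.loc_res_hom[OF subB(2) XB]] c1(1)[OF VA[OF v'] G1[OF v']] c2(1)[OF VA[OF v'] G2[OF v']]])
    have yt: "transition (loc A ?X) (loc P (\<chi> ` ?X)) (loc_map P (\<chi> ` ?X) \<chi>) (loc_res P (\<chi> ` ?X) (y v)) (loc_res P (\<chi> ` ?X) (y v'))
        (nf ?X ?u) (ns ?X (fst (p v')) ?u ?c)"
      using N1.img_transition[OF XA pg[unfolded p_def] N1.img_res[OF sub(1) XA G1[OF v] i1[OF v]] N1.img_res[OF sub(2) XA G1[OF v'] i1[OF v']]]
      unfolding folds p_def .
    have yt': "transition (loc A ?X) (loc P' (\<chi>' ` ?X)) (loc_map P' (\<chi>' ` ?X) \<chi>') (loc_res P' (\<chi>' ` ?X) (y' v)) (loc_res P' (\<chi>' ` ?X) (y' v'))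
        (nf ?X ?u') (ns ?X (fst (q v')) ?u' ?c')"
      using N2.img_transition[OF XA qg[unfolded q_def] N2.img_res[OF sub(1) XA G2[OF v] i2[OF v]] N2.img_res[OF sub(2) XA G2[OF v'] i2[OF v']]]
      unfolding folds q_def .
    let ?z = "\<lambda>v. qres A P \<chi> ?X (fst (Z v))" and ?z' = "\<lambda>v. qres A P' \<chi>' ?X (snd (Z v))"
    have zg: "qgens A P \<chi> ?X (?z v)" "qgens A P \<chi> ?X (?z v')" "qgens A P' \<chi>' ?X (?z' v)" "qgens A P' \<chi>' ?X (?z' v')"
      using SA.gen_rs[OF sub(1) XA conjI[OF Z1[OF v] Z2[OF v]]] SA.gen_rs[OF sub(2) XA conjI[OF Z1[OF v'] Z2[OF v']]]
      unfolding fst_conv snd_conv by blast+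
    have zy: "snd (snd (?z v)) = loc_res P (\<chi> ` ?X) (y v)" "snd (snd (?z' v)) = loc_res P' (\<chi>' ` ?X) (y' v)" for v
      unfolding qres_sel Z_def fst_conv snd_conv by (rule refl)+
    \<comment> \<open>The same on the other route: the transitions between the generators of
      \<open>P\<close> and of \<open>P'\<close> are those given by the norm formulas, and the star
      cocycle over \<open>A\<close> takes them as input.\<close>
    note zl = ring_hom_cring.qlin_eq[OF P XA zg(2) yt[folded zy]] and zl' = ring_hom_cring.qlin_eq[OF P' XA zg(4) yt'[folded zy]]
    have zT: "fst (?z v') = nf ?X (fst (p v'))" "fst (?z' v') = nf ?X (fst (q v'))"
      unfolding qres_sel(1) Z_def fst_conv snd_conv nf_def p_def q_def
      using N1.t_rs[OF sub(2) XA G1[OF v']] N2.t_rs[OF sub(2) XA G2[OF v']] unfolding qres_sel(1) by simp_all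
    have ft: "transition (loc A ?X) (loc F (\<eta> ` ?X)) (loc_map F (\<eta> ` ?X) \<eta>) (loc_res F (\<eta> ` ?X) (f v)) (loc_res F (\<eta> ` ?X) (f v'))
        (nf ?X ?u \<otimes>\<^bsub>loc A ?X\<^esub> nf ?X ?u')
        (star_shift (loc A ?X) (nf ?X (fst (p v'))) (nf ?X (fst (q v'))) (nf ?X ?u) (ns ?X (fst (p v')) ?u ?c) (nf ?X ?u') (ns ?X (fst (q v')) ?u' ?c'))"
      using SA.img_transition[OF XA SA.gen_rs[OF sub(1) XA conjI[OF Z1[OF v] Z2[OF v]]] SA.gen_rs[OF sub(2) XA conjI[OF Z1[OF v'] Z2[OF v']]]
          SA.img_res[OF sub(1) XA conjI[OF Z1[OF v] Z2[OF v]] if'[OF v]] SA.img_res[OF sub(2) XA conjI[OF Z1[OF v'] Z2[OF v']] if'[OF v']]]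
      unfolding fst_conv snd_conv zl zl' zT .
    note N = loc_rank_framed[OF XA] and cp = c1(1)[OF XA pg(2)] c1(3,4)[OF XA pg] and cq = c2(1)[OF XA qg(2)] c2(3,4)[OF XA qg]
    \<comment> \<open>The comparison of the two routes: multiplicativity of the norm for the linear
      coefficients and, next, \<open>norm_star_shift\<close> for the constant ones.\<close>
    have "nf ?X (?u \<otimes>\<^bsub>locS ?X\<^esub> ?u') = nf ?X ?u \<otimes>\<^bsub>loc A ?X\<^esub> nf ?X ?u'"
      unfolding nf_def by (rule rank_framed.norm_fun_mult(1)[OF N cp(2) cq(2)])
    moreover have "ns ?X (fst (?h v')) (?u \<otimes>\<^bsub>locS ?X\<^esub> ?u') (star_shift (locS ?X) (fst (p v')) (fst (q v')) ?u ?c ?u' ?c')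
      = star_shift (loc A ?X) (nf ?X (fst (p v'))) (nf ?X (fst (q v'))) (nf ?X ?u) (ns ?X (fst (p v')) ?u ?c) (nf ?X ?u') (ns ?X (fst (q v')) ?u' ?c')"
      unfolding hT nf_def ns_def by (rule rank_framed.norm_star_shift[OF N cp(1) cq(1) cp(2,3) cq(2,3)])
    ultimately show "\<exists>u c.
      transition (loc A ?X) (loc E (\<gamma> ` ?X)) (loc_map E (\<gamma> ` ?X) \<gamma>) (loc_res E (\<gamma> ` ?X) (e v)) (loc_res E (\<gamma> ` ?X) (e v')) u c \<and>
      transition (loc A ?X) (loc F (\<eta> ` ?X)) (loc_map F (\<eta> ` ?X) \<eta>) (loc_res F (\<eta> ` ?X) (f v)) (loc_res F (\<eta> ` ?X) (f v')) u c"
      using et ft by auto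
  qed
qed

theorem theorem4p5:
  fixes n :: nat
    and A :: "('a, 'a1) ring_scheme" and B :: "('b, 'b1) ring_scheme" and \<phi> :: "'a \<Rightarrow> 'b"
    and D :: "('d, 'd1) ring_scheme" and \<psi> :: "'b \<Rightarrow> 'd"
    and D' :: "('e, 'e1) ring_scheme" and \<psi>' :: "'b \<Rightarrow> 'e"
    and DD' :: "('f, 'f1) ring_scheme" and \<sigma> :: "'b \<Rightarrow> 'f"
    and NmD :: "('g, 'g1) ring_scheme" and \<chi> :: "'a \<Rightarrow> 'g"
    and NmD' :: "('h, 'h1) ring_scheme" and \<chi>' :: "'a \<Rightarrow> 'h"
    and NmDD' :: "('i, 'i1) ring_scheme" and \<gamma> :: "'a \<Rightarrow> 'i"
    and NmD_NmD' :: "('j, 'j1) ring_scheme" and \<eta> :: "'a \<Rightarrow> 'j"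
  assumes "rank_algebra n A B \<phi>"
    and "rank_algebra 2 B D \<psi>" and "rank_algebra 2 B D' \<psi>'"
    and "is_star B D \<psi> D' \<psi>' DD' \<sigma>"
    and "is_Nm n A B \<phi> DD' \<sigma> NmDD' \<gamma>"
    and "is_Nm n A B \<phi> D \<psi> NmD \<chi>" and "is_Nm n A B \<phi> D' \<psi>' NmD' \<chi>'"
    and "is_star A NmD \<chi> NmD' \<chi>' NmD_NmD' \<eta>"
  shows "\<exists>h. alg_iso A NmDD' \<gamma> NmD_NmD' \<eta> h"
proof -
  obtain m x f where fr: "framed_algebra A B \<phi> m x f" "loc_free n A B \<phi>"
    by (rule rank_algebra_framed[OF assms(1)])
  have "rank_framed A B \<phi> m x f n" by (intro rank_framed.intro rank_framed_axioms.intro fr)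
  moreover have "ring_hom_cring B D \<psi>" "ring_hom_cring B D' \<psi>'"
    using assms(2,3) unfolding rank_algebra_def by (blast intro: is_alg_hom)+
  ultimately show ?thesis by (rule rank_framed.norm_star_iso[OF _ _ _ assms(4-8)])
qed

end
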